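(* Let $\mathbb{K}$ be an infinite field and $n,r\ge1$ integers. The algebra $\mathfrak{C}_n(\Lambda(n,r))$ is isomorphic to the Borel subalgebra $S^+(n,r)=S^+_{\mathbb{K}}(n,r)$ of the Schur algebra $S(n,r)$.
   Context: $\mathbb{N}$ contains $0$. $\Lambda(n,r)=\{\lambda\in\mathbb{N}^n:\sum\lambda_i=r\}\subset\mathbb{Z}^n$. $v_1,\dots,v_n$ is the standard basis of $\mathbb{Z}^n$ and $\Psi_n\subset\mathbb{Z}^n$ is the submonoid generated by $v_i-v_{i+1}$, $1\le i\le n-1$. Schur algebra: $V=\mathbb{K}^n$ is the natural $GL_n(\mathbb{K})$-module; $S(n,r)\subset\operatorname{End}_{\mathbb{K}}(V^{\otimes r})$ is the linear span of the operators $g^{\otimes r}$, $g\in GL_n(\mathbb{K})$, and $S^+(n,r)$ is the linear span of the operators $g^{\otimes r}$ with $g\in GL_n(\mathbb{K})$ upper triangular. Kostant form: $sl_n^+$ is the Lie algebra of strictly upper triangular $n\times n$ matrices over $\mathbb{C}$ with basis of matrix units $e_{ij}$, $i<j$; $\mathfrak{A}_n(\mathbb{C})$ is its universal enveloping algebra; $e_{ij}^{(k)}=e_{ij}^k/k!$. Products $\prod_{i<j}$ are taken with the factor for $e_{ij}$ to the left of the factor for $e_{i'j'}$ whenever $(j,i)>_{lex}(j',i')$. $\mathfrak{A}_n(\mathbb{Z})$ is the $\mathbb{Z}$-span of all $\prod_{i<j}e_{ij}^{(k_{ij})}$, $k_{ij}\in\mathbb{N}$; it is a subring, and $\mathfrak{A}_n(\mathbb{K})=\mathbb{K}\otimes_{\mathbb{Z}}\mathfrak{A}_n(\mathbb{Z})$.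 It is $\Psi_n$-graded by $\deg\prod e_{ij}^{(k_{ij})}=\sum k_{ij}(v_i-v_j)$. Skew product: $B_n$ is the algebra of all functions $\mathbb{Z}^n\to\mathbb{K}$, with $\Psi_n$ acting by $f^\gamma(z)=f(z+\gamma)$. $\mathfrak{C}_n(\mathbb{K})=\mathfrak{A}_n(\mathbb{K})\ltimes_{\Psi_n}B_n$ is the vector space $\mathfrak{A}_n(\mathbb{K})\otimes B_n$ with product $(a\otimes b)(a'\otimes b')=aa'\otimes b^{\gamma}b'$ for $a'$ homogeneous of degree $\gamma$. Let $\chi$ be the indicator function of $\Lambda(n,r)$ and $\bar e=1-1\otimes\chi$. Then $\mathfrak{C}_n(\Lambda(n,r))=\mathfrak{C}_n(\mathbb{K})/\mathfrak{C}_n(\mathbb{K})\bar e\,\mathfrak{C}_n(\mathbb{K})$. *)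

theory Defs
  imports "HOL-Algebra.Free_Abelian_Groups" "HOL-Algebra.QuotRing" "HOL-Algebra.Module"
    "Jordan_Normal_Form.Matrix"
begin

text \<open>
  Algebras over a field are represented as \<^typ>\<open>('c, 'a) module\<close> records, that is, HOL-Algebra rings
  with a scalar multiplication; all elements of the scalar type act. Matrix and vector indices
  start at 0.
\<close>

section \<open>Generalities on algebras\<close>

definition lin_span :: "('c, 'a, 'm) module_scheme \<Rightarrow> 'a set \<Rightarrow> 'a set" where
  "lin_span A X = generate (add_monoid A) {c \<odot>\<^bsub>A\<^esub> x | c x. x \<in> X}"

definition algebra_isomorphic ::
  "('c, 'a, 'm) module_scheme \<Rightarrow> ('c, 'b, 'n) module_scheme \<Rightarrow> bool" where
  "algebra_isomorphic A B \<longleftrightarrow>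
    (\<exists>h \<in> ring_iso A B. \<forall>c. \<forall>x \<in> carrier A. h (c \<odot>\<^bsub>A\<^esub> x) = c \<odot>\<^bsub>B\<^esub> h x)"

text \<open>Quotient by a two-sided ideal: the ring \<^term>\<open>A Quot I\<close> with the induced scalar multiplication.\<close>

definition quot_algebra :: "('c, 'a, 'm) module_scheme \<Rightarrow> 'a set \<Rightarrow> ('c, 'a set) module" where
  "quot_algebra A I =
    \<lparr>carrier = carrier (A Quot I), monoid.mult = monoid.mult (A Quot I), one = one (A Quot I),
     zero = zero (A Quot I), add = add (A Quot I),
     smult = (\<lambda>c X. \<Union>x\<in>X. I +>\<^bsub>A\<^esub> (c \<odot>\<^bsub>A\<^esub> x))\<rparr>"

text \<open>Noncommutative polynomials in the letters \<open>X\<close>, as finitely supported functions on words.\<close>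

definition free_algebra :: "'x set \<Rightarrow> ('c::comm_ring_1, 'x list \<Rightarrow> 'c) module" where
  "free_algebra X =
    \<lparr>carrier = {f. finite {w. f w \<noteq> 0} \<and> {w. f w \<noteq> 0} \<subseteq> lists X},
     monoid.mult = (\<lambda>f g w. \<Sum>k\<le>length w. f (take k w) * g (drop k w)),
     one = (\<lambda>w. if w = [] then 1 else 0),
     zero = (\<lambda>w. 0),
     add = (\<lambda>f g w. f w + g w),
     smult = (\<lambda>c f w. c * f w)\<rparr>"

definition letter :: "'x \<Rightarrow> 'x list \<Rightarrow> 'c::comm_ring_1" where
  "letter x = (\<lambda>w. if w = [x] then 1 else 0)"

section \<open>Tensor products\<close>

text \<open>
  For modules over a commutative ring whose elements are those of the type \<^typ>\<open>'r\<close>, the tensor product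
  is the free abelian group on pairs modulo the subgroup generated by the usual relations.
\<close>

definition tensor_relations ::
  "('r, 'a, 'm) module_scheme \<Rightarrow> ('r, 'b, 'n) module_scheme \<Rightarrow> ('a \<times> 'b \<Rightarrow>\<^sub>0 int) set" where
  "tensor_relations M N =
    {frag_of (x \<oplus>\<^bsub>M\<^esub> x', y) - frag_of (x, y) - frag_of (x', y) | x x' y.
       x \<in> carrier M \<and> x' \<in> carrier M \<and> y \<in> carrier N} \<union>
    {frag_of (x, y \<oplus>\<^bsub>N\<^esub> y') - frag_of (x, y) - frag_of (x, y') | x y y'.
       x \<in> carrier M \<and> y \<in> carrier N \<and> y' \<in> carrier N} \<union>
    {frag_of (c \<odot>\<^bsub>M\<^esub> x, y) - frag_of (x, c \<odot>\<^bsub>N\<^esub> y) | c x y.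
       x \<in> carrier M \<and> y \<in> carrier N}"

definition tensor_kernel ::
  "('r, 'a, 'm) module_scheme \<Rightarrow> ('r, 'b, 'n) module_scheme \<Rightarrow> ('a \<times> 'b \<Rightarrow>\<^sub>0 int) set" where
  "tensor_kernel M N =
    generate (free_Abelian_group (carrier M \<times> carrier N)) (tensor_relations M N)"

definition tensor_class ::
  "('r, 'a, 'm) module_scheme \<Rightarrow> ('r, 'b, 'n) module_scheme \<Rightarrow>
   ('a \<times> 'b \<Rightarrow>\<^sub>0 int) \<Rightarrow> ('a \<times> 'b \<Rightarrow>\<^sub>0 int) set" where
  "tensor_class M N x =
    tensor_kernel M N #>\<^bsub>free_Abelian_group (carrier M \<times> carrier N)\<^esub> x"

definition pure_tensor ::
  "('r, 'a, 'm) module_scheme \<Rightarrow> ('r, 'b, 'n) module_scheme \<Rightarrow>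
   'a \<Rightarrow> 'b \<Rightarrow> ('a \<times> 'b \<Rightarrow>\<^sub>0 int) set" where
  "pure_tensor M N a b = tensor_class M N (frag_of (a, b))"

text \<open>
  The tensor product as an algebra. Here \<open>p (a, b) (a', b')\<close> is a formal sum of pairs
  representing the product of \<open>a \<otimes> b\<close> and \<open>a' \<otimes> b'\<close>, extended biadditively, and scalars
  act by \<open>c (a \<otimes> b) = s c a \<otimes> b\<close>.
\<close>

definition tensor_algebra ::
  "('r, 'a, 'm) module_scheme \<Rightarrow> ('r, 'b, 'n) module_scheme \<Rightarrow> ('s \<Rightarrow> 'a \<Rightarrow> 'a) \<Rightarrow>
   ('a \<times> 'b \<Rightarrow> 'a \<times> 'b \<Rightarrow> ('a \<times> 'b \<Rightarrow>\<^sub>0 int)) \<Rightarrow> ('s, ('a \<times> 'b \<Rightarrow>\<^sub>0 int) set) module" where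
  "tensor_algebra M N s p =
    (let Q = free_Abelian_group (carrier M \<times> carrier N) Mod tensor_kernel M N in
     \<lparr>carrier = carrier Q,
      monoid.mult = (\<lambda>X Y. \<Union>x\<in>X. \<Union>y\<in>Y.
        tensor_class M N (frag_extend (\<lambda>u. frag_extend (\<lambda>v. p u v) y) x)),
      one = pure_tensor M N \<one>\<^bsub>M\<^esub> \<one>\<^bsub>N\<^esub>,
      zero = one Q,
      add = monoid.mult Q,
      smult = (\<lambda>c X. \<Union>x\<in>X.
        tensor_class M N (frag_extend (\<lambda>(a, b). frag_of (s c a, b)) x))\<rparr>)"

text \<open>The ground field as a ring and \<open>\<int>\<close>-module, and the \<open>'k\<close>-algebra \<open>'k \<otimes>\<^sub>\<int> A\<close> for a ring \<open>A\<close>.\<close>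

definition ground_ring :: "(int, 'k::field) module" where
  "ground_ring =
    \<lparr>carrier = UNIV, monoid.mult = (*), one = 1, zero = 0, add = (+),
     smult = (\<lambda>z c. of_int z * c)\<rparr>"

definition base_change ::
  "(int, 'a, 'm) module_scheme \<Rightarrow> ('k::field, ('k \<times> 'a \<Rightarrow>\<^sub>0 int) set) module" where
  "base_change A =
    tensor_algebra ground_ring A (*) (\<lambda>(c, x) (d, y). frag_of (c * d, x \<otimes>\<^bsub>A\<^esub> y))"

section \<open>The Kostant form\<close>

definition strict_upper :: "nat \<Rightarrow> complex mat set" where
  "strict_upper n = {x \<in> carrier_mat n n. \<forall>i<n. \<forall>j\<le>i. x $$ (i, j) = 0}"

definition matrix_unit :: "nat \<Rightarrow> nat \<Rightarrow> nat \<Rightarrow> 'c::zero_neq_one mat" where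
  "matrix_unit n i j = mat n n (\<lambda>(a, b). if a = i \<and> b = j then 1 else 0)"

text \<open>
  The universal enveloping algebra \<open>T(L)/(x \<otimes> y - y \<otimes> x - [x, y])\<close> of a Lie algebra \<open>L\<close> of matrices;
  the first two families of relations cut the tensor algebra \<open>T(L)\<close> out of the free algebra on
  the set \<open>L\<close>.
\<close>

definition enveloping_relations :: "'c::field mat set \<Rightarrow> ('c mat list \<Rightarrow> 'c) set" where
  "enveloping_relations L = (let F = free_algebra L in
    {letter (x + y) \<ominus>\<^bsub>F\<^esub> (letter x \<oplus>\<^bsub>F\<^esub> letter y) | x y. x \<in> L \<and> y \<in> L} \<union>
    {letter (c \<cdot>\<^sub>m x) \<ominus>\<^bsub>F\<^esub> (c \<odot>\<^bsub>F\<^esub> letter x) | c x. x \<in> L} \<union>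
    {(letter x \<otimes>\<^bsub>F\<^esub> letter y \<ominus>\<^bsub>F\<^esub> letter y \<otimes>\<^bsub>F\<^esub> letter x) \<ominus>\<^bsub>F\<^esub> letter (x * y - y * x) | x y.
       x \<in> L \<and> y \<in> L})"

definition enveloping_ideal :: "'c::field mat set \<Rightarrow> ('c mat list \<Rightarrow> 'c) set" where
  "enveloping_ideal L = Idl\<^bsub>free_algebra L\<^esub> (enveloping_relations L)"

definition enveloping_algebra :: "'c::field mat set \<Rightarrow> ('c, ('c mat list \<Rightarrow> 'c) set) module" where
  "enveloping_algebra L = quot_algebra (free_algebra L) (enveloping_ideal L)"

definition enveloping_embedding :: "'c::field mat set \<Rightarrow> 'c mat \<Rightarrow> ('c mat list \<Rightarrow> 'c) set" where
  "enveloping_embedding L x = enveloping_ideal L +>\<^bsub>free_algebra L\<^esub> letter x"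

type_synonym kostant = "(complex mat list \<Rightarrow> complex) set"

abbreviation kostant_C :: "nat \<Rightarrow> (complex, kostant) module" where
  "kostant_C n \<equiv> enveloping_algebra (strict_upper n)"

definition divided_power :: "nat \<Rightarrow> nat \<Rightarrow> nat \<Rightarrow> nat \<Rightarrow> kostant" where
  "divided_power n i j k =
    (1 / fact k) \<odot>\<^bsub>kostant_C n\<^esub>
      (enveloping_embedding (strict_upper n) (matrix_unit n i j) [^]\<^bsub>kostant_C n\<^esub> k)"

text \<open>The pairs \<open>i < j < n\<close>, with \<open>(j, i)\<close> lexicographically decreasing.\<close>

definition root_list :: "nat \<Rightarrow> (nat \<times> nat) list" where
  "root_list n = concat (map (\<lambda>j. map (\<lambda>i. (i, j)) (rev [0..<j])) (rev [0..<n]))"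

text \<open>Only the exponents \<open>k i j\<close> with \<open>i < j < n\<close> matter.\<close>

definition kostant_monomial :: "nat \<Rightarrow> (nat \<Rightarrow> nat \<Rightarrow> nat) \<Rightarrow> kostant" where
  "kostant_monomial n k =
    foldr (\<lambda>(i, j) y. divided_power n i j (k i j) \<otimes>\<^bsub>kostant_C n\<^esub> y) (root_list n) \<one>\<^bsub>kostant_C n\<^esub>"

definition kostant_Z :: "nat \<Rightarrow> (int, kostant) module" where
  "kostant_Z n =
    \<lparr>carrier = generate (add_monoid (kostant_C n)) (range (kostant_monomial n)),
     monoid.mult = monoid.mult (kostant_C n), one = one (kostant_C n), zero = zero (kostant_C n),
     add = add (kostant_C n), smult = (\<lambda>z x. [z] \<cdot>\<^bsub>kostant_C n\<^esub> x)\<rparr>"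

definition kostant_K :: "nat \<Rightarrow> ('k::field, ('k \<times> kostant \<Rightarrow>\<^sub>0 int) set) module" where
  "kostant_K n = base_change (kostant_Z n)"

section \<open>The grading\<close>

inductive_set root_monoid :: "nat \<Rightarrow> int vec set" for n where
  zero: "0\<^sub>v n \<in> root_monoid n"
| step: "\<gamma> \<in> root_monoid n \<Longrightarrow> Suc i < n \<Longrightarrow>
    \<gamma> + (unit_vec n i - unit_vec n (Suc i)) \<in> root_monoid n"

definition kostant_degree :: "nat \<Rightarrow> (nat \<Rightarrow> nat \<Rightarrow> nat) \<Rightarrow> int vec" where
  "kostant_degree n k =
    vec n (\<lambda>a. \<Sum>j<n. \<Sum>i<j. int (k i j) * ((unit_vec n i - unit_vec n j) $ a))"

definition kostant_homogeneous ::
  "nat \<Rightarrow> int vec \<Rightarrow> ('k::field \<times> kostant \<Rightarrow>\<^sub>0 int) set set" where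
  "kostant_homogeneous n \<gamma> = lin_span (kostant_K n)
    {pure_tensor ground_ring (kostant_Z n) 1 (kostant_monomial n k) | k. kostant_degree n k = \<gamma>}"

text \<open>The family of homogeneous components of an element.\<close>

definition kostant_components ::
  "nat \<Rightarrow> ('k::field \<times> kostant \<Rightarrow>\<^sub>0 int) set \<Rightarrow> int vec \<Rightarrow> ('k \<times> kostant \<Rightarrow>\<^sub>0 int) set" where
  "kostant_components n a = (THE d.
    (\<forall>\<gamma> \<in> root_monoid n. d \<gamma> \<in> kostant_homogeneous n \<gamma>) \<and>
    (\<forall>\<gamma>. \<gamma> \<notin> root_monoid n \<longrightarrow> d \<gamma> = \<zero>\<^bsub>kostant_K n\<^esub>) \<and>
    finite {\<gamma>. d \<gamma> \<noteq> \<zero>\<^bsub>kostant_K n\<^esub>} \<and>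
    a = finsum (kostant_K n) d {\<gamma>. d \<gamma> \<noteq> \<zero>\<^bsub>kostant_K n\<^esub>})"

section \<open>The skew product and its quotient\<close>

text \<open>Functions on \<open>\<int>\<^sup>n\<close> are extended by 0 to vectors of other dimensions.\<close>

definition weight_functions :: "nat \<Rightarrow> ('k::field, int vec \<Rightarrow> 'k) module" where
  "weight_functions n =
    \<lparr>carrier = {f. \<forall>z. z \<notin> carrier_vec n \<longrightarrow> f z = 0},
     monoid.mult = (\<lambda>f g z. f z * g z),
     one = (\<lambda>z. if z \<in> carrier_vec n then 1 else 0),
     zero = (\<lambda>z. 0),
     add = (\<lambda>f g z. f z + g z),
     smult = (\<lambda>c f z. c * f z)\<rparr>"

definition weight_shift :: "nat \<Rightarrow> int vec \<Rightarrow> (int vec \<Rightarrow> 'k::field) \<Rightarrow> int vec \<Rightarrow> 'k" where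
  "weight_shift n \<gamma> f = (\<lambda>z. if z \<in> carrier_vec n then f (z + \<gamma>) else 0)"

type_synonym 'k skew = "(('k \<times> kostant \<Rightarrow>\<^sub>0 int) set \<times> (int vec \<Rightarrow> 'k) \<Rightarrow>\<^sub>0 int) set"

text \<open>
  \<open>(a \<otimes> b)(a' \<otimes> b')\<close> is the sum of \<open>a a'\<^sub>\<gamma> \<otimes> b\<^sup>\<gamma> b'\<close> over the homogeneous components \<open>a'\<^sub>\<gamma>\<close> of \<open>a'\<close>.
\<close>

definition skew_product :: "nat \<Rightarrow> ('k::field, 'k skew) module" where
  "skew_product n =
    tensor_algebra (kostant_K n) (weight_functions n) (smult (kostant_K n))
      (\<lambda>(a, b) (a', b').
        \<Sum>\<gamma> | \<gamma> \<in> root_monoid n \<and> kostant_components n a' \<gamma> \<noteq> \<zero>\<^bsub>kostant_K n\<^esub>.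
          frag_of (a \<otimes>\<^bsub>kostant_K n\<^esub> kostant_components n a' \<gamma>,
                   weight_shift n \<gamma> b \<otimes>\<^bsub>weight_functions n\<^esub> b'))"

definition compositions :: "nat \<Rightarrow> nat \<Rightarrow> int vec set" where
  "compositions n r = {z \<in> carrier_vec n. (\<forall>i<n. 0 \<le> z $ i) \<and> (\<Sum>i<n. z $ i) = int r}"

definition ebar :: "nat \<Rightarrow> int vec set \<Rightarrow> 'k::field skew" where
  "ebar n W = \<one>\<^bsub>skew_product n\<^esub> \<ominus>\<^bsub>skew_product n\<^esub>
    pure_tensor (kostant_K n) (weight_functions n) \<one>\<^bsub>kostant_K n\<^esub> (\<lambda>z. if z \<in> W then 1 else 0)"

definition skew_quotient :: "nat \<Rightarrow> int vec set \<Rightarrow> ('k::field, 'k skew set) module" where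
  "skew_quotient n W =
    quot_algebra (skew_product n) (Idl\<^bsub>skew_product n\<^esub> {ebar n W})"

section \<open>Schur algebras\<close>

text \<open>
  The tensor power \<open>(K\<^sup>n)\<^sup>\<otimes>\<^sup>r\<close> in coordinates: \<open>t i\<close> is the coefficient of \<open>t\<close> at
  \<open>v\<^bsub>i!0\<^esub> \<otimes> \<dots> \<otimes> v\<^bsub>i!(r-1)\<^esub>\<close>.
\<close>

definition multi_indices :: "nat \<Rightarrow> nat \<Rightarrow> nat list set" where
  "multi_indices n r = {i. length i = r \<and> set i \<subseteq> {..<n}}"

definition tensor_power :: "nat \<Rightarrow> nat \<Rightarrow> (nat list \<Rightarrow> 'k::field) set" where
  "tensor_power n r = {t. \<forall>i. i \<notin> multi_indices n r \<longrightarrow> t i = 0}"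

definition elementary_tensor :: "nat \<Rightarrow> 'k::field vec list \<Rightarrow> nat list \<Rightarrow> 'k" where
  "elementary_tensor n vs = (\<lambda>i. if i \<in> multi_indices n (length vs)
    then \<Prod>k<length vs. (vs ! k) $ (i ! k) else 0)"

type_synonym 'k tensor_op = "(nat list \<Rightarrow> 'k) \<Rightarrow> (nat list \<Rightarrow> 'k)"

definition tensor_End :: "nat \<Rightarrow> nat \<Rightarrow> ('k::field, 'k tensor_op) module" where
  "tensor_End n r = (let T = tensor_power n r in
    \<lparr>carrier = {F \<in> T \<rightarrow>\<^sub>E T.
        (\<forall>s \<in> T. \<forall>t \<in> T. F (\<lambda>i. s i + t i) = (\<lambda>i. F s i + F t i)) \<and>
        (\<forall>c. \<forall>t \<in> T. F (\<lambda>i. c * t i) = (\<lambda>i. c * F t i))},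
     monoid.mult = compose T,
     one = (\<lambda>t\<in>T. t),
     zero = (\<lambda>t\<in>T. (\<lambda>i. 0)),
     add = (\<lambda>F G. \<lambda>t\<in>T. (\<lambda>i. F t i + G t i)),
     smult = (\<lambda>c F. \<lambda>t\<in>T. (\<lambda>i. c * F t i))\<rparr>)"

text \<open>The operator \<open>g\<^sup>\<otimes>\<^sup>r\<close>; see \<open>tensor_power_op_elementary\<close> below.\<close>

definition tensor_power_op :: "nat \<Rightarrow> nat \<Rightarrow> 'k::field mat \<Rightarrow> 'k tensor_op" where
  "tensor_power_op n r g = (\<lambda>t \<in> tensor_power n r. (\<lambda>i. if i \<in> multi_indices n r
    then \<Sum>j\<in>multi_indices n r. (\<Prod>k<r. g $$ (i ! k, j ! k)) * t j else 0))"

definition GL :: "nat \<Rightarrow> 'k::field mat set" where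
  "GL n = {g \<in> carrier_mat n n. invertible_mat g}"

definition schur_algebra :: "nat \<Rightarrow> nat \<Rightarrow> ('k::field, 'k tensor_op) module" where
  "schur_algebra n r =
    (tensor_End n r)\<lparr>carrier := lin_span (tensor_End n r) (tensor_power_op n r ` GL n)\<rparr>"

definition borel_schur_algebra :: "nat \<Rightarrow> nat \<Rightarrow> ('k::field, 'k tensor_op) module" where
  "borel_schur_algebra n r =
    (schur_algebra n r)\<lparr>carrier :=
      lin_span (tensor_End n r) (tensor_power_op n r ` {g \<in> GL n. upper_triangular g})\<rparr>"

lemma generate_subset: "X \<subseteq> Y \<Longrightarrow> generate G X \<subseteq> generate G Y"
proof
  fix x assume XY: "X \<subseteq> Y" and "x \<in> generate G X"
  from this(2) show "x \<in> generate G Y"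
    by (induction rule: generate.induct) (use XY in \<open>auto intro: generate.intros\<close>)
qed

lemma borel_subset_schur:
  "carrier (borel_schur_algebra n r) \<subseteq> carrier (schur_algebra n r)"
  unfolding borel_schur_algebra_def schur_algebra_def lin_span_def
  by simp (rule generate_subset, blast)

lemma multi_indices_Suc:
  "multi_indices n (Suc r) = (\<lambda>x. fst x # snd x) ` ({..<n} \<times> multi_indices n r)"
  by (auto simp: multi_indices_def length_Suc_conv image_iff)

lemma sum_multi_indices_prod:
  fixes f :: "nat \<Rightarrow> nat \<Rightarrow> 'k::comm_ring_1"
  shows "(\<Sum>j\<in>multi_indices n r. \<Prod>k<r. f k (j ! k)) = (\<Prod>k<r. \<Sum>a<n. f k a)"
proof (induction r arbitrary: f)
  case 0
  have "multi_indices n 0 = {[]}" by (auto simp: multi_indices_def)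
  then show ?case by simp
next
  case (Suc r)
  have inj: "inj_on (\<lambda>x. fst x # snd x) ({..<n} \<times> multi_indices n r)"
    by (auto simp: inj_on_def)
  have "(\<Sum>j\<in>multi_indices n (Suc r). \<Prod>k<Suc r. f k (j ! k))
      = (\<Sum>a<n. \<Sum>i\<in>multi_indices n r. f 0 a * (\<Prod>k<r. f (Suc k) (i ! k)))"
    unfolding multi_indices_Suc
    by (simp add: sum.reindex[OF inj] sum.cartesian_product prod.lessThan_Suc_shift case_prod_beta
        del: prod.lessThan_Suc)
  also have "\<dots> = (\<Sum>a<n. f 0 a) * (\<Prod>k<r. \<Sum>a<n. f (Suc k) a)"
    by (simp add: sum_distrib_left[symmetric] sum_distrib_right[symmetric]
        Suc.IH[of "\<lambda>k. f (Suc k)"])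
  also have "\<dots> = (\<Prod>k<Suc r. \<Sum>a<n. f k a)"
    by (simp add: prod.lessThan_Suc_shift del: prod.lessThan_Suc)
  finally show ?case .
qed

lemma tensor_power_op_elementary:
  assumes g: "g \<in> carrier_mat n n" and vs: "set vs \<subseteq> carrier_vec n"
  shows "tensor_power_op n (length vs) g (elementary_tensor n vs)
    = elementary_tensor n (map ((*\<^sub>v) g) vs)"
proof -
  let ?r = "length vs"
  have mem: "elementary_tensor n vs \<in> tensor_power n ?r"
    by (auto simp: elementary_tensor_def tensor_power_def)
  have "(\<Sum>j\<in>multi_indices n ?r. (\<Prod>k<?r. g $$ (i ! k, j ! k)) * elementary_tensor n vs j)
      = (\<Prod>k<?r. (g *\<^sub>v (vs ! k)) $ (i ! k))" if i: "i \<in> multi_indices n ?r" for i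
  proof -
    have "(\<Sum>j\<in>multi_indices n ?r. (\<Prod>k<?r. g $$ (i ! k, j ! k)) * elementary_tensor n vs j)
        = (\<Sum>j\<in>multi_indices n ?r. \<Prod>k<?r. g $$ (i ! k, j ! k) * (vs ! k) $ (j ! k))"
      by (rule sum.cong) (auto simp: elementary_tensor_def prod.distrib)
    also have "\<dots> = (\<Prod>k<?r. \<Sum>a<n. g $$ (i ! k, a) * (vs ! k) $ a)"
      by (rule sum_multi_indices_prod)
    also have "\<dots> = (\<Prod>k<?r. (g *\<^sub>v (vs ! k)) $ (i ! k))"
    proof (rule prod.cong[OF refl])
      fix k assume "k \<in> {..<?r}"
      then have k: "k < ?r" by simp
      then have "i ! k < n" using i nth_mem[of k i] by (simp add: multi_indices_def subset_eq)
      moreover have "vs ! k \<in> carrier_vec n" using k vs nth_mem by blast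
      ultimately show "(\<Sum>a<n. g $$ (i ! k, a) * (vs ! k) $ a) = (g *\<^sub>v (vs ! k)) $ (i ! k)"
        using g by (auto simp: scalar_prod_def lessThan_atLeast0 intro!: sum.cong)
    qed
    finally show ?thesis .
  qed
  then show ?thesis
    using mem by (auto simp: tensor_power_op_def elementary_tensor_def fun_eq_iff)
qed

end

theory Submission
  imports Defs "Jordan_Normal_Form.Determinant"
begin

text \<open>
  The proof represents all algebras by matrices whose rows and columns are words \<open>I\<close>, \<open>J\<close> in the
  letters \<open>0, \<dots>, n - 1\<close>, where a word stands for a basis tensor of some degree. Let \<open>e\<^sup>(\<^sup>k\<^sup>)\<close> denote
  the monomial with exponents \<open>k i j\<close>, \<open>i < j\<close>, in the Kostant form. It acts on tensors, and
  \<open>e\<^bsub>ij\<^esub>\<close> turns a letter \<open>j\<close> into \<open>i\<close>. In the prescribed order of the factors no letter is changed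
  twice, because the letter produced by a factor is never consumed by a factor that acts later.
  Therefore (\<open>entry_monomial\<close>) the entry of \<open>e\<^sup>(\<^sup>k\<^sup>)\<close> at \<open>(I, J)\<close> is 1 if \<open>I\<close> arises from \<open>J\<close> by
  changing exactly \<open>k i j\<close> letters \<open>j\<close> into \<open>i\<close>, for all \<open>i < j\<close>, and otherwise it is 0. Everything
  rests on this formula.

  First, for each \<open>k\<close> there is a pair of words at which no other monomial has a non-zero entry. As
  the monomials span the enveloping algebra (\<open>monomials_span_enveloping_algebra\<close>), the coefficients
  of an element are among its matrix entries. So an element belongs to the integral form if and only
  if its entries are integers, and in particular the integral form is closed under multiplication.
  By the same argument the Kostant form over a field embeds into matrices over that field. The skew
  product embeds into matrices whose entries are functions on \<open>\<int>\<^sup>n\<close>, with a convolution for the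
  product that moves the point by the difference of weights. A tensor product that is embedded in
  this way inherits the ring axioms; that is the content of the locale \<open>tensor_representation\<close>. An
  element of the Kostant form is homogeneous of degree \<open>\<gamma>\<close> if and only if its entries vanish
  unless \<open>I\<close> and \<open>J\<close> differ in weight by \<open>\<gamma>\<close>; hence homogeneous components are unique and easy to
  multiply.

  Secondly, let the functions on \<open>\<int>\<^sup>n\<close> act on a word through its weight. This gives the
  homomorphism \<open>skew_op\<close> from the skew product to the operators on \<open>V\<^sup>\<otimes>\<^sup>r\<close>. For \<open>\<nu>\<close> in \<open>\<Lambda>(n,r)\<close> let
  \<open>m\<close> be the upper triangular matrix with entries \<open>k i j\<close> above the diagonal and column sums \<open>\<nu>\<close>. If
  the diagonal of \<open>m\<close> is non-negative, then \<open>e\<^sup>(\<^sup>k\<^sup>) \<otimes> \<chi>\<^sub>\<nu>\<close> is mapped to the operator \<open>\<xi>\<^sub>m\<close> whose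
  entry is 1 exactly at those pairs \<open>(I, J)\<close> that contain \<open>m i j\<close> times the pair of letters
      \<open>(i, j)\<close>,
  for all \<open>i \<le> j\<close>. Otherwise it is mapped to 0. The operators \<open>\<xi>\<^sub>m\<close> span the Borel
  subalgebra, because \<open>g\<^sup>\<otimes>\<^sup>r\<close> is the sum of the \<open>\<xi>\<^sub>m\<close> with monomials in the entries of \<open>g\<close> as
  coefficients, and over an infinite field these monomials can be separated by interpolation
  (\<open>carrier_borel_schur_algebra\<close>).

  Thirdly, the kernel is the ideal generated by \<open>1 - 1 \<otimes> \<chi>\<close> (\<open>ideal_eq_kernel\<close>). The generator is
  mapped to 0 since all words of length \<open>r\<close> have a weight in \<open>\<Lambda>(n,r)\<close>. Conversely, modulo the ideal,
  every element is a combination of elements \<open>e\<^sup>(\<^sup>k\<^sup>) \<otimes> \<chi>\<^sub>\<nu>\<close> with \<open>\<nu>\<close> in \<open>\<Lambda>(n,r)\<close>. If the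
  diagonal entry \<open>m j j\<close> is negative, then the factors of the monomial that consume letters up to
  \<open>j\<close> lead from \<open>\<nu>\<close> to a weight with a negative coordinate, so \<open>e\<^sup>(\<^sup>k\<^sup>) \<otimes> \<chi>\<^sub>\<nu>\<close> lies in the
  ideal (\<open>invalid_in_ideal\<close>). The remaining elements have linearly independent images \<open>\<xi>\<^sub>m\<close>.
\<close>

section \<open>Modules and algebras over a type of scalars\<close>

text \<open>
  All elements of the scalar type act, so the scalars need no carrier set of their own.
\<close>

locale scalar_module = abelian_group A
  for A :: "('c::comm_ring_1, 'a, 'm) module_scheme" (structure) +
  assumes smult_closed: "x \<in> carrier A \<Longrightarrow> c \<odot> x \<in> carrier A"
    and smult_l_distr: "x \<in> carrier A \<Longrightarrow> (c + d) \<odot> x = c \<odot> x \<oplus> d \<odot> x"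
    and smult_r_distr: "\<lbrakk>x \<in> carrier A; y \<in> carrier A\<rbrakk> \<Longrightarrow> c \<odot> (x \<oplus> y) = c \<odot> x \<oplus> c \<odot> y"
    and smult_assoc: "x \<in> carrier A \<Longrightarrow> (c * d) \<odot> x = c \<odot> (d \<odot> x)"
    and smult_one: "x \<in> carrier A \<Longrightarrow> 1 \<odot> x = x"
begin

lemma smult_zero_left: "x \<in> carrier A \<Longrightarrow> 0 \<odot> x = \<zero>"
  by (metis add.r_cancel_one' smult_closed smult_l_distr add.inv_closed add_0)

lemma smult_zero_right: "c \<odot> \<zero> = \<zero>"
  by (metis add.r_cancel_one' smult_closed smult_r_distr zero_closed l_zero)

lemma smult_minus_left:
  assumes "x \<in> carrier A" shows "(- c) \<odot> x = \<ominus> (c \<odot> x)"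
proof -
  have "(- c) \<odot> x \<oplus> c \<odot> x = \<zero>"
    using assms smult_l_distr[of x "- c" c] by (simp add: smult_zero_left)
  then show ?thesis using assms by (metis minus_equality smult_closed)
qed

lemma lin_span_closed: "X \<subseteq> carrier A \<Longrightarrow> x \<in> lin_span A X \<Longrightarrow> x \<in> carrier A"
  using add.generate_in_carrier[of "{c \<odot> x | c x. x \<in> X}" x] smult_closed
  by (auto simp: lin_span_def)

lemma lin_span_zero: "\<zero> \<in> lin_span A X"
  unfolding lin_span_def using generate.one[of "add_monoid A"] by simp

lemma lin_span_smult_base: "x \<in> X \<Longrightarrow> c \<odot> x \<in> lin_span A X"
  unfolding lin_span_def by (rule generate.incl) auto

lemma lin_span_base: "x \<in> X \<Longrightarrow> x \<in> carrier A \<Longrightarrow> x \<in> lin_span A X"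
  using lin_span_smult_base[of x X 1] by (simp add: smult_one)

lemma lin_span_add: "x \<in> lin_span A X \<Longrightarrow> y \<in> lin_span A X \<Longrightarrow> x \<oplus> y \<in> lin_span A X"
  unfolding lin_span_def using generate.eng[of x "add_monoid A" _ y] by simp

lemma lin_span_induct [consumes 2, case_names zero base add]:
  assumes X: "X \<subseteq> carrier A" and x: "x \<in> lin_span A X"
    and zero: "P \<zero>"
    and base: "\<And>c x. x \<in> X \<Longrightarrow> P (c \<odot> x)"
    and add: "\<And>x y. x \<in> lin_span A X \<Longrightarrow> y \<in> lin_span A X \<Longrightarrow> P x \<Longrightarrow> P y \<Longrightarrow> P (x \<oplus> y)"
  shows "P x"
  using x unfolding lin_span_def
proof (induction rule: generate.induct)
  case one then show ?case using zero by simp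
next
  case (incl h) then show ?case using base by auto
next
  case (inv h)
  then obtain c x where h: "h = c \<odot> x" "x \<in> X" by auto
  then have "inv\<^bsub>add_monoid A\<^esub> h = (- c) \<odot> x"
    using X smult_minus_left[of x c] by (auto simp: a_inv_def)
  then show ?case using base[OF h(2)] by simp
next
  case (eng h1 h2) then show ?case using add unfolding lin_span_def by simp
qed

lemma lin_span_smult:
  assumes X: "X \<subseteq> carrier A" and x: "x \<in> lin_span A X"
  shows "c \<odot> x \<in> lin_span A X"
  using X x
proof (induction rule: lin_span_induct)
  case zero then show ?case by (simp add: smult_zero_right lin_span_zero)
next
  case (base d x)
  then have "c \<odot> (d \<odot> x) = (c * d) \<odot> x" using X smult_assoc by auto
  then show ?case using base by (simp add: lin_span_smult_base)
next
  case (add x y) then show ?case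
    using lin_span_closed[OF X] by (simp add: smult_r_distr lin_span_add)
qed

lemma lin_span_minimal:
  assumes X: "X \<subseteq> carrier A" and Y: "Y \<subseteq> carrier A" and "X \<subseteq> lin_span A Y"
    and x: "x \<in> lin_span A X"
  shows "x \<in> lin_span A Y"
  using X x
  by (induction rule: lin_span_induct)
    (use assms in \<open>auto intro: lin_span_zero lin_span_smult lin_span_add\<close>)

lemma lin_span_finsum:
  assumes "finite S" "f \<in> S \<rightarrow> lin_span A X" "X \<subseteq> carrier A"
  shows "finsum A f S \<in> lin_span A X"
  using assms(1,2)
proof (induction S)
  case empty then show ?case by (simp add: lin_span_zero)
next
  case (insert s S)
  then have "f \<in> S \<rightarrow> carrier A" "f s \<in> carrier A" using lin_span_closed[OF assms(3)] by auto
  then show ?case using insert by (simp add: lin_span_add)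
qed

end

locale scalar_algebra = ring A + scalar_module A
  for A :: "('c::comm_ring_1, 'a, 'm) module_scheme" (structure) +
  assumes smult_mult_left: "\<lbrakk>x \<in> carrier A; y \<in> carrier A\<rbrakk> \<Longrightarrow> (c \<odot> x) \<otimes> y = c \<odot> (x \<otimes> y)"
    and smult_mult_right: "\<lbrakk>x \<in> carrier A; y \<in> carrier A\<rbrakk> \<Longrightarrow> x \<otimes> (c \<odot> y) = c \<odot> (x \<otimes> y)"

lemma (in scalar_algebra) ideal_smult_closed:
  assumes "ideal I A" "x \<in> I" shows "c \<odot> x \<in> I"
proof -
  interpret I: ideal I A by fact
  have "c \<odot> x = (c \<odot> \<one>) \<otimes> x"
    using I.a_Hcarr[OF assms(2)] by (simp add: smult_mult_left)
  then show ?thesis using I.I_l_closed[OF assms(2), of "c \<odot> \<one>"] by (simp add: smult_closed)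
qed

section \<open>Quotient algebras\<close>

context
  fixes A :: "('c::comm_ring_1, 'a, 'm) module_scheme" (structure) and I
  assumes A: "scalar_algebra A" and I: "ideal I A"
begin

interpretation A: scalar_algebra A by (rule A)
interpretation I: ideal I A by (rule I)

lemma quot_coset_eq_iff:
  assumes "x \<in> carrier A" "y \<in> carrier A"
  shows "I +> x = I +> y \<longleftrightarrow> x \<ominus> y \<in> I"
  using assms
  by (metis A.quotient_eq_iff_same_a_r_cos I)

lemma quot_carrier: "carrier (quot_algebra A I) = (\<lambda>x. I +> x) ` carrier A"
  by (auto simp: quot_algebra_def FactRing_simps)

lemma quot_mult:
  "x \<in> carrier A \<Longrightarrow> y \<in> carrier A \<Longrightarrow>
   (I +> x) \<otimes>\<^bsub>quot_algebra A I\<^esub> (I +> y) = I +> (x \<otimes> y)"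
  by (simp add: quot_algebra_def FactRing_def I.rcoset_mult_add)

lemma quot_add:
  "x \<in> carrier A \<Longrightarrow> y \<in> carrier A \<Longrightarrow>
   (I +> x) \<oplus>\<^bsub>quot_algebra A I\<^esub> (I +> y) = I +> (x \<oplus> y)"
  by (simp add: quot_algebra_def FactRing_def I.a_rcos_sum)

lemma quot_one: "\<one>\<^bsub>quot_algebra A I\<^esub> = I +> \<one>"
  by (simp add: quot_algebra_def FactRing_def)

lemma quot_zero: "\<zero>\<^bsub>quot_algebra A I\<^esub> = I +> \<zero>"
  by (simp add: quot_algebra_def FactRing_def A.a_coset_add_zero I.a_subset)

lemma quot_smult:
  assumes x: "x \<in> carrier A"
  shows "c \<odot>\<^bsub>quot_algebra A I\<^esub> (I +> x) = I +> (c \<odot> x)"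
proof -
  have "I +> (c \<odot> y) = I +> (c \<odot> x)" if y: "y \<in> I +> x" for y
  proof -
    obtain h where h: "h \<in> I" "y = h \<oplus> x" using y by (auto simp: a_r_coset_def r_coset_def)
    then have "c \<odot> y \<ominus> c \<odot> x = c \<odot> h"
      using x by (simp add: A.smult_r_distr a_minus_def A.a_assoc A.r_neg A.smult_closed I.a_Hcarr)
    then have "c \<odot> y \<ominus> c \<odot> x \<in> I" using A.ideal_smult_closed[OF I h(1)] by simp
    then show ?thesis using quot_coset_eq_iff[of "c \<odot> y" "c \<odot> x"] h x
      by (simp add: A.smult_closed I.a_Hcarr)
  qed
  then have "(\<Union>y\<in>I +> x. I +> (c \<odot> y)) = (\<Union>y\<in>I +> x. I +> (c \<odot> x))" by (rule SUP_cong[OF refl])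
  moreover have "I +> x \<noteq> {}" using I.a_rcos_self[OF x] by blast
  ultimately show ?thesis by (simp add: quot_algebra_def)
qed

lemma quot_scalar_algebra: "scalar_algebra (quot_algebra A I)"
proof -
  have "ring (quot_algebra A I)"
  proof (rule ringI)
    show "abelian_group (quot_algebra A I)"
    proof (rule abelian_groupI)
      show "\<exists>Y\<in>carrier (quot_algebra A I). Y \<oplus>\<^bsub>quot_algebra A I\<^esub> X = \<zero>\<^bsub>quot_algebra A I\<^esub>"
        if X: "X \<in> carrier (quot_algebra A I)" for X
      proof -
        obtain x where "x \<in> carrier A" "X = I +> x" using X by (auto simp: quot_carrier)
        then show ?thesis
          by (intro bexI[of _ "I +> \<ominus> x"]) (auto simp: quot_carrier quot_add quot_zero A.l_neg)
      qed
      show "X \<oplus>\<^bsub>quot_algebra A I\<^esub> Y = Y \<oplus>\<^bsub>quot_algebra A I\<^esub> X"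
        if XY: "X \<in> carrier (quot_algebra A I)" "Y \<in> carrier (quot_algebra A I)" for X Y
      proof -
        obtain x y where "x \<in> carrier A" "X = I +> x" "y \<in> carrier A" "Y = I +> y"
          using XY by (auto simp: quot_carrier)
        then show ?thesis by (simp add: quot_add A.a_comm[of x y])
      qed
    qed (auto simp: quot_carrier quot_add quot_zero A.a_assoc)
    show "monoid (quot_algebra A I)"
      by (rule monoidI) (auto simp: quot_carrier quot_mult quot_one A.m_assoc)
  qed (auto simp: quot_carrier quot_mult quot_add A.l_distr A.r_distr)
  then interpret R: ring "quot_algebra A I" .
  note quot_simps = quot_mult quot_add quot_smult A.smult_closed
  show ?thesis
  proof unfold_locales
    fix X Y c d
    assume "X \<in> carrier (quot_algebra A I)"
    then obtain x where x: "x \<in> carrier A" and X: "X = I +> x" by (auto simp: quot_carrier)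
    show "c \<odot>\<^bsub>quot_algebra A I\<^esub> X \<in> carrier (quot_algebra A I)"
      using x by (simp add: X quot_carrier quot_smult A.smult_closed)
    show "(c + d) \<odot>\<^bsub>quot_algebra A I\<^esub> X
        = c \<odot>\<^bsub>quot_algebra A I\<^esub> X \<oplus>\<^bsub>quot_algebra A I\<^esub> d \<odot>\<^bsub>quot_algebra A I\<^esub> X"
      using x by (simp add: X quot_simps A.smult_l_distr)
    show "(c * d) \<odot>\<^bsub>quot_algebra A I\<^esub> X = c \<odot>\<^bsub>quot_algebra A I\<^esub> (d \<odot>\<^bsub>quot_algebra A I\<^esub> X)"
      using x by (simp add: X quot_simps A.smult_assoc)
    show "1 \<odot>\<^bsub>quot_algebra A I\<^esub> X = X"
      using x by (simp add: X quot_simps A.smult_one)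
    assume "Y \<in> carrier (quot_algebra A I)"
    then obtain y where y: "y \<in> carrier A" and Y: "Y = I +> y" by (auto simp: quot_carrier)
    show "c \<odot>\<^bsub>quot_algebra A I\<^esub> (X \<oplus>\<^bsub>quot_algebra A I\<^esub> Y)
        = c \<odot>\<^bsub>quot_algebra A I\<^esub> X \<oplus>\<^bsub>quot_algebra A I\<^esub> c \<odot>\<^bsub>quot_algebra A I\<^esub> Y"
      using x y by (simp add: X Y quot_simps A.smult_r_distr)
    show "(c \<odot>\<^bsub>quot_algebra A I\<^esub> X) \<otimes>\<^bsub>quot_algebra A I\<^esub> Y
        = c \<odot>\<^bsub>quot_algebra A I\<^esub> (X \<otimes>\<^bsub>quot_algebra A I\<^esub> Y)"
      using x y by (simp add: X Y quot_simps A.smult_mult_left)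
    show "X \<otimes>\<^bsub>quot_algebra A I\<^esub> (c \<odot>\<^bsub>quot_algebra A I\<^esub> Y)
        = c \<odot>\<^bsub>quot_algebra A I\<^esub> (X \<otimes>\<^bsub>quot_algebra A I\<^esub> Y)"
      using x y by (simp add: X Y quot_simps A.smult_mult_right)
  qed
qed

text \<open>
  The first isomorphism theorem. The target is given by its operations alone: that they obey the
  laws of an algebra is part of the conclusion, since they are transported from the quotient.
\<close>

lemma quot_algebra_isomorphic:
  fixes B :: "('c, 'b, 'n) module_scheme"
  assumes img: "\<phi> ` carrier A = carrier B"
    and ker: "\<And>x y. x \<in> carrier A \<Longrightarrow> y \<in> carrier A \<Longrightarrow> \<phi> x = \<phi> y \<longleftrightarrow> x \<ominus> y \<in> I"
    and mult: "\<And>x y. x \<in> carrier A \<Longrightarrow> y \<in> carrier A \<Longrightarrow> \<phi> (x \<otimes> y) = \<phi> x \<otimes>\<^bsub>B\<^esub> \<phi> y"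
    and add: "\<And>x y. x \<in> carrier A \<Longrightarrow> y \<in> carrier A \<Longrightarrow> \<phi> (x \<oplus> y) = \<phi> x \<oplus>\<^bsub>B\<^esub> \<phi> y"
    and one: "\<phi> \<one> = \<one>\<^bsub>B\<^esub>"
    and smult: "\<And>c x. x \<in> carrier A \<Longrightarrow> \<phi> (c \<odot> x) = c \<odot>\<^bsub>B\<^esub> \<phi> x"
  shows "algebra_isomorphic (quot_algebra A I) B"
proof -
  define h where "h = (\<lambda>X. \<phi> (SOME x. x \<in> X))"
  have h: "h (I +> x) = \<phi> x" if x: "x \<in> carrier A" for x
  proof -
    have "(SOME y. y \<in> I +> x) \<in> I +> x" using I.a_rcos_self[OF x] by (rule someI)
    moreover have "\<phi> y = \<phi> x" if "y \<in> I +> x" for y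
    proof -
      have y: "y \<in> carrier A" using that x I.a_elemrcos_carrier by blast
      then have "y \<ominus> x \<in> I" using that x I.a_rcos_module_minus[OF A.ring_axioms x y] by simp
      then show ?thesis using ker[OF y x] by simp
    qed
    ultimately show ?thesis by (simp add: h_def)
  qed
  have "h \<in> ring_iso (quot_algebra A I) B"
  proof (rule ring_iso_memI)
    show "bij_betw h (carrier (quot_algebra A I)) (carrier B)"
    proof (rule bij_betw_imageI)
      show "inj_on h (carrier (quot_algebra A I))"
      proof (rule inj_onI)
        fix X Y assume "X \<in> carrier (quot_algebra A I)" "Y \<in> carrier (quot_algebra A I)"
          and eq: "h X = h Y"
        then obtain x y where xy: "x \<in> carrier A" "X = I +> x" "y \<in> carrier A" "Y = I +> y"
          by (auto simp: quot_carrier)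
        then have "\<phi> x = \<phi> y" using eq h by metis
        then show "X = Y" using ker[OF xy(1,3)] quot_coset_eq_iff[OF xy(1,3)] xy by metis
      qed
      show "h ` carrier (quot_algebra A I) = carrier B"
        unfolding quot_carrier img[symmetric] image_image by (rule image_cong) (auto simp: h)
    qed
    show "h \<one>\<^bsub>quot_algebra A I\<^esub> = \<one>\<^bsub>B\<^esub>" by (simp add: quot_one h one)
    fix X assume "X \<in> carrier (quot_algebra A I)"
    then obtain x where x: "x \<in> carrier A" and X: "X = I +> x" by (auto simp: quot_carrier)
    show "h X \<in> carrier B" using x by (simp add: X h flip: img)
    fix Y assume "Y \<in> carrier (quot_algebra A I)"
    then obtain y where y: "y \<in> carrier A" and Y: "Y = I +> y" by (auto simp: quot_carrier)
    show "h (X \<otimes>\<^bsub>quot_algebra A I\<^esub> Y) = h X \<otimes>\<^bsub>B\<^esub> h Y"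
      using x y by (simp add: X Y quot_mult h mult)
    show "h (X \<oplus>\<^bsub>quot_algebra A I\<^esub> Y) = h X \<oplus>\<^bsub>B\<^esub> h Y"
      using x y by (simp add: X Y quot_add h add)
  qed
  note iso = this
  have sm: "h (c \<odot>\<^bsub>quot_algebra A I\<^esub> X) = c \<odot>\<^bsub>B\<^esub> h X" if cX: "X \<in> carrier (quot_algebra A I)" for c X
  proof -
    obtain x where x: "x \<in> carrier A" and X: "X = I +> x" using cX by (auto simp: quot_carrier)
    show ?thesis using x by (simp add: X quot_smult h smult A.smult_closed)
  qed
  show ?thesis unfolding algebra_isomorphic_def
    by (intro bexI[OF _ iso] allI ballI) (rule sm)
qed

end

section \<open>The free algebra\<close>

text \<open>
  A finitely supported function on words is determined by its pairings with arbitrary functions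
  on words, and the product is the one that pairs words by concatenation. This turns the ring
  axioms into one-line computations.
\<close>

definition word_pairing :: "('x list \<Rightarrow> 'c::comm_ring_1) \<Rightarrow> ('x list \<Rightarrow> 'c) \<Rightarrow> 'c" where
  "word_pairing f \<phi> = (\<Sum>w | f w \<noteq> 0. f w * \<phi> w)"

lemma word_pairing_superset:
  "finite W \<Longrightarrow> {w. f w \<noteq> 0} \<subseteq> W \<Longrightarrow> word_pairing f \<phi> = (\<Sum>w\<in>W. f w * \<phi> w)"
  unfolding word_pairing_def by (rule sum.mono_neutral_left) auto

lemma word_pairing_delta:
  "finite {w. f w \<noteq> 0} \<Longrightarrow> word_pairing f (\<lambda>v. if v = w then 1 else 0) = f w"
  by (subst word_pairing_superset[of "insert w {w. f w \<noteq> 0}"])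
    (auto simp: if_distrib sum.delta cong: if_cong)

lemma word_pairing_sum:
  "word_pairing f (\<lambda>w. \<Sum>a\<in>S. \<phi> a w) = (\<Sum>a\<in>S. word_pairing f (\<phi> a))"
  unfolding word_pairing_def by (subst sum.swap) (simp add: sum_distrib_left)

lemma word_pairing_scale: "word_pairing f (\<lambda>w. c * \<phi> w) = c * word_pairing f \<phi>"
  unfolding word_pairing_def by (simp add: sum_distrib_left mult_ac)

lemma free_algebra_simps:
  "carrier (free_algebra X) = {f. finite {w. f w \<noteq> 0} \<and> {w. f w \<noteq> 0} \<subseteq> lists X}"
  "f \<otimes>\<^bsub>free_algebra X\<^esub> g = (\<lambda>w. \<Sum>k\<le>length w. f (take k w) * g (drop k w))"
  "\<one>\<^bsub>free_algebra X\<^esub> = (\<lambda>w. if w = [] then 1 else 0)"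
  "\<zero>\<^bsub>free_algebra X\<^esub> = (\<lambda>w. 0)"
  "f \<oplus>\<^bsub>free_algebra X\<^esub> g = (\<lambda>w. f w + g w)"
  "c \<odot>\<^bsub>free_algebra X\<^esub> f = (\<lambda>w. c * f w)"
  by (simp_all add: free_algebra_def)

lemma word_pairing_add:
  assumes "finite {w. f w \<noteq> 0}" "finite {w. g w \<noteq> 0}"
  shows "word_pairing (\<lambda>w. f w + g w) \<phi> = word_pairing f \<phi> + word_pairing g \<phi>"
  using assms word_pairing_superset[of "{w. f w \<noteq> 0} \<union> {w. g w \<noteq> 0}"]
  by (subst (1 2 3) word_pairing_superset[of "{w. f w \<noteq> 0} \<union> {w. g w \<noteq> 0}"])
    (auto simp: sum.distrib distrib_right)

lemma word_pairing_smult: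
  assumes "finite {w. f w \<noteq> 0}"
  shows "word_pairing (\<lambda>w. c * f w) \<phi> = c * word_pairing f \<phi>"
  using assms
  by (subst (1 2) word_pairing_superset[of "{w. f w \<noteq> 0}"]) (auto simp: sum_distrib_left mult_ac)

lemma word_product_support:
  fixes f g :: "'x list \<Rightarrow> 'c::comm_ring_1"
  shows "{w. (\<Sum>k\<le>length w. f (take k w) * g (drop k w)) \<noteq> 0}
    \<subseteq> (\<lambda>(u, v). u @ v) ` ({w. f w \<noteq> 0} \<times> {w. g w \<noteq> 0})"
proof
  fix w assume "w \<in> {w. (\<Sum>k\<le>length w. f (take k w) * g (drop k w)) \<noteq> 0}"
  then obtain k where "f (take k w) * g (drop k w) \<noteq> 0"
    using sum.not_neutral_contains_not_neutral by blast
  then have "f (take k w) \<noteq> 0" "g (drop k w) \<noteq> 0" by auto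
  then show "w \<in> (\<lambda>(u, v). u @ v) ` ({w. f w \<noteq> 0} \<times> {w. g w \<noteq> 0})"
    by (intro image_eqI[of _ _ "(take k w, drop k w)"]) auto
qed

text \<open>
  Pairing with functions of the concatenated word: both sides are the sum of
  \<open>f u * g v * \<phi> (u @ v)\<close> over all pairs, grouped by \<open>u @ v\<close> on the left.
\<close>

lemma word_pairing_mult:
  assumes f: "finite {w. f w \<noteq> 0}" and g: "finite {w. g w \<noteq> 0}"
  shows "word_pairing (\<lambda>w. \<Sum>k\<le>length w. f (take k w) * g (drop k w)) \<phi>
    = word_pairing f (\<lambda>u. word_pairing g (\<lambda>v. \<phi> (u @ v)))" (is "word_pairing ?p \<phi> = _")
proof -
  let ?P = "{w. f w \<noteq> 0} \<times> {w. g w \<noteq> 0}"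
  let ?c = "\<lambda>(u, v). u @ v"
  have P: "finite ?P" using f g by simp
  have prod: "?p w = (\<Sum>x | x \<in> ?P \<and> ?c x = w. f (fst x) * g (snd x))" for w
  proof -
    have "?p w = (\<Sum>k | k \<le> length w \<and> f (take k w) \<noteq> 0 \<and> g (drop k w) \<noteq> 0.
        f (take k w) * g (drop k w))"
      by (rule sum.mono_neutral_right) auto
    also have "\<dots> = (\<Sum>x | x \<in> ?P \<and> ?c x = w. f (fst x) * g (snd x))"
      by (rule sum.reindex_bij_witness[of _ "\<lambda>x. length (fst x)" "\<lambda>k. (take k w, drop k w)"]) auto
    finally show ?thesis .
  qed
  have "word_pairing ?p \<phi> = (\<Sum>w \<in> ?c ` ?P. ?p w * \<phi> w)"
    using P word_product_support by (intro word_pairing_superset) auto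
  also have "\<dots> = (\<Sum>w \<in> ?c ` ?P. \<Sum>x | x \<in> ?P \<and> ?c x = w. f (fst x) * g (snd x) * \<phi> (?c x))"
    unfolding prod sum_distrib_right by (intro sum.cong) auto
  also have "\<dots> = (\<Sum>x\<in>?P. f (fst x) * g (snd x) * \<phi> (?c x))"
    by (rule sum.group) (use P in auto)
  also have "\<dots> = word_pairing f (\<lambda>u. word_pairing g (\<lambda>v. \<phi> (u @ v)))"
    unfolding word_pairing_def
    by (simp add: sum.cartesian_product sum_distrib_left mult_ac case_prod_beta)
  finally show ?thesis .
qed

lemma word_function_eqI:
  assumes "finite {w. f w \<noteq> 0}" "finite {w. g w \<noteq> 0}"
    and "\<And>\<phi>. word_pairing f \<phi> = word_pairing g \<phi>"
  shows "f = g"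
  using assms word_pairing_delta by (metis ext)

lemma free_algebra_mult_closed:
  assumes "f \<in> carrier (free_algebra X)" "g \<in> carrier (free_algebra X)"
  shows "f \<otimes>\<^bsub>free_algebra X\<^esub> g \<in> carrier (free_algebra X)"
proof -
  have supp: "u \<in> lists X" if "f u \<noteq> 0 \<or> g u \<noteq> 0" for u
    using assms that by (auto simp only: free_algebra_simps)
  have "u @ v \<in> lists X" if "f u \<noteq> 0" "g v \<noteq> 0" for u v
    using supp[of u] supp[of v] that by (simp only: append_in_lists_conv) simp
  then have "finite ((\<lambda>(u, v). u @ v) ` ({w. f w \<noteq> 0} \<times> {w. g w \<noteq> 0}))"
    "(\<lambda>(u, v). u @ v) ` ({w. f w \<noteq> 0} \<times> {w. g w \<noteq> 0}) \<subseteq> lists X"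
    using assms by (auto simp only: free_algebra_simps)
  from finite_subset[OF word_product_support this(1)] subset_trans[OF word_product_support this(2)]
  show ?thesis unfolding free_algebra_simps by (intro CollectI conjI)
qed

lemma free_algebra_scalar_algebra:
  "scalar_algebra (free_algebra X :: ('c::comm_ring_1, 'x list \<Rightarrow> 'c) module)"
proof -
  let ?F = "free_algebra X :: ('c, 'x list \<Rightarrow> 'c) module"
  have sm: "(\<lambda>w. c * f w) \<in> carrier ?F" if "f \<in> carrier ?F" for c f
  proof -
    have "{w. c * f w \<noteq> 0} \<subseteq> {w. f w \<noteq> 0}" by auto
    then show ?thesis using that by (auto simp: free_algebra_simps intro: finite_subset)
  qed
  have ad: "(\<lambda>w. f w + g w) \<in> carrier ?F" if "f \<in> carrier ?F" "g \<in> carrier ?F" for f g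
  proof -
    have "{w. f w + g w \<noteq> 0} \<subseteq> {w. f w \<noteq> 0} \<union> {w. g w \<noteq> 0}" by auto
    then have "finite {w. f w + g w \<noteq> 0}"
      by (rule finite_subset) (use that in \<open>auto simp: free_algebra_simps\<close>)
    then show ?thesis using that \<open>{w. f w + g w \<noteq> 0} \<subseteq> _\<close> by (auto simp: free_algebra_simps)
  qed
  have one: "\<one>\<^bsub>?F\<^esub> \<in> carrier ?F" by (auto simp: free_algebra_simps)
  have zero: "\<zero>\<^bsub>?F\<^esub> \<in> carrier ?F" by (auto simp: free_algebra_simps)
  note mc = free_algebra_mult_closed[where X = X and 'b = 'c]
  have fin: "finite {w. f w \<noteq> 0}" if "f \<in> carrier ?F" for f using that
    by (simp add: free_algebra_simps)
  have pm: "word_pairing (f \<otimes>\<^bsub>?F\<^esub> g) \<phi> = word_pairing f (\<lambda>u. word_pairing g (\<lambda>v. \<phi> (u @ v)))"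
    if "f \<in> carrier ?F" "g \<in> carrier ?F" for f g \<phi>
    using word_pairing_mult[OF fin[OF that(1)] fin[OF that(2)]] by (simp add: free_algebra_simps)
  have pa: "word_pairing (f \<oplus>\<^bsub>?F\<^esub> g) \<phi> = word_pairing f \<phi> + word_pairing g \<phi>"
    if "f \<in> carrier ?F" "g \<in> carrier ?F" for f g \<phi>
    using word_pairing_add[OF fin[OF that(1)] fin[OF that(2)]] by (simp add: free_algebra_simps)
  have ps: "word_pairing (c \<odot>\<^bsub>?F\<^esub> f) \<phi> = c * word_pairing f \<phi>" if "f \<in> carrier ?F" for c f \<phi>
    using word_pairing_smult[OF fin[OF that]] by (simp add: free_algebra_simps)
  have po: "word_pairing \<one>\<^bsub>?F\<^esub> \<phi> = \<phi> []" for \<phi>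
    by (subst word_pairing_superset[of "{[]}"]) (auto simp: free_algebra_simps)
  have pp: "word_pairing f (\<lambda>u. \<phi> u + \<psi> u) = word_pairing f \<phi> + word_pairing f \<psi>"
      for f \<phi> and \<psi> :: "'x list \<Rightarrow> 'c"
    by (simp add: word_pairing_def sum.distrib distrib_left)
  have smF: "c \<odot>\<^bsub>?F\<^esub> f \<in> carrier ?F" if "f \<in> carrier ?F" for c f
    using sm[OF that, of c] by (simp add: free_algebra_simps)
  have adF: "f \<oplus>\<^bsub>?F\<^esub> g \<in> carrier ?F" if "f \<in> carrier ?F" "g \<in> carrier ?F" for f g
    using ad[OF that] by (simp add: free_algebra_simps)
  note eqI = word_function_eqI[OF fin fin]
  have ag: "abelian_group ?F"
  proof (rule abelian_groupI)
    show "\<exists>y\<in>carrier ?F. y \<oplus>\<^bsub>?F\<^esub> x = \<zero>\<^bsub>?F\<^esub>" if "x \<in> carrier ?F" for x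
      using sm[OF that, of "- 1"]
        by (intro bexI[of _ "\<lambda>w. - 1 * x w"]) (auto simp: free_algebra_simps)
  qed (use adF zero in \<open>auto simp: free_algebra_simps add_ac\<close>)
  have mo: "monoid ?F"
    by (rule monoidI) (auto intro!: eqI intro: mc one simp: pm po mc one)
  have "ring ?F"
    by (rule ringI[OF ag mo]) (auto intro!: eqI intro: mc adF simp: pm pa pp mc adF)
  then interpret ring ?F .
  show ?thesis
  proof unfold_locales
    fix f g c d assume f: "f \<in> carrier ?F"
    show "c \<odot>\<^bsub>?F\<^esub> f \<in> carrier ?F" by (rule smF[OF f])
    show "(c + d) \<odot>\<^bsub>?F\<^esub> f = c \<odot>\<^bsub>?F\<^esub> f \<oplus>\<^bsub>?F\<^esub> d \<odot>\<^bsub>?F\<^esub> f"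
      by (simp add: free_algebra_simps distrib_right)
    show "(c * d) \<odot>\<^bsub>?F\<^esub> f = c \<odot>\<^bsub>?F\<^esub> (d \<odot>\<^bsub>?F\<^esub> f)"
      by (simp add: free_algebra_simps mult.assoc)
    show "1 \<odot>\<^bsub>?F\<^esub> f = f" by (simp add: free_algebra_simps)
    assume g: "g \<in> carrier ?F"
    show "c \<odot>\<^bsub>?F\<^esub> (f \<oplus>\<^bsub>?F\<^esub> g) = c \<odot>\<^bsub>?F\<^esub> f \<oplus>\<^bsub>?F\<^esub> c \<odot>\<^bsub>?F\<^esub> g"
      by (simp add: free_algebra_simps distrib_left)
    show "(c \<odot>\<^bsub>?F\<^esub> f) \<otimes>\<^bsub>?F\<^esub> g = c \<odot>\<^bsub>?F\<^esub> (f \<otimes>\<^bsub>?F\<^esub> g)"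
      by (simp add: free_algebra_simps sum_distrib_left mult.assoc)
    show "f \<otimes>\<^bsub>?F\<^esub> (c \<odot>\<^bsub>?F\<^esub> g) = c \<odot>\<^bsub>?F\<^esub> (f \<otimes>\<^bsub>?F\<^esub> g)"
      by (simp add: free_algebra_simps sum_distrib_left mult.left_commute)
  qed
qed

section \<open>Tensor products with a faithful linear representation\<close>

definition frag_eval :: "('u \<Rightarrow> 'k::comm_ring_1) \<Rightarrow> ('u \<Rightarrow>\<^sub>0 int) \<Rightarrow> 'k" where
  "frag_eval n x = (\<Sum>u\<in>Poly_Mapping.keys x. of_int (Poly_Mapping.lookup x u) * n u)"

lemma frag_eval_zero [simp]: "frag_eval n 0 = 0"
  by (simp add: frag_eval_def)

lemma frag_eval_of [simp]: "frag_eval n (frag_of u) = n u"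
  by (simp add: frag_eval_def)

lemma frag_eval_superset:
  "finite S \<Longrightarrow> Poly_Mapping.keys x \<subseteq> S \<Longrightarrow>
   frag_eval n x = (\<Sum>u\<in>S. of_int (Poly_Mapping.lookup x u) * n u)"
  unfolding frag_eval_def by (rule sum.mono_neutral_left) (auto simp: in_keys_iff)

lemma frag_eval_diff [simp]: "frag_eval n (x - y) = frag_eval n x - frag_eval n y"
proof -
  let ?S = "Poly_Mapping.keys x \<union> Poly_Mapping.keys y"
  have "frag_eval n (x - y) = (\<Sum>u\<in>?S. of_int (Poly_Mapping.lookup (x - y) u) * n u)"
    using keys_diff[of x y] by (intro frag_eval_superset) auto
  moreover have "frag_eval n x = (\<Sum>u\<in>?S. of_int (Poly_Mapping.lookup x u) * n u)"
    by (rule frag_eval_superset) auto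
  moreover have "frag_eval n y = (\<Sum>u\<in>?S. of_int (Poly_Mapping.lookup y u) * n u)"
    by (rule frag_eval_superset) auto
  ultimately show ?thesis by (simp add: lookup_minus left_diff_distrib sum_subtractf)
qed

lemma frag_eval_uminus [simp]: "frag_eval n (- x) = - frag_eval n x"
  using frag_eval_diff[of n 0 x] by simp

lemma frag_eval_add [simp]: "frag_eval n (x + y) = frag_eval n x + frag_eval n y"
  using frag_eval_diff[of n x "- y"] by simp

lemma frag_eval_sum [simp]: "frag_eval n (sum f S) = (\<Sum>s\<in>S. frag_eval n (f s))"
  by (induction S rule: infinite_finite_induct) auto

lemma frag_eval_extend: "frag_eval n (frag_extend p x) = frag_eval (\<lambda>u. frag_eval n (p u)) x"
  using subset_UNIV by (induction x rule: frag_induction) (auto simp: frag_extend_diff)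

lemma frag_eval_cong:
  "(\<And>u. u \<in> Poly_Mapping.keys x \<Longrightarrow> n u = n' u) \<Longrightarrow> frag_eval n x = frag_eval n' x"
  by (simp add: frag_eval_def)

text \<open>
  A product of two formal sums is evaluated through its effect on generators; if that effect is a
  finite sum of products, then so is the effect on the formal sums.
\<close>

lemma frag_eval_bilinear:
  "frag_eval (\<lambda>u. frag_eval (\<lambda>v. \<Sum>l\<in>L. f u l * g v l) y) x
    = (\<Sum>l\<in>L. frag_eval (\<lambda>u. f u l) x * frag_eval (\<lambda>v. g v l) y)"
proof -
  have "frag_eval (\<lambda>v. \<Sum>l\<in>L. f u l * g v l) y = (\<Sum>l\<in>L. f u l * frag_eval (\<lambda>v. g v l) y)" for u
    unfolding frag_eval_def sum_distrib_left by (subst sum.swap) (simp add: mult_ac)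
  then have "frag_eval (\<lambda>u. frag_eval (\<lambda>v. \<Sum>l\<in>L. f u l * g v l) y) x
      = frag_eval (\<lambda>u. \<Sum>l\<in>L. f u l * frag_eval (\<lambda>v. g v l) y) x"
    by simp
  also have "\<dots> = (\<Sum>l\<in>L. frag_eval (\<lambda>u. f u l) x * frag_eval (\<lambda>v. g v l) y)"
    unfolding frag_eval_def[of _ x] sum_distrib_left sum_distrib_right
    by (subst sum.swap) (simp add: mult.assoc)
  finally show ?thesis .
qed

lemma frag_eval_scale: "frag_eval (\<lambda>u. c * n u) x = c * frag_eval n x"
  by (simp add: frag_eval_def sum_distrib_left mult_ac)

lemma frag_extend_closed:
  assumes "Poly_Mapping.keys x \<subseteq> C" "\<And>u. u \<in> C \<Longrightarrow> Poly_Mapping.keys (p u) \<subseteq> D"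
  shows "Poly_Mapping.keys (frag_extend p x) \<subseteq> D"
  using keys_frag_extend[of p x] assms by blast

text \<open>
  Suppose that a family \<open>n\<close> of functionals on pairs describes the tensor product completely: a
  formal sum of pairs lies in the kernel exactly if all functionals vanish on it. Suppose also
  that the functionals turn the product into a fixed, associative, finite convolution
  \<open>f \<star> g = (\<lambda>i. \<Sum>l\<in>L i. f (\<alpha> i l) * g (\<beta> i l))\<close>. Then the tensor
  product is an algebra, because it embeds into functions under this convolution.
\<close>

locale tensor_representation =
  fixes M :: "('r, 'a, 'm) module_scheme" and N :: "('r, 'b, 'n) module_scheme"
    and s :: "'k::comm_ring_1 \<Rightarrow> 'a \<Rightarrow> 'a"
    and p :: "'a \<times> 'b \<Rightarrow> 'a \<times> 'b \<Rightarrow> ('a \<times> 'b \<Rightarrow>\<^sub>0 int)"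
    and n :: "'a \<times> 'b \<Rightarrow> 'i \<Rightarrow> 'k"
    and L :: "'i \<Rightarrow> 'l set" and \<alpha> \<beta> :: "'i \<Rightarrow> 'l \<Rightarrow> 'i"
  assumes relations_closed: "x \<in> tensor_relations M N \<Longrightarrow> Poly_Mapping.keys x \<subseteq> carrier M \<times> carrier N"
    and relations_kernel: "x \<in> tensor_relations M N \<Longrightarrow> frag_eval (\<lambda>u. n u i) x = 0"
    and kernel: "Poly_Mapping.keys x \<subseteq> carrier M \<times> carrier N \<Longrightarrow>
      (\<And>i. frag_eval (\<lambda>u. n u i) x = 0) \<Longrightarrow> x \<in> tensor_kernel M N"
    and p_closed: "u \<in> carrier M \<times> carrier N \<Longrightarrow> v \<in> carrier M \<times> carrier N \<Longrightarrow>
      Poly_Mapping.keys (p u v) \<subseteq> carrier M \<times> carrier N"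
    and p_rep: "u \<in> carrier M \<times> carrier N \<Longrightarrow> v \<in> carrier M \<times> carrier N \<Longrightarrow>
      frag_eval (\<lambda>u. n u i) (p u v) = (\<Sum>l\<in>L i. n u (\<alpha> i l) * n v (\<beta> i l))"
    and one_in: "\<one>\<^bsub>M\<^esub> \<in> carrier M" "\<one>\<^bsub>N\<^esub> \<in> carrier N"
    and s_closed: "a \<in> carrier M \<Longrightarrow> s c a \<in> carrier M"
    and s_rep: "a \<in> carrier M \<Longrightarrow> b \<in> carrier N \<Longrightarrow> n (s c a, b) i = c * n (a, b) i"
    and convolution_assoc: "\<And>(f :: 'i \<Rightarrow> 'k) (g :: 'i \<Rightarrow> 'k) (h :: 'i \<Rightarrow> 'k) i.
      (\<Sum>l\<in>L i. (\<Sum>m\<in>L (\<alpha> i l). f (\<alpha> (\<alpha> i l) m) * g (\<beta> (\<alpha> i l) m)) * h (\<beta> i l))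
      = (\<Sum>l\<in>L i. f (\<alpha> i l) * (\<Sum>m\<in>L (\<beta> i l). g (\<alpha> (\<beta> i l) m) * h (\<beta> (\<beta> i l) m)))"
    and one_left: "u \<in> carrier M \<times> carrier N \<Longrightarrow>
      (\<Sum>l\<in>L i. n (\<one>\<^bsub>M\<^esub>, \<one>\<^bsub>N\<^esub>) (\<alpha> i l) * n u (\<beta> i l)) = n u i"
    and one_right: "u \<in> carrier M \<times> carrier N \<Longrightarrow>
      (\<Sum>l\<in>L i. n u (\<alpha> i l) * n (\<one>\<^bsub>M\<^esub>, \<one>\<^bsub>N\<^esub>) (\<beta> i l)) = n u i"
begin

abbreviation pairs where "pairs \<equiv> carrier M \<times> carrier N"
abbreviation ev where "ev x i \<equiv> frag_eval (\<lambda>u. n u i) x"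
abbreviation TA where "TA \<equiv> tensor_algebra M N s p"
abbreviation tc where "tc \<equiv> tensor_class M N"

definition rep where "rep X i = ev (SOME x. x \<in> X) i"

definition convolution :: "('i \<Rightarrow> 'k) \<Rightarrow> ('i \<Rightarrow> 'k) \<Rightarrow> 'i \<Rightarrow> 'k" where
  "convolution f g i = (\<Sum>l\<in>L i. f (\<alpha> i l) * g (\<beta> i l))"

lemma kernel_iff:
  "x \<in> tensor_kernel M N \<longleftrightarrow> Poly_Mapping.keys x \<subseteq> pairs \<and> (\<forall>i. ev x i = 0)"
proof
  assume "x \<in> tensor_kernel M N"
  then show "Poly_Mapping.keys x \<subseteq> pairs \<and> (\<forall>i. ev x i = 0)"
    unfolding tensor_kernel_def
  proof (induction rule: generate.induct)
    case one then show ?case by simp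
  next
    case (incl h) then show ?case using relations_closed relations_kernel by blast
  next
    case (inv h)
    then have "Poly_Mapping.keys h \<subseteq> pairs" "\<And>i. ev h i = 0"
      using relations_closed relations_kernel by blast+
    then show ?case by simp
  next
    case (eng h1 h2)
    then have "Poly_Mapping.keys (h1 + h2) \<subseteq> pairs" using keys_add[of h1 h2] by blast
    then show ?case using eng by simp
  qed
qed (use kernel in blast)

text \<open>
  This is where the completeness of the functionals enters: they separate classes.
\<close>

lemma class_eq:
  assumes x: "Poly_Mapping.keys x \<subseteq> pairs"
  shows "tc x = {y. Poly_Mapping.keys y \<subseteq> pairs \<and> (\<forall>i. ev y i = ev x i)}"
proof (intro subset_antisym subsetI)
  fix y assume "y \<in> tc x"
  then obtain t where t: "t \<in> tensor_kernel M N" "y = t + x"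
    by (auto simp: tensor_class_def r_coset_def)
  have "Poly_Mapping.keys (t + x) \<subseteq> pairs" using t(1) x keys_add[of t x] by (auto simp: kernel_iff)
  then show "y \<in> {y. Poly_Mapping.keys y \<subseteq> pairs \<and> (\<forall>i. ev y i = ev x i)}"
    using t by (simp add: kernel_iff)
next
  fix y assume y: "y \<in> {y. Poly_Mapping.keys y \<subseteq> pairs \<and> (\<forall>i. ev y i = ev x i)}"
  then have "Poly_Mapping.keys (y - x) \<subseteq> pairs" using x keys_diff[of y x] by blast
  then have "y - x \<in> tensor_kernel M N" using y by (simp add: kernel_iff)
  moreover have "y = (y - x) + x" by simp
  ultimately have "\<exists>t\<in>tensor_kernel M N. y = t + x" by metis
  then show "y \<in> tc x" unfolding tensor_class_def r_coset_def by simp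
qed

lemma class_eq_iff:
  assumes "Poly_Mapping.keys x \<subseteq> pairs" "Poly_Mapping.keys y \<subseteq> pairs"
  shows "tc x = tc y \<longleftrightarrow> (\<forall>i. ev x i = ev y i)"
  unfolding class_eq[OF assms(1)] class_eq[OF assms(2)] using assms by fastforce

lemma rep_class: "Poly_Mapping.keys x \<subseteq> pairs \<Longrightarrow> rep (tc x) i = ev x i"
  unfolding rep_def
  by (rule someI2[where P = "\<lambda>y. y \<in> tc x" and a = x]) (simp_all add: class_eq)

lemma TA_carrier: "carrier TA = tc ` {x. Poly_Mapping.keys x \<subseteq> pairs}"
  by (auto simp: tensor_algebra_def Let_def FactGroup_def RCOSETS_def tensor_class_def)

lemma TA_carrierE:
  assumes "X \<in> carrier TA"
  obtains x where "Poly_Mapping.keys x \<subseteq> pairs" "X = tc x"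
  using assms unfolding TA_carrier by blast

lemma class_closed: "Poly_Mapping.keys x \<subseteq> pairs \<Longrightarrow> tc x \<in> carrier TA"
  unfolding TA_carrier by blast

lemma TA_add:
  assumes x: "Poly_Mapping.keys x \<subseteq> pairs" and y: "Poly_Mapping.keys y \<subseteq> pairs"
  shows "tc x \<oplus>\<^bsub>TA\<^esub> tc y = tc (x + y)"
proof -
  have xy: "Poly_Mapping.keys (x + y) \<subseteq> pairs" using x y keys_add[of x y] by blast
  have "tc x \<oplus>\<^bsub>TA\<^esub> tc y = {h + k | h k. h \<in> tc x \<and> k \<in> tc y}"
    by (auto simp: tensor_algebra_def Let_def FactGroup_def set_mult_def)
  also have "\<dots> = tc (x + y)"
  proof (intro subset_antisym subsetI)
    fix z assume "z \<in> {h + k | h k. h \<in> tc x \<and> k \<in> tc y}"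
    then obtain h k where hk: "h \<in> tc x" "k \<in> tc y" "z = h + k" by blast
    then have "Poly_Mapping.keys (h + k) \<subseteq> pairs"
      using keys_add[of h k] by (auto simp: class_eq x y)
    then show "z \<in> tc (x + y)" using hk by (simp add: class_eq x y xy)
  next
    fix z assume z: "z \<in> tc (x + y)"
    then have "Poly_Mapping.keys (z - y) \<subseteq> pairs"
      using keys_diff[of z y] y by (auto simp: class_eq xy)
    then have "z - y \<in> tc x" "y \<in> tc y" using z by (simp_all add: class_eq x y xy)
    moreover have "z = (z - y) + y" by simp
    ultimately show "z \<in> {h + k | h k. h \<in> tc x \<and> k \<in> tc y}" by blast
  qed
  finally show ?thesis .
qed

lemma product_closed:
  assumes "Poly_Mapping.keys x \<subseteq> pairs" "Poly_Mapping.keys y \<subseteq> pairs"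
  shows "Poly_Mapping.keys (frag_extend (\<lambda>u. frag_extend (\<lambda>v. p u v) y) x) \<subseteq> pairs"
  by (rule frag_extend_closed[OF assms(1)], rule frag_extend_closed[OF assms(2)], rule p_closed)

lemma product_rep:
  assumes x: "Poly_Mapping.keys x \<subseteq> pairs" and y: "Poly_Mapping.keys y \<subseteq> pairs"
  shows "ev (frag_extend (\<lambda>u. frag_extend (\<lambda>v. p u v) y) x) i = convolution (ev x) (ev y) i"
proof -
  have "ev (frag_extend (\<lambda>u. frag_extend (\<lambda>v. p u v) y) x) i
      = frag_eval (\<lambda>u. frag_eval (\<lambda>v. \<Sum>l\<in>L i. n u (\<alpha> i l) * n v (\<beta> i l)) y) x"
    unfolding frag_eval_extend
    using x y by (intro frag_eval_cong p_rep) auto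
  then show ?thesis by (simp add: frag_eval_bilinear convolution_def)
qed

lemma Union_const: "a \<in> A \<Longrightarrow> (\<And>y. y \<in> A \<Longrightarrow> f y = c) \<Longrightarrow> (\<Union>y\<in>A. f y) = c"
  by auto

lemma class_self: "Poly_Mapping.keys x \<subseteq> pairs \<Longrightarrow> x \<in> tc x"
  by (simp add: class_eq)

lemma TA_mult:
  assumes x: "Poly_Mapping.keys x \<subseteq> pairs" and y: "Poly_Mapping.keys y \<subseteq> pairs"
  shows "tc x \<otimes>\<^bsub>TA\<^esub> tc y = tc (frag_extend (\<lambda>u. frag_extend (\<lambda>v. p u v) y) x)"
proof -
  have "tc (frag_extend (\<lambda>u. frag_extend (\<lambda>v. p u v) k) h)
      = tc (frag_extend (\<lambda>u. frag_extend (\<lambda>v. p u v) y) x)"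
    if "h \<in> tc x" "k \<in> tc y" for h k
  proof -
    have h: "Poly_Mapping.keys h \<subseteq> pairs" "ev h = ev x"
      and k: "Poly_Mapping.keys k \<subseteq> pairs" "ev k = ev y"
      using that by (simp_all add: class_eq x y)
    show ?thesis
      using product_rep[OF h(1) k(1)] product_rep[OF x y]
      unfolding class_eq_iff[OF product_closed[OF h(1) k(1)] product_closed[OF x y]] h(2) k(2)
      by simp
  qed
  then have "(\<Union>h\<in>tc x. \<Union>k\<in>tc y. tc (frag_extend (\<lambda>u. frag_extend (\<lambda>v. p u v) k) h))
      = tc (frag_extend (\<lambda>u. frag_extend (\<lambda>v. p u v) y) x)"
    by (intro Union_const[OF class_self[OF x]] Union_const[OF class_self[OF y]])
  then show ?thesis by (simp add: tensor_algebra_def Let_def)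
qed

abbreviation scaled where "scaled c x \<equiv> frag_extend (\<lambda>(a, b). frag_of (s c a, b)) x"

lemma scaled_closed:
  "Poly_Mapping.keys x \<subseteq> pairs \<Longrightarrow> Poly_Mapping.keys (scaled c x) \<subseteq> pairs"
  by (erule frag_extend_closed) (auto simp: s_closed)

lemma scaled_rep:
  assumes x: "Poly_Mapping.keys x \<subseteq> pairs" shows "ev (scaled c x) i = c * ev x i"
  unfolding frag_eval_extend frag_eval_scale[symmetric]
  using x by (intro frag_eval_cong) (auto simp: s_rep)

lemma TA_smult:
  assumes x: "Poly_Mapping.keys x \<subseteq> pairs"
  shows "c \<odot>\<^bsub>TA\<^esub> tc x = tc (scaled c x)"
proof -
  have "tc (scaled c h) = tc (scaled c x)" if "h \<in> tc x" for h
    using that x by (simp add: class_eq_iff scaled_closed scaled_rep class_eq)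
  then have "(\<Union>h\<in>tc x. tc (scaled c h)) = tc (scaled c x)"
    by (intro Union_const[OF class_self[OF x]])
  then show ?thesis by (simp add: tensor_algebra_def Let_def)
qed

lemma one_pairs: "Poly_Mapping.keys (frag_of (\<one>\<^bsub>M\<^esub>, \<one>\<^bsub>N\<^esub>)) \<subseteq> pairs"
  using one_in by simp

lemma TA_one: "\<one>\<^bsub>TA\<^esub> = tc (frag_of (\<one>\<^bsub>M\<^esub>, \<one>\<^bsub>N\<^esub>))"
  by (simp add: tensor_algebra_def Let_def pure_tensor_def)

lemma TA_zero: "\<zero>\<^bsub>TA\<^esub> = tc 0"
  by (auto simp: tensor_algebra_def Let_def FactGroup_def tensor_class_def r_coset_def)

text \<open>The representation is an injective algebra homomorphism.\<close>

lemma rep_inj: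
  assumes "X \<in> carrier TA" "Y \<in> carrier TA" "\<And>i. rep X i = rep Y i"
  shows "X = Y"
proof -
  obtain x y where x: "Poly_Mapping.keys x \<subseteq> pairs" "X = tc x"
    and y: "Poly_Mapping.keys y \<subseteq> pairs" "Y = tc y"
    using assms TA_carrierE by metis
  then show ?thesis using assms(3) by (simp add: class_eq_iff rep_class)
qed

lemma rep_add:
  assumes "X \<in> carrier TA" "Y \<in> carrier TA"
  shows "X \<oplus>\<^bsub>TA\<^esub> Y \<in> carrier TA" "rep (X \<oplus>\<^bsub>TA\<^esub> Y) i = rep X i + rep Y i"
proof -
  obtain x y where x: "Poly_Mapping.keys x \<subseteq> pairs" "X = tc x"
    and y: "Poly_Mapping.keys y \<subseteq> pairs" "Y = tc y"
    using assms TA_carrierE by metis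
  have xy: "Poly_Mapping.keys (x + y) \<subseteq> pairs" using x y keys_add[of x y] by blast
  show "X \<oplus>\<^bsub>TA\<^esub> Y \<in> carrier TA" "rep (X \<oplus>\<^bsub>TA\<^esub> Y) i = rep X i + rep Y i"
    using x y xy by (simp_all add: TA_add rep_class class_closed)
qed

lemma rep_mult:
  assumes "X \<in> carrier TA" "Y \<in> carrier TA"
  shows "X \<otimes>\<^bsub>TA\<^esub> Y \<in> carrier TA" "rep (X \<otimes>\<^bsub>TA\<^esub> Y) i = convolution (rep X) (rep Y) i"
proof -
  obtain x y where x: "Poly_Mapping.keys x \<subseteq> pairs" "X = tc x"
    and y: "Poly_Mapping.keys y \<subseteq> pairs" "Y = tc y"
    using assms TA_carrierE by metis
  show "X \<otimes>\<^bsub>TA\<^esub> Y \<in> carrier TA" "rep (X \<otimes>\<^bsub>TA\<^esub> Y) i = convolution (rep X) (rep Y) i"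
    using x(1) y(1) product_closed[OF x(1) y(1)]
    unfolding x(2) y(2)
    by (simp_all add: TA_mult rep_class class_closed product_rep convolution_def)
qed

lemma rep_smult:
  assumes "X \<in> carrier TA"
  shows "c \<odot>\<^bsub>TA\<^esub> X \<in> carrier TA" "rep (c \<odot>\<^bsub>TA\<^esub> X) i = c * rep X i"
proof -
  obtain x where x: "Poly_Mapping.keys x \<subseteq> pairs" "X = tc x"
    using assms TA_carrierE by metis
  show "c \<odot>\<^bsub>TA\<^esub> X \<in> carrier TA" "rep (c \<odot>\<^bsub>TA\<^esub> X) i = c * rep X i"
    using scaled_closed[OF x(1)] scaled_rep[OF x(1)] x
    by (simp_all add: TA_smult rep_class class_closed)
qed

lemma rep_one: "\<one>\<^bsub>TA\<^esub> \<in> carrier TA" "rep \<one>\<^bsub>TA\<^esub> i = n (\<one>\<^bsub>M\<^esub>, \<one>\<^bsub>N\<^esub>) i"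
  unfolding TA_one by (rule class_closed[OF one_pairs]) (simp add: rep_class[OF one_pairs])

lemma rep_zero: "\<zero>\<^bsub>TA\<^esub> \<in> carrier TA" "rep \<zero>\<^bsub>TA\<^esub> i = 0"
  unfolding TA_zero by (simp_all add: class_closed rep_class)

lemma rep_pure:
  assumes "a \<in> carrier M" "b \<in> carrier N"
  shows "pure_tensor M N a b \<in> carrier TA" "rep (pure_tensor M N a b) i = n (a, b) i"
  unfolding pure_tensor_def using assms by (simp_all add: class_closed rep_class)

text \<open>
  The unit laws of the convolution hold for values of the representation only: an arbitrary
  function of the index need not vanish where representing functions do.
\<close>

lemma convolution_one:
  assumes "X \<in> carrier TA"
  shows "convolution (n (\<one>\<^bsub>M\<^esub>, \<one>\<^bsub>N\<^esub>)) (rep X) i = rep X i"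
    and "convolution (rep X) (n (\<one>\<^bsub>M\<^esub>, \<one>\<^bsub>N\<^esub>)) i = rep X i"
proof -
  obtain x where x: "Poly_Mapping.keys x \<subseteq> pairs" "X = tc x"
    using assms TA_carrierE by metis
  let ?o = "frag_of (\<one>\<^bsub>M\<^esub>, \<one>\<^bsub>N\<^esub>)"
  have "convolution (n (\<one>\<^bsub>M\<^esub>, \<one>\<^bsub>N\<^esub>)) (rep X) i = convolution (ev ?o) (ev x) i"
    using x by (simp add: convolution_def rep_class)
  also have "\<dots> = frag_eval (\<lambda>v. ev (p (\<one>\<^bsub>M\<^esub>, \<one>\<^bsub>N\<^esub>) v) i) x"
    unfolding product_rep[OF one_pairs x(1), symmetric] by (simp add: frag_eval_extend)
  also have "\<dots> = ev x i"
    using x(1) one_in by (intro frag_eval_cong) (subst p_rep, auto simp: one_left)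
  finally show "convolution (n (\<one>\<^bsub>M\<^esub>, \<one>\<^bsub>N\<^esub>)) (rep X) i = rep X i"
    using x by (simp add: rep_class)
  have "convolution (rep X) (n (\<one>\<^bsub>M\<^esub>, \<one>\<^bsub>N\<^esub>)) i = convolution (ev x) (ev ?o) i"
    using x by (simp add: convolution_def rep_class)
  also have "\<dots> = frag_eval (\<lambda>v. ev (p v (\<one>\<^bsub>M\<^esub>, \<one>\<^bsub>N\<^esub>)) i) x"
    unfolding product_rep[OF x(1) one_pairs, symmetric] by (simp add: frag_eval_extend)
  also have "\<dots> = ev x i"
    using x(1) one_in by (intro frag_eval_cong) (subst p_rep, auto simp: one_right)
  finally show "convolution (rep X) (n (\<one>\<^bsub>M\<^esub>, \<one>\<^bsub>N\<^esub>)) i = rep X i"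
    using x by (simp add: rep_class)
qed

theorem scalar_algebra: "scalar_algebra TA"
proof -
  have ag: "abelian_group TA"
  proof (rule abelian_groupI)
    fix X assume X: "X \<in> carrier TA"
    show "\<exists>Y\<in>carrier TA. Y \<oplus>\<^bsub>TA\<^esub> X = \<zero>\<^bsub>TA\<^esub>"
    proof
      show "(- 1) \<odot>\<^bsub>TA\<^esub> X \<oplus>\<^bsub>TA\<^esub> X = \<zero>\<^bsub>TA\<^esub>"
        using X by (intro rep_inj) (simp_all add: rep_add rep_smult rep_zero)
    qed (rule rep_smult(1)[OF X])
    show "\<zero>\<^bsub>TA\<^esub> \<oplus>\<^bsub>TA\<^esub> X = X"
      using X by (intro rep_inj) (simp_all add: rep_add rep_zero)
    fix Y assume Y: "Y \<in> carrier TA"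
    show "X \<oplus>\<^bsub>TA\<^esub> Y = Y \<oplus>\<^bsub>TA\<^esub> X"
      using X Y by (intro rep_inj) (simp_all add: rep_add add.commute)
    fix Z assume Z: "Z \<in> carrier TA"
    show "X \<oplus>\<^bsub>TA\<^esub> Y \<oplus>\<^bsub>TA\<^esub> Z = X \<oplus>\<^bsub>TA\<^esub> (Y \<oplus>\<^bsub>TA\<^esub> Z)"
      using X Y Z by (intro rep_inj) (simp_all add: rep_add add.assoc)
  qed (simp_all add: rep_add rep_zero)
  have conv_cong: "convolution f g i = convolution f' g' i"
    if "\<And>j. f j = f' j" "\<And>j. g j = g' j" for f g f' g' i
    using that by (simp add: convolution_def)
  have mo: "monoid TA"
  proof (rule monoidI)
    fix X assume X: "X \<in> carrier TA"
    show "\<one>\<^bsub>TA\<^esub> \<otimes>\<^bsub>TA\<^esub> X = X"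
    proof (rule rep_inj)
      fix i show "rep (\<one>\<^bsub>TA\<^esub> \<otimes>\<^bsub>TA\<^esub> X) i = rep X i"
        using convolution_one(1)[OF X, of i] rep_mult(2)[OF rep_one(1) X, of i]
        by (simp add: convolution_def rep_one(2))
    qed (use X in \<open>simp_all add: rep_mult(1) rep_one(1)\<close>)
    show "X \<otimes>\<^bsub>TA\<^esub> \<one>\<^bsub>TA\<^esub> = X"
    proof (rule rep_inj)
      fix i show "rep (X \<otimes>\<^bsub>TA\<^esub> \<one>\<^bsub>TA\<^esub>) i = rep X i"
        using convolution_one(2)[OF X, of i] rep_mult(2)[OF X rep_one(1), of i]
        by (simp add: convolution_def rep_one(2))
    qed (use X in \<open>simp_all add: rep_mult(1) rep_one(1)\<close>)
    fix Y Z assume YZ: "Y \<in> carrier TA" "Z \<in> carrier TA"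
    show "X \<otimes>\<^bsub>TA\<^esub> Y \<otimes>\<^bsub>TA\<^esub> Z = X \<otimes>\<^bsub>TA\<^esub> (Y \<otimes>\<^bsub>TA\<^esub> Z)"
    proof (rule rep_inj)
      fix i
      show "rep (X \<otimes>\<^bsub>TA\<^esub> Y \<otimes>\<^bsub>TA\<^esub> Z) i = rep (X \<otimes>\<^bsub>TA\<^esub> (Y \<otimes>\<^bsub>TA\<^esub> Z)) i"
        using X YZ convolution_assoc[where f = "rep X" and g = "rep Y" and h = "rep Z" and i = i]
        by (simp add: rep_mult convolution_def)
    qed (use X YZ in \<open>simp_all add: rep_mult(1)\<close>)
  qed (simp_all add: rep_mult(1) rep_one(1))
  have "ring TA"
  proof (rule ringI[OF ag mo])
    fix X Y Z assume XYZ: "X \<in> carrier TA" "Y \<in> carrier TA" "Z \<in> carrier TA"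
    show "(X \<oplus>\<^bsub>TA\<^esub> Y) \<otimes>\<^bsub>TA\<^esub> Z = X \<otimes>\<^bsub>TA\<^esub> Z \<oplus>\<^bsub>TA\<^esub> Y \<otimes>\<^bsub>TA\<^esub> Z"
      using XYZ by (intro rep_inj)
        (simp_all add: rep_add rep_mult convolution_def distrib_right sum.distrib)
    show "Z \<otimes>\<^bsub>TA\<^esub> (X \<oplus>\<^bsub>TA\<^esub> Y) = Z \<otimes>\<^bsub>TA\<^esub> X \<oplus>\<^bsub>TA\<^esub> Z \<otimes>\<^bsub>TA\<^esub> Y"
      using XYZ by (intro rep_inj)
        (simp_all add: rep_add rep_mult convolution_def distrib_left sum.distrib)
  qed
  then interpret ring TA .
  show ?thesis
  proof unfold_locales
    fix X Y c d assume X: "X \<in> carrier TA"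
    show "c \<odot>\<^bsub>TA\<^esub> X \<in> carrier TA" by (rule rep_smult(1)[OF X])
    show "(c + d) \<odot>\<^bsub>TA\<^esub> X = c \<odot>\<^bsub>TA\<^esub> X \<oplus>\<^bsub>TA\<^esub> d \<odot>\<^bsub>TA\<^esub> X"
      using X by (intro rep_inj) (simp_all add: rep_add rep_smult distrib_right)
    show "(c * d) \<odot>\<^bsub>TA\<^esub> X = c \<odot>\<^bsub>TA\<^esub> (d \<odot>\<^bsub>TA\<^esub> X)"
      using X by (intro rep_inj) (simp_all add: rep_smult mult.assoc)
    show "1 \<odot>\<^bsub>TA\<^esub> X = X"
      using X by (intro rep_inj) (simp_all add: rep_smult)
    assume Y: "Y \<in> carrier TA"
    show "c \<odot>\<^bsub>TA\<^esub> (X \<oplus>\<^bsub>TA\<^esub> Y) = c \<odot>\<^bsub>TA\<^esub> X \<oplus>\<^bsub>TA\<^esub> c \<odot>\<^bsub>TA\<^esub> Y"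
      using X Y by (intro rep_inj) (simp_all add: rep_add rep_smult distrib_left)
    show "(c \<odot>\<^bsub>TA\<^esub> X) \<otimes>\<^bsub>TA\<^esub> Y = c \<odot>\<^bsub>TA\<^esub> (X \<otimes>\<^bsub>TA\<^esub> Y)"
      using X Y by (intro rep_inj)
        (simp_all add: rep_mult rep_smult convolution_def sum_distrib_left mult.assoc)
    show "X \<otimes>\<^bsub>TA\<^esub> (c \<odot>\<^bsub>TA\<^esub> Y) = c \<odot>\<^bsub>TA\<^esub> (X \<otimes>\<^bsub>TA\<^esub> Y)"
      using X Y by (intro rep_inj)
        (simp_all add: rep_mult rep_smult convolution_def sum_distrib_left mult.left_commute)
  qed
qed

end

section \<open>The action of the enveloping algebra on functions on words\<close>

text \<open>
  Reading a matrix outside of its dimensions gives an unspecified value; such entries are made 0, so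
  that the action below is linear in the matrix even on words with letters beyond \<open>n\<close>.
\<close>

definition mat_entry :: "nat \<Rightarrow> 'c::zero mat \<Rightarrow> nat \<Rightarrow> nat \<Rightarrow> 'c" where
  "mat_entry n x i j = (if i < n \<and> j < n then x $$ (i, j) else 0)"

text \<open>
  A function \<open>t\<close> on words is a family of tensors, one of each degree, where \<open>t I\<close> is the coefficient
  at the basis tensor that belongs to \<open>I\<close>. The matrix \<open>x\<close> acts by the Leibniz rule as
  \<open>x \<otimes> 1 \<otimes> \<dots> \<otimes> 1 + \<dots> + 1 \<otimes> \<dots> \<otimes> 1 \<otimes> x\<close>, simultaneously in all degrees.
\<close>

definition lie_action :: "nat \<Rightarrow> complex mat \<Rightarrow> (nat list \<Rightarrow> complex) \<Rightarrow> nat list \<Rightarrow> complex" where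
  "lie_action n x t I = (\<Sum>p<length I. \<Sum>a<n. mat_entry n x (I ! p) a * t (I[p := a]))"

lemma lie_action_linear:
  "lie_action n x (\<lambda>I. \<Sum>s\<in>S. c s * t s I) = (\<lambda>I. \<Sum>s\<in>S. c s * lie_action n x (t s) I)"
proof
  fix I
  have "lie_action n x (\<lambda>I. \<Sum>s\<in>S. c s * t s I) I
      = (\<Sum>p<length I. \<Sum>a<n. \<Sum>s\<in>S. c s * (mat_entry n x (I ! p) a * t s (I[p := a])))"
    by (simp add: lie_action_def sum_distrib_left mult.left_commute)
  also have "\<dots> = (\<Sum>s\<in>S. \<Sum>p<length I. \<Sum>a<n. c s * (mat_entry n x (I ! p) a * t s (I[p := a])))"
    by (simp add: sum.swap[of _ S])
  finally show "lie_action n x (\<lambda>I. \<Sum>s\<in>S. c s * t s I) I = (\<Sum>s\<in>S. c s * lie_action n x (t s) I)"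
    by (simp add: lie_action_def sum_distrib_left)
qed

lemma lie_action_add_left:
  assumes "x \<in> carrier_mat n n" "y \<in> carrier_mat n n"
  shows "lie_action n (x + y) t I = lie_action n x t I + lie_action n y t I"
proof -
  have "mat_entry n (x + y) i j = mat_entry n x i j + mat_entry n y i j" for i j
    using assms by (auto simp: mat_entry_def)
  then show ?thesis by (simp add: lie_action_def sum.distrib distrib_right)
qed

lemma lie_action_smult_left:
  assumes "x \<in> carrier_mat n n"
  shows "lie_action n (c \<cdot>\<^sub>m x) t I = c * lie_action n x t I"
proof -
  have "mat_entry n (c \<cdot>\<^sub>m x) i j = c * mat_entry n x i j" for i j
    using assms by (auto simp: mat_entry_def)
  then show ?thesis by (simp add: lie_action_def sum_distrib_left mult.assoc)
qed

lemma mat_entry_mult: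
  assumes "x \<in> carrier_mat n n" "y \<in> carrier_mat n n"
  shows "mat_entry n (x * y :: complex mat) i j = (\<Sum>a<n. mat_entry n x i a * mat_entry n y a j)"
  using assms by (auto simp: mat_entry_def scalar_prod_def lessThan_atLeast0 intro!: sum.cong)

text \<open>
  In \<open>x (y t)\<close> the two matrices act either on the same letter, which gives the action of
  \<open>x y\<close>, or on different letters, which gives an expression symmetric in \<open>x\<close> and \<open>y\<close>.
\<close>

lemma lie_action_product:
  assumes x: "x \<in> carrier_mat n n" and y: "y \<in> carrier_mat n n"
  shows "lie_action n x (lie_action n y t) I = lie_action n (x * y) t I
    + (\<Sum>p<length I. \<Sum>q<length I. if p = q then 0 else
        \<Sum>a<n. \<Sum>b<n. mat_entry n x (I ! p) a * mat_entry n y (I ! q) b * t (I[p := a, q := b]))"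
proof -
  let ?l = "length I"
  let ?G = "\<lambda>p q. \<Sum>a<n. \<Sum>b<n. mat_entry n x (I ! p) a * mat_entry n y (I[p := a] ! q) b
      * t (I[p := a, q := b])"
  let ?S = "\<lambda>p q. \<Sum>a<n. \<Sum>b<n. mat_entry n x (I ! p) a * mat_entry n y (I ! q) b
      * t (I[p := a, q := b])"
  let ?D = "\<lambda>p. \<Sum>b<n. mat_entry n (x * y) (I ! p) b * t (I[p := b])"
  have "lie_action n x (lie_action n y t) I
      = (\<Sum>p<?l. \<Sum>a<n. \<Sum>q<?l. \<Sum>b<n. mat_entry n x (I ! p) a * mat_entry n y (I[p := a] ! q) b * t
          (I[p := a, q := b]))"
    by (simp add: lie_action_def sum_distrib_left mult.assoc)
  also have "\<dots> = (\<Sum>p<?l. \<Sum>q<?l. ?G p q)"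
    by (rule sum.cong[OF refl], rule sum.swap)
  also have "\<dots> = (\<Sum>p<?l. \<Sum>q<?l. (if p = q then ?D p else 0) + (if p = q then 0 else ?S p q))"
  proof (intro sum.cong[OF refl])
    fix p q assume pq: "p \<in> {..<?l}" "q \<in> {..<?l}"
    have "?G p p = ?D p"
    proof -
      have "?G p p = (\<Sum>a<n. \<Sum>b<n. mat_entry n x (I ! p) a * mat_entry n y a b * t (I[p := b]))"
        using pq by simp
      also have "\<dots> = (\<Sum>b<n. \<Sum>a<n. mat_entry n x (I ! p) a * mat_entry n y a b * t (I[p := b]))"
        by (rule sum.swap)
      also have "\<dots> = ?D p" by (simp add: mat_entry_mult[OF x y] sum_distrib_right)
      finally show ?thesis .
    qed
    moreover have "?G p q = ?S p q" if "p \<noteq> q" using that by simp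
    ultimately show "?G p q = (if p = q then ?D p else 0) + (if p = q then 0 else ?S p q)"
      by (cases "p = q") (simp_all only: if_True if_False add_0_left add_0_right refl simp_thms)
  qed
  also have "\<dots> = (\<Sum>p<?l. ?D p) + (\<Sum>p<?l. \<Sum>q<?l. if p = q then 0 else ?S p q)"
    by (simp add: sum.distrib)
  finally show ?thesis by (simp add: lie_action_def)
qed

text \<open>
  The symmetric expression of the preceding lemma cancels; its symmetry amounts to exchanging the
  names of the two positions.
\<close>

lemma lie_action_bracket:
  assumes x: "x \<in> carrier_mat n n" and y: "y \<in> carrier_mat n n"
  shows "lie_action n x (lie_action n y t) I - lie_action n y (lie_action n x t) I
    = lie_action n (x * y - y * x) t I"
proof -
  have "(\<Sum>p<length I. \<Sum>q<length I. if p = q then 0 else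
        \<Sum>a<n. \<Sum>b<n. mat_entry n x (I ! p) a * mat_entry n y (I ! q) b * t (I[p := a, q := b]))
      = (\<Sum>q<length I. \<Sum>p<length I. if p = q then 0 else
        \<Sum>a<n. \<Sum>b<n. mat_entry n x (I ! p) a * mat_entry n y (I ! q) b * t (I[p := a, q := b]))"
    by (rule sum.swap)
  also have "\<dots> = (\<Sum>q<length I. \<Sum>p<length I. if q = p then 0 else
        \<Sum>b<n. \<Sum>a<n. mat_entry n y (I ! q) b * mat_entry n x (I ! p) a * t (I[q := b, p := a]))"
  proof (intro sum.cong[OF refl])
    fix p q
    have "(\<Sum>a<n. \<Sum>b<n. mat_entry n x (I ! p) a * mat_entry n y (I ! q) b * t (I[p := a, q := b]))
        = (\<Sum>b<n. \<Sum>a<n. mat_entry n x (I ! p) a * mat_entry n y (I ! q) b * t (I[p := a, q := b]))"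
      by (rule sum.swap)
    also have "\<dots> = (\<Sum>b<n. \<Sum>a<n. mat_entry n y (I ! q) b * mat_entry n x (I ! p) a
        * t (I[q := b, p := a]))"
      if "p \<noteq> q" using that by (simp add: list_update_swap mult.commute)
    finally show "(if p = q then 0 else
        \<Sum>a<n. \<Sum>b<n. mat_entry n x (I ! p) a * mat_entry n y (I ! q) b * t (I[p := a, q := b]))
      = (if q = p then 0 else
        \<Sum>b<n. \<Sum>a<n. mat_entry n y (I ! q) b * mat_entry n x (I ! p) a * t (I[q := b, p := a]))"
      by simp
  qed
  finally have sym: "(\<Sum>p<length I. \<Sum>q<length I. if p = q then 0 else
        \<Sum>a<n. \<Sum>b<n. mat_entry n x (I ! p) a * mat_entry n y (I ! q) b * t (I[p := a, q := b]))
      = (\<Sum>q<length I. \<Sum>p<length I. if q = p then 0 else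
        \<Sum>b<n. \<Sum>a<n. mat_entry n y (I ! q) b * mat_entry n x (I ! p) a * t (I[q := b, p := a]))" .
  have "mat_entry n (x * y - y * x) i j = mat_entry n (x * y) i j - mat_entry n (y * x) i j" for i j
    using x y by (auto simp: mat_entry_def)
  then have "lie_action n (x * y - y * x) t I = lie_action n (x * y) t I - lie_action n (y * x) t I"
    by (simp add: lie_action_def sum_subtractf left_diff_distrib)
  then show ?thesis
    unfolding lie_action_product[OF x y] lie_action_product[OF y x] sym by simp
qed

definition word_action where "word_action n w t = foldr (lie_action n) w t"

lemma word_action_linear:
  "word_action n w (\<lambda>I. \<Sum>s\<in>S. c s * t s I) = (\<lambda>I. \<Sum>s\<in>S. c s * word_action n w (t s) I)"
  by (induction w) (simp_all add: word_action_def lie_action_linear)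

definition free_action :: "nat \<Rightarrow> (complex mat list \<Rightarrow> complex) \<Rightarrow> (nat list \<Rightarrow> complex) \<Rightarrow> nat list \<Rightarrow>
    complex" where
  "free_action n f t I = word_pairing f (\<lambda>w. word_action n w t I)"

lemma strict_upper_carrier: "x \<in> strict_upper n \<Longrightarrow> x \<in> carrier_mat n n"
  by (simp add: strict_upper_def)

lemma strict_upper_add: "x \<in> strict_upper n \<Longrightarrow> y \<in> strict_upper n \<Longrightarrow> x + y \<in> strict_upper n"
  by (auto simp: strict_upper_def)

lemma strict_upper_smult: "x \<in> strict_upper n \<Longrightarrow> c \<cdot>\<^sub>m x \<in> strict_upper n"
  by (auto simp: strict_upper_def)

lemma strict_upper_mult:
  assumes "x \<in> strict_upper n" "y \<in> strict_upper n" shows "x * y \<in> strict_upper n"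
proof -
  have "x $$ (i, k) * y $$ (k, j) = 0" if "i < n" "j \<le> i" "k < n" for i j k
    using that assms by (cases "k \<le> i") (auto simp: strict_upper_def)
  then have "(x * y) $$ (i, j) = 0" if "i < n" "j \<le> i" for i j
    using that assms by (auto simp: strict_upper_def scalar_prod_def intro!: sum.neutral)
  then show ?thesis using assms by (auto simp: strict_upper_def)
qed

lemma strict_upper_diff: "x \<in> strict_upper n \<Longrightarrow> y \<in> strict_upper n \<Longrightarrow> x - y \<in> strict_upper n"
  by (auto simp: strict_upper_def)

lemma letter_closed: "x \<in> X \<Longrightarrow> letter x \<in> carrier (free_algebra X)"
  by (auto simp: free_algebra_simps letter_def)

lemma letter_pairing: "word_pairing (letter x) \<phi> = \<phi> [x]"
  by (subst word_pairing_superset[of "{[x]}"]) (auto simp: letter_def)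

abbreviation (input) kostant_free :: "nat \<Rightarrow> (complex, complex mat list \<Rightarrow> complex) module" where
  "kostant_free n \<equiv> free_algebra (strict_upper n)"

abbreviation (input) kostant_class :: "nat \<Rightarrow> (complex mat list \<Rightarrow> complex) \<Rightarrow> kostant" where
  "kostant_class n f \<equiv> enveloping_ideal (strict_upper n) +>\<^bsub>kostant_free n\<^esub> f"

context
  fixes n :: nat
begin

interpretation F: scalar_algebra "kostant_free n" by (rule free_algebra_scalar_algebra)

lemma free_algebra_finite_support: "f \<in> carrier (kostant_free n) \<Longrightarrow> finite {w. f w \<noteq> 0}"
  by (simp add: free_algebra_simps)

lemma free_action_add:
  "f \<in> carrier (kostant_free n) \<Longrightarrow> g \<in> carrier (kostant_free n) \<Longrightarrow>
   free_action n (f \<oplus>\<^bsub>kostant_free n\<^esub> g) t I = free_action n f t I + free_action n g t I"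
  by (simp add: free_action_def free_algebra_simps word_pairing_add)

lemma free_action_smult:
  "f \<in> carrier (kostant_free n) \<Longrightarrow> free_action n (c \<odot>\<^bsub>kostant_free n\<^esub> f) t I = c * free_action n f t I"
  by (simp add: free_action_def free_algebra_simps word_pairing_smult)

lemma free_action_minus:
  assumes f: "f \<in> carrier (kostant_free n)" and g: "g \<in> carrier (kostant_free n)"
  shows "free_action n (f \<ominus>\<^bsub>kostant_free n\<^esub> g) t I = free_action n f t I - free_action n g t I"
proof -
  have "f \<ominus>\<^bsub>kostant_free n\<^esub> g = f \<oplus>\<^bsub>kostant_free n\<^esub> ((- 1) \<odot>\<^bsub>kostant_free n\<^esub> g)"
    using g by (simp add: a_minus_def F.smult_minus_left F.smult_one)
  then show ?thesis using f g F.smult_closed[OF g, of "- 1"]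
    by (simp add: free_action_add free_action_smult)
qed

lemma free_action_mult:
  assumes f: "f \<in> carrier (kostant_free n)" and g: "g \<in> carrier (kostant_free n)"
  shows "free_action n (f \<otimes>\<^bsub>kostant_free n\<^esub> g) t I = free_action n f (free_action n g t) I"
proof -
  have "free_action n (f \<otimes>\<^bsub>kostant_free n\<^esub> g) t I
      = word_pairing f (\<lambda>u. word_pairing g (\<lambda>v. word_action n u (word_action n v t) I))"
    unfolding free_action_def free_algebra_simps
    using word_pairing_mult[OF free_algebra_finite_support[OF f] free_algebra_finite_support[OF g]]
    by (simp add: word_action_def)
  also have "\<dots> = word_pairing f (\<lambda>u. word_action n u (free_action n g t) I)"
    unfolding free_action_def[abs_def] word_pairing_def[of g] word_action_linear ..
  finally show ?thesis by (simp add: free_action_def)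
qed

lemma free_action_letter: "free_action n (letter x) t = lie_action n x t"
  by (rule ext) (simp add: free_action_def letter_pairing word_action_def)

lemma free_action_zero_right: "free_action n f (\<lambda>I. 0) I = 0"
proof -
  have "word_action n w (\<lambda>I. 0) = (\<lambda>I. 0)" for w
    using word_action_linear[of n w "\<lambda>_. 0" "\<lambda>_ _. 0" "{}"] by simp
  then show ?thesis by (simp add: free_action_def word_pairing_def)
qed

lemma action_kernel_ideal: "ideal {f \<in> carrier (kostant_free n). \<forall>t I. free_action n f t I
    = 0} (kostant_free n)" (is "ideal ?K _")
proof (rule idealI[OF F.ring_axioms])
  show "subgroup ?K (add_monoid (kostant_free n))"
  proof (rule F.add.subgroupI)
    have "free_action n \<zero>\<^bsub>kostant_free n\<^esub> t I = 0" for t I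
      by (simp add: free_action_def word_pairing_def free_algebra_simps(4))
    then show "?K \<noteq> {}" using F.zero_closed by blast
    fix f assume f: "f \<in> ?K"
    have "\<ominus>\<^bsub>kostant_free n\<^esub> f = (- 1) \<odot>\<^bsub>kostant_free n\<^esub> f" using f
      by (simp add: F.smult_minus_left F.smult_one)
    then show "\<ominus>\<^bsub>kostant_free n\<^esub> f \<in> ?K" using f F.smult_closed[of f "- 1"]
      by (simp add: free_action_smult)
    fix g assume g: "g \<in> ?K"
    show "f \<oplus>\<^bsub>kostant_free n\<^esub> g \<in> ?K" using f g by (simp add: free_action_add)
  qed auto
  fix f g assume f: "f \<in> ?K" and g: "g \<in> carrier (kostant_free n)"
  have "free_action n f t = (\<lambda>I. 0)" for t using f by auto
  then show "g \<otimes>\<^bsub>kostant_free n\<^esub> f \<in> ?K" using f g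
    by (simp add: free_action_mult free_action_zero_right)
  show "f \<otimes>\<^bsub>kostant_free n\<^esub> g \<in> ?K" using f g by (simp add: free_action_mult)
qed

text \<open>
  Together with the preceding lemma this makes the action descend to the enveloping algebra: the
  elements that act as zero form an ideal, so it suffices to look at the generating relations.
\<close>

lemma relations_act_trivially:
  "enveloping_relations (strict_upper n) \<subseteq> {f \<in> carrier (kostant_free n). \<forall>t I. free_action n f t I
      = 0}"
proof -
  note L = letter_closed[where X = "strict_upper n" and 'b = complex]
  have 1: "letter (x + y) \<ominus>\<^bsub>kostant_free n\<^esub> (letter x \<oplus>\<^bsub>kostant_free n\<^esub> letter y)
      \<in> {f \<in> carrier (kostant_free n). \<forall>t I. free_action n f t I = 0}"
    if "x \<in> strict_upper n" "y \<in> strict_upper n" for x y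
    using that L[OF that(1)] L[OF that(2)] L[OF strict_upper_add[OF that]]
    by (simp add: free_action_minus free_action_add free_action_letter lie_action_add_left
        strict_upper_carrier)
  have 2: "letter (c \<cdot>\<^sub>m x) \<ominus>\<^bsub>kostant_free n\<^esub> (c \<odot>\<^bsub>kostant_free n\<^esub> letter x)
      \<in> {f \<in> carrier (kostant_free n). \<forall>t I. free_action n f t I = 0}"
    if "x \<in> strict_upper n" for c x
    using that L[OF that(1)] L[OF strict_upper_smult[OF that]]
    by (simp add: free_action_minus free_action_smult free_action_letter lie_action_smult_left
        strict_upper_carrier F.smult_closed)
  have 3: "(letter x \<otimes>\<^bsub>kostant_free n\<^esub> letter y \<ominus>\<^bsub>kostant_free n\<^esub> letter y \<otimes>\<^bsub>kostant_free n\<^esub> letter x)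
      \<ominus>\<^bsub>kostant_free n\<^esub> letter (x * y - y * x)
      \<in> {f \<in> carrier (kostant_free n). \<forall>t I. free_action n f t I = 0}"
    if "x \<in> strict_upper n" "y \<in> strict_upper n" for x y
    using that L[OF that(1)] L[OF that(2)]
      L[OF strict_upper_diff[OF strict_upper_mult[OF that] strict_upper_mult[OF that(2,1)]]]
    by (simp add: free_action_minus free_action_mult free_action_letter
        lie_action_bracket[symmetric]
        strict_upper_carrier)
  show ?thesis unfolding enveloping_relations_def Let_def
    by (intro Un_least subsetI; elim CollectE exE conjE; hypsubst) (assumption | rule 1 2 3)+
qed

lemma enveloping_ideal_ideal: "ideal (enveloping_ideal (strict_upper n)) (kostant_free n)"
  unfolding enveloping_ideal_def
  by (rule F.genideal_ideal) (use relations_act_trivially in blast)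

lemma relation_in_ideal: "f \<in> enveloping_relations (strict_upper n)
    \<Longrightarrow> f \<in> enveloping_ideal (strict_upper n)"
  unfolding enveloping_ideal_def
  using F.genideal_self[of "enveloping_relations (strict_upper n)"] relations_act_trivially by blast

lemma ideal_acts_trivially: "f \<in> enveloping_ideal (strict_upper n) \<Longrightarrow> free_action n f t I = 0"
  using F.genideal_minimal[OF action_kernel_ideal relations_act_trivially]
  unfolding enveloping_ideal_def by blast

lemma enveloping_algebra: "scalar_algebra (kostant_C n)"
  unfolding enveloping_algebra_def
  by (rule quot_scalar_algebra[OF free_algebra_scalar_algebra enveloping_ideal_ideal])

lemmas enveloping_quot = quot_carrier[OF free_algebra_scalar_algebra enveloping_ideal_ideal, folded
    enveloping_algebra_def]
  quot_mult[OF free_algebra_scalar_algebra enveloping_ideal_ideal, folded enveloping_algebra_def]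
  quot_add[OF free_algebra_scalar_algebra enveloping_ideal_ideal, folded enveloping_algebra_def]
  quot_smult[OF free_algebra_scalar_algebra enveloping_ideal_ideal, folded enveloping_algebra_def]
  quot_one[OF free_algebra_scalar_algebra enveloping_ideal_ideal, folded enveloping_algebra_def]
lemmas kostant_class_eq_iff = quot_coset_eq_iff[OF free_algebra_scalar_algebra
    enveloping_ideal_ideal]

definition env_action :: "kostant \<Rightarrow> (nat list \<Rightarrow> complex) \<Rightarrow> nat list \<Rightarrow> complex" where
  "env_action X t I = free_action n (SOME f. f \<in> X) t I"

lemma env_action_class:
  assumes f: "f \<in> carrier (kostant_free n)" shows "env_action (kostant_class n f) t I
      = free_action n f t I"
proof -
  interpret E: ideal "enveloping_ideal (strict_upper n)" "kostant_free n"
    by (rule enveloping_ideal_ideal)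
  have "free_action n g t I = free_action n f t I" if g: "g \<in> kostant_class n f" for g
  proof -
    obtain h where h: "h \<in> enveloping_ideal (strict_upper n)" "g = h \<oplus>\<^bsub>kostant_free n\<^esub> f" using g
      by (auto simp: a_r_coset_def r_coset_def)
    then show ?thesis using f by (simp add: free_action_add E.a_Hcarr ideal_acts_trivially)
  qed
  moreover have "f \<in> kostant_class n f" by (rule E.a_rcos_self[OF f])
  ultimately show ?thesis unfolding env_action_def by (metis someI)
qed

lemma enveloping_carrierE:
  assumes "u \<in> carrier (kostant_C n)" obtains f where "f \<in> carrier (kostant_free n)"
      "u = kostant_class n f"
  using assms unfolding enveloping_quot by blast

lemma env_action_add:
  assumes "u \<in> carrier (kostant_C n)" "v \<in> carrier (kostant_C n)"
  shows "env_action (u \<oplus>\<^bsub>kostant_C n\<^esub> v) t I = env_action u t I + env_action v t I"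
  using assms by (elim enveloping_carrierE) (simp add: enveloping_quot env_action_class
      free_action_add)

lemma env_action_smult:
  assumes "u \<in> carrier (kostant_C n)"
  shows "env_action (c \<odot>\<^bsub>kostant_C n\<^esub> u) t I = c * env_action u t I"
  using assms by (elim enveloping_carrierE) (simp add: enveloping_quot env_action_class
      free_action_smult F.smult_closed)

lemma env_action_mult:
  assumes "u \<in> carrier (kostant_C n)" "v \<in> carrier (kostant_C n)"
  shows "env_action (u \<otimes>\<^bsub>kostant_C n\<^esub> v) t I = env_action u (env_action v t) I"
proof -
  obtain f g where fg: "f \<in> carrier (kostant_free n)" "u = kostant_class n f"
      "g \<in> carrier (kostant_free n)" "v = kostant_class n g"
    using assms by (elim enveloping_carrierE)
  then have "env_action v t = free_action n g t" by (auto simp: env_action_class)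
  then show ?thesis using fg by (simp add: enveloping_quot env_action_class free_action_mult)
qed

lemma env_action_one: "env_action \<one>\<^bsub>kostant_C n\<^esub> t I = t I"
proof -
  have "word_pairing \<one>\<^bsub>kostant_free n\<^esub> \<phi> = \<phi> []" for \<phi>
    by (subst word_pairing_superset[of "{[]}"]) (auto simp: free_algebra_simps)
  then show ?thesis
    unfolding enveloping_quot by (simp add: env_action_class free_action_def word_action_def)
qed

lemma env_action_linear:
  assumes "u \<in> carrier (kostant_C n)"
  shows "env_action u (\<lambda>I. \<Sum>s\<in>S. c s * t s I) I = (\<Sum>s\<in>S. c s * env_action u (t s) I)"
  using assms
  by (elim enveloping_carrierE)
    (simp add: env_action_class free_action_def word_action_linear word_pairing_sum
        word_pairing_scale)

subsection \<open>Matrix entries\<close>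

lemma finite_multi_indices: "finite (multi_indices m r)"
  using finite_lists_length_eq[of "{..<m}" r] by (simp add: multi_indices_def conj_commute)

text \<open>
  The action replaces letters by letters below \<open>n\<close> and keeps the length of words, so it preserves
  the tensors of a fixed degree.
\<close>

lemma env_action_support:
  assumes u: "u \<in> carrier (kostant_C n)" and t: "\<And>I. I \<notin> multi_indices n r \<Longrightarrow> t I = 0"
    and I: "I \<notin> multi_indices n r"
  shows "env_action u t I = 0"
proof -
  have lie: "lie_action n x t I = 0"
    if t: "\<And>I. I \<notin> multi_indices n r \<Longrightarrow> t I = 0" and I: "I \<notin> multi_indices n r" for x t I
    unfolding lie_action_def
  proof (intro sum.neutral ballI)
    fix p a assume p: "p \<in> {..<length I}" and a: "a \<in> {..<n}"
    show "mat_entry n x (I ! p) a * t (I[p := a]) = 0"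
    proof (cases "I[p := a] \<in> multi_indices n r")
      case True
      have "\<not> I ! p < n"
      proof
        assume "I ! p < n"
        moreover have "I = (I[p := a])[p := I ! p]" by simp
        ultimately have "set I \<subseteq> {..<n}"
          using True set_update_subset_insert[of "I[p := a]" p "I ! p"]
            by (auto simp: multi_indices_def)
        then show False using True I by (auto simp: multi_indices_def)
      qed
      then show ?thesis by (simp add: mat_entry_def)
    qed (simp add: t)
  qed
  have word: "word_action n w t I = 0" if "I \<notin> multi_indices n r" for w I
    using that by (induction w arbitrary: I) (simp_all add: word_action_def t lie)
  show ?thesis using u
    by (elim enveloping_carrierE) (simp add: env_action_class free_action_def word[OF I]
        word_pairing_def)
qed

definition entry :: "kostant \<Rightarrow> nat list \<Rightarrow> nat list \<Rightarrow> complex" where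
  "entry u I J = env_action u (\<lambda>K. if K = J then 1 else 0) I"

lemma entry_add:
  "u \<in> carrier (kostant_C n) \<Longrightarrow> v \<in> carrier (kostant_C n) \<Longrightarrow> entry (u \<oplus>\<^bsub>kostant_C n\<^esub> v) I J
      = entry u I J + entry v I J"
  by (simp add: entry_def env_action_add)

lemma entry_smult: "u \<in> carrier (kostant_C n) \<Longrightarrow> entry (c \<odot>\<^bsub>kostant_C n\<^esub> u) I J = c * entry u I J"
  by (simp add: entry_def env_action_smult)

lemma entry_one: "entry \<one>\<^bsub>kostant_C n\<^esub> I J = (if I = J then 1 else 0)"
  by (simp add: entry_def env_action_one)

text \<open>
  On tensors of one degree, with their finite basis of words, the action is given by matrices.
\<close>

lemma entry_mult:
  assumes u: "u \<in> carrier (kostant_C n)" and v: "v \<in> carrier (kostant_C n)" and J: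
      "J \<in> multi_indices n r"
  shows "entry (u \<otimes>\<^bsub>kostant_C n\<^esub> v) I J = (\<Sum>K\<in>multi_indices n r. entry u I K * entry v K J)"
proof -
  have supp: "entry v K J = 0" if "K \<notin> multi_indices n r" for K
    unfolding entry_def by (rule env_action_support[OF v _ that]) (use J in auto)
  have "env_action v (\<lambda>K. if K = J then 1 else 0)
      = (\<lambda>K'. \<Sum>K\<in>multi_indices n r. entry v K J * (if K' = K then 1 else 0))"
  proof
    fix K'
    show "env_action v (\<lambda>K. if K = J then 1 else 0) K'
        = (\<Sum>K\<in>multi_indices n r. entry v K J * (if K' = K then 1 else 0))"
      using supp[of K'] finite_multi_indices[of n r]
      by (cases "K' \<in> multi_indices n r") (auto simp: entry_def if_distrib cong: if_cong)
  qed
  then have "entry (u \<otimes>\<^bsub>kostant_C n\<^esub> v) I J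
      = env_action u (\<lambda>K'. \<Sum>K\<in>multi_indices n r. entry v K J * (if K' = K then 1 else 0)) I"
    by (simp add: entry_def[of "u \<otimes>\<^bsub>kostant_C n\<^esub> v"] env_action_mult[OF u v])
  also have "\<dots> = (\<Sum>K\<in>multi_indices n r. entry v K J * env_action u (\<lambda>K'. if K' = K then 1 else 0)
      I)"
    by (rule env_action_linear[OF u])
  finally show ?thesis by (simp add: entry_def[of u] mult.commute)
qed

end

section \<open>Matrix entries of the monomials\<close>

definition pair_count :: "nat list \<Rightarrow> nat list \<Rightarrow> nat \<Rightarrow> nat \<Rightarrow> nat" where
  "pair_count I J i j = card {p. p < length J \<and> I ! p = i \<and> J ! p = j}"

text \<open>
  \<open>raises xs k I J\<close>: the word \<open>I\<close> arises from \<open>J\<close> by changing, for each \<open>(i, j)\<close> in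
  \<open>xs\<close>, exactly \<open>k i j\<close> of the letters \<open>j\<close> into \<open>i\<close>.
\<close>

definition raises :: "(nat \<times> nat) list \<Rightarrow> (nat \<Rightarrow> nat \<Rightarrow> nat) \<Rightarrow> nat list \<Rightarrow> nat list \<Rightarrow> bool" where
  "raises xs k I J \<longleftrightarrow> length I = length J \<and>
    (\<forall>p<length J. I ! p = J ! p \<or> (I ! p, J ! p) \<in> set xs) \<and>
    (\<forall>(i, j)\<in>set xs. pair_count I J i j = k i j)"

lemma raises_cong:
  "(\<And>i j. (i, j) \<in> set xs \<Longrightarrow> k i j = k' i j) \<Longrightarrow> raises xs k I J = raises xs k' I J"
  unfolding raises_def by (intro conj_cong refl ball_cong) auto

text \<open>
  Undoing one change: the word with \<open>j\<close> put back at position \<open>p\<close> has one change less exactly if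
  \<open>p\<close> is one of the positions where \<open>j\<close> was changed into \<open>i\<close>. That letter \<open>j\<close> cannot be the
  result of another change, because no pair in \<open>ys\<close> produces \<open>j\<close>.
\<close>

lemma raises_update:
  assumes ij: "i \<noteq> j" "(i, j) \<notin> set ys" "\<forall>(a, b)\<in>set ys. a \<noteq> j"
    and len: "length I = length J" and p: "p < length J" "I ! p = i" and m: "k i j = m"
  shows "raises ((i, j) # ys) k (I[p := j]) J
    \<longleftrightarrow> J ! p = j \<and> raises ((i, j) # ys) (k(i := (k i)(j := Suc m))) I J"
proof (cases "J ! p = j")
  case False
  have "\<not> ((I[p := j]) ! p = J ! p \<or> ((I[p := j]) ! p, J ! p) \<in> set ((i, j) # ys))"
    using False ij p len by auto
  then show ?thesis using False p(1) unfolding raises_def by blast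
next
  case True
  have other: "pair_count (I[p := j]) J a b = pair_count I J a b" if "(a, b) \<noteq> (i, j)" "a \<noteq> j"
      for a b
  proof -
    have "{q. q < length J \<and> (I[p := j]) ! q = a \<and> J ! q = b} = {q. q < length J \<and> I ! q = a \<and> J ! q
        = b}"
      using that p len True by (auto simp: nth_list_update)
    then show ?thesis by (simp add: pair_count_def)
  qed
  have same: "pair_count I J i j = Suc (pair_count (I[p := j]) J i j)"
  proof -
    have "{q. q < length J \<and> I ! q = i \<and> J ! q = j}
        = insert p {q. q < length J \<and> (I[p := j]) ! q = i \<and> J ! q = j}"
      using p len True ij(1) by (auto simp: nth_list_update)
    moreover have "p \<notin> {q. q < length J \<and> (I[p := j]) ! q = i \<and> J ! q = j}"
      using p len ij(1) by simp
    ultimately show ?thesis by (simp add: pair_count_def)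
  qed
  have A: "(\<forall>q<length J. (I[p := j]) ! q = J ! q \<or> ((I[p := j]) ! q, J ! q) \<in> set ((i, j) # ys))
      \<longleftrightarrow> (\<forall>q<length J. I ! q = J ! q \<or> (I ! q, J ! q) \<in> set ((i, j) # ys))"
  proof (intro all_cong1 imp_cong refl)
    fix q
    show "((I[p := j]) ! q = J ! q \<or> ((I[p := j]) ! q, J ! q) \<in> set ((i, j) # ys))
      \<longleftrightarrow> (I ! q = J ! q \<or> (I ! q, J ! q) \<in> set ((i, j) # ys))"
      using True p len by (cases "q = p") auto
  qed
  have B: "(\<forall>(a, b)\<in>set ys. pair_count (I[p := j]) J a b = k a b)
      \<longleftrightarrow> (\<forall>(a, b)\<in>set ys. pair_count I J a b = (k(i := (k i)(j := Suc m))) a b)"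
  proof (intro ball_cong refl)
    fix x assume x: "x \<in> set ys"
    obtain a b where ab: "x = (a, b)" by fastforce
    have "(a, b) \<noteq> (i, j)" "a \<noteq> j" using x ij(2,3) unfolding ab by auto
    note ab = ab this
    then show "(case x of (a, b) \<Rightarrow> pair_count (I[p := j]) J a b = k a b)
      \<longleftrightarrow> (case x of (a, b) \<Rightarrow> pair_count I J a b = (k(i := (k i)(j := Suc m))) a b)"
      using other[of a b] by auto
  qed
  show ?thesis
    unfolding raises_def A using B same True len m by (simp add: case_prod_beta)
qed

definition root_indices :: "nat \<Rightarrow> (nat \<times> nat) set" where
  "root_indices n = {(i, j). i < j \<and> j < n}"

text \<open>
  A factor \<open>e\<^bsub>ij\<^esub>\<close> turns letters \<open>j\<close> into \<open>i\<close>, and factors further to the right act earlier. The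
  condition says that no factor consumes a letter that an earlier one has produced. Hence no
  letter is changed twice.
\<close>

fun compatible_order :: "nat \<Rightarrow> (nat \<times> nat) list \<Rightarrow> bool" where
  "compatible_order n [] \<longleftrightarrow> True"
| "compatible_order n ((i, j) # ys) \<longleftrightarrow>
    i < j \<and> j < n \<and> (i, j) \<notin> set ys \<and> (\<forall>(a, b)\<in>set ys. a \<noteq> j) \<and> compatible_order n ys"

lemma root_list_Suc: "root_list (Suc n) = map (\<lambda>i. (i, n)) (rev [0..<n]) @ root_list n"
  by (simp add: root_list_def)

lemma set_root_list: "set (root_list n) = root_indices n"
proof (induction n)
  case 0 then show ?case by (simp add: root_list_def root_indices_def)
next
  case (Suc n)
  have "set (root_list (Suc n)) = (\<lambda>i. (i, n)) ` {0..<n} \<union> root_indices n"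
    by (simp add: root_list_Suc Suc.IH)
  also have "\<dots> = root_indices (Suc n)" by (auto simp: root_indices_def less_Suc_eq)
  finally show ?case .
qed

lemma compatible_order_root_list: "compatible_order n (root_list n)"
proof -
  have mono: "compatible_order n xs \<Longrightarrow> compatible_order (Suc n) xs" for n xs
    by (induction n xs rule: compatible_order.induct) auto
  show ?thesis
  proof (induction n)
    case 0 then show ?case by (simp add: root_list_def)
  next
    case (Suc n)
    have "compatible_order (Suc n) (map (\<lambda>i. (i, n)) is @ root_list n)"
      if "distinct is" "set is \<subseteq> {..<n}" for "is"
      using that
    proof (induction "is")
      case Nil then show ?case using mono[OF Suc.IH] by simp
    next
      case (Cons i "is")
      then have "(i, n) \<notin> set (map (\<lambda>i. (i, n)) is @ root_list n)"
        "\<forall>(a, b)\<in>set (map (\<lambda>i. (i, n)) is @ root_list n). a \<noteq> n"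
        by (auto simp: set_root_list root_indices_def)
      then show ?case using Cons by simp
    qed
    from this[of "rev [0..<n]"] show ?case by (simp add: root_list_Suc atLeast0LessThan)
  qed
qed

context
  fixes n :: nat
begin

interpretation U: scalar_algebra "kostant_C n" by (rule enveloping_algebra)

definition root_vector :: "nat \<times> nat \<Rightarrow> kostant" where
  "root_vector x = enveloping_embedding (strict_upper n) (matrix_unit n (fst x) (snd x))"

lemma embedding_closed: "x \<in> strict_upper n \<Longrightarrow> enveloping_embedding (strict_upper n) x
    \<in> carrier (kostant_C n)"
  unfolding enveloping_embedding_def enveloping_quot by (intro imageI letter_closed)

lemma matrix_unit_strict_upper: "x \<in> root_indices n \<Longrightarrow> matrix_unit n (fst x) (snd x) \<in> strict_upper
    n"
  by (auto simp: matrix_unit_def strict_upper_def root_indices_def)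

lemma root_vector_closed: "x \<in> root_indices n \<Longrightarrow> root_vector x \<in> carrier (kostant_C n)"
  unfolding root_vector_def by (intro embedding_closed matrix_unit_strict_upper)

lemma env_action_root_vector:
  assumes "(i, j) \<in> root_indices n"
  shows "env_action n (root_vector (i, j)) t I = (\<Sum>p | p < length I \<and> I ! p = i. t (I[p := j]))"
proof -
  have "env_action n (root_vector (i, j)) t I = lie_action n (matrix_unit n i j) t I"
    using matrix_unit_strict_upper[OF assms]
    by (simp add: root_vector_def enveloping_embedding_def env_action_class letter_closed
        free_action_letter)
  also have "\<dots> = (\<Sum>p<length I. if I ! p = i then t (I[p := j]) else 0)"
    unfolding lie_action_def
  proof (rule sum.cong[OF refl])
    fix p
    have "(\<Sum>a<n. mat_entry n (matrix_unit n i j) (I ! p) a * t (I[p := a]))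
        = (\<Sum>a<n. if a = j then (if I ! p = i then t (I[p := a]) else 0) else 0)"
      by (rule sum.cong) (use assms in \<open>auto simp: mat_entry_def matrix_unit_def root_indices_def\<close>)
    then show "(\<Sum>a<n. mat_entry n (matrix_unit n i j) (I ! p) a * t (I[p := a]))
        = (if I ! p = i then t (I[p := j]) else 0)"
      using assms by (simp add: root_indices_def)
  qed
  also have "\<dots> = (\<Sum>p | p < length I \<and> I ! p = i. t (I[p := j]))"
    by (simp add: sum.If_cases Int_def)
  finally show ?thesis .
qed

text \<open>
  Any of the \<open>Suc m\<close> changed letters may have been the last one to be changed, hence the factor.
\<close>

lemma root_vector_raises:
  assumes comp: "compatible_order n ((i, j) # ys)" and m: "k i j = m"
  shows "env_action n (root_vector (i, j)) (\<lambda>I. of_bool (raises ((i, j) # ys) k I J)) I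
    = of_nat (Suc m) * of_bool (raises ((i, j) # ys) (k(i := (k i)(j := Suc m))) I J)"
proof (cases "length I = length J")
  case False
  then show ?thesis using comp
    by (simp add: env_action_root_vector root_indices_def raises_def)
next
  case True
  let ?k = "k(i := (k i)(j := Suc m))"
  have ij: "i \<noteq> j" "(i, j) \<notin> set ys" "\<forall>(a, b)\<in>set ys. a \<noteq> j" and R: "(i, j) \<in> root_indices n"
    using comp by (auto simp: root_indices_def)
  have "env_action n (root_vector (i, j)) (\<lambda>I. of_bool (raises ((i, j) # ys) k I J)) I
      = (\<Sum>p | p < length I \<and> I ! p = i. of_bool (J ! p = j \<and> raises ((i, j) # ys) ?k I J))"
    unfolding env_action_root_vector[OF R]
    using True by (intro sum.cong refl) (simp add: raises_update[OF ij True, of _ k m] m)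
  also have "\<dots> = (\<Sum>p | p < length I \<and> I ! p = i \<and> J ! p = j. of_bool (raises ((i, j) # ys) ?k I J))"
    by (rule sum.mono_neutral_cong_right) auto
  also have "\<dots> = of_nat (pair_count I J i j) * of_bool (raises ((i, j) # ys) ?k I J)"
    using True by (simp add: pair_count_def)
  also have "\<dots> = of_nat (Suc m) * of_bool (raises ((i, j) # ys) ?k I J)"
    by (cases "raises ((i, j) # ys) ?k I J") (simp_all add: raises_def)
  finally show ?thesis .
qed

text \<open>
  The factors of the preceding lemma multiply up to \<open>fact m\<close>, which the divided power cancels.
\<close>

lemma root_vector_power_raises:
  assumes comp: "compatible_order n ((i, j) # ys)"
  shows "env_action n (root_vector (i, j) [^]\<^bsub>kostant_C n\<^esub> (m::nat)) (\<lambda>I. of_bool (raises ys k I J)) I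
    = fact m * of_bool (raises ((i, j) # ys) (k(i := (k i)(j := m))) I J)"
proof (induction m arbitrary: I)
  case 0
  have "raises ys k I J \<longleftrightarrow> raises ((i, j) # ys) (k(i := (k i)(j := 0))) I J"
  proof -
    have none: "pair_count I J i j = 0 \<longleftrightarrow> (\<forall>p<length J. (I ! p, J ! p) \<noteq> (i, j))"
      by (auto simp: pair_count_def)
    have A: "raises ((i, j) # ys) (k(i := (k i)(j := 0))) I J \<longleftrightarrow>
        raises ys (k(i := (k i)(j := 0))) I J \<and> pair_count I J i j = 0"
      unfolding raises_def using none by (auto 4 3)
    have B: "raises ys (k(i := (k i)(j := 0))) I J \<longleftrightarrow> raises ys k I J"
      by (rule raises_cong) (use comp in auto)
    have "pair_count I J i j = 0" if "raises ys k I J"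
      unfolding none using that comp by (auto simp: raises_def)
    then show ?thesis using A B by blast
  qed
  then show ?case by (simp only: U.nat_pow_0 env_action_one fact_0 mult_1)
next
  case (Suc m)
  have R: "root_vector (i, j) \<in> carrier (kostant_C n)"
    using comp by (intro root_vector_closed) (simp add: root_indices_def)
  have IH: "env_action n (root_vector (i, j) [^]\<^bsub>kostant_C n\<^esub> m) (\<lambda>I. of_bool (raises ys k I J))
      = (\<lambda>I. fact m * of_bool (raises ((i, j) # ys) (k(i := (k i)(j := m))) I J))"
    by (rule ext) (rule Suc.IH)
  have "env_action n (root_vector (i, j) [^]\<^bsub>kostant_C n\<^esub> Suc m) (\<lambda>I. of_bool (raises ys k I J)) I
      = env_action n (root_vector (i, j)) (env_action n (root_vector (i, j) [^]\<^bsub>kostant_C n\<^esub> m)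
          (\<lambda>I. of_bool (raises ys k I J))) I"
    using R by (simp only: U.nat_pow_Suc2 env_action_mult U.nat_pow_closed)
  also have "\<dots> = env_action n (root_vector (i, j)) (\<lambda>I. \<Sum>s\<in>{()}. fact m *
      of_bool (raises ((i, j) # ys) (k(i := (k i)(j := m))) I J)) I"
    unfolding IH by simp
  also have "\<dots> = fact m * env_action n (root_vector (i, j))
      (\<lambda>I. of_bool (raises ((i, j) # ys) (k(i := (k i)(j := m))) I J)) I"
    by (subst env_action_linear[OF R]) simp
  also have "\<dots> = fact (Suc m) * of_bool (raises ((i, j) # ys) (k(i := (k i)(j := Suc m))) I J)"
    by (subst root_vector_raises[OF comp, where m = m]) (simp_all add: algebra_simps)
  finally show ?case .
qed

lemma divided_power_closed: "(i, j) \<in> root_indices n \<Longrightarrow> divided_power n i j m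
    \<in> carrier (kostant_C n)"
  unfolding divided_power_def
  using root_vector_closed[of "(i, j)"] by (simp add: root_vector_def U.smult_closed)

abbreviation (input) ordered_product where
  "ordered_product k xs \<equiv> foldr (\<lambda>(i, j) y. divided_power n i j (k i j) \<otimes>\<^bsub>kostant_C n\<^esub> y) xs
      \<one>\<^bsub>kostant_C n\<^esub>"

lemma ordered_product_closed: "set xs \<subseteq> root_indices n \<Longrightarrow> ordered_product k xs
    \<in> carrier (kostant_C n)"
  by (induction xs) (auto intro!: U.m_closed divided_power_closed)

lemma kostant_monomial_closed: "kostant_monomial n k \<in> carrier (kostant_C n)"
  unfolding kostant_monomial_def by (rule ordered_product_closed) (simp add: set_root_list)

lemma ordered_product_raises:
  assumes "compatible_order n xs"
  shows "entry n (ordered_product k xs) I J = of_bool (raises xs k I J)"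
  using assms
proof (induction xs arbitrary: I)
  case Nil
  have "raises [] k I J \<longleftrightarrow> I = J" by (auto simp: raises_def list_eq_iff_nth_eq)
  then show ?case by (simp add: entry_one)
next
  case (Cons x xs)
  obtain i j where x: "x = (i, j)" by fastforce
  have R: "(i, j) \<in> root_indices n" using Cons.prems by (simp add: x root_indices_def)
  have sub: "set xs \<subseteq> root_indices n"
  proof -
    have "compatible_order n zs \<Longrightarrow> set zs \<subseteq> root_indices n" for zs
      by (induction n zs rule: compatible_order.induct) (auto simp: root_indices_def)
    then show ?thesis using Cons.prems by (auto simp: x)
  qed
  have "entry n (ordered_product k (x # xs)) I J
      = env_action n (divided_power n i j (k i j)) (\<lambda>I. entry n (ordered_product k xs) I J) I"
    using divided_power_closed[OF R] ordered_product_closed[OF sub]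
    by (simp add: x entry_def env_action_mult)
  also have "\<dots> = env_action n (divided_power n i j (k i j)) (\<lambda>I. of_bool (raises xs k I J)) I"
    using Cons by (simp add: x)
  also have "\<dots> = 1 / fact (k i j) *
      env_action n (root_vector (i, j) [^]\<^bsub>kostant_C n\<^esub> k i j) (\<lambda>I. of_bool (raises xs k I J)) I"
    using root_vector_closed[OF R] by (simp add: divided_power_def root_vector_def env_action_smult)
  also have "\<dots> = of_bool (raises (x # xs) k I J)"
    using Cons.prems unfolding x by (subst root_vector_power_raises) simp_all
  finally show ?case .
qed

text \<open>
  The matrix entries of a monomial in the given order are 0 and 1, and they tell the exponents:
  the key to everything that follows.
\<close>

lemma entry_monomial:
  "entry n (kostant_monomial n k) I J = of_bool (raises (root_list n) k I J)"
  unfolding kostant_monomial_def by (rule ordered_product_raises[OF compatible_order_root_list])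

end

subsection \<open>Words with prescribed pair counts\<close>

lemma pair_count_conv_count: 
  "pair_count (map fst zs) (map snd zs) i j = count (mset zs) (i, j)"
proof -
  have "{p. p < length zs \<and> map fst zs ! p = i \<and> map snd zs ! p = j} = {p. p < length zs \<and> zs ! p
      = (i, j)}"
    by (auto simp: prod_eq_iff)
  moreover have "count (mset zs) (i, j) = card {p. p < length zs \<and> zs ! p = (i, j)}"
    by (simp add: count_mset count_list_eq_length_filter length_filter_conv_card eq_commute)
  ultimately show ?thesis by (simp add: pair_count_def)
qed

text \<open>
  Any matrix of natural numbers is a matrix of pair counts. This provides the matrix entries that
  single out one monomial.
\<close>

lemma words_with_pair_counts:
  fixes m :: "nat \<Rightarrow> nat \<Rightarrow> nat"
  obtains I J where "length I = length J" "length J = (\<Sum>i<n. \<Sum>j<n. m i j)"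
    "set I \<subseteq> {..<n}" "set J \<subseteq> {..<n}"
    "\<And>i j. i < n \<Longrightarrow> j < n \<Longrightarrow> pair_count I J i j = m i j"
    "\<And>p. p < length J \<Longrightarrow> m (I ! p) (J ! p) \<noteq> 0"
proof -
  let ?A = "{..<n} \<times> {..<n}"
  let ?M = "\<Sum>x\<in>?A. replicate_mset (m (fst x) (snd x)) x"
  obtain zs where zs: "mset zs = ?M" using ex_mset by blast
  have count: "count ?M x = (if x \<in> ?A then m (fst x) (snd x) else 0)" for x
    by (simp add: count_sum sum.delta' if_distrib cong: if_cong)
  have elem: "x \<in> ?A \<and> m (fst x) (snd x) \<noteq> 0" if "x \<in> set zs" for x
    using that count[of x] unfolding zs[symmetric]
    by (metis count_mset_0_iff)
  show ?thesis
  proof (rule that[of "map fst zs" "map snd zs"])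
    have "length zs = size ?M" by (simp flip: zs)
    also have "\<dots> = (\<Sum>x\<in>?A. m (fst x) (snd x))" by (simp add: size_multiset_sum)
    finally show "length (map snd zs) = (\<Sum>i<n. \<Sum>j<n. m i j)"
      by (simp add: sum.cartesian_product case_prod_beta)
    show "set (map fst zs) \<subseteq> {..<n}" "set (map snd zs) \<subseteq> {..<n}" using elem by fastforce+
    show "pair_count (map fst zs) (map snd zs) i j = m i j" if "i < n" "j < n" for i j
      using that by (simp add: pair_count_conv_count zs count)
    show "m (map fst zs ! p) (map snd zs ! p) \<noteq> 0" if "p < length (map snd zs)" for p
      using elem[of "zs ! p"] that by simp
  qed simp
qed

section \<open>The monomials span the enveloping algebra\<close>

lemma (in ring) minus_telescope:
  "\<lbrakk>x \<in> carrier R; y \<in> carrier R; z \<in> carrier R\<rbrakk> \<Longrightarrow> (x \<ominus> y) \<oplus> (y \<ominus> z) = x \<ominus> z"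
  by (simp add: a_minus_def a_assoc r_neg1)

lemma (in ring) minus_mult_left:
  "\<lbrakk>x \<in> carrier R; y \<in> carrier R; z \<in> carrier R\<rbrakk> \<Longrightarrow> x \<otimes> (y \<ominus> z) = x \<otimes> y \<ominus> x \<otimes> z"
  by (simp add: a_minus_def r_distr r_minus)

lemma (in ring) minus_mult_right:
  "\<lbrakk>x \<in> carrier R; y \<in> carrier R; z \<in> carrier R\<rbrakk> \<Longrightarrow> (x \<ominus> y) \<otimes> z = x \<otimes> z \<ominus> y \<otimes> z"
  by (simp add: a_minus_def l_distr l_minus)

lemma (in ring) minus_add_cancel:
  "\<lbrakk>x \<in> carrier R; y \<in> carrier R\<rbrakk> \<Longrightarrow> (x \<ominus> y) \<oplus> y = x"
  by (simp add: a_minus_def a_assoc l_neg)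

lemma (in scalar_algebra) add_pow_conv_smult:
  assumes x: "x \<in> carrier A" shows "[z] \<cdot> x = of_int z \<odot> x"
proof -
  have nat: "[m] \<cdot> x = of_nat m \<odot> x" for m :: nat
  proof (induction m)
    case 0 show ?case using smult_zero_left[OF x] by (simp add: add_pow_def nat_pow_def)
  next
    case (Suc m)
    have "[Suc m] \<cdot> x = [m] \<cdot> x \<oplus> x" by (simp add: add_pow_def nat_pow_def)
    also have "\<dots> = of_nat m \<odot> x \<oplus> 1 \<odot> x" unfolding Suc.IH smult_one[OF x] ..
    also have "\<dots> = (of_nat m + 1) \<odot> x" by (rule smult_l_distr[OF x, symmetric])
    finally show ?case by (simp only: of_nat_Suc add.commute)
  qed
  show ?thesis
  proof (cases "z < 0")
    case True
    have "[z] \<cdot> x = \<ominus> ([nat (- z)] \<cdot> x)"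
      using True by (simp only: add_pow_def int_pow_def2 a_inv_def if_True)
    also have "\<dots> = (- of_nat (nat (- z))) \<odot> x" unfolding nat smult_minus_left[OF x] ..
    also have "- of_nat (nat (- z)) = (of_int z :: 'c)" using True of_nat_nat[of "- z"] by simp
    finally show ?thesis .
  next
    case False
    have "[z] \<cdot> x = [nat z] \<cdot> x" using False by (simp only: add_pow_def int_pow_def2 if_False)
    also have "\<dots> = of_nat (nat z) \<odot> x" by (rule nat)
    also have "of_nat (nat z) = (of_int z :: 'c)" using False by (intro of_nat_nat) simp
    finally show ?thesis .
  qed
qed

context
  fixes n :: nat
begin

interpretation U: scalar_algebra "kostant_C n" by (rule enveloping_algebra)
interpretation F: scalar_algebra "kostant_free n" by (rule free_algebra_scalar_algebra)

lemma kostant_class_minus: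
  assumes f: "f \<in> carrier (kostant_free n)" and g: "g \<in> carrier (kostant_free n)"
  shows "kostant_class n f \<ominus>\<^bsub>kostant_C n\<^esub> kostant_class n g = kostant_class n (f \<ominus>\<^bsub>kostant_free n\<^esub> g)"
proof -
  have c: "kostant_class n g \<in> carrier (kostant_C n)" using g by (simp add: enveloping_quot)
  have "\<ominus>\<^bsub>kostant_C n\<^esub> kostant_class n g = (- 1) \<odot>\<^bsub>kostant_C n\<^esub> kostant_class n g" using c
    by (simp add: U.smult_minus_left U.smult_one)
  also have "\<dots> = kostant_class n (\<ominus>\<^bsub>kostant_free n\<^esub> g)" using g
    by (simp add: enveloping_quot F.smult_minus_left F.smult_one)
  finally show ?thesis using f g by (simp add: a_minus_def enveloping_quot)
qed

lemma embedding_add: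
  assumes "x \<in> strict_upper n" "y \<in> strict_upper n"
      shows "enveloping_embedding (strict_upper n) (x + y) = enveloping_embedding (strict_upper n) x
      \<oplus>\<^bsub>kostant_C n\<^esub> enveloping_embedding (strict_upper n) y"
proof -
  have "letter (x + y) \<ominus>\<^bsub>kostant_free n\<^esub> (letter x \<oplus>\<^bsub>kostant_free n\<^esub> letter y) \<in> enveloping_ideal
      (strict_upper n)"
    by (rule relation_in_ideal, unfold enveloping_relations_def Let_def, rule UnI1, rule UnI1)
      (rule CollectI, rule exI[of _ x], rule exI[of _ y], simp add: assms)
  then show ?thesis using assms
    by (simp add: enveloping_embedding_def enveloping_quot letter_closed kostant_class_eq_iff
        strict_upper_add)
qed

lemma embedding_smult:
  assumes "x \<in> strict_upper n" shows "enveloping_embedding (strict_upper n) (c \<cdot>\<^sub>m x)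
      = c \<odot>\<^bsub>kostant_C n\<^esub> enveloping_embedding (strict_upper n) x"
proof -
  have "letter (c \<cdot>\<^sub>m x) \<ominus>\<^bsub>kostant_free n\<^esub> (c \<odot>\<^bsub>kostant_free n\<^esub> letter x) \<in> enveloping_ideal
      (strict_upper n)"
    by (rule relation_in_ideal, unfold enveloping_relations_def Let_def, rule UnI1, rule UnI2)
      (rule CollectI, rule exI[of _ c], rule exI[of _ x], simp add: assms)
  then show ?thesis using assms
    by (simp add: enveloping_embedding_def enveloping_quot letter_closed kostant_class_eq_iff
        strict_upper_smult
        F.smult_closed)
qed

lemma embedding_bracket:
  assumes "x \<in> strict_upper n" "y \<in> strict_upper n"
  shows "enveloping_embedding (strict_upper n) x \<otimes>\<^bsub>kostant_C n\<^esub> enveloping_embedding (strict_upper n)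
      y \<ominus>\<^bsub>kostant_C n\<^esub> enveloping_embedding (strict_upper n) y \<otimes>\<^bsub>kostant_C n\<^esub> enveloping_embedding
      (strict_upper n) x = enveloping_embedding (strict_upper n) (x * y - y * x)"
proof -
  have c: "x * y - y * x \<in> strict_upper n" using assms
    by (intro strict_upper_diff strict_upper_mult)
  have "(letter x \<otimes>\<^bsub>kostant_free n\<^esub> letter y \<ominus>\<^bsub>kostant_free n\<^esub> letter y \<otimes>\<^bsub>kostant_free n\<^esub> letter x)
      \<ominus>\<^bsub>kostant_free n\<^esub> letter (x * y - y * x) \<in> enveloping_ideal (strict_upper n)"
    by (rule relation_in_ideal, unfold enveloping_relations_def Let_def, rule UnI2)
      (rule CollectI, rule exI[of _ x], rule exI[of _ y], simp add: assms)
  then show ?thesis using assms c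
    by (simp add: enveloping_embedding_def enveloping_quot letter_closed kostant_class_minus
        kostant_class_eq_iff)
qed

lemma root_vectors_closed: "root_vector n ` root_indices n \<subseteq> carrier (kostant_C n)"
  using root_vector_closed by blast

text \<open>
  The matrix is assembled from multiples of matrix units, one entry at a time.
\<close>

lemma embedding_in_span_of_root_vectors:
  assumes x: "x \<in> strict_upper n"
      shows "enveloping_embedding (strict_upper n) x \<in> lin_span (kostant_C n) (root_vector n `
      root_indices n)"
proof -
  let ?x = "\<lambda>S. mat n n (\<lambda>(i, j). if (i, j) \<in> S then x $$ (i, j) else 0)"
  have fin: "finite (root_indices n)"
    by (rule finite_subset[of _ "{..<n} \<times> {..<n}"]) (auto simp: root_indices_def)
  have "?x S \<in> strict_upper n \<and> enveloping_embedding (strict_upper n) (?x S)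
      \<in> lin_span (kostant_C n) (root_vector n ` root_indices n)" if "finite S" "S \<subseteq> root_indices n"
      for S
    using that
  proof (induction S)
    case empty
    let ?z = "0\<^sub>m n n :: complex mat"
    have z: "?z \<in> strict_upper n" by (auto simp: strict_upper_def)
    have "enveloping_embedding (strict_upper n) ?z = enveloping_embedding (strict_upper n)
        (0 \<cdot>\<^sub>m ?z)" by simp
    also have "\<dots> = \<zero>\<^bsub>kostant_C n\<^esub>" using z
      by (simp only: embedding_smult U.smult_zero_left embedding_closed)
    finally have "enveloping_embedding (strict_upper n) ?z = \<zero>\<^bsub>kostant_C n\<^esub>" .
    moreover have "?x {} = ?z" by (rule eq_matI) auto
    ultimately show ?case using z by (simp only: U.lin_span_zero simp_thms)
  next
    case (insert s S)
    obtain i j where s: "s = (i, j)" by fastforce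
    have sP: "(i, j) \<in> root_indices n" using insert.prems by (simp add: s)
    have u: "matrix_unit n i j \<in> strict_upper n" using matrix_unit_strict_upper[OF sP] by simp
    have eq: "?x (insert s S) = ?x S + x $$ (i, j) \<cdot>\<^sub>m matrix_unit n i j"
      by (rule eq_matI) (use insert.hyps in \<open>auto simp: s matrix_unit_def\<close>)
    have IH: "?x S \<in> strict_upper n" "enveloping_embedding (strict_upper n) (?x S)
        \<in> lin_span (kostant_C n) (root_vector n ` root_indices n)" using insert.IH insert.prems by
        blast+
    have "enveloping_embedding (strict_upper n) (?x (insert s S))
        = enveloping_embedding (strict_upper n) (?x S) \<oplus>\<^bsub>kostant_C n\<^esub> x $$ (i, j) \<odot>\<^bsub>kostant_C n\<^esub>
        root_vector n (i, j)"
      unfolding eq embedding_add[OF IH(1) strict_upper_smult[OF u]] embedding_smult[OF u]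
      by (simp add: root_vector_def)
    moreover have "\<dots> \<in> lin_span (kostant_C n) (root_vector n ` root_indices n)"
      by (rule U.lin_span_add[OF IH(2) U.lin_span_smult_base]) (rule imageI[OF sP])
    moreover have "?x (insert s S) \<in> strict_upper n"
      unfolding eq by (intro strict_upper_add strict_upper_smult IH u)
    ultimately show ?case by (simp only: simp_thms)
  qed
  from this[OF fin] have "enveloping_embedding (strict_upper n) (?x (root_indices n))
      \<in> lin_span (kostant_C n) (root_vector n ` root_indices n)" by blast
  moreover have "?x (root_indices n) = x"
    by (rule eq_matI) (use x in \<open>auto simp: strict_upper_def root_indices_def\<close>)
  ultimately show ?thesis by simp
qed

lemma root_vector_bracket:
  assumes a: "a \<in> root_indices n" and b: "b \<in> root_indices n"
  shows "root_vector n a \<otimes>\<^bsub>kostant_C n\<^esub> root_vector n b \<ominus>\<^bsub>kostant_C n\<^esub> root_vector n b \<otimes>\<^bsub>kostant_C n\<^esub>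
      root_vector n a \<in> lin_span (kostant_C n) (root_vector n ` root_indices n)"
proof -
  let ?a = "matrix_unit n (fst a) (snd a) :: complex mat"
  let ?b = "matrix_unit n (fst b) (snd b) :: complex mat"
  have "enveloping_embedding (strict_upper n) (?a * ?b - ?b * ?a) \<in> lin_span (kostant_C n)
      (root_vector n ` root_indices n)"
    by (rule embedding_in_span_of_root_vectors)
      (intro strict_upper_diff strict_upper_mult matrix_unit_strict_upper a b)
  then show ?thesis
    using embedding_bracket[OF matrix_unit_strict_upper[OF a] matrix_unit_strict_upper[OF b]]
    by (simp only: root_vector_def)
qed

definition root_word :: "(nat \<times> nat) list \<Rightarrow> kostant" where
  "root_word w = foldr (\<lambda>x y. root_vector n x \<otimes>\<^bsub>kostant_C n\<^esub> y) w \<one>\<^bsub>kostant_C n\<^esub>"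

text \<open>
  The standard filtration of the enveloping algebra.
\<close>

definition short_span :: "nat \<Rightarrow> kostant set" where
  "short_span d = lin_span (kostant_C n) (root_word ` {w \<in> lists (root_indices n). length w \<le> d})"

lemma root_word_simps: "root_word [] = \<one>\<^bsub>kostant_C n\<^esub>" "root_word (x # w)
    = root_vector n x \<otimes>\<^bsub>kostant_C n\<^esub> root_word w"
  by (simp_all add: root_word_def)

lemma root_word_closed: "w \<in> lists (root_indices n) \<Longrightarrow> root_word w \<in> carrier (kostant_C n)"
  by (induction w) (auto simp: root_word_simps root_vector_closed)

lemma short_words_closed: "root_word ` {w \<in> lists (root_indices n). length w \<le> d}
    \<subseteq> carrier (kostant_C n)"
  using root_word_closed by blast

lemma short_span_add: "u \<in> short_span d \<Longrightarrow> v \<in> short_span d \<Longrightarrow> u \<oplus>\<^bsub>kostant_C n\<^esub> v \<in> short_span d"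
  unfolding short_span_def by (rule U.lin_span_add)

lemma short_span_zero: "\<zero>\<^bsub>kostant_C n\<^esub> \<in> short_span d"
  unfolding short_span_def by (rule U.lin_span_zero)

lemma short_span_root_vector:
  assumes a: "a \<in> root_indices n" and u: "u \<in> short_span d"
  shows "root_vector n a \<otimes>\<^bsub>kostant_C n\<^esub> u \<in> short_span (Suc d)"
  using short_words_closed u unfolding short_span_def[of d]
proof (induction rule: U.lin_span_induct)
  case zero
  then show ?case using root_vector_closed[OF a] by (simp add: short_span_zero)
next
  case (base c x)
  then obtain w where w: "w \<in> lists (root_indices n)" "length w \<le> d" "x = root_word w" by blast
  have "root_vector n a \<otimes>\<^bsub>kostant_C n\<^esub> (c \<odot>\<^bsub>kostant_C n\<^esub> x) = c \<odot>\<^bsub>kostant_C n\<^esub> root_word (a # w)"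
    using w root_word_closed[OF w(1)] root_vector_closed[OF a]
    by (simp add: root_word_simps U.smult_mult_right)
  moreover have "root_word (a # w) \<in> root_word ` {w \<in> lists (root_indices n). length w \<le> Suc d}"
    by (rule imageI) (use w a in auto)
  ultimately show ?case unfolding short_span_def by (simp add: U.lin_span_smult_base)
next
  case (add x y)
  then have "x \<in> carrier (kostant_C n)" "y \<in> carrier (kostant_C n)"
    using U.lin_span_closed[OF short_words_closed] by blast+
  then show ?case using add root_vector_closed[OF a] by (simp add: U.r_distr short_span_add)
qed

text \<open>
  The difference is a commutator times a word, and the commutator of two root vectors is linear in
  root vectors, so one letter is lost.
\<close>

lemma root_word_swap:
  assumes a: "a \<in> root_indices n" and b: "b \<in> root_indices n" and w: "w \<in> lists (root_indices n)"
  shows "root_word (a # b # w) \<ominus>\<^bsub>kostant_C n\<^esub> root_word (b # a # w) \<in> short_span (Suc (length w))"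
proof -
  note c = root_vector_closed[OF a] root_vector_closed[OF b] root_word_closed[OF w]
  have "c \<otimes>\<^bsub>kostant_C n\<^esub> root_word w \<in> short_span (Suc (length w))"
      if "c \<in> lin_span (kostant_C n) (root_vector n ` root_indices n)" for c
    using root_vectors_closed that
  proof (induction rule: U.lin_span_induct)
    case zero then show ?case using c by (simp add: short_span_zero)
  next
    case (base d x)
    then obtain e where e: "e \<in> root_indices n" "x = root_vector n e" by blast
    have "(d \<odot>\<^bsub>kostant_C n\<^esub> x) \<otimes>\<^bsub>kostant_C n\<^esub> root_word w = d \<odot>\<^bsub>kostant_C n\<^esub> root_word (e # w)"
      using e c root_vector_closed[OF e(1)] by (simp add: root_word_simps U.smult_mult_left)
    moreover have "root_word (e # w) \<in> root_word ` {w' \<in> lists (root_indices n). length w'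
        \<le> Suc (length w)}"
      by (rule imageI) (use w e in auto)
    ultimately show ?case unfolding short_span_def by (simp add: U.lin_span_smult_base)
  next
    case (add x y)
    then have "x \<in> carrier (kostant_C n)" "y \<in> carrier (kostant_C n)"
      using U.lin_span_closed[OF root_vectors_closed] by blast+
    then show ?case using add c by (simp add: U.l_distr short_span_add)
  qed
  from this[OF root_vector_bracket[OF a b]] show ?thesis
    using c by (simp add: root_word_simps U.minus_mult_right U.m_assoc)
qed

lemma root_word_move:
  assumes "a \<in> root_indices n" "p \<in> lists (root_indices n)" "q \<in> lists (root_indices n)"
  shows "root_word (a # p @ q) \<ominus>\<^bsub>kostant_C n\<^esub> root_word (p @ a # q) \<in> short_span (length (p @ q))"
  using assms(2)
proof (induction p)
  case Nil
  have "root_word (a # q) \<in> carrier (kostant_C n)" by (rule root_word_closed) (use assms in auto)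
  then show ?case by (simp add: U.r_neg a_minus_def short_span_zero)
next
  case (Cons b p)
  have b: "b \<in> root_indices n" and p: "p \<in> lists (root_indices n)" using Cons by auto
  have pq: "p @ q \<in> lists (root_indices n)" "a # p @ q \<in> lists (root_indices n)"
      "p @ a # q \<in> lists (root_indices n)"
    "a # b # p @ q \<in> lists (root_indices n)" "b # a # p @ q \<in> lists (root_indices n)"
        "b # p @ a # q \<in> lists (root_indices n)"
    using b p assms by auto
  note c = pq[THEN root_word_closed]
  have "root_word (b # a # p @ q) \<ominus>\<^bsub>kostant_C n\<^esub> root_word (b # p @ a # q)
      = root_vector n b \<otimes>\<^bsub>kostant_C n\<^esub> (root_word (a # p @ q) \<ominus>\<^bsub>kostant_C n\<^esub> root_word (p @ a # q))"
    using U.minus_mult_left[OF root_vector_closed[OF b] c(2,3)] by (simp add: root_word_simps)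
  then have "root_word (b # a # p @ q) \<ominus>\<^bsub>kostant_C n\<^esub> root_word (b # p @ a # q) \<in> short_span
      (length ((b # p) @ q))"
    using short_span_root_vector[OF b Cons.IH] by simp
  moreover have "root_word (a # b # p @ q) \<ominus>\<^bsub>kostant_C n\<^esub> root_word (b # a # p @ q) \<in> short_span
      (length ((b # p) @ q))"
    using root_word_swap[OF assms(1) b pq(1)] by simp
  ultimately show ?case
    using U.minus_telescope[OF c(4,5,6)] short_span_add by (metis append_Cons)
qed

text \<open>Up to words with fewer letters, the letters of a word commute.\<close>

lemma root_word_permute:
  assumes "w \<in> lists (root_indices n)" "mset w = mset w'"
  shows "root_word w \<ominus>\<^bsub>kostant_C n\<^esub> root_word w' \<in> short_span (length w - 1)"
  using assms
proof (induction w arbitrary: w' rule: list.induct)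
  case Nil
  then show ?case by (simp add: root_word_simps U.r_neg a_minus_def short_span_zero)
next
  case (Cons a u)
  have "a \<in> set w'" using Cons.prems(2) by (metis list.set_intros(1) set_mset_mset)
  then obtain p q where w': "w' = p @ a # q" by (meson split_list)
  have a: "a \<in> root_indices n" and u: "u \<in> lists (root_indices n)" using Cons.prems by auto
  have "set w' \<subseteq> root_indices n" using Cons.prems by (metis in_lists_conv_set set_mset_mset subsetI)
  then have p: "p \<in> lists (root_indices n)" and q: "q \<in> lists (root_indices n)" by (auto simp: w')
  have m: "mset u = mset (p @ q)" using Cons.prems(2) by (simp add: w')
  then have len: "length u = length (p @ q)" by (metis mset_eq_length)
  have pq: "p @ q \<in> lists (root_indices n)" "a # p @ q \<in> lists (root_indices n)"
      "p @ a # q \<in> lists (root_indices n)" "a # u \<in> lists (root_indices n)"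
    using a p q u by auto
  note c = pq[THEN root_word_closed]
  have "root_vector n a \<otimes>\<^bsub>kostant_C n\<^esub> (root_word u \<ominus>\<^bsub>kostant_C n\<^esub> root_word (p @ q)) \<in> short_span
      (length u)"
  proof (cases u)
    case Nil
    then have "p @ q = []" using len by simp
    then show ?thesis using root_vector_closed[OF a]
      by (simp add: Nil root_word_simps U.r_neg a_minus_def short_span_zero)
  next
    case (Cons x xs)
    then show ?thesis using short_span_root_vector[OF a Cons.IH[OF u m]] \<open>u = x # xs\<close> by simp
  qed
  then have "root_word (a # u) \<ominus>\<^bsub>kostant_C n\<^esub> root_word (a # p @ q) \<in> short_span (length u)"
    using U.minus_mult_left[OF root_vector_closed[OF a] root_word_closed[OF u] c(1)]
    by (simp add: root_word_simps)
  moreover have "root_word (a # p @ q) \<ominus>\<^bsub>kostant_C n\<^esub> root_word (p @ a # q) \<in> short_span (length u)"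
    using root_word_move[OF a p q] len by simp
  ultimately show ?case
    using U.minus_telescope[OF c(4,2,3)] short_span_add by (metis w' length_Cons diff_Suc_1)
qed

definition canonical_word :: "(nat \<Rightarrow> nat \<Rightarrow> nat) \<Rightarrow> (nat \<times> nat) list" where
  "canonical_word k = concat (map (\<lambda>(i, j). replicate (k i j) (i, j)) (root_list n))"

abbreviation (input) monomials where "monomials \<equiv> range (kostant_monomial n)"

lemma monomials_closed: "monomials \<subseteq> carrier (kostant_C n)"
  using kostant_monomial_closed by blast

text \<open>
  A power of a root vector is a factorial multiple of the divided power.
\<close>

lemma root_word_canonical: "root_word (canonical_word k) \<in> lin_span (kostant_C n) monomials"
proof -
  have rep: "root_word (replicate m (i, j) @ w) = fact m \<odot>\<^bsub>kostant_C n\<^esub> (divided_power n i j m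
      \<otimes>\<^bsub>kostant_C n\<^esub> root_word w)"
    if R: "(i, j) \<in> root_indices n" and w: "w \<in> lists (root_indices n)" for i j m w
  proof -
    note c = root_vector_closed[OF R] root_word_closed[OF w]
    have "root_word (replicate m (i, j) @ w) = (root_vector n (i, j) [^]\<^bsub>kostant_C n\<^esub> m) \<otimes>\<^bsub>kostant_C n\<^esub>
        root_word w"
    proof (induction m)
      case 0 then show ?case using c by simp
    next
      case (Suc m)
      have "root_word (replicate (Suc m) (i, j) @ w)
          = root_vector n (i, j) \<otimes>\<^bsub>kostant_C n\<^esub> (root_vector n (i, j) [^]\<^bsub>kostant_C n\<^esub> m \<otimes>\<^bsub>kostant_C n\<^esub>
              root_word w)"
        by (simp add: root_word_simps Suc.IH)
      also have "\<dots> = (root_vector n (i, j) \<otimes>\<^bsub>kostant_C n\<^esub> root_vector n (i, j) [^]\<^bsub>kostant_C n\<^esub> m)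
          \<otimes>\<^bsub>kostant_C n\<^esub> root_word w"
        using c by (simp only: U.m_assoc U.nat_pow_closed)
      also have "\<dots> = root_vector n (i, j) [^]\<^bsub>kostant_C n\<^esub> Suc m \<otimes>\<^bsub>kostant_C n\<^esub> root_word w"
        using c by (simp only: U.nat_pow_Suc2)
      finally show ?case .
    qed
    also have "root_vector n (i, j) [^]\<^bsub>kostant_C n\<^esub> m = fact m \<odot>\<^bsub>kostant_C n\<^esub> divided_power n i j m"
      using c by (simp add: divided_power_def root_vector_def U.smult_one flip: U.smult_assoc)
    finally show ?thesis
      using c divided_power_closed[OF R, of m] by (simp add: U.smult_mult_left)
  qed
  let ?op = "\<lambda>xs. foldr (\<lambda>(i, j) y. divided_power n i j (k i j) \<otimes>\<^bsub>kostant_C n\<^esub> y) xs \<one>\<^bsub>kostant_C n\<^esub>"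
  have "\<exists>c. root_word (concat (map (\<lambda>(i, j). replicate (k i j) (i, j)) xs)) = c \<odot>\<^bsub>kostant_C n\<^esub> ?op xs"
    if "set xs \<subseteq> root_indices n" for xs
    using that
  proof (induction xs)
    case Nil
    then show ?case by (intro exI[of _ 1]) (simp add: root_word_simps U.smult_one)
  next
    case (Cons x xs)
    obtain i j where x: "x = (i, j)" by fastforce
    obtain c where c: "root_word (concat (map (\<lambda>(i, j). replicate (k i j) (i, j)) xs))
        = c \<odot>\<^bsub>kostant_C n\<^esub> ?op xs"
      using Cons by auto
    have R: "(i, j) \<in> root_indices n" and w: "concat (map (\<lambda>(i, j). replicate (k i j) (i, j)) xs)
        \<in> lists (root_indices n)"
      using Cons.prems by (auto simp: x)
    have op: "?op xs \<in> carrier (kostant_C n)" using Cons.prems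
      by (intro ordered_product_closed) auto
    have "root_word (concat (map (\<lambda>(i, j). replicate (k i j) (i, j)) (x # xs)))
        = (fact (k i j) * c) \<odot>\<^bsub>kostant_C n\<^esub> ?op (x # xs)"
      using rep[OF R w, of "k i j"] op divided_power_closed[OF R, of "k i j"]
      by (simp add: x c U.smult_mult_right U.smult_assoc U.smult_closed)
    then show ?case by blast
  qed
  from this[of "root_list n"] obtain c where "root_word (canonical_word k)
      = c \<odot>\<^bsub>kostant_C n\<^esub> kostant_monomial n k"
    unfolding canonical_word_def kostant_monomial_def by (auto simp: set_root_list)
  then show ?thesis by (simp add: U.lin_span_smult_base)
qed

lemma distinct_root_list: "distinct (root_list n)"
proof -
  have "compatible_order n zs \<Longrightarrow> distinct zs" for zs
    by (induction n zs rule: compatible_order.induct) auto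
  then show ?thesis using compatible_order_root_list by blast
qed

lemma mset_canonical_word:
  assumes "w \<in> lists (root_indices n)"
  shows "mset (canonical_word (\<lambda>i j. count (mset w) (i, j))) = mset w"
proof (rule multiset_eqI)
  fix x
  have "count (mset (concat (map (\<lambda>(i, j). replicate (count (mset w) (i, j)) (i, j)) zs))) x
      = (if x \<in> set zs then count (mset w) x else 0)" if "distinct zs" for zs
    using that by (induction zs) (auto simp: case_prod_beta)
  from this[OF distinct_root_list]
  have "count (mset (canonical_word (\<lambda>i j. count (mset w) (i, j)))) x
      = (if x \<in> root_indices n then count (mset w) x else 0)"
    by (simp add: canonical_word_def set_root_list)
  then show "count (mset (canonical_word (\<lambda>i j. count (mset w) (i, j)))) x = count (mset w) x"
    using assms by (metis in_lists_conv_set count_mset_0_iff)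
qed

text \<open>
  Sort the letters of the word into the order of the monomials; the error consists of shorter words.
\<close>

lemma root_word_in_span: "w \<in> lists (root_indices n) \<Longrightarrow> root_word w \<in> lin_span (kostant_C n)
    monomials"
proof (induction "length w" arbitrary: w rule: less_induct)
  case less
  define w' where "w' = canonical_word (\<lambda>i j. count (mset w) (i, j))"
  have m: "mset w = mset w'" using mset_canonical_word[OF less.prems] by (simp add: w'_def)
  have w': "w' \<in> lists (root_indices n)" using less.prems m
    by (metis in_lists_conv_set set_mset_mset)
  show ?case
  proof (cases w)
    case Nil
    then have "w' = []" using m by simp
    then show ?thesis using root_word_canonical Nil unfolding w'_def by metis
  next
    case (Cons a u)
    have "root_word ` {v \<in> lists (root_indices n). length v \<le> length w - 1} \<subseteq> lin_span (kostant_C n)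
        monomials"
    proof (rule image_subsetI)
      fix v assume "v \<in> {v \<in> lists (root_indices n). length v \<le> length w - 1}"
      then show "root_word v \<in> lin_span (kostant_C n) monomials" using less.hyps[of v] Cons by simp
    qed
    then have "u \<in> lin_span (kostant_C n) monomials" if "u \<in> short_span (length w - 1)" for u
      using that U.lin_span_minimal[OF short_words_closed monomials_closed]
      unfolding short_span_def by blast
    from this[OF root_word_permute[OF less.prems m]]
    have "(root_word w \<ominus>\<^bsub>kostant_C n\<^esub> root_word w') \<oplus>\<^bsub>kostant_C n\<^esub> root_word w' \<in> lin_span (kostant_C n)
        monomials"
      by (rule U.lin_span_add) (simp add: w'_def root_word_canonical)
    then show ?thesis
      using U.minus_add_cancel[OF root_word_closed[OF less.prems] root_word_closed[OF w']] by simp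
  qed
qed

lemma root_words_closed: "root_word ` lists (root_indices n) \<subseteq> carrier (kostant_C n)"
  using root_word_closed by blast

lemma embedding_mult_span:
  assumes x: "x \<in> strict_upper n" and u:
      "u \<in> lin_span (kostant_C n) (root_word ` lists (root_indices n))"
  shows "enveloping_embedding (strict_upper n) x \<otimes>\<^bsub>kostant_C n\<^esub> u \<in> lin_span (kostant_C n)
      (root_word ` lists (root_indices n))"
proof -
  note cl = U.lin_span_closed[OF root_words_closed]
  have 1: "root_vector n a \<otimes>\<^bsub>kostant_C n\<^esub> u \<in> lin_span (kostant_C n) (root_word ` lists (root_indices
      n))" if a: "a \<in> root_indices n" for a
    using root_words_closed u
  proof (induction rule: U.lin_span_induct)
    case zero then show ?case using root_vector_closed[OF a] by (simp add: U.lin_span_zero)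
  next
    case (base c x)
    then obtain w where w: "w \<in> lists (root_indices n)" "x = root_word w" by blast
    have "root_vector n a \<otimes>\<^bsub>kostant_C n\<^esub> (c \<odot>\<^bsub>kostant_C n\<^esub> x) = c \<odot>\<^bsub>kostant_C n\<^esub> root_word (a # w)"
      using w root_word_closed[OF w(1)] root_vector_closed[OF a]
      by (simp add: root_word_simps U.smult_mult_right)
    moreover have "root_word (a # w) \<in> root_word ` lists (root_indices n)" using w a
      by (intro imageI) auto
    ultimately show ?case by (simp add: U.lin_span_smult_base)
  next
    case (add x y)
    then show ?case using cl root_vector_closed[OF a] by (simp add: U.r_distr U.lin_span_add)
  qed
  show ?thesis
    using root_vectors_closed embedding_in_span_of_root_vectors[OF x]
  proof (induction rule: U.lin_span_induct)
    case zero then show ?case using cl[OF u] by (simp add: U.lin_span_zero)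
  next
    case (base c x)
    then obtain a where a: "a \<in> root_indices n" "x = root_vector n a" by blast
    then have "(c \<odot>\<^bsub>kostant_C n\<^esub> x) \<otimes>\<^bsub>kostant_C n\<^esub> u = c \<odot>\<^bsub>kostant_C n\<^esub> (root_vector n a \<otimes>\<^bsub>kostant_C n\<^esub> u)"
      using cl[OF u] root_vector_closed[OF a(1)] by (simp add: U.smult_mult_left)
    then show ?case using U.lin_span_smult[OF root_words_closed 1[OF a(1)]] by simp
  next
    case (add x y)
    then have "x \<in> carrier (kostant_C n)" "y \<in> carrier (kostant_C n)"
      using U.lin_span_closed[OF root_vectors_closed] by blast+
    then show ?case using add cl[OF u] by (simp add: U.l_distr U.lin_span_add)
  qed
qed

lemma word_class_in_span:
  assumes "w \<in> lists (strict_upper n)"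
  shows "(\<lambda>v. if v = w then 1 else 0) \<in> carrier (kostant_free n)
    \<and> kostant_class n (\<lambda>v. if v = w then 1 else 0) \<in> lin_span (kostant_C n) (root_word ` lists
        (root_indices n))"
  using assms
proof (induction w rule: list.induct)
  case Nil
  have "(\<lambda>v. if v = [] then 1 else 0) = \<one>\<^bsub>kostant_free n\<^esub>" by (simp add: free_algebra_simps)
  moreover have "kostant_class n \<one>\<^bsub>kostant_free n\<^esub> = root_word []"
    by (simp add: root_word_simps enveloping_quot)
  moreover have "root_word [] \<in> lin_span (kostant_C n) (root_word ` lists (root_indices n))"
    by (rule U.lin_span_base) (auto simp: root_word_closed)
  ultimately show ?case by simp
next
  case (Cons x w)
  let ?w = "\<lambda>v. if v = w then 1 else (0::complex)"
  let ?xw = "\<lambda>v. if v = x # w then 1 else (0::complex)"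
  have x: "x \<in> strict_upper n" using Cons.prems by simp
  have w: "?w \<in> carrier (kostant_free n)" "kostant_class n ?w \<in> lin_span (kostant_C n)
      (root_word ` lists (root_indices n))" using Cons by auto
  have lx: "letter x \<in> carrier (kostant_free n)" by (rule letter_closed[OF x])
  have wp: "word_pairing (\<lambda>v. if v = u then 1 else (0::complex)) \<phi> = \<phi> u" for u \<phi>
    by (subst word_pairing_superset[of "{u}"]) auto
  have prod: "letter x \<otimes>\<^bsub>kostant_free n\<^esub> ?w = ?xw"
  proof (rule word_function_eqI)
    show "finite {v. (letter x \<otimes>\<^bsub>kostant_free n\<^esub> ?w) v \<noteq> 0}" using F.m_closed[OF lx w(1)]
      by (rule free_algebra_finite_support)
    fix \<phi>
    show "word_pairing (letter x \<otimes>\<^bsub>kostant_free n\<^esub> ?w) \<phi> = word_pairing ?xw \<phi>"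
      unfolding free_algebra_simps word_pairing_mult[OF free_algebra_finite_support[OF lx]
          free_algebra_finite_support[OF w(1)]]
      by (simp add: letter_pairing wp)
  qed auto
  have "kostant_class n ?xw = enveloping_embedding (strict_upper n) x \<otimes>\<^bsub>kostant_C n\<^esub> kostant_class n
      ?w"
    using lx w by (simp add: enveloping_embedding_def enveloping_quot prod)
  then show ?case using F.m_closed[OF lx w(1)] embedding_mult_span[OF x w(2)] by (simp add: prod)
qed

text \<open>
  The spanning part of the Poincare-Birkhoff-Witt theorem; linear independence of the monomials is
  read off their matrix entries.
\<close>

lemma monomials_span_enveloping_algebra:
  assumes u: "u \<in> carrier (kostant_C n)" shows "u \<in> lin_span (kostant_C n) monomials"
proof -
  obtain f where f: "f \<in> carrier (kostant_free n)" "u = kostant_class n f" using u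
    by (elim enveloping_carrierE)
  have "kostant_class n f \<in> lin_span (kostant_C n) (root_word ` lists (root_indices n))"
    if "finite S" "{w. f w \<noteq> 0} \<subseteq> S" "S \<subseteq> lists (strict_upper n)"
        for S and f :: "complex mat list \<Rightarrow> complex"
    using that
  proof (induction S arbitrary: f)
    case empty
    then have "f = (\<lambda>w. 0)" by auto
    then have "f = \<zero>\<^bsub>kostant_free n\<^esub>" by (simp add: free_algebra_simps)
    then have "kostant_class n f = 0 \<odot>\<^bsub>kostant_C n\<^esub> kostant_class n \<zero>\<^bsub>kostant_free n\<^esub>"
      by (simp add: enveloping_quot F.smult_zero_left)
    also have "\<dots> = \<zero>\<^bsub>kostant_C n\<^esub>" by (rule U.smult_zero_left) (simp add: enveloping_quot)
    finally show ?case by (simp add: U.lin_span_zero)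
  next
    case (insert w S)
    let ?g = "f(w := 0)" and ?w = "\<lambda>v. if v = w then 1 else (0::complex)"
    have supp: "{v. ?g v \<noteq> 0} \<subseteq> S" using insert.prems by auto
    have g: "?g \<in> carrier (kostant_free n)"
      using supp insert finite_subset[OF supp] by (auto simp: free_algebra_simps)
    have w: "?w \<in> carrier (kostant_free n)" "kostant_class n ?w \<in> lin_span (kostant_C n)
        (root_word ` lists (root_indices n))"
      using word_class_in_span[of w] insert.prems by auto
    have "f = ?g \<oplus>\<^bsub>kostant_free n\<^esub> (f w \<odot>\<^bsub>kostant_free n\<^esub> ?w)" by (auto simp: free_algebra_simps)
    then have "kostant_class n f = kostant_class n ?g \<oplus>\<^bsub>kostant_C n\<^esub> f w \<odot>\<^bsub>kostant_C n\<^esub> kostant_class n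
        ?w"
      using g w F.smult_closed[OF w(1)] by (metis enveloping_quot(3) enveloping_quot(4))
    moreover have "S \<subseteq> lists (strict_upper n)" using insert.prems by blast
    ultimately show ?case
      using U.lin_span_add[OF insert.IH[OF supp] U.lin_span_smult[OF root_words_closed w(2)]]
      by (simp only:)
  qed
  from this[of "{w. f w \<noteq> 0}" f] have
      "u \<in> lin_span (kostant_C n) (root_word ` lists (root_indices n))"
    using f by (simp add: free_algebra_simps)
  then show ?thesis
    using U.lin_span_minimal[OF root_words_closed monomials_closed] root_word_in_span by blast
qed

end

section \<open>Normal forms in tensor products\<close>

lemma (in scalar_module) finsum_smult_extend:
  assumes "finite T" "S \<subseteq> T" "\<And>k. k \<notin> S \<Longrightarrow> c k = 0" "f ` T \<subseteq> carrier A"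
  shows "finsum A (\<lambda>k. c k \<odot> f k) S = finsum A (\<lambda>k. c k \<odot> f k) T"
  by (rule add.finprod_mono_neutral_cong_left)
    (use assms in \<open>auto simp: smult_zero_left image_subset_iff intro: smult_closed\<close>)

lemma (in scalar_module) lin_span_expansion:
  assumes f: "f ` K \<subseteq> carrier A" and x: "x \<in> lin_span A (f ` K)"
  obtains S c where "finite S" "S \<subseteq> K" "\<And>k. k \<notin> S \<Longrightarrow> c k = 0"
    "x = finsum A (\<lambda>k. c k \<odot> f k) S"
proof -
  have "\<exists>S c. finite S \<and> S \<subseteq> K \<and> (\<forall>k. k \<notin> S \<longrightarrow> c k = 0) \<and> x = finsum A (\<lambda>k. c k \<odot> f k) S"
    using f x
  proof (induction rule: lin_span_induct)
    case zero
    show ?case by (intro exI[of _ "{}"] exI[of _ "\<lambda>_. 0"]) simp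
  next
    case (base d x)
    then obtain k where k: "k \<in> K" "x = f k" by blast
    then have "f k \<in> carrier A" using f by blast
    then show ?case using k
      by (intro exI[of _ "{k}"] exI[of _ "\<lambda>k'. if k' = k then d else 0"]) (simp add: smult_closed)
  next
    case (add x y)
    then obtain S c S' c' where
      S: "finite S" "S \<subseteq> K" "\<And>k. k \<notin> S \<Longrightarrow> c k = 0" "x = finsum A (\<lambda>k. c k \<odot> f k) S" and
      S': "finite S'" "S' \<subseteq> K" "\<And>k. k \<notin> S' \<Longrightarrow> c' k = 0" "y = finsum A (\<lambda>k. c' k \<odot> f k) S'"
      by blast
    let ?T = "S \<union> S'"
    have T: "finite ?T" "?T \<subseteq> K" using S S' by auto
    have fT: "f k \<in> carrier A" if "k \<in> ?T" for k using that T f by blast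
    have "x = finsum A (\<lambda>k. c k \<odot> f k) ?T" "y = finsum A (\<lambda>k. c' k \<odot> f k) ?T"
      unfolding S(4) S'(4) by (rule finsum_smult_extend; use S S' fT in auto)+
    then have "x \<oplus> y = finsum A (\<lambda>k. c k \<odot> f k \<oplus> c' k \<odot> f k) ?T"
      using fT by (simp add: finsum_addf smult_closed Pi_def)
    also have "\<dots> = finsum A (\<lambda>k. (c k + c' k) \<odot> f k) ?T"
      using fT by (intro finsum_cong') (auto simp: smult_l_distr smult_closed)
    finally show ?case using T S(3) S'(3)
      by (intro exI[of _ ?T] exI[of _ "\<lambda>k. c k + c' k"]) auto
  qed
  then show ?thesis using that by blast
qed

text \<open>
  If generators reduce, modulo a subgroup \<open>K\<close>, to finite sums of terms \<open>g k a\<close> that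
  are additive in \<open>a\<close>, then so does every formal sum of generators.
\<close>

lemma formal_sum_normal_form:
  fixes C :: "('a, 'm) ring_scheme" and g :: "'k \<Rightarrow> 'a \<Rightarrow> ('u \<Rightarrow>\<^sub>0 int)"
  assumes C: "abelian_group C"
    and K0: "0 \<in> K" and Kd: "\<And>x y. x \<in> K \<Longrightarrow> y \<in> K \<Longrightarrow> x - y \<in> K"
    and g: "\<And>k a b. k \<in> B \<Longrightarrow> a \<in> carrier C \<Longrightarrow> b \<in> carrier C \<Longrightarrow> g k (a \<oplus>\<^bsub>C\<^esub> b) - g k a - g k b \<in> K"
    and gen: "\<And>u. u \<in> X \<Longrightarrow> \<exists>S c. finite S \<and> S \<subseteq> B \<and> (\<forall>k. c k \<in> carrier C) \<and>
      frag_of u - (\<Sum>k\<in>S. g k (c k)) \<in> K"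
    and x: "Poly_Mapping.keys x \<subseteq> X"
  obtains S c where "finite S" "S \<subseteq> B" "\<And>k. c k \<in> carrier C" "x - (\<Sum>k\<in>S. g k (c k)) \<in> K"
proof -
  interpret C: abelian_group C by (rule C)
  have Ka: "x + y \<in> K" if "x \<in> K" "y \<in> K" for x y
    using Kd[OF that(1) Kd[OF K0 that(2)]] by simp
  have Ks: "sum f S \<in> K" if "\<And>k. k \<in> S \<Longrightarrow> f k \<in> K" for f :: "'k \<Rightarrow> _" and S
    using that by (induction S rule: infinite_finite_induct) (auto simp: K0 intro: Ka)
  have g0: "g k \<zero>\<^bsub>C\<^esub> \<in> K" if "k \<in> B" for k
    using Kd[OF K0 g[OF that C.zero_closed C.zero_closed]] by simp
  \<comment> \<open>additivity gives compatibility with differences, since \<open>(a - b) + b = a\<close>\<close>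
  have gd: "g k (a \<ominus>\<^bsub>C\<^esub> b) - (g k a - g k b) \<in> K"
    if "k \<in> B" "a \<in> carrier C" "b \<in> carrier C" for k a b
  proof -
    have "g k ((a \<ominus>\<^bsub>C\<^esub> b) \<oplus>\<^bsub>C\<^esub> b) - g k (a \<ominus>\<^bsub>C\<^esub> b) - g k b \<in> K"
      using that by (intro g) auto
    moreover have "(a \<ominus>\<^bsub>C\<^esub> b) \<oplus>\<^bsub>C\<^esub> b = a"
      using that by (simp add: a_minus_def C.a_assoc C.l_neg)
    ultimately have "0 - (g k a - g k (a \<ominus>\<^bsub>C\<^esub> b) - g k b) \<in> K" by (intro Kd[OF K0]) simp
    then show ?thesis by (simp add: algebra_simps)
  qed
  have extend: "\<exists>c'. (\<forall>k. c' k \<in> carrier C) \<and> x - (\<Sum>k\<in>T. g k (c' k)) \<in> K"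
    if "finite T" "S \<subseteq> T" "T \<subseteq> B" "\<forall>k. c k \<in> carrier C" "x - (\<Sum>k\<in>S. g k (c k)) \<in> K" for S T c x
  proof -
    let ?c = "\<lambda>k. if k \<in> S then c k else \<zero>\<^bsub>C\<^esub>"
    have "(\<Sum>k\<in>T. g k (?c k)) = (\<Sum>k\<in>T - S. g k (?c k)) + (\<Sum>k\<in>S. g k (?c k))"
      by (rule sum.subset_diff[OF that(2,1)])
    also have "(\<Sum>k\<in>S. g k (?c k)) = (\<Sum>k\<in>S. g k (c k))" by (rule sum.cong) auto
    also have "(\<Sum>k\<in>T - S. g k (?c k)) = (\<Sum>k\<in>T - S. g k \<zero>\<^bsub>C\<^esub>)" by (rule sum.cong) auto
    finally have "x - (\<Sum>k\<in>T. g k (?c k)) = (x - (\<Sum>k\<in>S. g k (c k))) - (\<Sum>k\<in>T - S. g k \<zero>\<^bsub>C\<^esub>)"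
      by (simp add: algebra_simps)
    moreover have "(\<Sum>k\<in>T - S. g k \<zero>\<^bsub>C\<^esub>) \<in> K" using that by (intro Ks g0) auto
    ultimately have "x - (\<Sum>k\<in>T. g k (?c k)) \<in> K" using Kd[OF that(5)] by presburger
    then show ?thesis using that(4) by (intro exI[of _ ?c]) auto
  qed
  have "\<exists>S c. finite S \<and> S \<subseteq> B \<and> (\<forall>k. c k \<in> carrier C) \<and> x - (\<Sum>k\<in>S. g k (c k)) \<in> K"
    using x
  proof (induction x rule: frag_induction)
    case zero
    show ?case by (intro exI[of _ "{}"] exI[of _ "\<lambda>_. \<zero>\<^bsub>C\<^esub>"]) (simp add: K0)
  next
    case (one u)
    then show ?case by (rule gen)
  next
    case (diff x y)
    then obtain S c S' c' where
      S: "finite S" "S \<subseteq> B" "\<forall>k. c k \<in> carrier C" "x - (\<Sum>k\<in>S. g k (c k)) \<in> K" and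
      S': "finite S'" "S' \<subseteq> B" "\<forall>k. c' k \<in> carrier C" "y - (\<Sum>k\<in>S'. g k (c' k)) \<in> K"
      by blast
    let ?T = "S \<union> S'"
    have T: "finite ?T" "?T \<subseteq> B" using S S' by auto
    obtain d where d: "\<forall>k. d k \<in> carrier C" "x - (\<Sum>k\<in>?T. g k (d k)) \<in> K"
      using extend[OF T(1) _ T(2) S(3,4)] by blast
    obtain d' where d': "\<forall>k. d' k \<in> carrier C" "y - (\<Sum>k\<in>?T. g k (d' k)) \<in> K"
      using extend[OF T(1) _ T(2) S'(3,4)] by blast
    have "(\<Sum>k\<in>?T. g k (d k \<ominus>\<^bsub>C\<^esub> d' k) - (g k (d k) - g k (d' k))) \<in> K"
      using T d d' by (intro Ks gd) auto
    moreover have "(x - a) - (y - b) - (c - (a - b)) = x - y - c" for a b c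
      by (simp add: algebra_simps)
    ultimately have "x - y - (\<Sum>k\<in>?T. g k (d k \<ominus>\<^bsub>C\<^esub> d' k)) \<in> K"
      using Kd[OF Kd[OF d(2) d'(2)]] unfolding sum_subtractf by metis
    then show ?case using T d(1) d'(1) by (intro exI[of _ ?T] exI[of _ "\<lambda>k. d k \<ominus>\<^bsub>C\<^esub> d' k"]) auto
  qed
  then show ?thesis using that by blast
qed

context
  fixes M :: "('r::comm_ring_1, 'a, 'm) module_scheme" and N :: "('r, 'b, 'n) module_scheme"
  assumes M: "scalar_module M" and N: "scalar_module N"
begin

interpretation M: scalar_module M by (rule M)
interpretation N: scalar_module N by (rule N)

lemma tensor_relations_closed:
  assumes "x \<in> tensor_relations M N" shows "Poly_Mapping.keys x \<subseteq> carrier M \<times> carrier N"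
proof -
  have 2: "Poly_Mapping.keys (frag_of a - frag_of b) \<subseteq> S" if "{a, b} \<subseteq> S" for a b :: "'a \<times> 'b" and S
    using keys_diff[of "frag_of a" "frag_of b"] that by auto
  have 3: "Poly_Mapping.keys (frag_of a - frag_of b - frag_of c) \<subseteq> S"
    if "{a, b, c} \<subseteq> S" for a b c :: "'a \<times> 'b" and S
    using keys_diff[of "frag_of a - frag_of b" "frag_of c"] 2[of a b S] that by auto
  show ?thesis
    using assms unfolding tensor_relations_def
    by (elim UnE CollectE exE conjE; hypsubst; intro 2 3)
      (simp_all add: M.smult_closed N.smult_closed)
qed

lemma tensor_kernel_subgroup:
  "0 \<in> tensor_kernel M N"
  "x \<in> tensor_kernel M N \<Longrightarrow> y \<in> tensor_kernel M N \<Longrightarrow> x - y \<in> tensor_kernel M N"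
  "x \<in> tensor_kernel M N \<Longrightarrow> y \<in> tensor_kernel M N \<Longrightarrow> x + y \<in> tensor_kernel M N"
proof -
  let ?G = "free_Abelian_group (carrier M \<times> carrier N)"
  have sub: "subgroup (tensor_kernel M N) ?G"
    unfolding tensor_kernel_def
    by (rule group.generate_is_subgroup) (use tensor_relations_closed in auto)
  then show "0 \<in> tensor_kernel M N" using subgroup.one_closed[OF sub] by simp
  have uminus: "- y \<in> tensor_kernel M N" if "y \<in> tensor_kernel M N" for y
  proof -
    have "Poly_Mapping.keys y \<subseteq> carrier M \<times> carrier N"
      using subgroup.mem_carrier[OF sub that] by simp
    then show ?thesis using subgroup.m_inv_closed[OF sub that] by simp
  qed
  show "x + y \<in> tensor_kernel M N" if "x \<in> tensor_kernel M N" "y \<in> tensor_kernel M N" for x y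
    using subgroup.m_closed[OF sub that] by simp
  then show "x - y \<in> tensor_kernel M N" if "x \<in> tensor_kernel M N" "y \<in> tensor_kernel M N" for x y
    using that uminus[OF that(2)] by (metis add_uminus_conv_diff)
qed

lemma tensor_kernel_relation: "x \<in> tensor_relations M N \<Longrightarrow> x \<in> tensor_kernel M N"
  unfolding tensor_kernel_def by (rule generate.incl)

lemma tensor_kernel_add_left:
  assumes "x \<in> carrier M" "x' \<in> carrier M" "y \<in> carrier N"
  shows "frag_of (x \<oplus>\<^bsub>M\<^esub> x', y) - frag_of (x, y) - frag_of (x', y) \<in> tensor_kernel M N"
  by (rule tensor_kernel_relation, unfold tensor_relations_def, rule UnI1, rule UnI1, rule CollectI,
      rule exI[of _ x], rule exI[of _ x'], rule exI[of _ y]) (simp add: assms)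

lemma tensor_kernel_add_right:
  assumes "x \<in> carrier M" "y \<in> carrier N" "y' \<in> carrier N"
  shows "frag_of (x, y \<oplus>\<^bsub>N\<^esub> y') - frag_of (x, y) - frag_of (x, y') \<in> tensor_kernel M N"
  by (rule tensor_kernel_relation, unfold tensor_relations_def, rule UnI1, rule UnI2, rule CollectI,
      rule exI[of _ x], rule exI[of _ y], rule exI[of _ y']) (simp add: assms)

lemma tensor_kernel_balanced:
  assumes "x \<in> carrier M" "y \<in> carrier N"
  shows "frag_of (c \<odot>\<^bsub>M\<^esub> x, y) - frag_of (x, c \<odot>\<^bsub>N\<^esub> y) \<in> tensor_kernel M N"
  by (rule tensor_kernel_relation, unfold tensor_relations_def, rule UnI2, rule CollectI,
      rule exI[of _ c], rule exI[of _ x], rule exI[of _ y]) (simp add: assms)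

lemma tensor_kernel_zero_left:
  assumes "y \<in> carrier N" shows "frag_of (\<zero>\<^bsub>M\<^esub>, y) \<in> tensor_kernel M N"
  using tensor_kernel_subgroup(2)[OF tensor_kernel_subgroup(1)
      tensor_kernel_add_left[OF M.zero_closed M.zero_closed assms]] by simp

lemma tensor_kernel_zero_right:
  assumes "x \<in> carrier M" shows "frag_of (x, \<zero>\<^bsub>N\<^esub>) \<in> tensor_kernel M N"
  using tensor_kernel_subgroup(2)[OF tensor_kernel_subgroup(1)
      tensor_kernel_add_right[OF assms N.zero_closed N.zero_closed]] by simp

text \<open>
  Scalars move across the tensor sign, so coefficients of one factor are collected in the other one.
\<close>

lemma tensor_expand_right:
  assumes x: "x \<in> carrier M" and "finite S" "f ` S \<subseteq> carrier N"
  shows "frag_of (x, finsum N (\<lambda>k. c k \<odot>\<^bsub>N\<^esub> f k) S) - (\<Sum>k\<in>S. frag_of (c k \<odot>\<^bsub>M\<^esub> x, f k))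
    \<in> tensor_kernel M N"
  using assms(2,3)
proof (induction S)
  case empty then show ?case by (simp add: tensor_kernel_zero_right x)
next
  case (insert s S)
  let ?t = "finsum N (\<lambda>k. c k \<odot>\<^bsub>N\<^esub> f k) S"
  have f: "f s \<in> carrier N" "f ` S \<subseteq> carrier N" using insert.prems by auto
  have t: "?t \<in> carrier N" using f(2) by (intro N.finsum_closed) (auto intro: N.smult_closed)
  have eq: "finsum N (\<lambda>k. c k \<odot>\<^bsub>N\<^esub> f k) (insert s S) = c s \<odot>\<^bsub>N\<^esub> f s \<oplus>\<^bsub>N\<^esub> ?t"
    using insert.hyps f by (intro N.finsum_insert) (auto intro: N.smult_closed)
  have 1: "frag_of (x, c s \<odot>\<^bsub>N\<^esub> f s \<oplus>\<^bsub>N\<^esub> ?t) - frag_of (x, c s \<odot>\<^bsub>N\<^esub> f s) - frag_of (x, ?t) \<in> tensor_kernel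
      M N"
    by (rule tensor_kernel_add_right) (use x f t in \<open>auto intro: N.smult_closed\<close>)
  have 2: "frag_of (c s \<odot>\<^bsub>M\<^esub> x, f s) - frag_of (x, c s \<odot>\<^bsub>N\<^esub> f s) \<in> tensor_kernel M N"
    by (rule tensor_kernel_balanced[OF x f(1)])
  from tensor_kernel_subgroup(2)[OF tensor_kernel_subgroup(3)[OF 1 insert.IH[OF f(2)]] 2]
  show ?case unfolding eq using insert.hyps by (simp add: algebra_simps)
qed

lemma tensor_expand_left:
  assumes y: "y \<in> carrier N" and "finite S" "f ` S \<subseteq> carrier M"
  shows "frag_of (finsum M (\<lambda>k. c k \<odot>\<^bsub>M\<^esub> f k) S, y) - (\<Sum>k\<in>S. frag_of (f k, c k \<odot>\<^bsub>N\<^esub> y))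
    \<in> tensor_kernel M N"
  using assms(2,3)
proof (induction S)
  case empty then show ?case by (simp add: tensor_kernel_zero_left y)
next
  case (insert s S)
  let ?t = "finsum M (\<lambda>k. c k \<odot>\<^bsub>M\<^esub> f k) S"
  have f: "f s \<in> carrier M" "f ` S \<subseteq> carrier M" using insert.prems by auto
  have t: "?t \<in> carrier M" using f(2) by (intro M.finsum_closed) (auto intro: M.smult_closed)
  have eq: "finsum M (\<lambda>k. c k \<odot>\<^bsub>M\<^esub> f k) (insert s S) = c s \<odot>\<^bsub>M\<^esub> f s \<oplus>\<^bsub>M\<^esub> ?t"
    using insert.hyps f by (intro M.finsum_insert) (auto intro: M.smult_closed)
  have 1: "frag_of (c s \<odot>\<^bsub>M\<^esub> f s \<oplus>\<^bsub>M\<^esub> ?t, y) - frag_of (c s \<odot>\<^bsub>M\<^esub> f s, y) - frag_of (?t, y) \<in> tensor_kernel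
      M N"
    by (rule tensor_kernel_add_left) (use y f t in \<open>auto intro: M.smult_closed\<close>)
  have 2: "frag_of (c s \<odot>\<^bsub>M\<^esub> f s, y) - frag_of (f s, c s \<odot>\<^bsub>N\<^esub> y) \<in> tensor_kernel M N"
    by (rule tensor_kernel_balanced[OF f(1) y])
  from tensor_kernel_subgroup(3)[OF tensor_kernel_subgroup(3)[OF 1 insert.IH[OF f(2)]] 2]
  show ?case unfolding eq using insert.hyps by (simp add: algebra_simps)
qed

lemma frag_eval_tensor_relation:
  assumes add_left: "\<And>a a' b. a \<in> carrier M \<Longrightarrow> a' \<in> carrier M \<Longrightarrow> b \<in> carrier N \<Longrightarrow>
      n (a \<oplus>\<^bsub>M\<^esub> a', b) = n (a, b) + n (a', b)"
    and add_right: "\<And>a b b'. a \<in> carrier M \<Longrightarrow> b \<in> carrier N \<Longrightarrow> b' \<in> carrier N \<Longrightarrow>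
      n (a, b \<oplus>\<^bsub>N\<^esub> b') = n (a, b) + n (a, b')"
    and balanced: "\<And>c a b. a \<in> carrier M \<Longrightarrow> b \<in> carrier N \<Longrightarrow>
      n (c \<odot>\<^bsub>M\<^esub> a, b) = n (a, c \<odot>\<^bsub>N\<^esub> b)"
    and x: "x \<in> tensor_relations M N"
  shows "frag_eval n x = 0"
  using x unfolding tensor_relations_def
  by (elim UnE CollectE exE conjE; hypsubst) (simp_all add: add_left add_right balanced)

end

section \<open>The integral form\<close>

definition exponents :: "nat \<Rightarrow> (nat \<Rightarrow> nat \<Rightarrow> nat) set" where
  "exponents n = {k. \<forall>i j. (i, j) \<notin> root_indices n \<longrightarrow> k i j = 0}"

lemma kostant_monomial_cong:
  assumes "\<And>i j. (i, j) \<in> root_indices n \<Longrightarrow> k i j = k' i j"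
  shows "kostant_monomial n k = kostant_monomial n k'"
  unfolding kostant_monomial_def
  by (rule foldr_cong[OF refl refl]) (use assms set_root_list in auto)

lemma range_kostant_monomial: "range (kostant_monomial n) = kostant_monomial n ` exponents n"
proof -
  have "kostant_monomial n k \<in> kostant_monomial n ` exponents n" for k
  proof (rule image_eqI)
    let ?k = "\<lambda>i j. if (i, j) \<in> root_indices n then k i j else 0"
    show "kostant_monomial n k = kostant_monomial n ?k" by (rule kostant_monomial_cong) simp
    show "?k \<in> exponents n" by (simp add: exponents_def)
  qed
  then show ?thesis by blast
qed

text \<open>
  A pair of words at which, of all monomials, only the one with exponents \<open>k\<close> has a non-zero entry.
\<close>

definition coef_words :: "nat \<Rightarrow> (nat \<Rightarrow> nat \<Rightarrow> nat) \<Rightarrow> nat list \<times> nat list" where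
  "coef_words n k = (SOME (I, J). set I \<subseteq> {..<n} \<and> set J \<subseteq> {..<n} \<and> length I = length J \<and>
    (\<forall>k'\<in>exponents n. raises (root_list n) k' I J \<longleftrightarrow> k' = k))"

lemma exponents_eqI:
  assumes "k \<in> exponents n" "k' \<in> exponents n"
    "\<And>i j. (i, j) \<in> root_indices n \<Longrightarrow> k i j = k' i j"
  shows "k = k'"
proof (intro ext)
  fix i j show "k i j = k' i j"
    using assms by (cases "(i, j) \<in> root_indices n") (auto simp: exponents_def)
qed

lemma coef_words:
  assumes k: "k \<in> exponents n" and IJ: "coef_words n k = (I, J)"
  shows "I \<in> multi_indices n (length J)" "J \<in> multi_indices n (length J)"
    "k' \<in> exponents n \<Longrightarrow> raises (root_list n) k' I J \<longleftrightarrow> k' = k"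
proof -
  let ?Q = "\<lambda>(I, J). set I \<subseteq> {..<n} \<and> set J \<subseteq> {..<n} \<and> length I = length J \<and>
    (\<forall>k'\<in>exponents n. raises (root_list n) k' I J \<longleftrightarrow> k' = k)"
  obtain I' J' where w: "length I' = length J'" "set I' \<subseteq> {..<n}" "set J' \<subseteq> {..<n}"
    "\<And>i j. i < n \<Longrightarrow> j < n \<Longrightarrow> pair_count I' J' i j = k i j"
    "\<And>p. p < length J' \<Longrightarrow> k (I' ! p) (J' ! p) \<noteq> 0"
    by (rule words_with_pair_counts[where n = n and m = k]) blast
  have "raises (root_list n) k' I' J' \<longleftrightarrow> k' = k" if k': "k' \<in> exponents n" for k'
  proof
    assume r: "raises (root_list n) k' I' J'"
    show "k' = k"
    proof (rule exponents_eqI[OF k' k])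
      fix i j assume ij: "(i, j) \<in> root_indices n"
      then have "pair_count I' J' i j = k' i j" using r by (auto simp: raises_def set_root_list)
      then show "k' i j = k i j" using w(4) ij by (auto simp: root_indices_def)
    qed
  next
    assume "k' = k"
    moreover have "raises (root_list n) k I' J'"
      unfolding raises_def set_root_list
    proof (intro conjI allI impI ballI)
      fix p assume "p < length J'"
      then have "(I' ! p, J' ! p) \<in> root_indices n" using w(5) k unfolding exponents_def by blast
      then show "I' ! p = J' ! p \<or> (I' ! p, J' ! p) \<in> root_indices n" by blast
    qed (use w in \<open>auto simp: root_indices_def\<close>)
    ultimately show "raises (root_list n) k' I' J'" by simp
  qed
  then have "?Q (I', J')" using w by auto
  then have "?Q (coef_words n k)" unfolding coef_words_def by (rule someI)
  then show "I \<in> multi_indices n (length J)" "J \<in> multi_indices n (length J)"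
    "k' \<in> exponents n \<Longrightarrow> raises (root_list n) k' I J \<longleftrightarrow> k' = k"
    by (auto simp: IJ multi_indices_def)
qed

context
  fixes n :: nat
begin

interpretation U: scalar_algebra "kostant_C n" by (rule enveloping_algebra)

lemma entry_finsum:
  assumes "finite S" "f ` S \<subseteq> carrier (kostant_C n)"
  shows "entry n (finsum (kostant_C n) f S) I J = (\<Sum>s\<in>S. entry n (f s) I J)"
  using assms
proof (induction S)
  case empty
  have "entry n \<zero>\<^bsub>kostant_C n\<^esub> I J = 0"
    using entry_smult[of "\<zero>\<^bsub>kostant_C n\<^esub>" n 0 I J] by (simp add: U.smult_zero_right)
  then show ?case by simp
next
  case (insert s S)
  then have c: "f s \<in> carrier (kostant_C n)" "f \<in> S \<rightarrow> carrier (kostant_C n)" by auto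
  then show ?case using insert by (simp add: entry_add)
qed

text \<open>
  The coefficient of a monomial is the entry at its words.
\<close>

lemma enveloping_expansion:
  assumes u: "u \<in> carrier (kostant_C n)"
  obtains S where "finite S" "S \<subseteq> exponents n"
    "u = finsum (kostant_C n) (\<lambda>k. entry n u (fst (coef_words n k)) (snd (coef_words n k))
        \<odot>\<^bsub>kostant_C n\<^esub> kostant_monomial n k) S"
proof -
  have cl: "(kostant_monomial n) ` exponents n \<subseteq> carrier (kostant_C n)"
    using kostant_monomial_closed by blast
  have "u \<in> lin_span (kostant_C n) ((kostant_monomial n) ` exponents n)"
    using monomials_span_enveloping_algebra[OF u] by (simp add: range_kostant_monomial)
  then obtain S c where S: "finite S" "S \<subseteq> exponents n"
      "u = finsum (kostant_C n) (\<lambda>k. c k \<odot>\<^bsub>kostant_C n\<^esub> kostant_monomial n k) S"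
    by (rule U.lin_span_expansion[OF cl]) blast
  have "entry n u (fst (coef_words n k)) (snd (coef_words n k)) = c k" if k: "k \<in> S" for k
  proof -
    obtain I J where IJ: "coef_words n k = (I, J)" by fastforce
    have kE: "k \<in> exponents n" using S k by blast
    have "entry n u I J = (\<Sum>k'\<in>S. c k' * of_bool (raises (root_list n) k' I J))"
      using S(1) unfolding S(3)
      by (subst entry_finsum)
        (auto simp: entry_smult kostant_monomial_closed entry_monomial U.smult_closed)
    also have "\<dots> = (\<Sum>k'\<in>S. if k' = k then c k' else 0)"
      by (rule sum.cong) (use S(2) coef_words(3)[OF kE IJ] in auto)
    also have "\<dots> = c k" using S(1) k by simp
    finally show ?thesis by (simp add: IJ)
  qed
  then have "u = finsum (kostant_C n) (\<lambda>k. entry n u (fst (coef_words n k)) (snd (coef_words n k))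
      \<odot>\<^bsub>kostant_C n\<^esub> kostant_monomial n k) S"
    unfolding S(3)[symmetric]
    by (subst S(3), intro U.finsum_cong') (auto simp: U.smult_closed kostant_monomial_closed)
  then show ?thesis using that S by blast
qed

lemma kostant_Z_simps:
  "x \<otimes>\<^bsub>kostant_Z n\<^esub> y = x \<otimes>\<^bsub>kostant_C n\<^esub> y" "x \<oplus>\<^bsub>kostant_Z n\<^esub> y = x \<oplus>\<^bsub>kostant_C n\<^esub> y" "\<one>\<^bsub>kostant_Z n\<^esub>
      = \<one>\<^bsub>kostant_C n\<^esub>" "\<zero>\<^bsub>kostant_Z n\<^esub> = \<zero>\<^bsub>kostant_C n\<^esub>"
  "carrier (kostant_Z n) = generate (add_monoid (kostant_C n)) (range (kostant_monomial n))"
  by (simp_all add: kostant_Z_def)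

lemma kostant_Z_subgroup: "subgroup (carrier (kostant_Z n)) (add_monoid (kostant_C n))"
  unfolding kostant_Z_simps
  by (rule U.add.generate_is_subgroup) (use kostant_monomial_closed in auto)

lemma kostant_Z_closed: "u \<in> carrier (kostant_Z n) \<Longrightarrow> u \<in> carrier (kostant_C n)"
  using subgroup.mem_carrier[OF kostant_Z_subgroup] by simp

lemma kostant_Z_smult: "u \<in> carrier (kostant_Z n) \<Longrightarrow> z \<odot>\<^bsub>kostant_Z n\<^esub> u = of_int z \<odot>\<^bsub>kostant_C n\<^esub> u"
  using U.add_pow_conv_smult[OF kostant_Z_closed] by (simp add: kostant_Z_def)

lemma kostant_Z_smult_closed: "u \<in> carrier (kostant_Z n) \<Longrightarrow> z \<odot>\<^bsub>kostant_Z n\<^esub> u \<in> carrier (kostant_Z n)"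
  using U.add.subgroup_int_pow_closed[OF kostant_Z_subgroup, of u z]
  by (simp add: kostant_Z_def)

lemma kostant_Z_zero: "\<zero>\<^bsub>kostant_C n\<^esub> \<in> carrier (kostant_Z n)"
  using subgroup.one_closed[OF kostant_Z_subgroup] by simp

lemma kostant_Z_add: "u \<in> carrier (kostant_Z n) \<Longrightarrow> v \<in> carrier (kostant_Z n) \<Longrightarrow> u \<oplus>\<^bsub>kostant_C n\<^esub> v
    \<in> carrier (kostant_Z n)"
  using subgroup.m_closed[OF kostant_Z_subgroup] by simp

lemma kostant_Z_monomial: "kostant_monomial n k \<in> carrier (kostant_Z n)"
  unfolding kostant_Z_simps by (rule generate.incl) simp

text \<open>
  An element of the enveloping algebra lies in the integral form if and only if its matrix entries
  are integers, because its coefficients with respect to the monomials are among these entries.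
  In particular the integral form is closed under multiplication.
\<close>

lemma kostant_Z_entry_Ints:
  assumes "u \<in> carrier (kostant_Z n)" shows "entry n u I J \<in> \<int>"
  using assms unfolding kostant_Z_simps
proof (induction rule: generate.induct)
  case one
  have "entry n \<zero>\<^bsub>kostant_C n\<^esub> I J = 0" using entry_finsum[of "{}" "\<lambda>_. \<zero>\<^bsub>kostant_C n\<^esub>" I J] by simp
  then show ?case by simp
next
  case (incl h)
  then show ?case by (auto simp: entry_monomial)
next
  case (inv h)
  then obtain k where k: "h = kostant_monomial n k" by blast
  have "inv\<^bsub>add_monoid (kostant_C n)\<^esub> h = (- 1) \<odot>\<^bsub>kostant_C n\<^esub> h"
    using kostant_monomial_closed[of n k]
    by (simp add: k U.smult_minus_left U.smult_one flip: a_inv_def)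
  then show ?case using kostant_monomial_closed[of n k] by (simp add: k entry_smult entry_monomial)
next
  case (eng u v)
  then have "u \<in> carrier (kostant_C n)" "v \<in> carrier (kostant_C n)" using kostant_Z_closed
    unfolding kostant_Z_simps by blast+
  then show ?case using eng by (simp add: entry_add)
qed

lemma kostant_Z_I:
  assumes u: "u \<in> carrier (kostant_C n)"
    and int: "\<And>I J. I \<in> multi_indices n (length J) \<Longrightarrow> J \<in> multi_indices n (length J)
        \<Longrightarrow> entry n u I J \<in> \<int>"
  obtains S z where "finite S" "S \<subseteq> exponents n"
      "u = finsum (kostant_Z n) (\<lambda>k. z k \<odot>\<^bsub>kostant_Z n\<^esub> kostant_monomial n k) S"
      "u \<in> carrier (kostant_Z n)"
proof -
  let ?e = "\<lambda>k. entry n u (fst (coef_words n k)) (snd (coef_words n k))"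
  obtain S where S: "finite S" "S \<subseteq> exponents n"
      "u = finsum (kostant_C n) (\<lambda>k. ?e k \<odot>\<^bsub>kostant_C n\<^esub> kostant_monomial n k) S"
    using enveloping_expansion[OF u] by blast
  have "\<exists>z. ?e k = of_int z" if "k \<in> S" for k
  proof -
    obtain I J where IJ: "coef_words n k = (I, J)" by fastforce
    have "k \<in> exponents n" using that S(2) by blast
    from int[OF coef_words(1,2)[OF this IJ]] show ?thesis by (auto simp: IJ Ints_def)
  qed
  then obtain z where z: "\<And>k. k \<in> S \<Longrightarrow> ?e k = of_int (z k)" by metis
  have eq: "?e k \<odot>\<^bsub>kostant_C n\<^esub> kostant_monomial n k = z k \<odot>\<^bsub>kostant_Z n\<^esub> kostant_monomial n k"
      if "k \<in> S" for k
    using z[OF that] kostant_Z_smult[OF kostant_Z_monomial] by simp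
  have tm: "?e k \<odot>\<^bsub>kostant_C n\<^esub> kostant_monomial n k \<in> carrier (kostant_C n)" for k
    by (intro U.smult_closed kostant_monomial_closed)
  have "abelian_monoid (kostant_Z n)"
    by (rule abelian_monoidI)
      (auto simp: kostant_Z_simps(2,4) kostant_Z_add kostant_Z_zero kostant_Z_closed U.a_assoc
          intro!: U.a_comm)
  then interpret KZ: abelian_monoid "kostant_Z n" .
  have "finsum (kostant_C n) (\<lambda>k. ?e k \<odot>\<^bsub>kostant_C n\<^esub> kostant_monomial n k) T
      = finsum (kostant_Z n) (\<lambda>k. z k \<odot>\<^bsub>kostant_Z n\<^esub> kostant_monomial n k) T" if "finite T" "T \<subseteq> S"
      for T
    using that
  proof (induction T)
    case empty then show ?case by (simp add: kostant_Z_simps)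
  next
    case (insert k T)
    have "finsum (kostant_C n) (\<lambda>k. ?e k \<odot>\<^bsub>kostant_C n\<^esub> kostant_monomial n k) (insert k T)
        = ?e k \<odot>\<^bsub>kostant_C n\<^esub> kostant_monomial n k \<oplus>\<^bsub>kostant_C n\<^esub> finsum (kostant_C n)
            (\<lambda>k. ?e k \<odot>\<^bsub>kostant_C n\<^esub> kostant_monomial n k) T"
      using insert.hyps tm by (intro U.finsum_insert) auto
    moreover have "finsum (kostant_Z n) (\<lambda>k. z k \<odot>\<^bsub>kostant_Z n\<^esub> kostant_monomial n k) (insert k T)
        = z k \<odot>\<^bsub>kostant_Z n\<^esub> kostant_monomial n k \<oplus>\<^bsub>kostant_Z n\<^esub> finsum (kostant_Z n)
            (\<lambda>k. z k \<odot>\<^bsub>kostant_Z n\<^esub> kostant_monomial n k) T"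
      using insert.hyps kostant_Z_smult_closed[OF kostant_Z_monomial]
        by (intro KZ.finsum_insert) auto
    ultimately show ?case using insert eq[of k] by (simp add: kostant_Z_simps(2))
  qed
  from this[OF S(1)] have u: "u = finsum (kostant_Z n) (\<lambda>k. z k \<odot>\<^bsub>kostant_Z n\<^esub> kostant_monomial n k)
      S" using S(3) by simp
  moreover have "finsum (kostant_Z n) (\<lambda>k. z k \<odot>\<^bsub>kostant_Z n\<^esub> kostant_monomial n k) S
      \<in> carrier (kostant_Z n)"
    using kostant_Z_smult_closed[OF kostant_Z_monomial] by (intro KZ.finsum_closed) auto
  ultimately show ?thesis using that S(1,2) by metis
qed

lemma kostant_Z_mult:
  assumes "u \<in> carrier (kostant_Z n)" "v \<in> carrier (kostant_Z n)"
      shows "u \<otimes>\<^bsub>kostant_C n\<^esub> v \<in> carrier (kostant_Z n)"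
proof -
  have uv: "u \<in> carrier (kostant_C n)" "v \<in> carrier (kostant_C n)" using assms kostant_Z_closed
    by auto
  have "entry n (u \<otimes>\<^bsub>kostant_C n\<^esub> v) I J \<in> \<int>" if "J \<in> multi_indices n (length J)" for I J
    unfolding entry_mult[OF uv that] using assms by (intro Ints_sum Ints_mult kostant_Z_entry_Ints)
  then show ?thesis using kostant_Z_I[of "u \<otimes>\<^bsub>kostant_C n\<^esub> v"] uv by blast
qed

lemma kostant_Z_one: "\<one>\<^bsub>kostant_C n\<^esub> \<in> carrier (kostant_Z n)"
proof -
  have "entry n \<one>\<^bsub>kostant_C n\<^esub> I J \<in> \<int>" for I J by (simp add: entry_one)
  then show ?thesis using kostant_Z_I[of "\<one>\<^bsub>kostant_C n\<^esub>"] by blast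
qed

lemma kostant_Z_expansion:
  assumes "u \<in> carrier (kostant_Z n)"
  obtains S z where "finite S" "S \<subseteq> exponents n"
      "u = finsum (kostant_Z n) (\<lambda>k. z k \<odot>\<^bsub>kostant_Z n\<^esub> kostant_monomial n k) S"
  using kostant_Z_I[OF kostant_Z_closed[OF assms] kostant_Z_entry_Ints[OF assms]] by blast

lemma kostant_Z_scalar_module: "scalar_module (kostant_Z n)"
proof -
  have "abelian_group (kostant_Z n)"
  proof (rule abelian_groupI)
    fix u assume u: "u \<in> carrier (kostant_Z n)"
    have "(- 1) \<odot>\<^bsub>kostant_Z n\<^esub> u \<oplus>\<^bsub>kostant_Z n\<^esub> u = \<zero>\<^bsub>kostant_Z n\<^esub>"
      using u kostant_Z_closed[OF u]
      by (simp add: kostant_Z_smult kostant_Z_simps(2,4) U.smult_minus_left U.smult_one U.l_neg)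
    then show "\<exists>v\<in>carrier (kostant_Z n). v \<oplus>\<^bsub>kostant_Z n\<^esub> u = \<zero>\<^bsub>kostant_Z n\<^esub>"
      using kostant_Z_smult_closed[OF u] by blast
  qed (auto simp: kostant_Z_simps(2,4) kostant_Z_add kostant_Z_zero kostant_Z_closed U.a_assoc
      intro!: U.a_comm)
  then interpret abelian_group "kostant_Z n" .
  show ?thesis
  proof unfold_locales
    fix u v c d assume u: "u \<in> carrier (kostant_Z n)"
    note uU = kostant_Z_closed[OF u]
    show cl: "c \<odot>\<^bsub>kostant_Z n\<^esub> u \<in> carrier (kostant_Z n)" for c by (rule kostant_Z_smult_closed[OF u])
    show "(c + d) \<odot>\<^bsub>kostant_Z n\<^esub> u = c \<odot>\<^bsub>kostant_Z n\<^esub> u \<oplus>\<^bsub>kostant_Z n\<^esub> d \<odot>\<^bsub>kostant_Z n\<^esub> u"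
      using uU by (simp add: kostant_Z_smult[OF u] kostant_Z_simps(2) U.smult_l_distr)
    show "(c * d) \<odot>\<^bsub>kostant_Z n\<^esub> u = c \<odot>\<^bsub>kostant_Z n\<^esub> (d \<odot>\<^bsub>kostant_Z n\<^esub> u)"
    proof -
      have "c \<odot>\<^bsub>kostant_Z n\<^esub> (d \<odot>\<^bsub>kostant_Z n\<^esub> u) = of_int c \<odot>\<^bsub>kostant_C n\<^esub> (d \<odot>\<^bsub>kostant_Z n\<^esub> u)"
        by (rule kostant_Z_smult[OF kostant_Z_smult_closed[OF u]])
      then show ?thesis using uU by (simp add: kostant_Z_smult[OF u] U.smult_assoc)
    qed
    show "1 \<odot>\<^bsub>kostant_Z n\<^esub> u = u" using uU by (simp add: kostant_Z_smult[OF u] U.smult_one)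
    assume v: "v \<in> carrier (kostant_Z n)"
    show "c \<odot>\<^bsub>kostant_Z n\<^esub> (u \<oplus>\<^bsub>kostant_Z n\<^esub> v) = c \<odot>\<^bsub>kostant_Z n\<^esub> u \<oplus>\<^bsub>kostant_Z n\<^esub> c \<odot>\<^bsub>kostant_Z n\<^esub> v"
      using uU kostant_Z_closed[OF v] kostant_Z_smult[OF kostant_Z_add[OF u v], of c]
      by (simp add: kostant_Z_smult[OF u] kostant_Z_smult[OF v] kostant_Z_simps(2) U.smult_r_distr)
  qed
qed

text \<open>
  On the integral form the entry is an integer, and the floor merely changes its type.
\<close>

definition int_entry :: "kostant \<Rightarrow> nat list \<Rightarrow> nat list \<Rightarrow> int" where
  "int_entry u I J = \<lfloor>Re (entry n u I J)\<rfloor>"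

lemma of_int_int_entry: "u \<in> carrier (kostant_Z n) \<Longrightarrow> of_int (int_entry u I J) = entry n u I J"
  unfolding int_entry_def using kostant_Z_entry_Ints[of u I J] by (auto simp: Ints_def)

lemma int_entry_eqI: "u \<in> carrier (kostant_Z n) \<Longrightarrow> entry n u I J = of_int z \<Longrightarrow> int_entry u I J = z"
  by (simp add: int_entry_def)

lemma int_entry_add:
  assumes "u \<in> carrier (kostant_Z n)" "v \<in> carrier (kostant_Z n)"
  shows "int_entry (u \<oplus>\<^bsub>kostant_Z n\<^esub> v) I J = int_entry u I J + int_entry v I J"
  unfolding kostant_Z_simps
  by (rule int_entry_eqI)
      (use assms in \<open>simp_all add: kostant_Z_add entry_add kostant_Z_closed of_int_int_entry\<close>)

lemma int_entry_smult:
  assumes "u \<in> carrier (kostant_Z n)" shows "int_entry (z \<odot>\<^bsub>kostant_Z n\<^esub> u) I J = z * int_entry u I J"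
  by (rule int_entry_eqI)
    (use assms kostant_Z_smult_closed[OF assms, of z] in \<open>simp_all add: kostant_Z_smult entry_smult
        kostant_Z_closed of_int_int_entry\<close>)

lemma int_entry_mult:
  assumes "u \<in> carrier (kostant_Z n)" "v \<in> carrier (kostant_Z n)" "J \<in> multi_indices n r"
  shows "int_entry (u \<otimes>\<^bsub>kostant_Z n\<^esub> v) I J = (\<Sum>K\<in>multi_indices n r. int_entry u I K * int_entry v K
      J)"
  unfolding kostant_Z_simps
  by (rule int_entry_eqI)
    (use assms in \<open>simp_all add: kostant_Z_mult kostant_Z_closed of_int_int_entry entry_mult[where r
        = r]\<close>)

lemma int_entry_one: "int_entry \<one>\<^bsub>kostant_Z n\<^esub> I J = of_bool (I = J)"
  unfolding kostant_Z_simps by (rule int_entry_eqI) (simp_all add: kostant_Z_one entry_one)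

lemma int_entry_monomial: "int_entry (kostant_monomial n k) I J
    = of_bool (raises (root_list n) k I J)"
  by (rule int_entry_eqI) (simp_all add: kostant_Z_monomial entry_monomial)

end

section \<open>The Kostant form over a field\<close>

definition same_shape :: "nat \<Rightarrow> nat list \<Rightarrow> nat list \<Rightarrow> bool" where
  "same_shape n I J \<longleftrightarrow> I \<in> multi_indices n (length J) \<and> J \<in> multi_indices n (length J)"

text \<open>
  The matrix of \<open>c \<otimes> u\<close>, made 0 outside of the square blocks of words of equal length.
\<close>

definition pair_entry :: "nat \<Rightarrow> 'k::field \<times> kostant \<Rightarrow> nat list \<times> nat list \<Rightarrow> 'k" where
  "pair_entry n u i = (if same_shape n (fst i) (snd i)
    then fst u * of_int (int_entry n (snd u) (fst i) (snd i)) else 0)"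

lemma multi_indices_length: "K \<in> multi_indices n r \<Longrightarrow> length K = r"
  by (simp add: multi_indices_def)

lemma same_shape_self: "K \<in> multi_indices n r \<Longrightarrow> same_shape n K K"
  by (simp add: same_shape_def multi_indices_def)

lemma same_shape_split:
  assumes "K \<in> multi_indices n (length J)"
  shows "same_shape n I J \<longleftrightarrow> same_shape n I K \<and> same_shape n K J"
proof -
  have "length K = length J" using assms by (rule multi_indices_length)
  then show ?thesis using assms by (auto simp: same_shape_def)
qed

lemma ground_ring_simps:
  "carrier ground_ring = UNIV" "x \<oplus>\<^bsub>ground_ring\<^esub> y = x + y" "\<one>\<^bsub>ground_ring\<^esub> = 1"
  "\<zero>\<^bsub>ground_ring\<^esub> = 0" "z \<odot>\<^bsub>ground_ring\<^esub> x = of_int z * x"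
  by (simp_all add: ground_ring_def)

lemma ground_ring_scalar_module: "scalar_module (ground_ring :: (int, 'k::field) module)"
proof -
  have "abelian_group (ground_ring :: (int, 'k) module)"
  proof (rule abelian_groupI)
    show "\<exists>y\<in>carrier ground_ring. y \<oplus>\<^bsub>ground_ring\<^esub> x = \<zero>\<^bsub>ground_ring\<^esub>" for x :: 'k
      by (intro bexI[of _ "- x"]) (simp_all add: ground_ring_simps)
  qed (simp_all add: ground_ring_simps add.assoc add.commute)
  then interpret abelian_group "ground_ring :: (int, 'k) module" .
  show ?thesis
    by unfold_locales (simp_all add: ground_ring_simps algebra_simps)
qed

text \<open>
  The essential point is that matrices detect the kernel. Modulo the relations, a formal sum is
  \<open>\<Sum> c\<^bsub>k\<^esub> \<otimes> e\<^sup>(\<^sup>k\<^sup>)\<close> with finitely many \<open>c\<^bsub>k\<^esub>\<close>, and its entry at the words of \<open>k\<close> is \<open>c\<^bsub>k\<^esub>\<close>. So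
  if all entries vanish, then the sum is zero.
\<close>

lemma base_change_representation:
  "tensor_representation (ground_ring :: (int, 'k::field) module) (kostant_Z n) (*)
    (\<lambda>(c, x) (d, y). frag_of (c * d, x \<otimes>\<^bsub>kostant_Z n\<^esub> y)) (pair_entry n)
    (\<lambda>i. multi_indices n (length (snd i))) (\<lambda>i K. (fst i, K)) (\<lambda>i K. (K, snd i))"
proof
  let ?G = "ground_ring :: (int, 'k) module" and ?Z = "kostant_Z n"
  note sm = ground_ring_scalar_module[where 'k = 'k] kostant_Z_scalar_module[of n]
  fix x and i :: "nat list \<times> nat list"
  assume x: "x \<in> tensor_relations ?G ?Z"
  show "Poly_Mapping.keys x \<subseteq> carrier ?G \<times> carrier ?Z" by (rule tensor_relations_closed[OF sm x])
  show "frag_eval (\<lambda>u. pair_entry n u i) x = 0"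
    by (rule frag_eval_tensor_relation[OF sm _ _ _ x])
      (simp_all add: pair_entry_def ground_ring_simps int_entry_add int_entry_smult algebra_simps)
next
  let ?G = "ground_ring :: (int, 'k) module" and ?Z = "kostant_Z n"
  note sm = ground_ring_scalar_module[where 'k = 'k] kostant_Z_scalar_module[of n]
  note K = tensor_kernel_subgroup[OF sm]
  fix x assume x: "Poly_Mapping.keys x \<subseteq> carrier ?G \<times> carrier ?Z"
    and ev: "\<And>i. frag_eval (\<lambda>u. pair_entry n u i) x = 0"
  interpret G: scalar_module ?G by (rule sm)
  obtain S c where S: "finite S" "S \<subseteq> exponents n"
    "x - (\<Sum>k\<in>S. frag_of (c k, kostant_monomial n k)) \<in> tensor_kernel ?G ?Z"
  proof (rule formal_sum_normal_form[of ?G "tensor_kernel ?G ?Z" "exponents n"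
        "\<lambda>k c. frag_of (c, kostant_monomial n k)", OF _ K(1,2) _ _ x])
    fix u assume "u \<in> carrier ?G \<times> carrier ?Z"
    then obtain d v where u: "u = (d, v)" "d \<in> carrier ?G" "v \<in> carrier ?Z" by blast
    obtain S z where S: "finite S" "S \<subseteq> exponents n"
      "v = finsum ?Z (\<lambda>k. z k \<odot>\<^bsub>?Z\<^esub> kostant_monomial n k) S"
      by (rule kostant_Z_expansion[OF u(3)])
    have "frag_of u - (\<Sum>k\<in>S. frag_of (z k \<odot>\<^bsub>?G\<^esub> d, kostant_monomial n k)) \<in> tensor_kernel ?G ?Z"
      unfolding u(1) S(3) by (rule tensor_expand_right[OF sm u(2) S(1)])
          (use kostant_Z_monomial in blast)
    then show "\<exists>S c. finite S \<and> S \<subseteq> exponents n \<and> (\<forall>k. c k \<in> carrier ?G) \<and>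
        frag_of u - (\<Sum>k\<in>S. frag_of (c k, kostant_monomial n k)) \<in> tensor_kernel ?G ?Z"
      using S(1,2) by (intro exI[of _ S] exI[of _ "\<lambda>k. z k \<odot>\<^bsub>?G\<^esub> d"]) (simp add: ground_ring_simps)
  next
    show "abelian_group ?G" by unfold_locales
  qed (auto intro: tensor_kernel_add_left[OF sm] kostant_Z_monomial)
  have "frag_eval (\<lambda>u. pair_entry n u i) (x - (\<Sum>k\<in>S. frag_of (c k, kostant_monomial n k))) = 0"
      for i
    using S(3) unfolding tensor_kernel_def
  proof (induction rule: generate.induct)
    case (incl h)
    then show ?case
      by (intro frag_eval_tensor_relation[OF sm])
        (simp_all add: pair_entry_def ground_ring_simps int_entry_add int_entry_smult algebra_simps)
  next
    case (inv h)
    then have "frag_eval (\<lambda>u. pair_entry n u i) h = 0"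
      by (intro frag_eval_tensor_relation[OF sm])
        (simp_all add: pair_entry_def ground_ring_simps int_entry_add int_entry_smult algebra_simps)
    then show ?case using tensor_relations_closed[OF sm inv] by simp
  qed simp_all
  then have sum0: "(\<Sum>k\<in>S. pair_entry n (c k, kostant_monomial n k) i) = 0" for i
    using ev[of i] by simp
  have c0: "c k = 0" if k: "k \<in> S" for k
  proof -
    obtain I J where IJ: "coef_words n k = (I, J)" by fastforce
    have kE: "k \<in> exponents n" using k S by blast
    note w = coef_words[OF kE IJ]
    have "(\<Sum>k'\<in>S. pair_entry n (c k', kostant_monomial n k') (I, J)) = (\<Sum>k'\<in>S. if k'
        = k then c k' else 0)"
      by (rule sum.cong[OF refl])
        (use S(2) w in \<open>auto simp: pair_entry_def same_shape_def int_entry_monomial\<close>)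
    then show ?thesis using sum0[of "(I, J)"] S(1) k by simp
  qed
  have "(\<Sum>k\<in>T. frag_of (c k, kostant_monomial n k)) \<in> tensor_kernel ?G ?Z" if "finite T" "T \<subseteq> S"
      for T
    using that
  proof (induction T)
    case (insert k T)
    have "frag_of (c k, kostant_monomial n k) \<in> tensor_kernel ?G ?Z"
      using tensor_kernel_zero_left[OF sm kostant_Z_monomial[of n k]] c0 insert.prems
      by (simp add: ground_ring_simps)
    then show ?case using insert by (simp add: K(3))
  qed (simp add: K(1))
  from K(3)[OF S(3) this[OF S(1) order_refl]] show "x \<in> tensor_kernel ?G ?Z" by simp
next
  fix u v :: "'k \<times> kostant" and i :: "nat list \<times> nat list"
  assume u: "u \<in> carrier ground_ring \<times> carrier (kostant_Z n)"
    and v: "v \<in> carrier ground_ring \<times> carrier (kostant_Z n)"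
  obtain c x d y where uv: "u = (c, x)" "v = (d, y)" by fastforce
  have xy: "x \<in> carrier (kostant_Z n)" "y \<in> carrier (kostant_Z n)" using u v uv by auto
  show "Poly_Mapping.keys ((\<lambda>(c, x) (d, y). frag_of (c * d, x \<otimes>\<^bsub>kostant_Z n\<^esub> y)) u v)
      \<subseteq> carrier ground_ring \<times> carrier (kostant_Z n)"
    using kostant_Z_mult[OF xy] by (simp add: uv ground_ring_simps kostant_Z_simps)
  obtain I J where i: "i = (I, J)" by fastforce
  show "frag_eval (\<lambda>u. pair_entry n u i) ((\<lambda>(c, x) (d, y). frag_of (c * d, x \<otimes>\<^bsub>kostant_Z n\<^esub> y)) u v)
      = (\<Sum>K\<in>multi_indices n (length (snd i)). pair_entry n u (fst i, K) * pair_entry n v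
          (K, snd i))"
  proof (cases "same_shape n I J")
    case True
    then have sh: "same_shape n I K" "same_shape n K J" if "K \<in> multi_indices n (length J)" for K
      using same_shape_split[OF that, of I] True by simp_all
    have "(\<Sum>K\<in>multi_indices n (length J). pair_entry n u (I, K) * pair_entry n v (K, J))
        = (\<Sum>K\<in>multi_indices n (length J). c * d * (of_int (int_entry n x I K) * of_int
            (int_entry n y K J)))"
      by (rule sum.cong) (simp_all add: uv pair_entry_def sh mult_ac)
    also have "\<dots> = c * d * of_int (int_entry n (x \<otimes>\<^bsub>kostant_Z n\<^esub> y) I J)"
    proof -
      have J: "J \<in> multi_indices n (length J)" using True by (simp only: same_shape_def)
      show ?thesis unfolding int_entry_mult[OF xy J] of_int_sum of_int_mult sum_distrib_left ..
    qed
    also have "\<dots> = pair_entry n (c * d, x \<otimes>\<^bsub>kostant_Z n\<^esub> y) (I, J)"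
      using True by (simp only: pair_entry_def fst_conv snd_conv if_True)
    finally have "(\<Sum>K\<in>multi_indices n (length J). pair_entry n u (I, K) * pair_entry n v (K, J))
        = pair_entry n (c * d, x \<otimes>\<^bsub>kostant_Z n\<^esub> y) (I, J)" .
    then show ?thesis by (simp only: uv i case_prod_conv frag_eval_of fst_conv snd_conv)
  next
    case False
    then have "pair_entry n u (I, K) * pair_entry n v (K, J) = 0"
        if "K \<in> multi_indices n (length J)" for K
      using same_shape_split[OF that, of I] by (auto simp: pair_entry_def)
    then have "(\<Sum>K\<in>multi_indices n (length J). pair_entry n u (I, K) * pair_entry n v (K, J)) = 0"
      by (rule sum.neutral[OF ballI])
    moreover have "pair_entry n (c * d, x \<otimes>\<^bsub>kostant_Z n\<^esub> y) (I, J) = 0"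
      using False by (simp only: pair_entry_def fst_conv snd_conv if_False)
    ultimately show ?thesis by (simp only: uv i case_prod_conv frag_eval_of fst_conv snd_conv)
  qed
next
  show "\<one>\<^bsub>kostant_Z n\<^esub> \<in> carrier (kostant_Z n)" by (simp add: kostant_Z_simps(3) kostant_Z_one)
next
  fix f g h :: "nat list \<times> nat list \<Rightarrow> 'k" and i :: "nat list \<times> nat list"
  obtain I J where i: "i = (I, J)" by fastforce
  let ?W = "multi_indices n (length J)"
  have "(\<Sum>l\<in>?W. (\<Sum>m\<in>multi_indices n (length l). f (I, m) * g (m, l)) * h (l, J))
      = (\<Sum>l\<in>?W. \<Sum>m\<in>?W. f (I, m) * g (m, l) * h (l, J))"
    by (rule sum.cong[OF refl]) (simp add: multi_indices_length sum_distrib_right)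
  also have "\<dots> = (\<Sum>m\<in>?W. \<Sum>l\<in>?W. f (I, m) * g (m, l) * h (l, J))" by (rule sum.swap)
  also have "\<dots> = (\<Sum>m\<in>?W. f (I, m) * (\<Sum>l\<in>?W. g (m, l) * h (l, J)))"
    by (simp add: sum_distrib_left mult.assoc)
  finally show "(\<Sum>l\<in>multi_indices n (length (snd i)).
        (\<Sum>m\<in>multi_indices n (length (snd (fst i, l))). f (fst (fst i, l), m) * g
            (m, snd (fst i, l))) *
        h (l, snd i)) =
      (\<Sum>l\<in>multi_indices n (length (snd i)). f (fst i, l) *
        (\<Sum>m\<in>multi_indices n (length (snd (l, snd i))). g (fst (l, snd i), m) * h
            (m, snd (l, snd i))))"
    by (simp add: i)
next
  fix u :: "'k \<times> kostant" and i :: "nat list \<times> nat list"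
  assume "u \<in> carrier ground_ring \<times> carrier (kostant_Z n)"
  obtain I J where i: "i = (I, J)" by fastforce
  let ?W = "multi_indices n (length J)"
  have "(\<Sum>l\<in>?W. pair_entry n (1, \<one>\<^bsub>kostant_Z n\<^esub>) (I, l) * pair_entry n u (l, J))
      = (\<Sum>l\<in>?W. if l = I then pair_entry n u (l, J) else 0)"
    by (rule sum.cong[OF refl]) (auto simp: pair_entry_def int_entry_one same_shape_self)
  also have "\<dots> = pair_entry n u (I, J)"
    by (auto simp: finite_multi_indices pair_entry_def same_shape_def)
  finally show "(\<Sum>l\<in>multi_indices n (length (snd i)).
      pair_entry n (\<one>\<^bsub>ground_ring\<^esub>, \<one>\<^bsub>kostant_Z n\<^esub>) (fst i, l) * pair_entry n u (l, snd i)) = pair_entry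
          n u i"
    by (simp add: i ground_ring_simps)
  have "(\<Sum>l\<in>?W. pair_entry n u (I, l) * pair_entry n (1, \<one>\<^bsub>kostant_Z n\<^esub>) (l, J))
      = (\<Sum>l\<in>?W. if l = J then pair_entry n u (I, l) else 0)"
    by (rule sum.cong[OF refl]) (auto simp: pair_entry_def int_entry_one same_shape_self)
  also have "\<dots> = pair_entry n u (I, J)"
    by (auto simp: finite_multi_indices pair_entry_def same_shape_def)
  finally show "(\<Sum>l\<in>multi_indices n (length (snd i)).
      pair_entry n u (fst i, l) * pair_entry n (\<one>\<^bsub>ground_ring\<^esub>, \<one>\<^bsub>kostant_Z n\<^esub>) (l, snd i)) = pair_entry
          n u i"
    by (simp add: i ground_ring_simps)
qed (simp_all add: ground_ring_simps pair_entry_def)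

type_synonym 'k kostant_ext = "('k \<times> kostant \<Rightarrow>\<^sub>0 int) set"

definition K_entry :: "nat \<Rightarrow> 'k::field kostant_ext \<Rightarrow> nat list \<Rightarrow> nat list \<Rightarrow> 'k" where
  "K_entry n a I J = tensor_representation.rep (pair_entry n) a (I, J)"

definition K_monomial :: "nat \<Rightarrow> (nat \<Rightarrow> nat \<Rightarrow> nat) \<Rightarrow> 'k::field kostant_ext" where
  "K_monomial n k = pure_tensor ground_ring (kostant_Z n) 1 (kostant_monomial n k)"

context
  fixes n :: nat
begin

interpretation T: tensor_representation "ground_ring :: (int, 'k::field) module" "kostant_Z n" "(*)"
  "\<lambda>(c, x) (d, y). frag_of (c * d, x \<otimes>\<^bsub>kostant_Z n\<^esub> y)" "pair_entry n"
  "\<lambda>i. multi_indices n (length (snd i))" "\<lambda>i K. (fst i, K)" "\<lambda>i K. (K, snd i)"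
  by (rule base_change_representation)

lemma kostant_K_eq: "(kostant_K n) = tensor_algebra ground_ring (kostant_Z n) (*)
    (\<lambda>(c, x) (d, y). frag_of (c * d, x \<otimes>\<^bsub>kostant_Z n\<^esub> y))"
  by (simp add: kostant_K_def base_change_def)

lemma kostant_K_algebra: "scalar_algebra (kostant_K n :: ('k::field, 'k kostant_ext) module)"
  unfolding kostant_K_eq by (rule T.scalar_algebra)

lemma K_entry_eqI:
  assumes "a \<in> carrier (kostant_K n)" "b \<in> carrier (kostant_K n)" "\<And>I J. K_entry n a I J
      = K_entry n b I J"
  shows "a = b"
  using assms unfolding K_entry_def kostant_K_eq by (intro T.rep_inj) auto

lemma K_entry_add:
  "a \<in> carrier (kostant_K n) \<Longrightarrow> b \<in> carrier (kostant_K n) \<Longrightarrow> K_entry n (a \<oplus>\<^bsub>kostant_K n\<^esub> b) I J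
      = K_entry n a I J + K_entry n b I J"
  unfolding K_entry_def kostant_K_eq by (rule T.rep_add)

lemma K_entry_smult:
  "a \<in> carrier (kostant_K n) \<Longrightarrow> K_entry n (c \<odot>\<^bsub>kostant_K n\<^esub> a) I J = c * K_entry n a I J"
  unfolding K_entry_def kostant_K_eq by (rule T.rep_smult)

lemma K_entry_mult:
  "a \<in> carrier (kostant_K n) \<Longrightarrow> b \<in> carrier (kostant_K n) \<Longrightarrow> K_entry n (a \<otimes>\<^bsub>kostant_K n\<^esub> b) I J
    = (\<Sum>K\<in>multi_indices n (length J). K_entry n a I K * K_entry n b K J)"
  unfolding K_entry_def kostant_K_eq by (simp add: T.rep_mult T.convolution_def)

lemma K_entry_zero: "K_entry n \<zero>\<^bsub>kostant_K n\<^esub> I J = 0"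
  unfolding K_entry_def kostant_K_eq by (rule T.rep_zero)

lemma K_entry_one:
  "K_entry n \<one>\<^bsub>kostant_K n\<^esub> I J = of_bool (same_shape n I J \<and> I = J)"
  unfolding K_entry_def kostant_K_eq
  by (simp add: T.rep_one ground_ring_simps pair_entry_def int_entry_one)

lemma K_monomial_closed: "K_monomial n k \<in> carrier (kostant_K n)"
  unfolding K_monomial_def kostant_K_eq
    by (rule T.rep_pure) (simp_all add: ground_ring_simps kostant_Z_monomial)

lemma K_entry_monomial:
  "K_entry n (K_monomial n k) I J = of_bool (same_shape n I J \<and> raises (root_list n) k I J)"
  unfolding K_monomial_def K_entry_def
  by (subst T.rep_pure) (simp_all add: ground_ring_simps kostant_Z_monomial pair_entry_def
      int_entry_monomial)

lemma K_entry_shape: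
  assumes "a \<in> carrier (kostant_K n)" "\<not> same_shape n I J" shows "K_entry n a I J = 0"
proof -
  obtain x where "Poly_Mapping.keys x \<subseteq> carrier ground_ring \<times> carrier (kostant_Z n)"
    "a = tensor_class ground_ring (kostant_Z n) x"
    using assms(1) unfolding kostant_K_eq by (rule T.TA_carrierE)
  then show ?thesis using assms(2)
    by (simp add: K_entry_def T.rep_class pair_entry_def frag_eval_def)
qed

lemma K_entry_finsum:
  fixes f :: "'s \<Rightarrow> 'k::field kostant_ext"
  assumes "finite S" "f ` S \<subseteq> carrier (kostant_K n)"
  shows "K_entry n (finsum (kostant_K n) f S) I J = (\<Sum>s\<in>S. K_entry n (f s) I J)"
proof -
  interpret KK: scalar_algebra "kostant_K n :: ('k, 'k kostant_ext) module"
    by (rule kostant_K_algebra)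
  show ?thesis using assms
  proof (induction S)
    case (insert s S)
    then have "f s \<in> carrier (kostant_K n)" "f \<in> S \<rightarrow> carrier (kostant_K n)" by auto
    then show ?case using insert by (simp add: K_entry_add)
  qed (simp add: K_entry_zero)
qed

lemma kostant_K_expansion:
  fixes a :: "'k::field kostant_ext"
  assumes a: "a \<in> carrier (kostant_K n)"
  obtains S c where "finite S" "S \<subseteq> exponents n"
      "a = finsum (kostant_K n) (\<lambda>k. c k \<odot>\<^bsub>kostant_K n\<^esub> K_monomial n k) S"
proof -
  interpret KK: scalar_algebra "kostant_K n :: ('k, 'k kostant_ext) module"
    by (rule kostant_K_algebra)
  let ?G = "ground_ring :: (int, 'k) module" and ?Z = "kostant_Z n"
  let ?X = "K_monomial n ` exponents n :: 'k kostant_ext set"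
  have X: "?X \<subseteq> carrier (kostant_K n)" using K_monomial_closed by blast
  have pure: "pure_tensor ?G ?Z d v \<in> lin_span (kostant_K n) ?X" if v: "v \<in> carrier ?Z" for d v
  proof -
    obtain S z where S: "finite S" "S \<subseteq> exponents n"
      "v = finsum ?Z (\<lambda>k. z k \<odot>\<^bsub>?Z\<^esub> kostant_monomial n k) S"
      by (rule kostant_Z_expansion[OF v])
    let ?s = "finsum (kostant_K n) (\<lambda>k. (of_int (z k) * d) \<odot>\<^bsub>kostant_K n\<^esub> K_monomial n k) S"
    have s: "?s \<in> lin_span (kostant_K n) ?X"
      using S by (intro KK.lin_span_finsum X) (auto intro!: KK.lin_span_smult_base)
    have p: "pure_tensor ?G ?Z d v \<in> carrier (kostant_K n)"
      unfolding kostant_K_eq using v by (intro T.rep_pure) (simp_all add: ground_ring_simps)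
    have "pure_tensor ?G ?Z d v = ?s"
    proof (rule K_entry_eqI[OF p KK.lin_span_closed[OF X s]])
      fix I J
      have "frag_of (d, v) - (\<Sum>k\<in>S. frag_of (z k \<odot>\<^bsub>?G\<^esub> d, kostant_monomial n k)) \<in> tensor_kernel ?G
          ?Z"
        unfolding S(3)
        by (rule tensor_expand_right[OF ground_ring_scalar_module kostant_Z_scalar_module _ S(1)])
          (use kostant_Z_monomial in \<open>auto simp: ground_ring_simps\<close>)
      then have "pair_entry n (d, v) (I, J)
          = (\<Sum>k\<in>S. pair_entry n (of_int (z k) * d, kostant_monomial n k) (I, J))"
        by (simp add: T.kernel_iff ground_ring_simps)
      moreover have "K_entry n ?s I J = (\<Sum>k\<in>S. of_int (z k) * d * K_entry n (K_monomial n k) I J)"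
        using S(1)
          by (subst K_entry_finsum) (auto simp: K_entry_smult K_monomial_closed KK.smult_closed)
      moreover have "K_entry n (pure_tensor ?G ?Z d v) I J = pair_entry n (d, v) (I, J)"
        unfolding K_entry_def using v by (subst T.rep_pure) (simp_all add: ground_ring_simps)
      moreover have "(\<Sum>k\<in>S. pair_entry n (of_int (z k) * d, kostant_monomial n k) (I, J))
          = (\<Sum>k\<in>S. of_int (z k) * d * K_entry n (K_monomial n k) I J)"
        by (rule sum.cong) (simp_all add: pair_entry_def K_entry_monomial int_entry_monomial)
      ultimately show "K_entry n (pure_tensor ?G ?Z d v) I J = K_entry n ?s I J" by simp
    qed
    then show ?thesis using s by simp
  qed
  have cls: "tensor_class ?G ?Z x \<in> lin_span (kostant_K n) ?X"
    if "Poly_Mapping.keys x \<subseteq> carrier ?G \<times> carrier ?Z" for x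
  proof (rule free_Abelian_group_induct[OF that])
    show "tensor_class ?G ?Z 0 \<in> lin_span (kostant_K n) ?X"
      using KK.lin_span_zero[of ?X] unfolding kostant_K_eq T.TA_zero .
  next
    fix x y
    assume x: "Poly_Mapping.keys x \<subseteq> carrier ?G \<times> carrier ?Z"
      and y: "Poly_Mapping.keys y \<subseteq> carrier ?G \<times> carrier ?Z"
      and IH: "tensor_class ?G ?Z x \<in> lin_span (kostant_K n) ?X"
          "tensor_class ?G ?Z y \<in> lin_span (kostant_K n) ?X"
    have u: "tensor_class ?G ?Z (- y) = (- 1) \<odot>\<^bsub>kostant_K n\<^esub> tensor_class ?G ?Z y"
    proof -
      have "frag_eval (\<lambda>u. pair_entry n u i) (- y)
          = frag_eval (\<lambda>u. pair_entry n u i) (frag_extend (\<lambda>(a, b). frag_of (- 1 * a, b)) y)" for i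
        unfolding T.scaled_rep[OF y] frag_eval_uminus by simp
      moreover have "Poly_Mapping.keys (- y) \<subseteq> carrier ?G \<times> carrier ?Z" using y by simp
      ultimately show ?thesis
        unfolding kostant_K_eq T.TA_smult[OF y] using T.class_eq_iff[OF _ T.scaled_closed[OF y]]
          by blast
    qed
    have "tensor_class ?G ?Z (x - y) = tensor_class ?G ?Z x \<oplus>\<^bsub>kostant_K n\<^esub> tensor_class ?G ?Z (- y)"
      unfolding kostant_K_eq using x y by (subst T.TA_add) simp_all
    then show "tensor_class ?G ?Z (x - y) \<in> lin_span (kostant_K n) ?X"
      using IH u by (simp add: KK.lin_span_add KK.lin_span_smult[OF X])
  next
    fix u assume "u \<in> carrier ?G \<times> carrier ?Z"
    then show "tensor_class ?G ?Z (frag_of u) \<in> lin_span (kostant_K n) ?X" using pure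
      by (auto simp: pure_tensor_def)
  qed
  obtain x where "Poly_Mapping.keys x \<subseteq> carrier ?G \<times> carrier ?Z" "a = tensor_class ?G ?Z x"
    using a unfolding kostant_K_eq by (rule T.TA_carrierE)
  then have "a \<in> lin_span (kostant_K n) ?X" using cls by simp
  then obtain S c where "finite S" "S \<subseteq> exponents n"
      "a = finsum (kostant_K n) (\<lambda>k. c k \<odot>\<^bsub>kostant_K n\<^esub> K_monomial n k) S"
    by (rule KK.lin_span_expansion[OF X])
  then show ?thesis by (rule that)
qed

end

section \<open>The grading\<close>

text \<open>
  The diagonal pair count of \<open>J\<close> with itself is the number of occurrences of a letter in \<open>J\<close>.
\<close>

definition weight :: "nat \<Rightarrow> nat list \<Rightarrow> int vec" where
  "weight n J = vec n (\<lambda>a. int (pair_count J J a a))"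

definition weight_diff :: "nat \<Rightarrow> nat list \<Rightarrow> nat list \<Rightarrow> int vec" where
  "weight_diff n I J = weight n I - weight n J"

lemma weight_carrier: "weight n J \<in> carrier_vec n"
  by (simp add: weight_def)

lemma weight_diff_carrier: "weight_diff n I J \<in> carrier_vec n"
  by (simp add: weight_diff_def weight_def)

lemma pair_count_sum: "int (pair_count I J i j) = (\<Sum>p<length J. of_bool (I ! p = i \<and> J ! p = j))"
proof -
  have "{p. p < length J \<and> I ! p = i \<and> J ! p = j} = {p \<in> {..<length J}. I ! p = i \<and> J ! p = j}"
    by auto
  then show ?thesis by (simp add: pair_count_def sum.If_cases of_bool_def Int_def)
qed

text \<open>
  Each change of a letter \<open>j\<close> into \<open>i\<close> adds \<open>v\<^sub>i - v\<^sub>j\<close> to the weight.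
\<close>

lemma raises_weight_diff:
  assumes "raises (root_list n) k I J"
  shows "weight_diff n I J = kostant_degree n k"
proof (rule eq_vecI)
  fix a assume "a < dim_vec (kostant_degree n k)"
  then have a: "a < n" by (simp add: kostant_degree_def)
  have len: "length I = length J" using assms by (simp add: raises_def)
  have k: "int (k i j) = (\<Sum>p<length J. of_bool (I ! p = i \<and> J ! p = j))" if "i < j" "j < n" for i j
    using assms that
      by (auto simp: raises_def set_root_list root_indices_def simp flip: pair_count_sum)
  have "kostant_degree n k $ a
      = (\<Sum>j<n. \<Sum>i<j. \<Sum>p<length J. of_bool (I ! p = i \<and> J ! p = j) * (of_bool (a = i) - of_bool
          (a = j)))"
    using a by (simp add: kostant_degree_def k sum_distrib_right of_bool_def)
  also have "\<dots> = (\<Sum>p<length J. \<Sum>j<n. \<Sum>i<j. of_bool (I ! p = i \<and> J ! p = j) * (of_bool (a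
      = i) - of_bool (a = j)))"
    by (subst sum.swap[of _ "{..<length J}"]) (intro sum.cong refl sum.swap)
  also have "\<dots> = (\<Sum>p<length J. of_bool (I ! p = a) - of_bool (J ! p = a))"
  proof (rule sum.cong[OF refl])
    fix p assume p: "p \<in> {..<length J}"
    let ?d = "of_bool (I ! p = a) - of_bool (J ! p = a) :: int"
    have "(\<Sum>i<j. of_bool (I ! p = i \<and> J ! p = j) * (of_bool (a = i) - of_bool (a = j)))
        = (if j = J ! p then (if I ! p < J ! p then ?d else 0) else 0)" for j
    proof -
      have "(\<Sum>i<j. of_bool (I ! p = i \<and> J ! p = j) * (of_bool (a = i) - of_bool (a = j)))
          = (\<Sum>i<j. if i = I ! p then (if j = J ! p then ?d else 0) else 0)"
        by (rule sum.cong) (auto simp: of_bool_def)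
      then show ?thesis by simp
    qed
    then have "(\<Sum>j<n. \<Sum>i<j. of_bool (I ! p = i \<and> J ! p = j) * (of_bool (a = i) - of_bool (a = j)))
        = (if J ! p < n \<and> I ! p < J ! p then ?d else 0)"
      by simp
    moreover have "I ! p = J ! p \<or> (I ! p, J ! p) \<in> root_indices n"
      using assms p by (auto simp: raises_def set_root_list)
    ultimately show "(\<Sum>j<n. \<Sum>i<j. of_bool (I ! p = i \<and> J ! p = j) * (of_bool (a = i) - of_bool (a
        = j))) = ?d"
      by (auto simp: root_indices_def)
  qed
  also have "\<dots> = weight_diff n I J $ a"
    using a len by (simp add: weight_diff_def weight_def pair_count_sum sum_subtractf)
  finally show "weight_diff n I J $ a = kostant_degree n k $ a" by simp
qed (simp add: kostant_degree_def weight_diff_def weight_def)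

lemma root_monoid_carrier: "\<gamma> \<in> root_monoid n \<Longrightarrow> \<gamma> \<in> carrier_vec n"
  by (induction rule: root_monoid.induct) auto

lemma root_monoid_add: "\<delta> \<in> root_monoid n \<Longrightarrow> \<gamma> \<in> root_monoid n \<Longrightarrow> \<gamma> + \<delta> \<in> root_monoid n"
proof (induction rule: root_monoid.induct)
  case zero then show ?case using root_monoid_carrier by (metis right_zero_vec)
next
  case (step \<delta> i)
  have "\<gamma> + (\<delta> + (unit_vec n i - unit_vec n (Suc i)))
      = (\<gamma> + \<delta>) + (unit_vec n i - unit_vec n (Suc i))"
    using root_monoid_carrier[OF step.prems] root_monoid_carrier[OF step.hyps(1)]
    by (intro assoc_add_vec[symmetric]) auto
  then show ?case using step.IH[OF step.prems] step.hyps(2) root_monoid.step by metis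
qed

lemma root_in_root_monoid: "i < j \<Longrightarrow> j < n \<Longrightarrow> unit_vec n i - unit_vec n j \<in> root_monoid n"
proof (induction j)
  case (Suc j)
  have simple: "unit_vec n j - unit_vec n (Suc j) \<in> root_monoid n"
    using root_monoid.step[OF root_monoid.zero, of j n] Suc.prems
    by (metis left_zero_vec minus_carrier_vec unit_vec_carrier)
  show ?case
  proof (cases "i = j")
    case False
    then have "unit_vec n i - unit_vec n j \<in> root_monoid n" using Suc by simp
    from root_monoid_add[OF simple this]
    have "(unit_vec n i - unit_vec n j) + (unit_vec n j - unit_vec n (Suc j)) \<in> root_monoid n" .
    moreover have "(unit_vec n i - unit_vec n j) + (unit_vec n j - unit_vec n (Suc j))
        = unit_vec n i - (unit_vec n (Suc j) :: int vec)"
      by (rule eq_vecI) auto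
    ultimately show ?thesis by simp
  qed (use simple in simp)
qed simp

lemma kostant_degree_root_monoid: "kostant_degree n k \<in> root_monoid n"
proof -
  let ?v = "\<lambda>x. unit_vec n (fst x) - unit_vec n (snd x) :: int vec"
  have mult: "vec n (\<lambda>a. int m * (?v x $ a)) \<in> root_monoid n" if x: "x \<in> root_indices n" for m x
  proof (induction m)
    case 0
    have "vec n (\<lambda>a. int 0 * (?v x $ a)) = 0\<^sub>v n" by (rule eq_vecI) auto
    then show ?case using root_monoid.zero by simp
  next
    case (Suc m)
    have "?v x \<in> root_monoid n" using x root_in_root_monoid by (auto simp: root_indices_def)
    from root_monoid_add[OF this Suc.IH] have "vec n (\<lambda>a. int m * (?v x $ a)) + ?v x \<in> root_monoid
        n" .
    moreover have "vec n (\<lambda>a. int m * (?v x $ a)) + ?v x = vec n (\<lambda>a. int (Suc m) * (?v x $ a))"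
      by (rule eq_vecI) (auto simp: algebra_simps)
    ultimately show ?case by simp
  qed
  have "vec n (\<lambda>a. \<Sum>x\<in>S. int (k (fst x) (snd x)) * (?v x $ a)) \<in> root_monoid n"
    if "finite S" "S \<subseteq> root_indices n" for S
    using that
  proof (induction S)
    case empty
    have "vec n (\<lambda>a. \<Sum>x\<in>{}. int (k (fst x) (snd x)) * (?v x $ a)) = 0\<^sub>v n" by (rule eq_vecI) auto
    then show ?case using root_monoid.zero by simp
  next
    case (insert x S)
    have 1: "vec n (\<lambda>a. int (k (fst x) (snd x)) * (?v x $ a)) \<in> root_monoid n"
      by (rule mult) (use insert.prems in simp)
    have 2: "vec n (\<lambda>a. \<Sum>x\<in>S. int (k (fst x) (snd x)) * (?v x $ a)) \<in> root_monoid n"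
      using insert by simp
    have "vec n (\<lambda>a. \<Sum>x\<in>insert x S. int (k (fst x) (snd x)) * (?v x $ a))
        = vec n (\<lambda>a. int (k (fst x) (snd x)) * (?v x $ a))
          + vec n (\<lambda>a. \<Sum>x\<in>S. int (k (fst x) (snd x)) * (?v x $ a))"
      by (rule eq_vecI) (use insert.hyps in auto)
    then show ?case using root_monoid_add[OF 2 1] by simp
  qed
  moreover have fin: "finite (root_indices n)"
    by (rule finite_subset[of _ "{..<n} \<times> {..<n}"]) (auto simp: root_indices_def)
  ultimately have "vec n (\<lambda>a. \<Sum>x\<in>root_indices n. int (k (fst x) (snd x)) * (?v x $ a)) \<in> root_monoid
      n"
    by blast
  moreover have "(\<Sum>x\<in>root_indices n. int (k (fst x) (snd x)) * (?v x $ a))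
      = (\<Sum>j<n. \<Sum>i<j. int (k i j) * ((unit_vec n i - unit_vec n j) $ a))" for a
  proof -
    have "(\<Sum>j<n. \<Sum>i<j. int (k i j) * ((unit_vec n i - unit_vec n j) $ a))
        = (\<Sum>y\<in>(SIGMA j:{..<n}. {..<j}). int (k (snd y) (fst y)) * ((unit_vec n (snd y) - unit_vec n
            (fst y)) $ a))"
      by (simp add: sum.Sigma case_prod_beta)
    also have "\<dots> = (\<Sum>x\<in>root_indices n. int (k (fst x) (snd x)) * (?v x $ a))"
      by (rule sum.reindex_bij_witness[of _ prod.swap prod.swap]) (auto simp: root_indices_def)
    finally show ?thesis by simp
  qed
  ultimately show ?thesis by (simp add: kostant_degree_def)
qed

context
  fixes n :: nat
begin

lemma homogeneous_conv_span:
  "kostant_homogeneous n \<gamma> = lin_span (kostant_K n) (K_monomial n ` {k. kostant_degree n k = \<gamma>})"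
  unfolding kostant_homogeneous_def K_monomial_def
  by (rule arg_cong[where f = "lin_span (kostant_K n)"]) auto

lemma K_monomials_closed: "K_monomial n ` B \<subseteq> carrier (kostant_K n)"
  using K_monomial_closed by blast

lemma homogeneous_entry:
  fixes a :: "'k::field kostant_ext"
  assumes a: "a \<in> kostant_homogeneous n \<gamma>" and ne: "weight_diff n I J \<noteq> \<gamma>"
  shows "K_entry n a I J = 0"
proof -
  interpret KK: scalar_algebra "kostant_K n :: ('k, 'k kostant_ext) module"
    by (rule kostant_K_algebra)
  let ?B = "K_monomial n ` {k. kostant_degree n k = \<gamma>} :: 'k kostant_ext set"
  show ?thesis
    using K_monomials_closed a[unfolded homogeneous_conv_span]
  proof (induction rule: KK.lin_span_induct)
    case zero show ?case by (rule K_entry_zero)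
  next
    case (base c x)
    then obtain k where k: "kostant_degree n k = \<gamma>" "x = K_monomial n k" by blast
    then have "\<not> raises (root_list n) k I J" using raises_weight_diff ne by blast
    then show ?case by (simp add: k K_entry_smult[OF K_monomial_closed] K_entry_monomial)
  next
    case (add x y)
    then have "x \<in> carrier (kostant_K n)" "y \<in> carrier (kostant_K n)"
      using KK.lin_span_closed[OF K_monomials_closed] by blast+
    then show ?case using add by (simp add: K_entry_add)
  qed
qed

lemma homogeneous_closed: "a \<in> kostant_homogeneous n \<gamma> \<Longrightarrow> a \<in> carrier (kostant_K n)"
proof -
  interpret KK: scalar_algebra "kostant_K n :: ('a, 'a kostant_ext) module"
    by (rule kostant_K_algebra)
  show "a \<in> kostant_homogeneous n \<gamma> \<Longrightarrow> a \<in> carrier (kostant_K n)"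
    unfolding homogeneous_conv_span by (rule KK.lin_span_closed[OF K_monomials_closed])
qed

text \<open>
  The homogeneous component of degree \<open>\<gamma>\<close> keeps exactly those matrix entries that raise
  weights by \<open>\<gamma>\<close>. As an element is determined by its entries, this shows that the decomposition
  into homogeneous components is unique.
\<close>

lemma components:
  fixes a :: "'k::field kostant_ext"
  assumes a: "a \<in> carrier (kostant_K n)"
  shows components_closed: "kostant_components n a \<gamma> \<in> carrier (kostant_K n)"
    and components_entry: "K_entry n (kostant_components n a \<gamma>) I J
      = (if weight_diff n I J = \<gamma> then K_entry n a I J else 0)"
    and components_root_monoid: "\<gamma> \<notin> root_monoid n \<Longrightarrow> kostant_components n a \<gamma> = \<zero>\<^bsub>kostant_K n\<^esub>"
    and components_finite: "finite {\<gamma>. kostant_components n a \<gamma> \<noteq> \<zero>\<^bsub>kostant_K n\<^esub>}"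
proof -
  interpret KK: scalar_algebra "kostant_K n :: ('k, 'k kostant_ext) module"
    by (rule kostant_K_algebra)
  let ?P = "\<lambda>d. (\<forall>\<gamma> \<in> root_monoid n. d \<gamma> \<in> kostant_homogeneous n \<gamma>) \<and>
    (\<forall>\<gamma>. \<gamma> \<notin> root_monoid n \<longrightarrow> d \<gamma> = \<zero>\<^bsub>kostant_K n\<^esub>) \<and>
    finite {\<gamma>. d \<gamma> \<noteq> \<zero>\<^bsub>kostant_K n\<^esub>} \<and>
    a = finsum (kostant_K n) d {\<gamma>. d \<gamma> \<noteq> \<zero>\<^bsub>kostant_K n\<^esub>}"
  obtain S c where S: "finite S" "S \<subseteq> exponents n"
      "a = finsum (kostant_K n) (\<lambda>k. c k \<odot>\<^bsub>kostant_K n\<^esub> K_monomial n k) S"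
    by (rule kostant_K_expansion[OF a])
  \<comment> \<open>the terms of degree \<open>\<gamma>\<close> in an expansion of \<open>a\<close>\<close>
  define d where "d \<gamma> = finsum (kostant_K n) (\<lambda>k. c k \<odot>\<^bsub>kostant_K n\<^esub> K_monomial n k) {k
      \<in> S. kostant_degree n k = \<gamma>}" for \<gamma>
  have tm: "c k \<odot>\<^bsub>kostant_K n\<^esub> K_monomial n k \<in> carrier (kostant_K n)" for k
    by (intro KK.smult_closed K_monomial_closed)
  have d_hom: "d \<gamma> \<in> kostant_homogeneous n \<gamma>" for \<gamma>
    unfolding d_def homogeneous_conv_span
    using S(1) by (intro KK.lin_span_finsum K_monomials_closed) (auto intro: KK.lin_span_smult_base)
  have d_cl: "d \<gamma> \<in> carrier (kostant_K n)" for \<gamma> by (rule homogeneous_closed[OF d_hom])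
  have d_entry: "K_entry n (d \<gamma>) I J = (if weight_diff n I J = \<gamma> then K_entry n a I J else 0)"
      for \<gamma> I J
  proof -
    have "K_entry n (d \<gamma>) I J = (\<Sum>k | k \<in> S \<and> kostant_degree n k
        = \<gamma>. c k * K_entry n (K_monomial n k) I J)"
      unfolding d_def using S(1) tm
        by (subst K_entry_finsum) (auto simp: K_entry_smult K_monomial_closed)
    also have "\<dots> = (\<Sum>k\<in>S. if weight_diff n I J = \<gamma> then c k * K_entry n (K_monomial n k) I J else
        0)"
      by (rule sum.mono_neutral_cong_left)
        (use S(1) raises_weight_diff in \<open>auto simp: K_entry_monomial\<close>)
    also have "\<dots> = (if weight_diff n I J = \<gamma> then (\<Sum>k\<in>S. c k * K_entry n (K_monomial n k) I J) else
        0)"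
      by simp
    also have "(\<Sum>k\<in>S. c k * K_entry n (K_monomial n k) I J) = K_entry n a I J"
      unfolding S(3) using S(1) tm
        by (subst K_entry_finsum) (auto simp: K_entry_smult K_monomial_closed)
    finally show ?thesis .
  qed
  have d_supp: "{\<gamma>. d \<gamma> \<noteq> \<zero>\<^bsub>kostant_K n\<^esub>} \<subseteq> kostant_degree n ` S"
  proof (rule subsetI, rule ccontr)
    fix \<gamma> assume "\<gamma> \<in> {\<gamma>. d \<gamma> \<noteq> \<zero>\<^bsub>kostant_K n\<^esub>}" and "\<gamma> \<notin> kostant_degree n ` S"
    then have "{k \<in> S. kostant_degree n k = \<gamma>} = {}" and ne: "d \<gamma> \<noteq> \<zero>\<^bsub>kostant_K n\<^esub>" by auto
    then have "d \<gamma> = \<zero>\<^bsub>kostant_K n\<^esub>" unfolding d_def by (simp only: KK.finsum_empty)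
    then show False using ne by simp
  qed
  then have d_fin: "finite {\<gamma>. d \<gamma> \<noteq> \<zero>\<^bsub>kostant_K n\<^esub>}" using S(1) finite_subset by blast
  have d_root: "d \<gamma> = \<zero>\<^bsub>kostant_K n\<^esub>" if "\<gamma> \<notin> root_monoid n" for \<gamma>
    using that d_supp kostant_degree_root_monoid by blast
  have d_sum: "a = finsum (kostant_K n) d {\<gamma>. d \<gamma> \<noteq> \<zero>\<^bsub>kostant_K n\<^esub>}"
  proof (rule K_entry_eqI[OF a])
    show "finsum (kostant_K n) d {\<gamma>. d \<gamma> \<noteq> \<zero>\<^bsub>kostant_K n\<^esub>} \<in> carrier (kostant_K n)" using d_cl
      by (intro KK.finsum_closed) auto
    fix I J
    let ?\<delta> = "weight_diff n I J"
    have "K_entry n (finsum (kostant_K n) d {\<gamma>. d \<gamma> \<noteq> \<zero>\<^bsub>kostant_K n\<^esub>}) I J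
        = (\<Sum>\<gamma> | d \<gamma> \<noteq> \<zero>\<^bsub>kostant_K n\<^esub>. if \<gamma> = ?\<delta> then K_entry n (d ?\<delta>) I J else 0)"
      using d_fin d_cl by (subst K_entry_finsum) (auto simp: d_entry intro!: sum.cong)
    also have "\<dots> = (if d ?\<delta> \<noteq> \<zero>\<^bsub>kostant_K n\<^esub> then K_entry n (d ?\<delta>) I J else 0)" using d_fin by simp
    also have "\<dots> = K_entry n (d ?\<delta>) I J" by (simp add: K_entry_zero)
    finally show "K_entry n a I J = K_entry n (finsum (kostant_K n) d {\<gamma>. d \<gamma> \<noteq> \<zero>\<^bsub>kostant_K n\<^esub>}) I J"
      by (simp add: d_entry)
  qed
  have "kostant_components n a = d"
    unfolding kostant_components_def
  proof (rule the_equality)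
    show "?P d" using d_hom d_root d_fin d_sum by (intro conjI ballI allI impI)
  next
    fix d' assume P: "?P d'"
    have hom': "d' \<gamma> \<in> kostant_homogeneous n \<gamma>" if "\<gamma> \<in> root_monoid n" for \<gamma> using P that by blast
    have zero': "d' \<gamma> = \<zero>\<^bsub>kostant_K n\<^esub>" if "\<gamma> \<notin> root_monoid n" for \<gamma> using P that by blast
    have fin': "finite {\<gamma>. d' \<gamma> \<noteq> \<zero>\<^bsub>kostant_K n\<^esub>}" using P by blast
    have sum': "a = finsum (kostant_K n) d' {\<gamma>. d' \<gamma> \<noteq> \<zero>\<^bsub>kostant_K n\<^esub>}" using P by blast
    have cl': "d' \<gamma> \<in> carrier (kostant_K n)" for \<gamma>
      using hom' zero' homogeneous_closed KK.zero_closed by metis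
    have off: "K_entry n (d' \<gamma>) I J = 0" if "weight_diff n I J \<noteq> \<gamma>" for \<gamma> I J
      using homogeneous_entry[OF hom' that] zero' K_entry_zero by metis
    have "K_entry n (d' \<gamma>) I J = K_entry n (d \<gamma>) I J" for \<gamma> I J
    proof (cases "weight_diff n I J = \<gamma>")
      case True
      have "K_entry n a I J = (\<Sum>\<gamma>' | d' \<gamma>' \<noteq> \<zero>\<^bsub>kostant_K n\<^esub>. K_entry n (d' \<gamma>') I J)"
        by (subst sum', rule K_entry_finsum[OF fin']) (use cl' in blast)
      also have "\<dots> = (\<Sum>\<gamma>' | d' \<gamma>' \<noteq> \<zero>\<^bsub>kostant_K n\<^esub>. if \<gamma>' = \<gamma> then K_entry n (d' \<gamma>) I J else 0)"
        by (rule sum.cong[OF refl]) (use off True in auto)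
      also have "\<dots> = (if d' \<gamma> \<noteq> \<zero>\<^bsub>kostant_K n\<^esub> then K_entry n (d' \<gamma>) I J else 0)" using fin' by simp
      also have "\<dots> = K_entry n (d' \<gamma>) I J" by (simp add: K_entry_zero)
      finally show ?thesis using True by (simp add: d_entry)
    next
      case False then show ?thesis by (simp add: off d_entry)
    qed
    then show "d' = d" using K_entry_eqI[OF cl' d_cl] by blast
  qed
  then show "kostant_components n a \<gamma> \<in> carrier (kostant_K n)"
    "K_entry n (kostant_components n a \<gamma>) I J = (if weight_diff n I J = \<gamma> then K_entry n a I J else
        0)"
    "\<gamma> \<notin> root_monoid n \<Longrightarrow> kostant_components n a \<gamma> = \<zero>\<^bsub>kostant_K n\<^esub>"
    "finite {\<gamma>. kostant_components n a \<gamma> \<noteq> \<zero>\<^bsub>kostant_K n\<^esub>}"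
    using d_cl d_entry d_root d_fin by simp_all
qed

end

section \<open>The skew product\<close>

lemma weight_functions_simps:
  "carrier (weight_functions n) = {f. \<forall>z. z \<notin> carrier_vec n \<longrightarrow> f z = 0}"
  "f \<otimes>\<^bsub>weight_functions n\<^esub> g = (\<lambda>z. f z * g z)"
  "\<one>\<^bsub>weight_functions n\<^esub> = (\<lambda>z. if z \<in> carrier_vec n then 1 else 0)"
  "\<zero>\<^bsub>weight_functions n\<^esub> = (\<lambda>z. 0)"
  "f \<oplus>\<^bsub>weight_functions n\<^esub> g = (\<lambda>z. f z + g z)"
  "c \<odot>\<^bsub>weight_functions n\<^esub> f = (\<lambda>z. c * f z)"
  by (simp_all add: weight_functions_def)

lemma weight_functions_scalar_module:
    "scalar_module (weight_functions n :: ('k::field, int vec \<Rightarrow> 'k) module)"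
proof -
  let ?B = "weight_functions n :: ('k, int vec \<Rightarrow> 'k) module"
  have "abelian_group ?B"
  proof (rule abelian_groupI)
    show "\<exists>g\<in>carrier ?B. g \<oplus>\<^bsub>?B\<^esub> f = \<zero>\<^bsub>?B\<^esub>" if "f \<in> carrier ?B" for f
      using that by (intro bexI[of _ "\<lambda>z. - f z"]) (simp_all add: weight_functions_simps)
  qed (simp_all add: weight_functions_simps add_ac)
  then interpret abelian_group ?B .
  show ?thesis
    by unfold_locales (simp_all add: weight_functions_simps algebra_simps)
qed

type_synonym skew_index = "nat list \<times> nat list \<times> int vec"

text \<open>
  The skew product acts faithfully on pairs of a word and a point of \<open>\<int>\<^sup>n\<close>: the tensor
  \<open>a \<otimes> b\<close> multiplies by the value of \<open>b\<close> at the point \<open>z\<close> and applies \<open>a\<close> to the word, and the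
  point is moved by the same amount as the weight of the word. Thus a matrix entry depends on two
  words and on the initial point.
\<close>

definition skew_pair_entry :: "nat \<Rightarrow> 'k::field kostant_ext \<times> (int vec \<Rightarrow> 'k) \<Rightarrow> skew_index \<Rightarrow> 'k" where
  "skew_pair_entry n u = (\<lambda>(I, J, z). K_entry n (fst u) I J * snd u z)"

text \<open>
  A formal sum that represents \<open>(a \<otimes> b)(a' \<otimes> b')\<close>.
\<close>

definition skew_product_rep ::
  "nat \<Rightarrow> 'k::field kostant_ext \<times> (int vec \<Rightarrow> 'k) \<Rightarrow> 'k kostant_ext \<times> (int vec \<Rightarrow> 'k) \<Rightarrow>
   ('k kostant_ext \<times> (int vec \<Rightarrow> 'k) \<Rightarrow>\<^sub>0 int)" where
  "skew_product_rep n = (\<lambda>(a, b) (a', b').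
        \<Sum>\<gamma> | \<gamma> \<in> root_monoid n \<and> kostant_components n a' \<gamma> \<noteq> \<zero>\<^bsub>kostant_K n\<^esub>.
          frag_of (a \<otimes>\<^bsub>kostant_K n\<^esub> kostant_components n a' \<gamma>,
                   weight_shift n \<gamma> b \<otimes>\<^bsub>weight_functions n\<^esub> b'))"

text \<open>
  In a product the left factor meets the word \<open>K\<close> that the right factor has produced from \<open>J\<close>, and
  the point that has moved along.
\<close>

definition index_left :: "nat \<Rightarrow> skew_index \<Rightarrow> nat list \<Rightarrow> skew_index" where
  "index_left n = (\<lambda>(I, J, z) K. (I, K, z + weight_diff n K J))"

definition index_right :: "skew_index \<Rightarrow> nat list \<Rightarrow> skew_index" where
  "index_right = (\<lambda>(I, J, z) K. (K, J, z))"

definition index_middle :: "nat \<Rightarrow> skew_index \<Rightarrow> nat list set" where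
  "index_middle n = (\<lambda>(I, J, z). multi_indices n (length J))"

lemmas skew_index_simps = index_left_def index_right_def index_middle_def

lemma shift_shift: "z + weight_diff n K J + weight_diff n M K = z + weight_diff n M J"
  by (rule eq_vecI) (auto simp: weight_diff_def weight_def)

text \<open>
  Only components of degree \<open>weight_diff n K J\<close> contribute to the entry at \<open>(K, J)\<close>, so the shift
  \<open>b\<^sup>\<gamma>\<close> in the product of the skew algebra is the motion of the point. The kernel is detected
  as before: modulo the relations, a formal sum is \<open>\<Sum> e\<^sup>(\<^sup>k\<^sup>) \<otimes> b\<^bsub>k\<^esub>\<close>, and the entry at the
  words of \<open>k\<close> and the point \<open>z\<close> is \<open>b\<^bsub>k\<^esub> z\<close>.
\<close>

lemma skew_representation:
  "tensor_representation (kostant_K n :: ('k::field, 'k kostant_ext) module) (weight_functions n)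
    (module.smult (kostant_K n)) (skew_product_rep n) (skew_pair_entry n)
    (index_middle n) (index_left n) index_right"
proof
  let ?A = "kostant_K n :: ('k, 'k kostant_ext) module"
  let ?B = "weight_functions n :: ('k, int vec \<Rightarrow> 'k) module"
  interpret A: scalar_algebra ?A by (rule kostant_K_algebra)
  note sm = A.scalar_module_axioms weight_functions_scalar_module[of n, where 'k = 'k]
  fix x and i :: skew_index
  assume x: "x \<in> tensor_relations ?A ?B"
  show "Poly_Mapping.keys x \<subseteq> carrier ?A \<times> carrier ?B" by (rule tensor_relations_closed[OF sm x])
  show "frag_eval (\<lambda>u. skew_pair_entry n u i) x = 0"
    by (rule frag_eval_tensor_relation[OF sm _ _ _ x])
      (simp_all add: skew_pair_entry_def weight_functions_simps K_entry_add K_entry_smult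
        algebra_simps split: prod.split)
next
  let ?A = "kostant_K n :: ('k, 'k kostant_ext) module"
  let ?B = "weight_functions n :: ('k, int vec \<Rightarrow> 'k) module"
  interpret A: scalar_algebra ?A by (rule kostant_K_algebra)
  interpret B: scalar_module ?B by (rule weight_functions_scalar_module)
  note sm = A.scalar_module_axioms B.scalar_module_axioms
  note K = tensor_kernel_subgroup[OF sm]
  have rel0: "frag_eval (\<lambda>u. skew_pair_entry n u i) x = 0" if "x \<in> tensor_relations ?A ?B" for x i
    by (rule frag_eval_tensor_relation[OF sm _ _ _ that])
      (simp_all add: skew_pair_entry_def weight_functions_simps K_entry_add K_entry_smult
        algebra_simps split: prod.split)
  fix x assume x: "Poly_Mapping.keys x \<subseteq> carrier ?A \<times> carrier ?B"
    and ev: "\<And>i. frag_eval (\<lambda>u. skew_pair_entry n u i) x = 0"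
  obtain S b where S: "finite S" "S \<subseteq> exponents n" "\<And>k. b k \<in> carrier ?B"
    "x - (\<Sum>k\<in>S. frag_of (K_monomial n k, b k)) \<in> tensor_kernel ?A ?B"
  proof (rule formal_sum_normal_form[of ?B "tensor_kernel ?A ?B" "exponents n"
        "\<lambda>k b. frag_of (K_monomial n k, b)", OF _ K(1,2) _ _ x])
    fix u assume "u \<in> carrier ?A \<times> carrier ?B"
    then obtain a b where u: "u = (a, b)" "a \<in> carrier ?A" "b \<in> carrier ?B" by blast
    obtain S c where S: "finite S" "S \<subseteq> exponents n"
      "a = finsum ?A (\<lambda>k. c k \<odot>\<^bsub>?A\<^esub> K_monomial n k) S"
      by (rule kostant_K_expansion[OF u(2)])
    have "frag_of u - (\<Sum>k\<in>S. frag_of (K_monomial n k, c k \<odot>\<^bsub>?B\<^esub> b)) \<in> tensor_kernel ?A ?B"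
      unfolding u(1) S(3)
      by (rule tensor_expand_left[OF sm u(3) S(1)]) (use K_monomial_closed in blast)
    then show "\<exists>S c. finite S \<and> S \<subseteq> exponents n \<and> (\<forall>k. c k \<in> carrier ?B) \<and>
        frag_of u - (\<Sum>k\<in>S. frag_of (K_monomial n k, c k)) \<in> tensor_kernel ?A ?B"
      using S(1,2) B.smult_closed[OF u(3)] by (intro exI[of _ S] exI[of _ "\<lambda>k. c k \<odot>\<^bsub>?B\<^esub> b"]) simp
  next
    show "abelian_group ?B" by unfold_locales
  qed (auto intro: tensor_kernel_add_right[OF sm] K_monomial_closed)
  have "frag_eval (\<lambda>u. skew_pair_entry n u i) (x - (\<Sum>k\<in>S. frag_of (K_monomial n k, b k))) = 0" for i
    using S(4) unfolding tensor_kernel_def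
  proof (induction rule: generate.induct)
    case (inv h)
    then show ?case using tensor_relations_closed[OF sm inv] rel0 by simp
  qed (simp_all add: rel0)
  then have sum0: "(\<Sum>k\<in>S. skew_pair_entry n (K_monomial n k, b k) i) = 0" for i
    using ev[of i] by simp
  have b0: "b k = (\<lambda>z. 0)" if k: "k \<in> S" for k
  proof
    fix z
    obtain I J where IJ: "coef_words n k = (I, J)" by fastforce
    have kE: "k \<in> exponents n" using k S by blast
    note w = coef_words[OF kE IJ]
    have "(\<Sum>k'\<in>S. skew_pair_entry n (K_monomial n k', b k') (I, J, z)) = (\<Sum>k'\<in>S. if k'
        = k then b k' z else 0)"
      by (rule sum.cong[OF refl])
        (use S(2) w in \<open>auto simp: skew_pair_entry_def K_entry_monomial same_shape_def\<close>)
    then show "b k z = 0" using sum0[of "(I, J, z)"] S(1) k by simp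
  qed
  have "(\<Sum>k\<in>T. frag_of (K_monomial n k, b k)) \<in> tensor_kernel ?A ?B" if "finite T" "T \<subseteq> S" for T
    using that
  proof (induction T)
    case (insert k T)
    have "frag_of (K_monomial n k, b k) \<in> tensor_kernel ?A ?B"
      using tensor_kernel_zero_right[OF sm K_monomial_closed[of n k]] b0 insert.prems
      by (simp add: weight_functions_simps)
    then show ?case using insert by (simp add: K(3))
  qed (simp add: K(1))
  from K(3)[OF S(4) this[OF S(1) order_refl]] show "x \<in> tensor_kernel ?A ?B" by simp
next
  let ?A = "kostant_K n :: ('k, 'k kostant_ext) module"
  let ?B = "weight_functions n :: ('k, int vec \<Rightarrow> 'k) module"
  interpret A: scalar_algebra ?A by (rule kostant_K_algebra)
  fix u v and i :: skew_index
  assume u: "u \<in> carrier ?A \<times> carrier ?B" and v: "v \<in> carrier ?A \<times> carrier ?B"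
  obtain a b a' b' where uv: "u = (a, b)" "v = (a', b')" by fastforce
  have ab: "a \<in> carrier ?A" "b \<in> carrier ?B" "a' \<in> carrier ?A" "b' \<in> carrier ?B" using u v uv
    by auto
  let ?D = "{\<gamma>. \<gamma> \<in> root_monoid n \<and> kostant_components n a' \<gamma> \<noteq> \<zero>\<^bsub>?A\<^esub>}"
  have D: "finite ?D" using components_finite[OF ab(3)] by (rule rev_finite_subset) auto
  have term_closed: "(a \<otimes>\<^bsub>?A\<^esub> kostant_components n a' \<gamma>, weight_shift n \<gamma> b \<otimes>\<^bsub>?B\<^esub> b') \<in> carrier ?A \<times>
      carrier ?B" for \<gamma>
    using A.m_closed[OF ab(1) components_closed[OF ab(3)]] ab(4)
    by (simp add: weight_functions_simps)
  have "Poly_Mapping.keys (\<Sum>\<gamma>\<in>?D. frag_of (a \<otimes>\<^bsub>?A\<^esub> kostant_components n a' \<gamma>,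
      weight_shift n \<gamma> b \<otimes>\<^bsub>?B\<^esub> b')) \<subseteq> carrier ?A \<times> carrier ?B"
  proof -
    have "(\<Sum>\<gamma>\<in>?D. frag_of (a \<otimes>\<^bsub>?A\<^esub> kostant_components n a' \<gamma>, weight_shift n \<gamma> b \<otimes>\<^bsub>?B\<^esub> b'))
        \<in> carrier (free_Abelian_group (carrier ?A \<times> carrier ?B))"
      by (rule sum_closed_free_Abelian_group) (simp only: frag_of_in_free_Abelian_group term_closed)
    then show ?thesis by (simp only: carrier_free_Abelian_group_iff)
  qed
  then show "Poly_Mapping.keys (skew_product_rep n u v) \<subseteq> carrier ?A \<times> carrier ?B"
    by (simp only: uv skew_product_rep_def case_prod_conv)
  obtain I J z where i: "i = (I, J, z)" by (cases i)
  let ?W = "multi_indices n (length J)"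
  have "frag_eval (\<lambda>u. skew_pair_entry n u i) (skew_product_rep n u v)
      = (\<Sum>\<gamma>\<in>?D. K_entry n (a \<otimes>\<^bsub>?A\<^esub> kostant_components n a' \<gamma>) I J * (weight_shift n \<gamma> b z * b' z))"
    by (simp only: uv i skew_product_rep_def case_prod_conv frag_eval_sum frag_eval_of
        skew_pair_entry_def fst_conv snd_conv weight_functions_simps)
  also have "\<dots> = (\<Sum>\<gamma>\<in>?D. \<Sum>K\<in>?W. if weight_diff n K J = \<gamma>
      then K_entry n a I K * b (z + \<gamma>) * (K_entry n a' K J * b' z) else 0)"
  proof (rule sum.cong[OF refl])
    fix \<gamma>
    have sh: "weight_shift n \<gamma> b z * b' z = b (z + \<gamma>) * b' z"
      using ab(4) by (simp add: weight_shift_def weight_functions_simps)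
    show "K_entry n (a \<otimes>\<^bsub>?A\<^esub> kostant_components n a' \<gamma>) I J * (weight_shift n \<gamma> b z * b' z)
        = (\<Sum>K\<in>?W. if weight_diff n K J = \<gamma>
            then K_entry n a I K * b (z + \<gamma>) * (K_entry n a' K J * b' z) else 0)"
      unfolding sh K_entry_mult[OF ab(1) components_closed[OF ab(3)]] sum_distrib_right
      by (rule sum.cong[OF refl]) (simp add: components_entry[OF ab(3)])
  qed
  also have "\<dots> = (\<Sum>K\<in>?W. \<Sum>\<gamma>\<in>?D. if weight_diff n K J = \<gamma>
      then K_entry n a I K * b (z + \<gamma>) * (K_entry n a' K J * b' z) else 0)"
    by (rule sum.swap)
  also have "\<dots> = (\<Sum>K\<in>?W. K_entry n a I K * b (z + weight_diff n K J) * (K_entry n a' K J * b' z))"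
  proof (rule sum.cong[OF refl])
    fix K
    let ?\<delta> = "weight_diff n K J"
    have "(\<Sum>\<gamma>\<in>?D. if ?\<delta> = \<gamma> then K_entry n a I K * b (z + \<gamma>) * (K_entry n a' K J * b' z) else 0)
        = (if ?\<delta> \<in> ?D then K_entry n a I K * b (z + ?\<delta>) * (K_entry n a' K J * b' z) else 0)"
      by (rule sum.delta'[OF D])
    moreover have "K_entry n a' K J = 0" if "?\<delta> \<notin> ?D"
    proof -
      have "kostant_components n a' ?\<delta> = \<zero>\<^bsub>?A\<^esub>" using that components_root_monoid[OF ab(3)] by blast
      then show ?thesis using components_entry[OF ab(3), of ?\<delta> K J] by (simp add: K_entry_zero)
    qed
    ultimately show "(\<Sum>\<gamma>\<in>?D. if ?\<delta> = \<gamma> then K_entry n a I K * b (z + \<gamma>) * (K_entry n a' K J * b' z)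
        else 0)
        = K_entry n a I K * b (z + ?\<delta>) * (K_entry n a' K J * b' z)"
      by (cases "?\<delta> \<in> ?D") simp_all
  qed
  finally show "frag_eval (\<lambda>u. skew_pair_entry n u i) (skew_product_rep n u v)
      = (\<Sum>l\<in>index_middle n i. skew_pair_entry n u (index_left n i l) * skew_pair_entry n v
          (index_right i l))"
    by (simp only: uv i skew_index_simps case_prod_conv skew_pair_entry_def fst_conv snd_conv)
next
  interpret A: scalar_algebra "kostant_K n :: ('k, 'k kostant_ext) module"
    by (rule kostant_K_algebra)
  show "\<one>\<^bsub>kostant_K n\<^esub> \<in> carrier (kostant_K n :: ('k, 'k kostant_ext) module)" by (rule A.one_closed)
  show "c \<odot>\<^bsub>kostant_K n\<^esub> a \<in> carrier (kostant_K n)"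
    if "a \<in> carrier (kostant_K n)" for c :: 'k and a by (rule A.smult_closed[OF that])
next
  show "\<one>\<^bsub>weight_functions n\<^esub> \<in> carrier (weight_functions n :: ('k, int vec \<Rightarrow> 'k) module)"
    by (simp add: weight_functions_simps)
next
  show "skew_pair_entry n (c \<odot>\<^bsub>kostant_K n\<^esub> a, b) i = c * skew_pair_entry n (a, b) i"
    if "a \<in> carrier (kostant_K n)" for c :: 'k and a b i
    using that by (simp add: skew_pair_entry_def K_entry_smult mult.assoc split: prod.split)
next
  fix f g h :: "skew_index \<Rightarrow> 'k" and i :: skew_index
  obtain I J z where i: "i = (I, J, z)" by (cases i)
  let ?W = "multi_indices n (length J)"
  have "(\<Sum>l\<in>?W. (\<Sum>m\<in>multi_indices n (length l).
        f (I, m, z + weight_diff n l J + weight_diff n m l) * g (m, l, z + weight_diff n l J)) * h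
            (l, J, z))
      = (\<Sum>l\<in>?W. \<Sum>m\<in>?W. f (I, m, z + weight_diff n m J) * g (m, l, z + weight_diff n l J) * h
          (l, J, z))"
    by (rule sum.cong[OF refl]) (simp add: multi_indices_length sum_distrib_right shift_shift)
  also have "\<dots> = (\<Sum>m\<in>?W. \<Sum>l\<in>?W. f (I, m, z + weight_diff n m J) * g (m, l, z + weight_diff n l J)
      * h (l, J, z))"
    by (rule sum.swap)
  also have "\<dots> = (\<Sum>m\<in>?W. f (I, m, z + weight_diff n m J) * (\<Sum>l\<in>?W. g (m, l, z + weight_diff n l J)
      * h (l, J, z)))"
    by (simp add: sum_distrib_left mult.assoc)
  finally show "(\<Sum>l\<in>index_middle n i.
        (\<Sum>m\<in>index_middle n (index_left n i l). f (index_left n (index_left n i l) m) *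
          g (index_right (index_left n i l) m)) * h (index_right i l)) =
      (\<Sum>l\<in>index_middle n i. f (index_left n i l) *
        (\<Sum>m\<in>index_middle n (index_right i l). g (index_left n (index_right i l) m) *
          h (index_right (index_right i l) m)))"
    by (simp add: i skew_index_simps)
next
  fix u :: "'k kostant_ext \<times> (int vec \<Rightarrow> 'k)" and i :: skew_index
  assume u: "u \<in> carrier (kostant_K n) \<times> carrier (weight_functions n)"
  obtain a b where ab: "u = (a, b)" by fastforce
  have a: "a \<in> carrier (kostant_K n)" and b: "b \<in> carrier (weight_functions n)" using u ab by auto
  obtain I J z where i: "i = (I, J, z)" by (cases i)
  let ?W = "multi_indices n (length J)"
  let ?o = "(\<one>\<^bsub>kostant_K n\<^esub>, \<one>\<^bsub>weight_functions n\<^esub>) :: 'k kostant_ext \<times> (int vec \<Rightarrow> 'k)"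
  have "(\<Sum>l\<in>?W. skew_pair_entry n ?o (I, l, z + weight_diff n l J) * skew_pair_entry n u (l, J, z))
      = (\<Sum>l\<in>?W. if l = I then K_entry n a l J * b z else 0)"
  proof (rule sum.cong[OF refl])
    fix l assume "l \<in> ?W"
    then have "K_entry n \<one>\<^bsub>kostant_K n\<^esub> I l = (of_bool (l = I) :: 'k)"
      by (auto simp: K_entry_one same_shape_self)
    then show "skew_pair_entry n ?o (I, l, z + weight_diff n l J) * skew_pair_entry n u (l, J, z)
        = (if l = I then K_entry n a l J * b z else 0)"
      using b by (cases "z \<in> carrier_vec n")
        (simp_all add: skew_pair_entry_def ab weight_functions_simps weight_diff_carrier)
  qed
  also have "\<dots> = (if I \<in> ?W then K_entry n a I J * b z else 0)" by (simp add: finite_multi_indices)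
  also have "\<dots> = K_entry n a I J * b z" using K_entry_shape[OF a] by (simp add: same_shape_def)
  finally show "(\<Sum>l\<in>index_middle n i. skew_pair_entry n (\<one>\<^bsub>kostant_K n\<^esub>, \<one>\<^bsub>weight_functions n\<^esub>)
      (index_left n i l) *
      skew_pair_entry n u (index_right i l)) = skew_pair_entry n u i"
    by (simp add: i skew_index_simps skew_pair_entry_def ab)
  have "(\<Sum>l\<in>?W. skew_pair_entry n u (I, l, z + weight_diff n l J) * skew_pair_entry n ?o (l, J, z))
      = (\<Sum>l\<in>?W. if l = J then K_entry n a I l * b z else 0)"
  proof (rule sum.cong[OF refl])
    fix l assume "l \<in> ?W"
    then have "K_entry n \<one>\<^bsub>kostant_K n\<^esub> l J = (of_bool (l = J) :: 'k)"
      by (auto simp: K_entry_one same_shape_self)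
    moreover have "b (z + weight_diff n J J) * (if z \<in> carrier_vec n then 1 else 0) = b z"
    proof (cases "z \<in> carrier_vec n")
      case True
      then have "z + weight_diff n J J = z"
        by (intro eq_vecI) (auto simp: weight_diff_def weight_def)
      then show ?thesis using True by simp
    next
      case False then show ?thesis using b by (simp add: weight_functions_simps)
    qed
    ultimately show "skew_pair_entry n u (I, l, z + weight_diff n l J) * skew_pair_entry n ?o
        (l, J, z)
        = (if l = J then K_entry n a I l * b z else 0)"
      by (simp add: skew_pair_entry_def ab weight_functions_simps mult.assoc)
  qed
  also have "\<dots> = (if J \<in> ?W then K_entry n a I J * b z else 0)" by (simp add: finite_multi_indices)
  also have "\<dots> = K_entry n a I J * b z" using K_entry_shape[OF a] by (simp add: same_shape_def)
  finally show "(\<Sum>l\<in>index_middle n i. skew_pair_entry n u (index_left n i l) *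
      skew_pair_entry n (\<one>\<^bsub>kostant_K n\<^esub>, \<one>\<^bsub>weight_functions n\<^esub>) (index_right i l)) = skew_pair_entry n u
          i"
    by (simp add: i skew_index_simps skew_pair_entry_def ab)
qed

definition skew_entry :: "nat \<Rightarrow> 'k::field skew \<Rightarrow> nat list \<Rightarrow> nat list \<Rightarrow> int vec \<Rightarrow> 'k" where
  "skew_entry n x I J z = tensor_representation.rep (skew_pair_entry n) x (I, J, z)"

abbreviation skew_pure where "skew_pure n a b \<equiv> pure_tensor (kostant_K n) (weight_functions n) a b"

context
  fixes n :: nat
begin

interpretation S: tensor_representation "kostant_K n :: ('k::field, 'k kostant_ext) module"
    "weight_functions n"
    "module.smult (kostant_K n)" "skew_product_rep n" "skew_pair_entry n" "index_middle n"
        "index_left n" index_right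
  by (rule skew_representation)

lemma skew_product_eq: "(skew_product n) = tensor_algebra (kostant_K n) (weight_functions n)
    (module.smult (kostant_K n)) (skew_product_rep n)"
  unfolding skew_product_def skew_product_rep_def ..

lemma skew_product_algebra: "scalar_algebra (skew_product n :: ('k::field, 'k skew) module)"
  unfolding skew_product_eq by (rule S.scalar_algebra)

lemma skew_entry_eqI:
  assumes "x \<in> carrier (skew_product n)" "y \<in> carrier (skew_product n)"
      "\<And>I J z. skew_entry n x I J z = skew_entry n y I J z"
  shows "x = y"
  using assms unfolding skew_entry_def skew_product_eq by (intro S.rep_inj) auto

lemma skew_entry_add:
  "x \<in> carrier (skew_product n) \<Longrightarrow> y \<in> carrier (skew_product n) \<Longrightarrow>
   skew_entry n (x \<oplus>\<^bsub>skew_product n\<^esub> y) I J z = skew_entry n x I J z + skew_entry n y I J z"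
  unfolding skew_entry_def skew_product_eq by (rule S.rep_add)

lemma skew_entry_smult:
  "x \<in> carrier (skew_product n) \<Longrightarrow> skew_entry n (c \<odot>\<^bsub>skew_product n\<^esub> x) I J z
      = c * skew_entry n x I J z"
  unfolding skew_entry_def skew_product_eq by (rule S.rep_smult)

lemma skew_entry_mult:
  "x \<in> carrier (skew_product n) \<Longrightarrow> y \<in> carrier (skew_product n) \<Longrightarrow> skew_entry n (x \<otimes>\<^bsub>skew_product n\<^esub> y)
      I J z
    = (\<Sum>K\<in>multi_indices n (length J). skew_entry n x I K (z + weight_diff n K J) * skew_entry n y K
        J z)"
  unfolding skew_entry_def skew_product_eq
  by (simp only: S.rep_mult S.convolution_def) (simp add: skew_index_simps)

lemma skew_entry_zero: "skew_entry n \<zero>\<^bsub>skew_product n\<^esub> I J z = 0"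
  unfolding skew_entry_def skew_product_eq by (rule S.rep_zero)

lemma skew_pure_closed:
  "a \<in> carrier (kostant_K n) \<Longrightarrow> b \<in> carrier (weight_functions n) \<Longrightarrow> skew_pure n a b
      \<in> carrier (skew_product n)"
  unfolding skew_product_eq by (rule S.rep_pure)

lemma skew_entry_pure:
  "a \<in> carrier (kostant_K n) \<Longrightarrow> b \<in> carrier (weight_functions n) \<Longrightarrow>
   skew_entry n (skew_pure n a b) I J z = K_entry n a I J * b z"
  unfolding skew_entry_def by (simp add: S.rep_pure skew_pair_entry_def)

lemma skew_product_one: "\<one>\<^bsub>skew_product n\<^esub> = skew_pure n \<one>\<^bsub>kostant_K n\<^esub> \<one>\<^bsub>weight_functions n\<^esub>"
  unfolding skew_product_eq S.TA_one pure_tensor_def ..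

lemma skew_product_induct [consumes 1, case_names pure add uminus]:
  fixes x :: "'k::field skew"
  assumes x: "x \<in> carrier (skew_product n)"
    and pure: "\<And>a b. a \<in> carrier (kostant_K n) \<Longrightarrow> b \<in> carrier (weight_functions n)
        \<Longrightarrow> Q (skew_pure n a b)"
    and add: "\<And>x y. x \<in> carrier (skew_product n) \<Longrightarrow> y \<in> carrier (skew_product n) \<Longrightarrow> Q x \<Longrightarrow> Q y
        \<Longrightarrow> Q (x \<oplus>\<^bsub>skew_product n\<^esub> y)"
    and uminus: "\<And>x. x \<in> carrier (skew_product n) \<Longrightarrow> Q x \<Longrightarrow> Q ((- 1) \<odot>\<^bsub>skew_product n\<^esub> x)"
  shows "Q x"
proof -
  let ?A = "kostant_K n :: ('k, 'k kostant_ext) module"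
  let ?B = "weight_functions n :: ('k, int vec \<Rightarrow> 'k) module"
  interpret A: scalar_algebra ?A by (rule kostant_K_algebra)
  interpret B: scalar_module ?B by (rule weight_functions_scalar_module)
  interpret X: scalar_algebra "skew_product n :: ('k, 'k skew) module"
    by (rule skew_product_algebra)
  have "Q (tensor_class ?A ?B t)" if "Poly_Mapping.keys t \<subseteq> carrier ?A \<times> carrier ?B" for t
  proof (rule free_Abelian_group_induct[OF that])
    have "tensor_class ?A ?B 0 = skew_pure n \<zero>\<^bsub>?A\<^esub> \<zero>\<^bsub>?B\<^esub>"
      unfolding S.TA_zero[symmetric] skew_product_eq[symmetric]
      by (rule skew_entry_eqI[OF X.zero_closed skew_pure_closed[OF A.zero_closed B.zero_closed]])
        (simp add: skew_entry_zero skew_entry_pure K_entry_zero)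
    then show "Q (tensor_class ?A ?B 0)" using pure[OF A.zero_closed B.zero_closed] by simp
  next
    fix x y
    assume x: "Poly_Mapping.keys x \<subseteq> carrier ?A \<times> carrier ?B"
      and y: "Poly_Mapping.keys y \<subseteq> carrier ?A \<times> carrier ?B"
      and IH: "Q (tensor_class ?A ?B x)" "Q (tensor_class ?A ?B y)"
    have my: "Poly_Mapping.keys (- y) \<subseteq> carrier ?A \<times> carrier ?B" using y by simp
    have c: "tensor_class ?A ?B x \<in> carrier (skew_product n)"
        "tensor_class ?A ?B y \<in> carrier (skew_product n)"
      unfolding skew_product_eq using x y by (auto intro: S.class_closed)
    have "frag_eval (\<lambda>u. skew_pair_entry n u i) (- y)
        = frag_eval (\<lambda>u. skew_pair_entry n u i) (frag_extend (\<lambda>(a, b). frag_of (- 1 \<odot>\<^bsub>?A\<^esub> a, b)) y)"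
            for i
      unfolding S.scaled_rep[OF y] frag_eval_uminus by simp
    then have u: "tensor_class ?A ?B (- y) = (- 1) \<odot>\<^bsub>skew_product n\<^esub> tensor_class ?A ?B y"
      unfolding skew_product_eq S.TA_smult[OF y] using S.class_eq_iff[OF my S.scaled_closed[OF y]]
        by blast
    have "tensor_class ?A ?B (x - y) = tensor_class ?A ?B x \<oplus>\<^bsub>skew_product n\<^esub> tensor_class ?A ?B
        (- y)"
      unfolding skew_product_eq S.TA_add[OF x my] by simp
    then show "Q (tensor_class ?A ?B (x - y))"
      using add[OF c(1) X.smult_closed[OF c(2)] IH(1) uminus[OF c(2) IH(2)]] u by simp
  next
    fix u assume "u \<in> carrier ?A \<times> carrier ?B"
    then show "Q (tensor_class ?A ?B (frag_of u))" using pure by (auto simp: pure_tensor_def)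
  qed
  moreover obtain t where "Poly_Mapping.keys t \<subseteq> carrier ?A \<times> carrier ?B" "x = tensor_class ?A ?B t"
    using x unfolding skew_product_eq by (rule S.TA_carrierE)
  ultimately show ?thesis by blast
qed

end

section \<open>The Borel subalgebra\<close>

definition matrix_op :: "nat \<Rightarrow> nat \<Rightarrow> (nat list \<Rightarrow> nat list \<Rightarrow> 'k::field) \<Rightarrow> 'k tensor_op" where
  "matrix_op n r M = (\<lambda>t \<in> tensor_power n r. (\<lambda>i. if i \<in> multi_indices n r
    then \<Sum>j\<in>multi_indices n r. M i j * t j else 0))"

lemma tensor_power_op_conv: "tensor_power_op n r g
    = matrix_op n r (\<lambda>i j. \<Prod>k<r. g $$ (i ! k, j ! k))"
  by (simp add: tensor_power_op_def matrix_op_def)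

lemma tensor_End_simps:
  "F \<in> carrier (tensor_End n r) \<longleftrightarrow> F \<in> tensor_power n r \<rightarrow>\<^sub>E tensor_power n r \<and>
    (\<forall>s \<in> tensor_power n r. \<forall>t \<in> tensor_power n r. F (\<lambda>i. s i + t i) = (\<lambda>i. F s i + F t i)) \<and>
    (\<forall>c. \<forall>t \<in> tensor_power n r. F (\<lambda>i. c * t i) = (\<lambda>i. c * F t i))"
  "F \<otimes>\<^bsub>tensor_End n r\<^esub> G = compose (tensor_power n r) F G"
  "\<one>\<^bsub>tensor_End n r\<^esub> = (\<lambda>t\<in>tensor_power n r. t)"
  "\<zero>\<^bsub>tensor_End n r\<^esub> = (\<lambda>t\<in>tensor_power n r. (\<lambda>i. 0))"
  "F \<oplus>\<^bsub>tensor_End n r\<^esub> G = (\<lambda>t\<in>tensor_power n r. (\<lambda>i. F t i + G t i))"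
  "c \<odot>\<^bsub>tensor_End n r\<^esub> F = (\<lambda>t\<in>tensor_power n r. (\<lambda>i. c * F t i))"
  by (simp_all add: tensor_End_def Let_def)

lemma tensor_power_closed:
  "s \<in> tensor_power n r \<Longrightarrow> t \<in> tensor_power n r \<Longrightarrow> (\<lambda>i. s i + t i) \<in> tensor_power n r"
  "t \<in> tensor_power n r \<Longrightarrow> (\<lambda>i. c * t i) \<in> tensor_power n r"
  "(\<lambda>i. 0) \<in> tensor_power n r"
  by (simp_all add: tensor_power_def)

lemma tensor_End_apply:
  "F \<in> carrier (tensor_End n r) \<Longrightarrow> t \<in> tensor_power n r \<Longrightarrow> F t \<in> tensor_power n r"
  "F \<in> carrier (tensor_End n r) \<Longrightarrow> s \<in> tensor_power n r \<Longrightarrow> t \<in> tensor_power n r \<Longrightarrow>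
    F (\<lambda>i. s i + t i) = (\<lambda>i. F s i + F t i)"
  "F \<in> carrier (tensor_End n r) \<Longrightarrow> t \<in> tensor_power n r \<Longrightarrow> F (\<lambda>i. c * t i) = (\<lambda>i. c * F t i)"
  unfolding tensor_End_simps by (blast intro: PiE_mem)+

lemma tensor_End_eqI:
  assumes "F \<in> carrier (tensor_End n r)" "G \<in> carrier (tensor_End n r)"
    "\<And>t i. t \<in> tensor_power n r \<Longrightarrow> F t i = G t i"
  shows "F = G"
proof (rule PiE_ext)
  show "F \<in> tensor_power n r \<rightarrow>\<^sub>E tensor_power n r" "G \<in> tensor_power n r \<rightarrow>\<^sub>E tensor_power n r"
    using assms(1,2) unfolding tensor_End_simps by blast+
  show "F t = G t" if "t \<in> tensor_power n r" for t using assms(3)[OF that] by (rule ext)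
qed

lemma tensor_End_scalar_module: "scalar_module (tensor_End n r :: ('k::field, 'k tensor_op) module)"
proof -
  let ?E = "tensor_End n r :: ('k, 'k tensor_op) module" and ?T =
      "tensor_power n r :: (nat list \<Rightarrow> 'k) set"
  have closedI: "(\<lambda>t\<in>?T. H t) \<in> carrier ?E"
    if "\<And>t. t \<in> ?T \<Longrightarrow> H t \<in> ?T"
      "\<And>s t. s \<in> ?T \<Longrightarrow> t \<in> ?T \<Longrightarrow> H (\<lambda>i. s i + t i) = (\<lambda>i. H s i + H t i)"
      "\<And>c t. t \<in> ?T \<Longrightarrow> H (\<lambda>i. c * t i) = (\<lambda>i. c * H t i)" for H
    using that by (simp add: tensor_End_simps(1) tensor_power_closed)
  have add: "F \<oplus>\<^bsub>?E\<^esub> G \<in> carrier ?E" if "F \<in> carrier ?E" "G \<in> carrier ?E" for F G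
    unfolding tensor_End_simps(5)
    by (rule closedI) (simp_all add: tensor_End_apply[OF that(1)] tensor_End_apply[OF that(2)]
        tensor_power_closed algebra_simps)
  have smult: "c \<odot>\<^bsub>?E\<^esub> F \<in> carrier ?E" if "F \<in> carrier ?E" for c F
    unfolding tensor_End_simps(6)
    by (rule closedI) (simp_all add: tensor_End_apply[OF that] tensor_power_closed algebra_simps)
  have zero: "\<zero>\<^bsub>?E\<^esub> \<in> carrier ?E"
    unfolding tensor_End_simps(4) by (rule closedI) (simp_all add: tensor_power_closed)
  have "abelian_group ?E"
  proof (rule abelian_groupI)
    fix F assume F: "F \<in> carrier ?E"
    show "\<exists>G\<in>carrier ?E. G \<oplus>\<^bsub>?E\<^esub> F = \<zero>\<^bsub>?E\<^esub>"
      by (rule bexI[OF _ smult[OF F, of "- 1"]]) (simp add: tensor_End_simps cong: restrict_cong)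
    show "\<zero>\<^bsub>?E\<^esub> \<oplus>\<^bsub>?E\<^esub> F = F"
      by (rule tensor_End_eqI[OF add[OF zero F] F]) (simp add: tensor_End_simps)
    fix G assume G: "G \<in> carrier ?E"
    show "F \<oplus>\<^bsub>?E\<^esub> G = G \<oplus>\<^bsub>?E\<^esub> F" by (simp add: tensor_End_simps add.commute)
    fix H assume H: "H \<in> carrier ?E"
    show "F \<oplus>\<^bsub>?E\<^esub> G \<oplus>\<^bsub>?E\<^esub> H = F \<oplus>\<^bsub>?E\<^esub> (G \<oplus>\<^bsub>?E\<^esub> H)"
      by (rule tensor_End_eqI[OF add[OF add[OF F G] H] add[OF F add[OF G H]]])
        (simp add: tensor_End_simps add.assoc)
  qed (simp_all add: add zero)
  then interpret abelian_group ?E .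
  show ?thesis
  proof unfold_locales
    fix F G c d assume F: "F \<in> carrier ?E"
    show "c \<odot>\<^bsub>?E\<^esub> F \<in> carrier ?E" by (rule smult[OF F])
    show "(c + d) \<odot>\<^bsub>?E\<^esub> F = c \<odot>\<^bsub>?E\<^esub> F \<oplus>\<^bsub>?E\<^esub> d \<odot>\<^bsub>?E\<^esub> F"
      by (rule tensor_End_eqI[OF smult[OF F] add[OF smult[OF F] smult[OF F]]])
        (simp add: tensor_End_simps distrib_right)
    show "(c * d) \<odot>\<^bsub>?E\<^esub> F = c \<odot>\<^bsub>?E\<^esub> (d \<odot>\<^bsub>?E\<^esub> F)"
      by (rule tensor_End_eqI[OF smult[OF F] smult[OF smult[OF F]]])
        (simp add: tensor_End_simps mult.assoc)
    show "1 \<odot>\<^bsub>?E\<^esub> F = F"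
      by (rule tensor_End_eqI[OF smult[OF F] F]) (simp add: tensor_End_simps)
    assume G: "G \<in> carrier ?E"
    show "c \<odot>\<^bsub>?E\<^esub> (F \<oplus>\<^bsub>?E\<^esub> G) = c \<odot>\<^bsub>?E\<^esub> F \<oplus>\<^bsub>?E\<^esub> c \<odot>\<^bsub>?E\<^esub> G"
      by (rule tensor_End_eqI[OF smult[OF add[OF F G]] add[OF smult[OF F] smult[OF G]]])
        (simp add: tensor_End_simps distrib_left)
  qed
qed

lemma matrix_op_in_tensor_power:
  "t \<in> tensor_power n r \<Longrightarrow> matrix_op n r M t \<in> tensor_power n r"
  by (simp add: matrix_op_def tensor_power_def)

lemma matrix_op_closed: "matrix_op n r M \<in> carrier (tensor_End n r)"
  by (auto simp: tensor_End_simps(1) matrix_op_def tensor_power_def fun_eq_iff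
      distrib_left sum.distrib sum_distrib_left mult_ac)

lemma matrix_op_cong:
  "(\<And>I J. I \<in> multi_indices n r \<Longrightarrow> J \<in> multi_indices n r \<Longrightarrow> M I J = M' I J) \<Longrightarrow>
   matrix_op n r M = matrix_op n r M'"
  unfolding matrix_op_def by (intro restrict_ext ext) simp

lemma matrix_op_eq_iff:
  "matrix_op n r M = matrix_op n r M' \<longleftrightarrow>
   (\<forall>I\<in>multi_indices n r. \<forall>J\<in>multi_indices n r. M I J = M' I J)"
proof
  assume eq: "matrix_op n r M = matrix_op n r M'"
  show "\<forall>I\<in>multi_indices n r. \<forall>J\<in>multi_indices n r. M I J = M' I J"
  proof (intro ballI)
    fix I J assume I: "I \<in> multi_indices n r" and J: "J \<in> multi_indices n r"
    let ?d = "\<lambda>K. if K = J then 1 else 0 :: 'a"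
    have d: "?d \<in> tensor_power n r" using J by (auto simp: tensor_power_def)
    have "matrix_op n r N ?d I = N I J" for N
    proof -
      have "matrix_op n r N ?d I = (\<Sum>K\<in>multi_indices n r. N I K * ?d K)"
        using d I by (simp add: matrix_op_def)
      also have "\<dots> = (\<Sum>K\<in>multi_indices n r. if K = J then N I J else 0)"
        by (rule sum.cong) auto
      also have "\<dots> = N I J" using J by (simp add: finite_multi_indices)
      finally show ?thesis .
    qed
    from this[of M] this[of M'] show "M I J = M' I J" unfolding eq by simp
  qed
qed (use matrix_op_cong in blast)

lemma matrix_op_add:
  "matrix_op n r M \<oplus>\<^bsub>tensor_End n r\<^esub> matrix_op n r M' = matrix_op n r (\<lambda>I J. M I J + M' I J)"
  unfolding tensor_End_simps matrix_op_def
  by (intro restrict_ext ext) (simp add: distrib_right sum.distrib)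

lemma matrix_op_smult:
  "c \<odot>\<^bsub>tensor_End n r\<^esub> matrix_op n r M = matrix_op n r (\<lambda>I J. c * M I J)"
  unfolding tensor_End_simps matrix_op_def
  by (intro restrict_ext ext) (simp add: sum_distrib_left mult.assoc)

lemma matrix_op_zero: "\<zero>\<^bsub>tensor_End n r\<^esub> = matrix_op n r (\<lambda>I J. 0)"
  unfolding tensor_End_simps matrix_op_def by (intro restrict_ext ext) simp

lemma matrix_op_one: "\<one>\<^bsub>tensor_End n r\<^esub> = matrix_op n r (\<lambda>I J. if I = J then 1 else 0)"
  unfolding tensor_End_simps matrix_op_def
proof (intro restrict_ext ext)
  fix t :: "nat list \<Rightarrow> 'a" and i assume t: "t \<in> tensor_power n r"
  have "(\<Sum>j\<in>multi_indices n r. (if i = j then 1 else 0) * t j) = (\<Sum>j\<in>multi_indices n r. if i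
      = j then t j else 0)"
    by (rule sum.cong) auto
  then show "t i = (if i \<in> multi_indices n r then \<Sum>j\<in>multi_indices n r. (if i = j then 1 else 0)
      * t j else 0)"
    using t by (simp add: finite_multi_indices tensor_power_def)
qed

lemma matrix_op_mult:
  "matrix_op n r M \<otimes>\<^bsub>tensor_End n r\<^esub> matrix_op n r M'
    = matrix_op n r (\<lambda>I J. \<Sum>K\<in>multi_indices n r. M I K * M' K J)"
proof -
  have "matrix_op n r M (matrix_op n r M' t) i
      = (if i \<in> multi_indices n r then \<Sum>j\<in>multi_indices n r. (\<Sum>K\<in>multi_indices n r. M i K * M' K j)
          * t j else 0)"
    if t: "t \<in> tensor_power n r" for t i
  proof -
    have "(\<Sum>K\<in>multi_indices n r. M i K * (\<Sum>j\<in>multi_indices n r. M' K j * t j))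
        = (\<Sum>K\<in>multi_indices n r. \<Sum>j\<in>multi_indices n r. M i K * M' K j * t j)"
      by (simp add: sum_distrib_left mult.assoc)
    also have "\<dots> = (\<Sum>j\<in>multi_indices n r. \<Sum>K\<in>multi_indices n r. M i K * M' K j * t j)"
      by (rule sum.swap)
    finally have eq: "(\<Sum>K\<in>multi_indices n r. M i K * (\<Sum>j\<in>multi_indices n r. M' K j * t j))
        = (\<Sum>j\<in>multi_indices n r. (\<Sum>K\<in>multi_indices n r. M i K * M' K j) * t j)"
      by (simp add: sum_distrib_right)
    have t': "matrix_op n r M' t \<in> tensor_power n r" by (rule matrix_op_in_tensor_power[OF t])
    have "matrix_op n r M (matrix_op n r M' t) i
        = (if i \<in> multi_indices n r then \<Sum>K\<in>multi_indices n r. M i K * matrix_op n r M' t K else 0)"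
      using t' by (simp add: matrix_op_def[of n r M])
    also have "(\<Sum>K\<in>multi_indices n r. M i K * matrix_op n r M' t K)
        = (\<Sum>K\<in>multi_indices n r. M i K * (\<Sum>j\<in>multi_indices n r. M' K j * t j))"
      using t by (intro sum.cong refl) (simp add: matrix_op_def)
    finally show ?thesis unfolding eq .
  qed
  then show ?thesis
    unfolding tensor_End_simps compose_def matrix_op_def[of n r "\<lambda>I J. \<Sum>K\<in>multi_indices n r. M I K
        * M' K J"]
    by (intro restrict_ext ext)
qed

subsection \<open>Interpolation\<close>

text \<open>
  Over an infinite field, every finitely supported functional on exponents is a combination of
  evaluations \<open>e \<mapsto> s ^ e\<close> at non-zero points: the coefficients come from the Lagrange basis
  polynomials.
\<close>

lemma power_interpolation:
  fixes \<phi> :: "nat \<Rightarrow> 'k::field"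
  assumes inf: "infinite (UNIV :: 'k set)"
  obtains S \<alpha> where "finite S" "0 \<notin> S" "\<And>e. e < D \<Longrightarrow> (\<Sum>s\<in>S. \<alpha> s * s ^ e) = \<phi> e"
proof -
  have "infinite (UNIV - {0 :: 'k})" using inf by simp
  then obtain S :: "'k set" where S: "finite S" "card S = D" "S \<subseteq> UNIV - {0}"
    using infinite_arbitrarily_large by blast
  define l where "l s = (\<Prod>u\<in>S - {s}. smult (1 / (s - u)) [:- u, 1:])" for s
  have l: "poly (l s) v = (if v = s then 1 else 0)" if "s \<in> S" "v \<in> S" for s v
  proof (cases "v = s")
    case True
    have "poly (l s) s = (\<Prod>u\<in>S - {s}. 1)"
      unfolding l_def poly_prod by (rule prod.cong) (auto simp flip: diff_divide_distrib)
    then show ?thesis using True by simp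
  next
    case False
    then have "\<exists>u\<in>S - {s}. poly (smult (1 / (s - u)) [:- u, 1:]) v = 0" using that by auto
    then show ?thesis using False S(1) unfolding l_def poly_prod by simp
  qed
  have deg: "degree (l s) < D" if "s \<in> S" for s
  proof -
    have "degree (l s) \<le> (\<Sum>u\<in>S - {s}. degree (smult (1 / (s - u)) [:- u, 1:]))"
      using degree_prod_sum_le[of "S - {s}" "\<lambda>u. smult (1 / (s - u)) [:- u, 1:]"] S(1)
      by (simp add: l_def comp_def)
    also have "\<dots> \<le> (\<Sum>u\<in>S - {s}. 1)" by (rule sum_mono) (simp add: degree_smult_le)
    also have "\<dots> = D - 1" using S that by simp
    finally show ?thesis using S that card_gt_0_iff[of S] by fastforce
  qed
  have interp: "(\<Sum>s\<in>S. smult (s ^ e) (l s)) = monom 1 e" if "e < D" for e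
  proof (rule poly_eqI_degree[of S])
    fix v assume v: "v \<in> S"
    have "poly (\<Sum>s\<in>S. smult (s ^ e) (l s)) v = (\<Sum>s\<in>S. if s = v then v ^ e else 0)"
      unfolding poly_sum by (rule sum.cong) (use v l in auto)
    then show "poly (\<Sum>s\<in>S. smult (s ^ e) (l s)) v = poly (monom 1 e) v"
      using v S(1) by (simp add: poly_monom)
  next
    have "degree (\<Sum>s\<in>S. smult (s ^ e) (l s)) \<le> D - 1"
    proof (rule degree_sum_le[OF S(1)])
      fix s assume "s \<in> S"
      then show "degree (smult (s ^ e) (l s)) \<le> D - 1"
        using deg[of s] degree_smult_le[of "s ^ e" "l s"] by simp
    qed
    then show "degree (\<Sum>s\<in>S. smult (s ^ e) (l s)) < card S" using S(2) that by simp
    show "degree (monom (1::'k) e) < card S" using S(2) that by (simp add: degree_monom_eq)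
  qed
  define \<alpha> where "\<alpha> s = (\<Sum>d<D. \<phi> d * coeff (l s) d)" for s
  have "(\<Sum>s\<in>S. \<alpha> s * s ^ e) = \<phi> e" if "e < D" for e
  proof -
    have "(\<Sum>s\<in>S. \<alpha> s * s ^ e) = (\<Sum>s\<in>S. \<Sum>d<D. \<phi> d * coeff (smult (s ^ e) (l s)) d)"
      by (simp add: \<alpha>_def sum_distrib_left mult_ac)
    also have "\<dots> = (\<Sum>d<D. \<phi> d * coeff (\<Sum>s\<in>S. smult (s ^ e) (l s)) d)"
      by (subst sum.swap) (simp add: coeff_sum sum_distrib_left)
    also have "\<dots> = (\<Sum>d<D. if d = e then \<phi> d else 0)"
      unfolding interp[OF that] by (rule sum.cong) auto
    also have "\<dots> = \<phi> e" using that by simp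
    finally show ?thesis .
  qed
  then show ?thesis using that[of S \<alpha>] S by blast
qed

text \<open>
  Uniqueness of the expansion in base \<open>N\<close>.
\<close>

lemma digits_unique:
  fixes N :: nat
  assumes "(\<Sum>x<m. d x * N ^ x) = (\<Sum>x<m. d' x * N ^ x)"
    and "\<And>x. d x < N" "\<And>x. d' x < N" "x < m"
  shows "d x = d' x"
  using assms
proof (induction m arbitrary: d d' x)
  case (Suc m)
  have N: "N > 0" using Suc.prems(2)[of 0] by simp
  have step: "(\<Sum>x<Suc m. f x * N ^ x) = f 0 + N * (\<Sum>x<m. f (Suc x) * N ^ x)" for f
    by (simp add: sum.lessThan_Suc_shift sum_distrib_left mult_ac del: sum.lessThan_Suc)
  have eq: "d 0 + N * (\<Sum>x<m. d (Suc x) * N ^ x) = d' 0 + N * (\<Sum>x<m. d' (Suc x) * N ^ x)"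
    using Suc.prems(1) unfolding step .
  then have "(d 0 + N * (\<Sum>x<m. d (Suc x) * N ^ x)) mod N = (d' 0 + N * (\<Sum>x<m. d' (Suc x) * N ^ x))
      mod N"
    by simp
  then have d0: "d 0 = d' 0" using Suc.prems(2)[of 0] Suc.prems(3)[of 0] by simp
  then have "(\<Sum>x<m. d (Suc x) * N ^ x) = (\<Sum>x<m. d' (Suc x) * N ^ x)" using eq N by simp
  from Suc.IH[OF this] have "d (Suc y) = d' (Suc y)" if "y < m" for y
    using Suc.prems(2,3) that by simp
  then show ?case using d0 Suc.prems(4) by (cases x) auto
qed simp

subsection \<open>A description by pair counts\<close>

definition weakly_raised :: "nat list \<Rightarrow> nat list \<Rightarrow> bool" where
  "weakly_raised I J \<longleftrightarrow> (\<forall>p<length J. I ! p \<le> J ! p)"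

text \<open>
  The operators whose matrix entry at \<open>(I, J)\<close> depends only on the pair counts and vanishes
  unless \<open>I \<le> J\<close>: the span of the basis elements \<open>\<xi>\<^bsub>I,J\<^esub>\<close>, \<open>I \<le> J\<close>, of the Schur algebra.
\<close>

definition count_op :: "nat \<Rightarrow> nat \<Rightarrow> ((nat \<Rightarrow> nat \<Rightarrow> nat) \<Rightarrow> 'k::field) \<Rightarrow> 'k tensor_op" where
  "count_op n r c = matrix_op n r (\<lambda>I J. if weakly_raised I J then c (pair_count I J) else 0)"

lemma multi_indices_nth: "I \<in> multi_indices n r \<Longrightarrow> p < r \<Longrightarrow> I ! p < n"
  using nth_mem[of p I] unfolding multi_indices_def by blast

lemma prod_by_pair_counts:
  fixes f :: "nat \<Rightarrow> nat \<Rightarrow> 'k::comm_monoid_mult"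
  assumes I: "I \<in> multi_indices n r" and J: "J \<in> multi_indices n r"
  shows "(\<Prod>p<r. f (I ! p) (J ! p)) = (\<Prod>a<n. \<Prod>b<n. f a b ^ pair_count I J a b)"
proof -
  have len: "length J = r" using J by (rule multi_indices_length)
  have "(\<Prod>p<r. f (I ! p) (J ! p))
      = (\<Prod>x\<in>{..<n} \<times> {..<n}. \<Prod>p\<in>{p \<in> {..<r}. (I ! p, J ! p) = x}. f (I ! p) (J ! p))"
    by (rule prod.group[symmetric]) (use multi_indices_nth[OF I] multi_indices_nth[OF J] in auto)
  also have "\<dots> = (\<Prod>x\<in>{..<n} \<times> {..<n}. f (fst x) (snd x) ^ pair_count I J (fst x) (snd x))"
  proof (rule prod.cong[OF refl])
    fix x :: "nat \<times> nat"
    have "{p \<in> {..<r}. (I ! p, J ! p) = x} = {p. p < length J \<and> I ! p = fst x \<and> J ! p = snd x}"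
      by (auto simp: len)
    moreover have "(\<Prod>p\<in>{p \<in> {..<r}. (I ! p, J ! p) = x}. f (I ! p) (J ! p))
        = (\<Prod>p\<in>{p \<in> {..<r}. (I ! p, J ! p) = x}. f (fst x) (snd x))"
      by (rule prod.cong) auto
    ultimately show "(\<Prod>p\<in>{p \<in> {..<r}. (I ! p, J ! p) = x}. f (I ! p) (J ! p))
        = f (fst x) (snd x) ^ pair_count I J (fst x) (snd x)"
      by (simp add: pair_count_def)
  qed
  finally show ?thesis by (simp add: prod.cartesian_product case_prod_beta)
qed

lemma pair_count_outside:
  assumes "I \<in> multi_indices n r" "J \<in> multi_indices n r" "\<not> (a < n \<and> b < n)"
  shows "pair_count I J a b = 0"
proof -
  have "{p. p < length J \<and> I ! p = a \<and> J ! p = b} = {}"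
    using assms multi_indices_nth[OF assms(1)] multi_indices_nth[OF assms(2)]
      multi_indices_length[OF assms(2)] by auto
  then show ?thesis by (simp add: pair_count_def)
qed

lemma pair_count_le: "pair_count I J a b \<le> length J"
proof -
  have "card {p. p < length J \<and> I ! p = a \<and> J ! p = b} \<le> card {..<length J}"
    by (rule card_mono) auto
  then show ?thesis by (simp add: pair_count_def)
qed

text \<open>
  The entry of \<open>g\<^sup>\<otimes>\<^sup>r\<close> is a product of entries of \<open>g\<close>, grouped by equal factors. It vanishes
  if it contains an entry below the diagonal.
\<close>

lemma triangular_tensor_power_op:
  fixes g :: "'k::field mat"
  assumes g: "g \<in> carrier_mat n n" "upper_triangular g"
  shows "tensor_power_op n r g = count_op n r (\<lambda>m. \<Prod>a<n. \<Prod>b<n. g $$ (a, b) ^ m a b)"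
  unfolding tensor_power_op_conv count_op_def
proof (rule matrix_op_cong)
  fix I J assume I: "I \<in> multi_indices n r" and J: "J \<in> multi_indices n r"
  show "(\<Prod>k<r. g $$ (I ! k, J ! k))
      = (if weakly_raised I J then \<Prod>a<n. \<Prod>b<n. g $$ (a, b) ^ pair_count I J a b else 0)"
  proof (cases "weakly_raised I J")
    case True
    then show ?thesis using prod_by_pair_counts[OF I J, of "\<lambda>a b. g $$ (a, b)"] by simp
  next
    case False
    then obtain p where p: "p < r" "J ! p < I ! p"
      using multi_indices_length[OF J] by (auto simp: weakly_raised_def not_le)
    then have "g $$ (I ! p, J ! p) = 0"
      using g multi_indices_nth[OF I p(1)] by (auto simp: upper_triangular_def)
    then show ?thesis using False p(1) by (auto intro: prod_zero)
  qed
qed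

lemma count_op_add: "count_op n r c \<oplus>\<^bsub>tensor_End n r\<^esub> count_op n r d = count_op n r (\<lambda>m. c m + d m)"
  unfolding count_op_def matrix_op_add by (rule matrix_op_cong) simp

lemma count_op_smult: "a \<odot>\<^bsub>tensor_End n r\<^esub> count_op n r c = count_op n r (\<lambda>m. a * c m)"
  unfolding count_op_def matrix_op_smult by (rule matrix_op_cong) simp

lemma count_op_zero: "\<zero>\<^bsub>tensor_End n r\<^esub> = count_op n r (\<lambda>m. 0)"
  unfolding count_op_def matrix_op_zero by (rule matrix_op_cong) simp

text \<open>
  One-parameter families suffice: in the matrix with entries \<open>t ^ N ^ (a n + b)\<close>, where
  \<open>N > r\<close>, different pair counts contribute different powers of \<open>t\<close>.
\<close>

lemma count_op_in_span:
  fixes c :: "(nat \<Rightarrow> nat \<Rightarrow> nat) \<Rightarrow> 'k::field"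
  assumes inf: "infinite (UNIV :: 'k set)"
  shows "count_op n r c \<in> lin_span (tensor_End n r) (tensor_power_op n r ` {g
      \<in> GL n. upper_triangular g})"
    (is "_ \<in> lin_span ?E ?X")
proof -
  interpret E: scalar_module ?E by (rule tensor_End_scalar_module)
  \<comment> \<open>pair counts are at most \<open>r\<close>, so they are digits in base \<open>N\<close>\<close>
  define N where "N = Suc r"
  define e where "e I J = (\<Sum>p<r. N ^ (I ! p * n + J ! p))" for I J :: "nat list"
  have e_digits: "e I J = (\<Sum>x<n * n. pair_count I J (x div n) (x mod n) * N ^ x)"
    if I: "I \<in> multi_indices n r" and J: "J \<in> multi_indices n r" for I J
  proof -
    have len: "length J = r" using J by (rule multi_indices_length)
    have "e I J = (\<Sum>x<n * n. \<Sum>p\<in>{p \<in> {..<r}. I ! p * n + J ! p = x}. N ^ (I ! p * n + J ! p))"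
      unfolding e_def
    proof (rule sum.group[symmetric])
      show "(\<lambda>p. I ! p * n + J ! p) ` {..<r} \<subseteq> {..<n * n}"
      proof clarsimp
        fix p assume "p < r"
        then have "I ! p < n" "J ! p < n" using multi_indices_nth[OF I] multi_indices_nth[OF J]
          by auto
        then have "I ! p * n + J ! p < (I ! p + 1) * n" "(I ! p + 1) * n \<le> n * n"
          using mult_le_mono1[of "I ! p + 1" n n] by simp_all
        then show "I ! p * n + J ! p < n * n" by linarith
      qed
    qed auto
    also have "\<dots> = (\<Sum>x<n * n. pair_count I J (x div n) (x mod n) * N ^ x)"
    proof (rule sum.cong[OF refl])
      fix x assume x: "x \<in> {..<n * n}"
      have "{p \<in> {..<r}. I ! p * n + J ! p = x} = {p. p < length J \<and> I ! p = x div n \<and> J ! p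
          = x mod n}"
      proof -
        have "(I ! p * n + J ! p) div n = I ! p" "(I ! p * n + J ! p) mod n = J ! p" if "p < r"
            for p
          using multi_indices_nth[OF J that] by simp_all
        then show ?thesis by (auto simp: len)
      qed
      moreover have "(\<Sum>p\<in>{p \<in> {..<r}. I ! p * n + J ! p = x}. N ^ (I ! p * n + J ! p))
          = (\<Sum>p\<in>{p \<in> {..<r}. I ! p * n + J ! p = x}. N ^ x)"
        by (rule sum.cong) auto
      ultimately show "(\<Sum>p\<in>{p \<in> {..<r}. I ! p * n + J ! p = x}. N ^ (I ! p * n + J ! p))
          = pair_count I J (x div n) (x mod n) * N ^ x"
        by (simp add: pair_count_def)
    qed
    finally show ?thesis .
  qed
  have e_inj: "pair_count I J = pair_count I' J'"
    if IJ: "I \<in> multi_indices n r" "J \<in> multi_indices n r" "I' \<in> multi_indices n r"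
        "J' \<in> multi_indices n r"
      and eq: "e I J = e I' J'" for I J I' J'
  proof (intro ext)
    fix a b
    have small: "pair_count I J i j < N" "pair_count I' J' i j < N" for i j
      using pair_count_le[of I J i j] pair_count_le[of I' J' i j]
        multi_indices_length[OF IJ(2)] multi_indices_length[OF IJ(4)] by (auto simp: N_def)
    show "pair_count I J a b = pair_count I' J' a b"
    proof (cases "a < n \<and> b < n")
      case True
      then have "a * n + b < (a + 1) * n" "(a + 1) * n \<le> n * n"
        using mult_le_mono1[of "a + 1" n n] by simp_all
      then have x: "a * n + b < n * n" by linarith
      have "pair_count I J ((a * n + b) div n) ((a * n + b) mod n)
          = pair_count I' J' ((a * n + b) div n) ((a * n + b) mod n)"
        by (rule digits_unique[OF _ _ _ x, where N = N])
          (use eq e_digits[OF IJ(1,2)] e_digits[OF IJ(3,4)] small in auto)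
      then show ?thesis using True by simp
    next
      case False
      then show ?thesis using pair_count_outside IJ by metis
    qed
  qed
  let ?P = "multi_indices n r \<times> multi_indices n r"
  \<comment> \<open>the coefficient as a function of the exponent that encodes the pair counts\<close>
  define \<phi> where "\<phi> d = c (let x = (SOME x. x \<in> ?P \<and> e (fst x) (snd x) = d) in pair_count (fst x)
      (snd x))" for d
  have \<phi>: "\<phi> (e I J) = c (pair_count I J)" if IJ: "I \<in> multi_indices n r" "J \<in> multi_indices n r"
      for I J
  proof -
    let ?x = "SOME x. x \<in> ?P \<and> e (fst x) (snd x) = e I J"
    have "?x \<in> ?P \<and> e (fst ?x) (snd ?x) = e I J"
      by (rule someI[of _ "(I, J)"]) (use IJ in simp)
    then have "pair_count (fst ?x) (snd ?x) = pair_count I J"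
      using e_inj[of "fst ?x" "snd ?x" I J] IJ by (auto simp: mem_Times_iff)
    then show ?thesis by (simp add: \<phi>_def Let_def)
  qed
  \<comment> \<open>a bound for all exponents that occur\<close>
  define D where "D = Suc (Max (insert 0 ((\<lambda>x. e (fst x) (snd x)) ` ?P)))"
  have D: "e I J < D" if "I \<in> multi_indices n r" "J \<in> multi_indices n r" for I J
    unfolding D_def less_Suc_eq_le
    by (rule Max_ge) (use that finite_multi_indices in \<open>auto intro!: image_eqI[of _ _ "(I, J)"]\<close>)
  obtain S \<alpha> where S: "finite S" "0 \<notin> S" "\<And>d. d < D \<Longrightarrow> (\<Sum>s\<in>S. \<alpha> s * s ^ d) = \<phi> d"
    using power_interpolation[OF inf] by blast
  define g where "g s = mat n n (\<lambda>(a, b). if a \<le> b then s ^ (N ^ (a * n + b)) else 0)" for s :: 'k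
  have g: "g s \<in> carrier_mat n n" "upper_triangular (g s)" for s by (auto simp: g_def)
  have GL: "g s \<in> GL n" if "s \<in> S" for s
  proof -
    have "det (g s) = prod_list (diag_mat (g s))" by (rule det_upper_triangular[OF g(2,1)])
    moreover have "0 \<notin> set (diag_mat (g s))"
      using that S(2) by (auto simp: diag_mat_def g_def)
    ultimately have "det (g s) \<noteq> 0" by (simp add: prod_list_zero_iff)
    then have "g s \<in> Units (ring_mat TYPE('k) n ())" by (rule det_non_zero_imp_unit[OF g(1)])
    then obtain B where "B \<in> carrier_mat n n" "B * g s = 1\<^sub>m n" "g s * B = 1\<^sub>m n"
      unfolding Units_def ring_mat_simps by blast
    then have "invertible_mat (g s)"
      using g(1)[of s] by (auto simp: invertible_mat_def inverts_mat_def)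
    then show ?thesis using g(1) by (simp add: GL_def)
  qed
  have gop: "tensor_power_op n r (g s) = matrix_op n r (\<lambda>I J. if weakly_raised I J then s ^ e I J
      else 0)" for s
    unfolding triangular_tensor_power_op[OF g] count_op_def
  proof (rule matrix_op_cong)
    fix I J assume IJ: "I \<in> multi_indices n r" "J \<in> multi_indices n r"
    have "(\<Prod>a<n. \<Prod>b<n. g s $$ (a, b) ^ pair_count I J a b) = s ^ e I J" if "weakly_raised I J"
    proof -
      have "(\<Prod>a<n. \<Prod>b<n. g s $$ (a, b) ^ pair_count I J a b) = (\<Prod>p<r. g s $$ (I ! p, J ! p))"
        using prod_by_pair_counts[OF IJ, of "\<lambda>a b. g s $$ (a, b)"] by simp
      also have "\<dots> = (\<Prod>p<r. s ^ (N ^ (I ! p * n + J ! p)))"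
        using that multi_indices_nth[OF IJ(1)] multi_indices_nth[OF IJ(2)] multi_indices_length[OF
            IJ(2)]
        by (intro prod.cong) (auto simp: g_def weakly_raised_def)
      finally show ?thesis by (simp add: e_def power_sum)
    qed
    then show "(if weakly_raised I J then \<Prod>a<n. \<Prod>b<n. g s $$ (a, b) ^ pair_count I J a b else 0)
        = (if weakly_raised I J then s ^ e I J else 0)" by simp
  qed
  have "matrix_op n r (\<lambda>I J. \<Sum>s\<in>T. \<alpha> s * (if weakly_raised I J then s ^ e I J else 0)) \<in> lin_span ?E
      ?X"
    if "finite T" "T \<subseteq> S" for T
    using that
  proof (induction T)
    case empty
    then show ?case using E.lin_span_zero[of ?X] by (simp add: matrix_op_zero)
  next
    case (insert s T)
    have "matrix_op n r (\<lambda>I J. \<Sum>s\<in>insert s T. \<alpha> s * (if weakly_raised I J then s ^ e I J else 0))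
        = \<alpha> s \<odot>\<^bsub>?E\<^esub> tensor_power_op n r (g s)
          \<oplus>\<^bsub>?E\<^esub> matrix_op n r (\<lambda>I J. \<Sum>s\<in>T. \<alpha> s * (if weakly_raised I J then s ^ e I J else 0))"
      unfolding gop matrix_op_smult matrix_op_add by (simp only: sum.insert[OF insert.hyps])
    moreover have "tensor_power_op n r (g s) \<in> ?X" using GL g insert.prems by auto
    ultimately show ?case using insert
      by (simp only: E.lin_span_add E.lin_span_smult_base insert_subset)
  qed
  from this[OF S(1) order_refl]
  have "matrix_op n r (\<lambda>I J. \<Sum>s\<in>S. \<alpha> s * (if weakly_raised I J then s ^ e I J else 0)) \<in> lin_span ?E
      ?X" .
  also have "matrix_op n r (\<lambda>I J. \<Sum>s\<in>S. \<alpha> s * (if weakly_raised I J then s ^ e I J else 0))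
      = count_op n r c"
    unfolding count_op_def
  proof (rule matrix_op_cong)
    fix I J assume IJ: "I \<in> multi_indices n r" "J \<in> multi_indices n r"
    show "(\<Sum>s\<in>S. \<alpha> s * (if weakly_raised I J then s ^ e I J else 0))
        = (if weakly_raised I J then c (pair_count I J) else 0)"
      using S(3)[OF D[OF IJ]] by (simp add: \<phi>[OF IJ])
  qed
  finally show ?thesis .
qed

lemma carrier_borel_schur_algebra:
  assumes "infinite (UNIV :: 'k::field set)"
  shows "carrier (borel_schur_algebra n r :: ('k, 'k tensor_op) module) = range (count_op n r)"
proof -
  let ?E = "tensor_End n r :: ('k, 'k tensor_op) module"
  let ?X = "tensor_power_op n r ` {g \<in> GL n. upper_triangular g} :: 'k tensor_op set"
  interpret E: scalar_module ?E by (rule tensor_End_scalar_module)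
  have X: "?X \<subseteq> carrier ?E" by (auto simp: tensor_power_op_conv matrix_op_closed)
  have "x \<in> range (count_op n r)" if "x \<in> lin_span ?E ?X" for x
    using X that
  proof (induction rule: E.lin_span_induct)
    case zero show ?case unfolding count_op_zero by blast
  next
    case (base a x)
    then obtain g where "g \<in> GL n" "upper_triangular g" "x = tensor_power_op n r g" by blast
    then show ?case by (simp add: GL_def triangular_tensor_power_op count_op_smult)
  next
    case (add x y)
    then obtain c d where "x = count_op n r c" "y = count_op n r d" by blast
    then show ?case by (simp add: count_op_add)
  qed
  moreover have "carrier (borel_schur_algebra n r :: ('k, 'k tensor_op) module) = lin_span ?E ?X"
    by (simp add: borel_schur_algebra_def)
  ultimately show ?thesis using count_op_in_span[OF assms, of n r] by blast
qed

lemma borel_schur_algebra_simps: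
  "F \<otimes>\<^bsub>borel_schur_algebra n r\<^esub> G = F \<otimes>\<^bsub>tensor_End n r\<^esub> G"
  "F \<oplus>\<^bsub>borel_schur_algebra n r\<^esub> G = F \<oplus>\<^bsub>tensor_End n r\<^esub> G"
  "\<one>\<^bsub>borel_schur_algebra n r\<^esub> = \<one>\<^bsub>tensor_End n r\<^esub>"
  "c \<odot>\<^bsub>borel_schur_algebra n r\<^esub> F = c \<odot>\<^bsub>tensor_End n r\<^esub> F"
  by (simp_all add: borel_schur_algebra_def schur_algebra_def)

section \<open>Monomials that leave the set of compositions\<close>

lemma root_list_split:
  "root_list n = filter (\<lambda>x. j < snd x) (root_list n) @ filter (\<lambda>x. snd x \<le> j) (root_list n)"
proof (induction n)
  case 0 then show ?case by (simp add: root_list_def)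
next
  case (Suc n)
  let ?b = "map (\<lambda>i. (i, n)) (rev [0..<n])"
  show ?case
  proof (cases "j < n")
    case True
    then have "filter (\<lambda>x. j < snd x) ?b = ?b" "filter (\<lambda>x. snd x \<le> j) ?b = []"
      by (auto simp: filter_empty_conv filter_id_conv)
    then show ?thesis using Suc.IH
      by (simp only: root_list_Suc filter_append append_Nil append_assoc)
  next
    case False
    have "snd x < n" if "x \<in> set (root_list n)" for x
      using that by (auto simp: set_root_list root_indices_def)
    then have "filter (\<lambda>x. j < snd x) (root_list (Suc n)) = []"
      "filter (\<lambda>x. snd x \<le> j) (root_list (Suc n)) = root_list (Suc n)"
      using False by (force simp: root_list_Suc filter_empty_conv filter_id_conv)+
    then show ?thesis by simp
  qed
qed

text \<open>A monomial is the product of its factors \<open>e\<^bsub>ib\<^esub>\<close> with \<open>b > j\<close> and those with \<open>b \<le> j\<close>.\<close>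

lemma kostant_monomial_split:
  "kostant_monomial n k = kostant_monomial n (\<lambda>a b. if j < b then k a b else 0)
    \<otimes>\<^bsub>kostant_C n\<^esub> kostant_monomial n (\<lambda>a b. if b \<le> j then k a b else 0)"
proof -
  interpret U: scalar_algebra "kostant_C n" by (rule enveloping_algebra)
  let ?op = "\<lambda>k xs. foldr (\<lambda>(i, j) y. divided_power n i j (k i j) \<otimes>\<^bsub>kostant_C n\<^esub> y) xs \<one>\<^bsub>kostant_C n\<^esub>"
  have closed: "?op k xs \<in> carrier (kostant_C n)" if "set xs \<subseteq> root_indices n" for k xs
    by (rule ordered_product_closed[OF that])
  have app: "?op k (xs @ ys) = ?op k xs \<otimes>\<^bsub>kostant_C n\<^esub> ?op k ys"
    if "set xs \<subseteq> root_indices n" "set ys \<subseteq> root_indices n" for k xs ys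
    using that
  proof (induction xs)
    case Nil then show ?case using closed[OF Nil(2)]
      by (simp only: append_Nil foldr_Nil id_apply U.l_one)
  next
    case (Cons x xs)
    obtain i j where x: "x = (i, j)" by fastforce
    have "(i, j) \<in> root_indices n" "set xs \<subseteq> root_indices n" using Cons.prems by (auto simp: x)
    then show ?case using Cons closed divided_power_closed[of i j n "k i j"]
      by (simp add: x U.m_assoc)
  qed
  have cong: "?op k xs = ?op k' xs" if "\<And>a b. (a, b) \<in> set xs \<Longrightarrow> k a b = k' a b" for k k' xs
    by (rule foldr_cong[OF refl refl]) (use that in auto)
  have one: "?op (\<lambda>a b. 0) xs = \<one>\<^bsub>kostant_C n\<^esub>" if "set xs \<subseteq> root_indices n" for xs
    using that
    by (induction xs) (auto simp: divided_power_def U.smult_one)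
  let ?xs = "filter (\<lambda>x. j < snd x) (root_list n)" and ?ys = "filter (\<lambda>x. snd x \<le> j) (root_list n)"
  let ?P = "\<lambda>a b. if j < b then k a b else 0" and ?Q = "\<lambda>a b. if b \<le> j then k a b else 0"
  have sub: "set ?xs \<subseteq> root_indices n" "set ?ys \<subseteq> root_indices n" by (auto simp: set_root_list)
  have mono: "kostant_monomial n k' = ?op k' ?xs \<otimes>\<^bsub>kostant_C n\<^esub> ?op k' ?ys" for k'
    unfolding kostant_monomial_def by (subst root_list_split[of n j]) (rule app[OF sub])
  have "?op ?P ?xs = ?op k ?xs" "?op ?Q ?ys = ?op k ?ys" by (rule cong, simp)+
  moreover have "?op ?P ?ys = ?op (\<lambda>a b. 0) ?ys" "?op ?Q ?xs = ?op (\<lambda>a b. 0) ?xs"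
    by (rule cong, simp)+
  ultimately have "kostant_monomial n ?P = ?op k ?xs" "kostant_monomial n ?Q = ?op k ?ys"
    using mono[of ?P] mono[of ?Q] one[OF sub(1)] one[OF sub(2)] closed[OF sub(1), of k]
        closed[OF sub(2), of k]
    by (simp_all only: U.r_one U.l_one)
  then show ?thesis using mono[of k] by simp
qed

lemma K_entry_monomial_split:
  fixes k :: "nat \<Rightarrow> nat \<Rightarrow> nat"
  defines "hi j \<equiv> \<lambda>a b. if j < b then k a b else 0" and "lo j \<equiv> \<lambda>a b. if b \<le> j then k a b else 0"
  shows "(K_entry n (K_monomial n k) I J :: 'k::field)
    = (\<Sum>K\<in>multi_indices n (length J). K_entry n (K_monomial n (hi j)) I K * K_entry n (K_monomial n
        (lo j)) K J)"
proof (cases "same_shape n I J")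
  case True
  then have J: "J \<in> multi_indices n (length J)" by (simp add: same_shape_def)
  have "int_entry n (kostant_monomial n k) I J
      = (\<Sum>K\<in>multi_indices n (length J). int_entry n (kostant_monomial n (hi j)) I K * int_entry n
          (kostant_monomial n (lo j)) K J)"
    unfolding kostant_monomial_split[of n k j] hi_def lo_def
    using int_entry_mult[OF kostant_Z_monomial kostant_Z_monomial J] unfolding kostant_Z_simps
      by blast
  from arg_cong[OF this, of "of_int :: int \<Rightarrow> 'k"]
  have "of_bool (raises (root_list n) k I J)
      = (\<Sum>K\<in>multi_indices n (length J). of_bool (raises (root_list n) (hi j) I K) * of_bool
          (raises (root_list n) (lo j) K J) :: 'k)"
    by (simp add: int_entry_monomial)
  also have "\<dots> = (\<Sum>K\<in>multi_indices n (length J). K_entry n (K_monomial n (hi j)) I K * K_entry n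
      (K_monomial n (lo j)) K J)"
  proof (rule sum.cong[OF refl])
    fix K assume "K \<in> multi_indices n (length J)"
    then have "same_shape n I K" "same_shape n K J" using same_shape_split[of K n J I] True by auto
    then show "of_bool (raises (root_list n) (hi j) I K) * of_bool (raises (root_list n) (lo j) K J)
        = (K_entry n (K_monomial n (hi j)) I K * K_entry n (K_monomial n (lo j)) K J :: 'k)"
      by (simp add: K_entry_monomial)
  qed
  finally show ?thesis using True by (simp add: K_entry_monomial)
next
  case False
  have "K_entry n (K_monomial n (hi j)) I K * K_entry n (K_monomial n (lo j)) K J = (0 :: 'k)"
    if "K \<in> multi_indices n (length J)" for K
    using same_shape_split[OF that, of I] False by (auto simp: K_entry_monomial)
  then have "(\<Sum>K\<in>multi_indices n (length J). K_entry n (K_monomial n (hi j)) I K * K_entry n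
      (K_monomial n (lo j)) K J) = (0 :: 'k)"
    by (rule sum.neutral[OF ballI])
  then show ?thesis using False by (simp add: K_entry_monomial)
qed

text \<open>
  Of the factors that are kept, those that change the coordinate \<open>j\<close> of the weight all consume
  letters \<open>j\<close>.
\<close>

lemma kostant_degree_lower:
  assumes j: "j < n"
  shows "kostant_degree n (\<lambda>a b. if b \<le> j then k a b else 0) $ j = - int (\<Sum>a<j. k a j)"
proof -
  have "kostant_degree n (\<lambda>a b. if b \<le> j then k a b else 0) $ j
      = (\<Sum>b<n. \<Sum>a<b. int (if b \<le> j then k a b else 0) * ((unit_vec n a - unit_vec n b) $ j))"
    using j by (simp add: kostant_degree_def)
  also have "\<dots> = (\<Sum>b<n. if b = j then - (\<Sum>a<j. int (k a j)) else 0)"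
  proof (rule sum.cong[OF refl])
    fix b assume b: "b \<in> {..<n}"
    have "(\<Sum>a<b. int (if b \<le> j then k a b else 0) * ((unit_vec n a - unit_vec n b) $ j))
        = (\<Sum>a<b. if b = j then - int (k a j) else 0)"
      by (rule sum.cong[OF refl]) (use j b in auto)
    then show "(\<Sum>a<b. int (if b \<le> j then k a b else 0) * ((unit_vec n a - unit_vec n b) $ j))
        = (if b = j then - (\<Sum>a<j. int (k a j)) else 0)"
      by (simp add: sum_negf)
  qed
  finally show ?thesis using j by simp
qed

section \<open>The homomorphism to the Borel subalgebra\<close>

lemma finite_compositions: "finite (compositions n r)"
proof (rule finite_subset)
  let ?L = "{l :: int list. set l \<subseteq> {0..int r} \<and> length l = n}"
  show "finite (vec_of_list ` ?L)" by (intro finite_imageI finite_lists_length_eq) simp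
  show "compositions n r \<subseteq> vec_of_list ` ?L"
  proof
    fix z assume z: "z \<in> compositions n r"
    then have d: "z \<in> carrier_vec n" and pos: "\<And>i. i < n \<Longrightarrow> 0 \<le> z $ i" and s: "(\<Sum>i<n. z $ i) = int r"
      by (auto simp: compositions_def)
    have "z $ i \<le> int r" if "i < n" for i
      unfolding s[symmetric] by (rule member_le_sum) (use that pos in auto)
    then have "list_of_vec z \<in> ?L" using d pos by (auto simp: set_list_of_vec vec_set_def)
    moreover have "z = vec_of_list (list_of_vec z)" by (simp add: vec_list)
    ultimately show "z \<in> vec_of_list ` ?L" by blast
  qed
qed

lemma compositions_carrier: "\<nu> \<in> compositions n r \<Longrightarrow> \<nu> \<in> carrier_vec n" for \<nu>
  by (simp add: compositions_def)

lemma sum_pair_count_diag: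
  assumes J: "J \<in> multi_indices n r" shows "(\<Sum>a<n. pair_count J J a a) = r"
proof -
  have len: "length J = r" by (rule multi_indices_length[OF J])
  have "(\<Sum>p<r. 1) = (\<Sum>a<n. \<Sum>p\<in>{p \<in> {..<r}. J ! p = a}. 1)"
    by (rule sum.group[symmetric]) (use multi_indices_nth[OF J] in auto)
  also have "\<dots> = (\<Sum>a<n. pair_count J J a a)"
  proof (rule sum.cong[OF refl])
    fix a
    have "{p \<in> {..<r}. J ! p = a} = {p. p < length J \<and> J ! p = a \<and> J ! p = a}" using len by auto
    then show "(\<Sum>p\<in>{p \<in> {..<r}. J ! p = a}. 1) = pair_count J J a a" by (simp add: pair_count_def)
  qed
  finally show ?thesis by simp
qed

lemma weight_composition: "J \<in> multi_indices n r \<Longrightarrow> weight n J \<in> compositions n r"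
  using sum_pair_count_diag[of J n r]
  by (simp add: compositions_def weight_carrier) (simp add: weight_def flip: of_nat_sum)

lemma weight_shift_cancel: "weight n J + weight_diff n K J = weight n K"
  by (rule eq_vecI) (auto simp: weight_diff_def weight_def)

text \<open>
  Hence the weight of \<open>J\<close> is a function of the pair counts, as \<open>skew_op_in_count_ops\<close> requires.
\<close>

lemma weight_column_sums:
  assumes I: "I \<in> multi_indices n r" and J: "J \<in> multi_indices n r"
  shows "weight n J = vec n (\<lambda>a. int (\<Sum>i<n. pair_count I J i a))"
proof (rule eq_vecI)
  fix a assume "a < dim_vec (vec n (\<lambda>a. int (\<Sum>i<n. pair_count I J i a)))"
  then have a: "a < n" by simp
  have len: "length J = r" by (rule multi_indices_length[OF J])
  have "pair_count J J a a = (\<Sum>p\<in>{p \<in> {..<r}. J ! p = a}. 1)"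
  proof -
    have "{p \<in> {..<r}. J ! p = a} = {p. p < length J \<and> J ! p = a \<and> J ! p = a}" using len by auto
    then show ?thesis by (simp add: pair_count_def)
  qed
  also have "\<dots> = (\<Sum>i<n. \<Sum>p\<in>{p \<in> {p \<in> {..<r}. J ! p = a}. I ! p = i}. 1)"
    by (rule sum.group[symmetric]) (use multi_indices_nth[OF I] in auto)
  also have "\<dots> = (\<Sum>i<n. pair_count I J i a)"
  proof (rule sum.cong[OF refl])
    fix i
    have "{p \<in> {p \<in> {..<r}. J ! p = a}. I ! p = i} = {p. p < length J \<and> I ! p = i \<and> J ! p = a}"
      using len by auto
    then show "(\<Sum>p\<in>{p \<in> {p \<in> {..<r}. J ! p = a}. I ! p = i}. 1) = pair_count I J i a"
      by (simp add: pair_count_def)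
  qed
  finally show "weight n J $ a = vec n (\<lambda>a. int (\<Sum>i<n. pair_count I J i a)) $ a"
    using a by (simp add: weight_def)
qed (simp add: weight_def)

lemma raises_root_list_iff:
  assumes "I \<in> multi_indices n r" "J \<in> multi_indices n r"
  shows "raises (root_list n) k I J \<longleftrightarrow>
    weakly_raised I J \<and> (\<forall>(i, j)\<in>root_indices n. pair_count I J i j = k i j)"
proof -
  have "length I = length J" using assms by (simp add: multi_indices_def)
  moreover have "I ! p = J ! p \<or> (I ! p, J ! p) \<in> root_indices n \<longleftrightarrow> I ! p \<le> J ! p"
    if "p < length J" for p
    using that multi_indices_nth[OF assms(2)] multi_indices_length[OF assms(2)]
    by (auto simp: root_indices_def)
  ultimately show ?thesis by (auto simp: raises_def set_root_list weakly_raised_def)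
qed

lemma pair_count_below_diagonal:
  assumes "weakly_raised I J" "j < i" shows "pair_count I J i j = 0"
proof -
  have "{p. p < length J \<and> I ! p = i \<and> J ! p = j} = {}" using assms
    by (auto simp: weakly_raised_def)
  then show ?thesis by (simp add: pair_count_def)
qed

text \<open>
  For \<open>I \<le> J\<close>, the counts above the diagonal and the weight of \<open>J\<close> determine all pair counts.
\<close>

lemma pair_count_determined:
  assumes I: "I \<in> multi_indices n r" and J: "J \<in> multi_indices n r"
    and I': "I' \<in> multi_indices n r" and J': "J' \<in> multi_indices n r"
    and tri: "weakly_raised I J" "weakly_raised I' J'"
    and roots: "\<forall>(i, j)\<in>root_indices n. pair_count I J i j = pair_count I' J' i j"
    and wt: "weight n J = weight n J'"
  shows "pair_count I J = pair_count I' J'"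
proof (intro ext)
  fix i j
  show "pair_count I J i j = pair_count I' J' i j"
  proof (cases "i < n \<and> j < n")
    case False then show ?thesis using pair_count_outside[OF I J] pair_count_outside[OF I' J']
      by simp
  next
    case True
    have off: "pair_count I J a j = pair_count I' J' a j" if "a \<noteq> j" for a
      using that roots True pair_count_below_diagonal[OF tri(1), of j a]
        pair_count_below_diagonal[OF tri(2), of j a]
      by (cases "a < j") (auto simp: root_indices_def)
    have "(\<Sum>a<n. pair_count I J a j) = (\<Sum>a<n. pair_count I' J' a j)"
    proof -
      have "int (\<Sum>a<n. pair_count I J a j) = weight n J $ j"
        unfolding weight_column_sums[OF I J] using True by simp
      also have "\<dots> = int (\<Sum>a<n. pair_count I' J' a j)"
        unfolding wt weight_column_sums[OF I' J'] using True by simp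
      finally show ?thesis by (simp only: of_nat_eq_iff)
    qed
    moreover have "(\<Sum>a<n. f a) = f j + (\<Sum>a\<in>{..<n} - {j}. f a)" for f :: "nat \<Rightarrow> nat"
      using True by (simp add: sum.remove)
    moreover have "(\<Sum>a\<in>{..<n} - {j}. pair_count I J a j) = (\<Sum>a\<in>{..<n} - {j}. pair_count I' J' a j)"
      by (rule sum.cong) (use off in auto)
    ultimately have "pair_count I J j j = pair_count I' J' j j" by simp
    then show ?thesis using off by (cases "i = j") auto
  qed
qed

text \<open>
  On tensors the function \<open>b\<close> in \<open>a \<otimes> b\<close> acts on a word through its weight. So the operator of an
  element of the skew product is obtained by choosing the weight of the word as the point.
\<close>

definition weight_entry :: "nat \<Rightarrow> 'k::field skew \<Rightarrow> nat list \<Rightarrow> nat list \<Rightarrow> 'k" where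
  "weight_entry n x I J = skew_entry n x I J (weight n J)"

definition skew_op :: "nat \<Rightarrow> nat \<Rightarrow> 'k::field skew \<Rightarrow> 'k tensor_op" where
  "skew_op n r x = matrix_op n r (weight_entry n x)"

definition delta :: "int vec \<Rightarrow> 'k::field \<Rightarrow> int vec \<Rightarrow> 'k" where
  "delta \<mu> c = (\<lambda>z. if z = \<mu> then c else 0)"

lemma delta_closed: "\<mu> \<in> carrier_vec n \<Longrightarrow> delta \<mu> c \<in> carrier (weight_functions n)"
  by (auto simp: delta_def weight_functions_simps)

context
  fixes n r :: nat
begin

lemma kostant_K_one_closed: "\<one>\<^bsub>kostant_K n\<^esub> \<in> carrier (kostant_K n :: ('k::field, 'k kostant_ext)
    module)"
proof -
  interpret A: scalar_algebra "kostant_K n :: ('k, 'k kostant_ext) module"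
    by (rule kostant_K_algebra)
  show ?thesis by (rule A.one_closed)
qed

lemma weight_functions_one_closed: "\<one>\<^bsub>weight_functions n\<^esub> \<in> carrier (weight_functions n)"
  by (simp add: weight_functions_simps)

lemma skew_entry_one:
  "skew_entry n \<one>\<^bsub>skew_product n\<^esub> I J z = of_bool (same_shape n I J \<and> I = J \<and> z \<in> carrier_vec n)"
  by (simp add: skew_product_one skew_entry_pure kostant_K_one_closed weight_functions_one_closed
      K_entry_one weight_functions_simps)

lemma weight_entry_mult:
  assumes "x \<in> carrier (skew_product n)" "y \<in> carrier (skew_product n)" "J \<in> multi_indices n r"
  shows "weight_entry n (x \<otimes>\<^bsub>skew_product n\<^esub> y) I J = (\<Sum>K\<in>(multi_indices n r). weight_entry n x I K
      * weight_entry n y K J)"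
  using assms multi_indices_length[OF assms(3)]
  by (simp add: weight_entry_def skew_entry_mult weight_shift_cancel)

lemma skew_op_mult:
  assumes "x \<in> carrier (skew_product n)" "y \<in> carrier (skew_product n)"
  shows "skew_op n r (x \<otimes>\<^bsub>skew_product n\<^esub> y) = skew_op n r x \<otimes>\<^bsub>tensor_End n r\<^esub> skew_op n r y"
  unfolding skew_op_def matrix_op_mult
  by (rule matrix_op_cong) (rule weight_entry_mult[OF assms])

lemma skew_op_add:
  assumes "x \<in> carrier (skew_product n)" "y \<in> carrier (skew_product n)"
  shows "skew_op n r (x \<oplus>\<^bsub>skew_product n\<^esub> y) = skew_op n r x \<oplus>\<^bsub>tensor_End n r\<^esub> skew_op n r y"
  unfolding skew_op_def matrix_op_add weight_entry_def[abs_def]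
  by (rule matrix_op_cong) (rule skew_entry_add[OF assms])

lemma skew_op_smult:
  assumes "x \<in> carrier (skew_product n)"
  shows "skew_op n r (c \<odot>\<^bsub>skew_product n\<^esub> x) = c \<odot>\<^bsub>tensor_End n r\<^esub> skew_op n r x"
  unfolding skew_op_def matrix_op_smult weight_entry_def[abs_def]
  by (rule matrix_op_cong) (rule skew_entry_smult[OF assms])

lemma skew_op_one: "skew_op n r \<one>\<^bsub>skew_product n\<^esub> = \<one>\<^bsub>tensor_End n r\<^esub>"
  unfolding skew_op_def matrix_op_one
  by (rule matrix_op_cong)
    (auto simp: weight_entry_def skew_entry_one weight_carrier same_shape_self)

lemma skew_expansion:
  fixes x :: "'k::field skew"
  assumes "x \<in> carrier (skew_product n)"
  obtains S b where "finite S" "S \<subseteq> exponents n" "\<And>k. b k \<in> carrier (weight_functions n)"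
    "\<And>I J z. skew_entry n x I J z = (\<Sum>k\<in>S. K_entry n (K_monomial n k) I J * b k z)"
proof -
  have "\<exists>S b. finite S \<and> S \<subseteq> exponents n \<and> (\<forall>k. b k \<in> carrier (weight_functions n))
      \<and> (\<forall>k. k \<notin> S \<longrightarrow> b k = (\<lambda>z. 0)) \<and>
    (\<forall>I J z. skew_entry n x I J z = (\<Sum>k\<in>S. K_entry n (K_monomial n k) I J * b k z))"
    using assms
  proof (induction rule: skew_product_induct)
    case (pure a b)
    interpret A: scalar_algebra "kostant_K n :: ('k, 'k kostant_ext) module"
      by (rule kostant_K_algebra)
    obtain S c where S: "finite S" "S \<subseteq> exponents n"
        "a = finsum (kostant_K n) (\<lambda>k. c k \<odot>\<^bsub>kostant_K n\<^esub> K_monomial n k) S"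
      by (rule kostant_K_expansion[OF pure(1)])
    have "K_entry n a I J = (\<Sum>k\<in>S. c k * K_entry n (K_monomial n k) I J)" for I J
      unfolding S(3) using S(1)
      by (subst K_entry_finsum) (auto simp: K_entry_smult K_monomial_closed A.smult_closed)
    then have "skew_entry n (skew_pure n a b) I J z
        = (\<Sum>k\<in>S. K_entry n (K_monomial n k) I J * (if k \<in> S then c k * b z else 0))" for I J z
      by (simp add: skew_entry_pure[OF pure] sum_distrib_left sum_distrib_right mult_ac cong:
          sum.cong)
    then show ?case using S(1,2) pure(2)
      by (intro exI[of _ S] exI[of _ "\<lambda>k z. if k \<in> S then c k * b z else 0"])
        (auto simp: weight_functions_simps)
  next
    case (add x y)
    then obtain S b S' b' where
      S: "finite S" "S \<subseteq> exponents n" "\<And>k. b k \<in> carrier (weight_functions n)" "\<And>k. k \<notin> S \<Longrightarrow> b k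
          = (\<lambda>z. 0)"
        "\<And>I J z. skew_entry n x I J z = (\<Sum>k\<in>S. K_entry n (K_monomial n k) I J * b k z)" and
      S': "finite S'" "S' \<subseteq> exponents n" "\<And>k. b' k \<in> carrier (weight_functions n)" "\<And>k. k \<notin> S'
          \<Longrightarrow> b' k = (\<lambda>z. 0)"
        "\<And>I J z. skew_entry n y I J z = (\<Sum>k\<in>S'. K_entry n (K_monomial n k) I J * b' k z)"
      by blast
    let ?T = "S \<union> S'"
    have "skew_entry n x I J z = (\<Sum>k\<in>?T. K_entry n (K_monomial n k) I J * b k z)" for I J z
      unfolding S(5) by (rule sum.mono_neutral_left) (use S S' in auto)
    moreover have "skew_entry n y I J z = (\<Sum>k\<in>?T. K_entry n (K_monomial n k) I J * b' k z)"
        for I J z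
      unfolding S'(5) by (rule sum.mono_neutral_left) (use S S' in auto)
    ultimately have "skew_entry n (x \<oplus>\<^bsub>skew_product n\<^esub> y) I J z
        = (\<Sum>k\<in>?T. K_entry n (K_monomial n k) I J * (b k z + b' k z))" for I J z
      using add(1,2) by (simp add: skew_entry_add distrib_left sum.distrib)
    then show ?case using S(1-4) S'(1-4)
      by (intro exI[of _ ?T] exI[of _ "\<lambda>k z. b k z + b' k z"]) (auto simp: weight_functions_simps)
  next
    case (uminus x)
    then obtain S b where
      S: "finite S" "S \<subseteq> exponents n" "\<And>k. b k \<in> carrier (weight_functions n)" "\<And>k. k \<notin> S \<Longrightarrow> b k
          = (\<lambda>z. 0)"
        "\<And>I J z. skew_entry n x I J z = (\<Sum>k\<in>S. K_entry n (K_monomial n k) I J * b k z)"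
      by blast
    have "skew_entry n ((- 1) \<odot>\<^bsub>skew_product n\<^esub> x) I J z
        = (\<Sum>k\<in>S. K_entry n (K_monomial n k) I J * (- b k z))" for I J z
      using uminus(1) by (simp add: skew_entry_smult S(5) sum_negf)
    then show ?case using S(1-4)
      by (intro exI[of _ S] exI[of _ "\<lambda>k z. - b k z"]) (auto simp: weight_functions_simps)
  qed
  then obtain S b where S: "finite S" "S \<subseteq> exponents n" "\<forall>k. b k \<in> carrier (weight_functions n)"
    "\<forall>I J z. skew_entry n x I J z = (\<Sum>k\<in>S. K_entry n (K_monomial n k) I J * b k z)"
    by (elim exE conjE)
  show ?thesis by (rule that[OF S(1,2) S(3)[rule_format] S(4)[rule_format]])
qed

lemma skew_entry_finsum:
  fixes f :: "'s \<Rightarrow> 'k::field skew"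
  assumes "finite S" "f ` S \<subseteq> carrier (skew_product n)"
  shows "skew_entry n (finsum (skew_product n) f S) I J z = (\<Sum>s\<in>S. skew_entry n (f s) I J z)"
proof -
  interpret X: scalar_algebra "skew_product n :: ('k, 'k skew) module"
    by (rule skew_product_algebra)
  show ?thesis using assms
  proof (induction S)
    case (insert s S)
    then have "f s \<in> carrier (skew_product n)" "f \<in> S \<rightarrow> carrier (skew_product n)" by auto
    then show ?case using insert by (simp add: skew_entry_add)
  qed (simp add: skew_entry_zero)
qed

text \<open>
  The entries of \<open>e\<^sup>(\<^sup>k\<^sup>) \<otimes> b\<close> depend only on the pair counts above the diagonal and on the weight of
  the second word.
\<close>

lemma skew_op_in_count_ops:
  fixes x :: "'k::field skew"
  assumes x: "x \<in> carrier (skew_product n)" shows "skew_op n r x \<in> range (count_op n r)"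
proof -
  obtain S b where S: "finite S" "S \<subseteq> exponents n" "\<And>k. b k \<in> carrier (weight_functions n)"
    "\<And>I J z. skew_entry n x I J z = (\<Sum>k\<in>S. K_entry n (K_monomial n k) I J * b k z)"
    by (rule skew_expansion[OF x]) blast
  define c where "c m = (\<Sum>k\<in>S. of_bool (\<forall>(i, j)\<in>root_indices n. m i j = k i j) *
    b k (vec n (\<lambda>a. int (\<Sum>i<n. m i a))))" for m :: "nat \<Rightarrow> nat \<Rightarrow> nat"
  have "skew_op n r x = count_op n r c"
    unfolding skew_op_def count_op_def
  proof (rule matrix_op_cong)
    fix I J assume IJ: "I \<in> multi_indices n r" "J \<in> multi_indices n r"
    then have "same_shape n I J" using multi_indices_length[OF IJ(2)] by (simp add: same_shape_def)
    then show "weight_entry n x I J = (if weakly_raised I J then c (pair_count I J) else 0)"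
      unfolding weight_entry_def S(4) c_def weight_column_sums[OF IJ, symmetric]
      by (simp add: K_entry_monomial raises_root_list_iff[OF IJ])
  qed
  then show ?thesis by blast
qed

text \<open>
  The basis element with pair counts \<open>m\<close> is the image of \<open>e\<^sup>(\<^sup>m\<^sup>) \<otimes> \<chi>\<^sub>\<nu>\<close>, where \<open>\<nu>\<close> are the
  column sums of \<open>m\<close>: exponents and weight together determine the pair counts.
\<close>

lemma count_op_in_image:
  fixes c :: "(nat \<Rightarrow> nat \<Rightarrow> nat) \<Rightarrow> 'k::field"
  obtains x where "x \<in> carrier (skew_product n)" "skew_op n r x = count_op n r c"
proof -
  interpret X: scalar_algebra "skew_product n :: ('k, 'k skew) module"
    by (rule skew_product_algebra)
  let ?M = "{pair_count I J | I J. I \<in> multi_indices n r \<and> J \<in> multi_indices n r \<and> weakly_raised I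
      J}"
  have fin: "finite ?M"
  proof (rule finite_subset)
    show "?M \<subseteq> (\<lambda>x. pair_count (fst x) (snd x)) ` ((multi_indices n r) \<times> (multi_indices n r))"
      by force
    show "finite ((\<lambda>x. pair_count (fst x) (snd x)) ` ((multi_indices n r) \<times> (multi_indices n r)))"
      using finite_multi_indices by blast
  qed
  let ?\<nu> = "\<lambda>m. vec n (\<lambda>a. int (\<Sum>i<n. m i a))"
  let ?f = "\<lambda>m. skew_pure n (K_monomial n m) (delta (?\<nu> m) (c m)) :: 'k skew"
  have f: "?f m \<in> carrier (skew_product n)" for m
    by (intro skew_pure_closed K_monomial_closed delta_closed) simp
  have "skew_op n r (finsum (skew_product n) ?f ?M) = count_op n r c"
    unfolding skew_op_def count_op_def
  proof (rule matrix_op_cong)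
    fix I J assume IJ: "I \<in> multi_indices n r" "J \<in> multi_indices n r"
    then have sh: "same_shape n I J" using multi_indices_length[OF IJ(2)]
      by (simp add: same_shape_def)
    have "weight_entry n (finsum (skew_product n) ?f ?M) I J
        = (\<Sum>m\<in>?M. of_bool (raises (root_list n) m I J) * delta (?\<nu> m) (c m) (weight n J))"
      unfolding weight_entry_def using fin f
      by (subst skew_entry_finsum)
        (auto simp: skew_entry_pure K_monomial_closed delta_closed K_entry_monomial sh)
    also have "\<dots> = (\<Sum>m\<in>?M. if m = pair_count I J then (if weakly_raised I J then c m else 0) else
        0)"
    proof (rule sum.cong[OF refl])
      fix m assume "m \<in> ?M"
      then obtain I' J' where m: "m = pair_count I' J'" "I' \<in> multi_indices n r"
          "J' \<in> multi_indices n r" "weakly_raised I' J'" by blast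
      have "raises (root_list n) m I J \<and> weight n J = ?\<nu> m \<longleftrightarrow> weakly_raised I J \<and> m = pair_count I J"
      proof
        assume "raises (root_list n) m I J \<and> weight n J = ?\<nu> m"
        then have tri: "weakly_raised I J"
          and roots: "\<forall>(i, j)\<in>root_indices n. pair_count I J i j = pair_count I' J' i j"
          and wt: "weight n J = weight n J'"
          unfolding m(1) raises_root_list_iff[OF IJ] weight_column_sums[OF m(2,3)] by simp_all
        show "weakly_raised I J \<and> m = pair_count I J"
          using pair_count_determined[OF IJ m(2,3) tri m(4) roots wt] tri
            by (simp only: m(1) simp_thms)
      next
        assume r: "weakly_raised I J \<and> m = pair_count I J"
        have "raises (root_list n) (pair_count I J) I J"
          unfolding raises_root_list_iff[OF IJ] using r by blast
        then show "raises (root_list n) m I J \<and> weight n J = ?\<nu> m"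
          using weight_column_sums[OF IJ] r by simp
      qed
      then show "of_bool (raises (root_list n) m I J) * delta (?\<nu> m) (c m) (weight n J)
          = (if m = pair_count I J then (if weakly_raised I J then c m else 0) else 0)"
        by (auto simp: delta_def)
    qed
    also have "\<dots> = (if weakly_raised I J then c (pair_count I J) else 0)"
      using fin IJ by (auto simp: sum.delta)
    finally show "weight_entry n (finsum (skew_product n) ?f ?M) I J
        = (if weakly_raised I J then c (pair_count I J) else 0)" .
  qed
  moreover have "finsum (skew_product n) ?f ?M \<in> carrier (skew_product n)" using f
    by (intro X.finsum_closed) auto
  ultimately show ?thesis using that by blast
qed

section \<open>The kernel\<close>

abbreviation (input) \<Lambda> where "\<Lambda> \<equiv> compositions n r"
abbreviation (input) eb :: "'k::field skew" where "eb \<equiv> ebar n \<Lambda>"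
abbreviation (input) \<chi> :: "int vec \<Rightarrow> 'k::field" where "\<chi> \<equiv> \<lambda>z. if z \<in> \<Lambda> then 1 else 0"

lemma chi_closed: "\<chi> \<in> carrier (weight_functions n)"
  using compositions_carrier by (auto simp: weight_functions_simps)

lemma ebar_closed: "eb \<in> carrier (skew_product n :: ('k::field, 'k skew) module)"
proof -
  interpret X: scalar_algebra "skew_product n :: ('k, 'k skew) module"
    by (rule skew_product_algebra)
  show ?thesis unfolding ebar_def
    by (intro X.minus_closed X.one_closed skew_pure_closed kostant_K_one_closed chi_closed)
qed

lemma ebar_entry:
  "skew_entry n (eb :: 'k::field skew) I J z
    = of_bool (same_shape n I J \<and> I = J \<and> z \<in> carrier_vec n \<and> z \<notin> \<Lambda>)"
proof -
  interpret X: scalar_algebra "skew_product n :: ('k, 'k skew) module"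
    by (rule skew_product_algebra)
  have p: "skew_pure n \<one>\<^bsub>kostant_K n\<^esub> \<chi> \<in> carrier (skew_product n :: ('k, 'k skew) module)"
    by (intro skew_pure_closed kostant_K_one_closed chi_closed)
  have "(eb :: 'k skew) = \<one>\<^bsub>skew_product n\<^esub> \<oplus>\<^bsub>skew_product n\<^esub> ((- 1) \<odot>\<^bsub>skew_product n\<^esub> skew_pure n
      \<one>\<^bsub>kostant_K n\<^esub> \<chi>)"
    using p by (simp add: ebar_def a_minus_def X.smult_minus_left X.smult_one)
  then show ?thesis
    using p X.smult_closed[OF p, of "- 1"] compositions_carrier[of z n r]
    by (auto simp: skew_entry_add skew_entry_smult skew_entry_one skew_entry_pure
        kostant_K_one_closed
        chi_closed K_entry_one)
qed

text \<open>
  Entries at the weight are multiplicative, so those elements for which they vanish form an ideal.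
\<close>

lemma skew_kernel_ideal:
  "ideal {x \<in> carrier (skew_product n). \<forall>I\<in>(multi_indices n r). \<forall>J\<in>(multi_indices n r). weight_entry
      n x I J = 0} (skew_product n :: ('k::field, 'k skew) module)"
    (is "ideal ?K _")
proof -
  interpret X: scalar_algebra "skew_product n :: ('k, 'k skew) module"
    by (rule skew_product_algebra)
  show ?thesis
  proof (rule idealI[OF X.ring_axioms])
    show "subgroup ?K (add_monoid (skew_product n))"
    proof (rule X.add.subgroupI)
      have "\<zero>\<^bsub>skew_product n\<^esub> \<in> ?K" by (simp add: weight_entry_def skew_entry_zero)
      then show "?K \<noteq> {}" by blast
      fix x assume x: "x \<in> ?K"
      have "\<ominus>\<^bsub>skew_product n\<^esub> x = (- 1) \<odot>\<^bsub>skew_product n\<^esub> x" using x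
        by (simp add: X.smult_minus_left X.smult_one)
      then show "\<ominus>\<^bsub>skew_product n\<^esub> x \<in> ?K"
        using x X.smult_closed[of x "- 1"] by (simp add: weight_entry_def skew_entry_smult)
      fix y assume "y \<in> ?K"
      then show "x \<oplus>\<^bsub>skew_product n\<^esub> y \<in> ?K" using x by (simp add: weight_entry_def skew_entry_add)
    qed auto
    fix x y :: "'k skew" assume x: "x \<in> ?K" and y: "y \<in> carrier (skew_product n)"
    show "y \<otimes>\<^bsub>skew_product n\<^esub> x \<in> ?K" using x y by (simp add: weight_entry_mult)
    show "x \<otimes>\<^bsub>skew_product n\<^esub> y \<in> ?K" using x y by (simp add: weight_entry_mult)
  qed
qed

text \<open>
  The factors of the monomial that consume a letter up to \<open>j\<close> act first. They lead from the weight
  \<open>\<nu>\<close> to a weight \<open>\<mu>\<close> whose coordinate \<open>j\<close> is negative, for they consume more letters \<open>j\<close> than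
  \<open>\<nu>\<close> has and produce none. Hence the element factors through \<open>1 \<otimes> \<chi>\<^sub>\<mu>\<close>, which is a multiple of the
  generator of the ideal because \<open>\<mu>\<close> is not a composition.
\<close>

lemma invalid_in_ideal:
  fixes c :: "'k::field"
  assumes \<nu>: "\<nu> \<in> \<Lambda>" and j: "j < n" and inv: "\<nu> $ j < int (\<Sum>a<j. k a j)"
  shows "skew_pure n (K_monomial n k) (delta \<nu> c) \<in> Idl\<^bsub>skew_product n\<^esub> {eb}" (is "_ \<in> ?I")
proof -
  interpret X: scalar_algebra "skew_product n :: ('k, 'k skew) module"
    by (rule skew_product_algebra)
  interpret I: ideal ?I "skew_product n :: ('k, 'k skew) module"
    by (rule X.genideal_ideal) (use ebar_closed in blast)
  have eb: "eb \<in> ?I" using X.genideal_self[of "{eb}"] ebar_closed by blast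
  let ?P = "\<lambda>a b. if j < b then k a b else 0" and ?Q = "\<lambda>a b. if b \<le> j then k a b else 0"
  \<comment> \<open>the weight after the factors that act first\<close>
  define \<mu> where "\<mu> = \<nu> + kostant_degree n ?Q"
  have \<nu>c: "\<nu> \<in> carrier_vec n" by (rule compositions_carrier[OF \<nu>])
  have deg: "kostant_degree n ?Q \<in> carrier_vec n" by (simp add: kostant_degree_def)
  have \<mu>c: "\<mu> \<in> carrier_vec n" using \<nu>c deg by (simp add: \<mu>_def)
  have "\<mu> $ j < 0" using inv j \<nu>c deg kostant_degree_lower[OF j, of k]
    by (simp add: \<mu>_def kostant_degree_def[of n ?Q])
  then have \<mu>: "\<mu> \<notin> \<Lambda>" using j by (auto simp: compositions_def not_le)
  let ?m = "skew_pure n \<one>\<^bsub>kostant_K n\<^esub> (delta \<mu> c) :: 'k skew"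
  let ?p = "skew_pure n (K_monomial n ?P) \<one>\<^bsub>weight_functions n\<^esub> :: 'k skew"
  let ?q = "skew_pure n (K_monomial n ?Q) \<one>\<^bsub>weight_functions n\<^esub> :: 'k skew"
  have cl: "?m \<in> carrier (skew_product n)" "?p \<in> carrier (skew_product n)"
      "?q \<in> carrier (skew_product n)"
    by (intro skew_pure_closed kostant_K_one_closed K_monomial_closed weight_functions_one_closed
        delta_closed[OF \<mu>c])+
  \<comment> \<open>multiplication by the unit of the Kostant form selects the summand \<open>K = I\<close>\<close>
  have one_left: "(\<Sum>K\<in>multi_indices n (length J). K_entry n \<one>\<^bsub>kostant_K n\<^esub> I K * g K)
      = (if same_shape n I J then g I else 0)"
    if "\<And>K. \<not> same_shape n K J \<Longrightarrow> g K = 0" for I J and g :: "nat list \<Rightarrow> 'k"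
  proof -
    have "(\<Sum>K\<in>multi_indices n (length J). K_entry n \<one>\<^bsub>kostant_K n\<^esub> I K * g K)
        = (\<Sum>K\<in>multi_indices n (length J). if K = I then g I else 0)"
      by (rule sum.cong[OF refl]) (auto simp: K_entry_one same_shape_self)
    also have "\<dots> = (if I \<in> multi_indices n (length J) then g I else 0)"
      by (simp add: finite_multi_indices)
    also have "\<dots> = (if same_shape n I J then g I else 0)" using that[of I]
      by (auto simp: same_shape_def)
    finally show ?thesis .
  qed
  have "?m = ?m \<otimes>\<^bsub>skew_product n\<^esub> eb"
  proof (rule skew_entry_eqI[OF cl(1) X.m_closed[OF cl(1) ebar_closed]])
    fix I J z
    have "skew_entry n (?m \<otimes>\<^bsub>skew_product n\<^esub> eb) I J z = (\<Sum>K\<in>multi_indices n (length J).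
        K_entry n \<one>\<^bsub>kostant_K n\<^esub> I K * (delta \<mu> c (z + weight_diff n K J) *
          of_bool (same_shape n K J \<and> K = J \<and> z \<in> carrier_vec n \<and> z \<notin> \<Lambda>)))"
      unfolding skew_entry_mult[OF cl(1) ebar_closed] ebar_entry
        skew_entry_pure[OF kostant_K_one_closed delta_closed[OF \<mu>c]] mult.assoc ..
    also have "\<dots> = (if same_shape n I J then delta \<mu> c (z + weight_diff n I J) *
          of_bool (same_shape n I J \<and> I = J \<and> z \<in> carrier_vec n \<and> z \<notin> \<Lambda>) else 0)"
      by (rule one_left) simp
    also have "\<dots> = K_entry n \<one>\<^bsub>kostant_K n\<^esub> I J * delta \<mu> c z"
    proof -
      have "z + weight_diff n J J = z" if "z \<in> carrier_vec n"
        using that by (intro eq_vecI) (auto simp: weight_diff_def weight_def)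
      then show ?thesis using \<mu> \<mu>c by (auto simp: K_entry_one delta_def)
    qed
    finally show "skew_entry n ?m I J z = skew_entry n (?m \<otimes>\<^bsub>skew_product n\<^esub> eb) I J z"
      by (simp add: skew_entry_pure kostant_K_one_closed delta_closed[OF \<mu>c])
  qed
  then have m: "?m \<in> ?I" using I.I_l_closed[OF eb cl(1)] by simp
  have q: "skew_entry n (?m \<otimes>\<^bsub>skew_product n\<^esub> ?q) I J z = K_entry n (K_monomial n ?Q) I J * delta \<nu> c
      z" for I J z
  proof -
    have "skew_entry n (?m \<otimes>\<^bsub>skew_product n\<^esub> ?q) I J z = (\<Sum>K\<in>multi_indices n (length J). K_entry n
        \<one>\<^bsub>kostant_K n\<^esub> I K *
        (delta \<mu> c (z + weight_diff n K J) * (K_entry n (K_monomial n ?Q) K J * \<one>\<^bsub>weight_functions n\<^esub>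
            z)))"
      using cl by (simp only: skew_entry_mult skew_entry_pure kostant_K_one_closed delta_closed[OF
          \<mu>c]
          K_monomial_closed weight_functions_one_closed mult.assoc)
    also have "\<dots> = (if same_shape n I J then
        delta \<mu> c (z + weight_diff n I J) * (K_entry n (K_monomial n ?Q) I J * \<one>\<^bsub>weight_functions n\<^esub>
            z) else 0)"
      by (rule one_left) (simp add: K_entry_monomial)
    also have "\<dots> = K_entry n (K_monomial n ?Q) I J * delta \<nu> c z"
    proof (cases "same_shape n I J \<and> raises (root_list n) ?Q I J \<and> z \<in> carrier_vec n")
      case True
      then have wd: "weight_diff n I J = kostant_degree n ?Q" using raises_weight_diff by blast
      have "z + kostant_degree n ?Q = \<mu> \<longleftrightarrow> z = \<nu>"
      proof
        assume eq: "z + kostant_degree n ?Q = \<mu>"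
        show "z = \<nu>"
        proof (rule eq_vecI)
          fix i assume "i < dim_vec \<nu>"
          then show "z $ i = \<nu> $ i"
            using arg_cong[OF eq, of "\<lambda>v. v $ i"] \<nu>c deg unfolding \<mu>_def by simp
        qed (use True \<nu>c in auto)
      qed (simp add: \<mu>_def)
      then show ?thesis using True wd by (simp add: delta_def weight_functions_simps)
    next
      case False
      then show ?thesis using \<nu>c by (auto simp: K_entry_monomial weight_functions_simps delta_def)
    qed
    finally show ?thesis .
  qed
  have "skew_pure n (K_monomial n k) (delta \<nu> c) = ?p \<otimes>\<^bsub>skew_product n\<^esub> (?m \<otimes>\<^bsub>skew_product n\<^esub> ?q)"
  proof (rule skew_entry_eqI)
    show "skew_pure n (K_monomial n k) (delta \<nu> c) \<in> carrier (skew_product n)"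
      by (intro skew_pure_closed K_monomial_closed delta_closed[OF \<nu>c])
    show "?p \<otimes>\<^bsub>skew_product n\<^esub> (?m \<otimes>\<^bsub>skew_product n\<^esub> ?q) \<in> carrier (skew_product n)" using cl
      by (intro X.m_closed)
    fix I J z
    have "skew_entry n (?p \<otimes>\<^bsub>skew_product n\<^esub> (?m \<otimes>\<^bsub>skew_product n\<^esub> ?q)) I J z
        = (\<Sum>K\<in>multi_indices n (length J).
        K_entry n (K_monomial n ?P) I K * \<one>\<^bsub>weight_functions n\<^esub> (z + weight_diff n K J) *
            (K_entry n (K_monomial n ?Q) K J * delta \<nu> c z))"
      unfolding skew_entry_mult[OF cl(2) X.m_closed[OF cl(1,3)]] q
      by (simp only: skew_entry_pure K_monomial_closed weight_functions_one_closed)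
    also have "\<dots> = (\<Sum>K\<in>multi_indices n (length J).
        K_entry n (K_monomial n ?P) I K * K_entry n (K_monomial n ?Q) K J * delta \<nu> c z)"
      by (rule sum.cong[OF refl])
        (use \<nu>c weight_diff_carrier in \<open>auto simp: delta_def weight_functions_simps\<close>)
    also have "\<dots> = K_entry n (K_monomial n k) I J * delta \<nu> c z"
      unfolding K_entry_monomial_split[of n k I J j] by (simp only: sum_distrib_right)
    finally show "skew_entry n (skew_pure n (K_monomial n k) (delta \<nu> c)) I J z
        = skew_entry n (?p \<otimes>\<^bsub>skew_product n\<^esub> (?m \<otimes>\<^bsub>skew_product n\<^esub> ?q)) I J z"
      by (simp only: skew_entry_pure[OF K_monomial_closed delta_closed[OF \<nu>c]])
  qed
  then show ?thesis using I.I_l_closed[OF I.I_r_closed[OF m cl(3)] cl(2)] by simp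
qed

text \<open>
  If the weight \<open>\<nu>\<close> has enough letters of each kind, then the exponents above the diagonal and
  the unchanged letters on the diagonal form a matrix of pair counts with column sums \<open>\<nu>\<close>.
\<close>

lemma valid_words:
  assumes k: "k \<in> exponents n" and \<nu>: "\<nu> \<in> \<Lambda>"
    and valid: "\<And>j. j < n \<Longrightarrow> int (\<Sum>a<j. k a j) \<le> \<nu> $ j"
  obtains I J where "I \<in> multi_indices n r" "J \<in> multi_indices n r" "weight n J = \<nu>"
    "\<And>k'. k' \<in> exponents n \<Longrightarrow> raises (root_list n) k' I J \<longleftrightarrow> k' = k"
proof -
  define m where "m i j = (if i < j then k i j else if i = j then nat (\<nu> $ j) - (\<Sum>a<j. k a j) else
      0)" for i j
  have col: "(\<Sum>i<n. m i j) = nat (\<nu> $ j)" if j: "j < n" for j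
  proof -
    have "(\<Sum>i<n. m i j) = (\<Sum>i\<in>insert j {..<j}. m i j)"
      by (rule sum.mono_neutral_right) (use j in \<open>auto simp: m_def\<close>)
    also have "\<dots> = m j j + (\<Sum>a<j. m a j)" by simp
    also have "(\<Sum>a<j. m a j) = (\<Sum>a<j. k a j)" by (rule sum.cong) (auto simp: m_def)
    also have "m j j = nat (\<nu> $ j) - (\<Sum>a<j. k a j)" by (simp add: m_def)
    also have "\<dots> + (\<Sum>a<j. k a j) = nat (\<nu> $ j)" using valid[OF j] by linarith
    finally show ?thesis .
  qed
  obtain I J where w: "length I = length J" "length J = (\<Sum>i<n. \<Sum>j<n. m i j)"
    "set I \<subseteq> {..<n}" "set J \<subseteq> {..<n}"
    "\<And>i j. i < n \<Longrightarrow> j < n \<Longrightarrow> pair_count I J i j = m i j"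
    "\<And>p. p < length J \<Longrightarrow> m (I ! p) (J ! p) \<noteq> 0"
    by (rule words_with_pair_counts[where n = n and m = m]) blast
  have "int (\<Sum>i<n. \<Sum>j<n. m i j) = (\<Sum>j<n. \<nu> $ j)"
  proof -
    have "(\<Sum>i<n. \<Sum>j<n. m i j) = (\<Sum>j<n. \<Sum>i<n. m i j)" by (rule sum.swap)
    also have "\<dots> = (\<Sum>j<n. nat (\<nu> $ j))" by (rule sum.cong) (simp_all add: col)
    finally show ?thesis using \<nu> by (simp add: compositions_def)
  qed
  moreover have "(\<Sum>j<n. \<nu> $ j) = int r" using \<nu> by (simp add: compositions_def)
  ultimately have "int (length J) = int r" unfolding w(2) by (rule trans)
  then have "length J = r" by (simp only: of_nat_eq_iff)
  then have IJ: "I \<in> multi_indices n r" "J \<in> multi_indices n r" using w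
    by (auto simp: multi_indices_def)
  have "weight n J = \<nu>"
  proof (rule eq_vecI)
    show "dim_vec (weight n J) = dim_vec \<nu>" using compositions_carrier[OF \<nu>]
      by (simp add: weight_def)
    fix j assume "j < dim_vec \<nu>"
    then have j: "j < n" using compositions_carrier[OF \<nu>] by simp
    have "weight n J $ j = int (\<Sum>i<n. pair_count I J i j)"
      unfolding weight_column_sums[OF IJ] using j by simp
    also have "(\<Sum>i<n. pair_count I J i j) = (\<Sum>i<n. m i j)" by (rule sum.cong) (use w(5) j in auto)
    finally show "weight n J $ j = \<nu> $ j" using col[OF j] \<nu> j by (simp add: compositions_def)
  qed
  moreover have tri: "weakly_raised I J"
    unfolding weakly_raised_def
  proof (intro allI impI, rule ccontr)
    fix p assume "p < length J" "\<not> I ! p \<le> J ! p"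
    then show False using w(6)[of p] by (simp add: m_def)
  qed
  have "raises (root_list n) k' I J \<longleftrightarrow> k' = k" if k': "k' \<in> exponents n" for k'
  proof -
    have "raises (root_list n) k' I J \<longleftrightarrow> (\<forall>(i, j)\<in>root_indices n. k i j = k' i j)"
      unfolding raises_root_list_iff[OF IJ] using tri w(5) by (auto simp: root_indices_def m_def)
    also have "\<dots> \<longleftrightarrow> k' = k" using exponents_eqI[OF k k'] by auto
    finally show ?thesis .
  qed
  ultimately show ?thesis using that IJ by blast
qed

text \<open>
  Modulo the ideal the element \<open>x\<close> agrees with \<open>x (1 \<otimes> \<chi>)\<close>, a finite sum of terms
  \<open>c (e\<^sup>(\<^sup>k\<^sup>) \<otimes> \<chi>\<^sub>\<nu>)\<close> with compositions \<open>\<nu>\<close>. A term lies in the ideal if \<open>k\<close> consumes more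
  letters than \<open>\<nu>\<close> has. Otherwise there are words at which no other term has a non-zero entry, so
  the coefficient \<open>c\<close> is an entry of \<open>x\<close> and vanishes.
\<close>

lemma kernel_in_ideal:
  fixes x :: "'k::field skew"
  assumes x: "x \<in> carrier (skew_product n)" and ker: "\<And>I J. I \<in> multi_indices n r
      \<Longrightarrow> J \<in> multi_indices n r \<Longrightarrow> weight_entry n x I J = 0"
  shows "x \<in> Idl\<^bsub>skew_product n\<^esub> {eb}" (is "_ \<in> ?I")
proof -
  interpret X: scalar_algebra "skew_product n :: ('k, 'k skew) module"
    by (rule skew_product_algebra)
  interpret I: ideal ?I "skew_product n :: ('k, 'k skew) module"
    by (rule X.genideal_ideal) (use ebar_closed in blast)
  have eb: "eb \<in> ?I" using X.genideal_self[of "{eb}"] ebar_closed by blast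
  obtain S b where S: "finite S" "S \<subseteq> exponents n" "\<And>k. b k \<in> carrier (weight_functions n)"
    "\<And>I J z. skew_entry n x I J z = (\<Sum>k\<in>S. K_entry n (K_monomial n k) I J * b k z)"
    by (rule skew_expansion[OF x]) blast
  let ?f = "\<lambda>y. skew_pure n (K_monomial n (fst y)) (delta (snd y) (b (fst y) (snd y))) :: 'k skew"
  let ?T = "S \<times> \<Lambda>"
  have T: "finite ?T" using S(1) finite_compositions by blast
  have dc: "delta (snd y) d \<in> carrier (weight_functions n)" if "y \<in> ?T" for y and d :: 'k
    using that compositions_carrier by (intro delta_closed) auto
  have f: "?f y \<in> carrier (skew_product n)" if "y \<in> ?T" for y
    by (intro skew_pure_closed K_monomial_closed dc[OF that])
  have f_ideal: "?f y \<in> ?I" if y: "y \<in> ?T" for y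
  proof -
    obtain k \<nu> where k\<nu>: "y = (k, \<nu>)" "k \<in> S" "\<nu> \<in> \<Lambda>" using y by blast
    have kE: "k \<in> exponents n" using k\<nu>(2) S(2) by blast
    show ?thesis
    proof (cases "\<forall>j<n. int (\<Sum>a<j. k a j) \<le> \<nu> $ j")
      case False
      then obtain j where "j < n" "\<nu> $ j < int (\<Sum>a<j. k a j)" by (auto simp: not_le)
      then show ?thesis using invalid_in_ideal[OF k\<nu>(3)] by (simp add: k\<nu>(1))
    next
      case True
      then obtain I J where w: "I \<in> multi_indices n r" "J \<in> multi_indices n r" "weight n J = \<nu>"
        "\<And>k'. k' \<in> exponents n \<Longrightarrow> raises (root_list n) k' I J \<longleftrightarrow> k' = k"
        using valid_words[OF kE k\<nu>(3)] by blast
      have sh: "same_shape n I J" using w(1,2) multi_indices_length[OF w(2)]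
        by (simp add: same_shape_def)
      have "weight_entry n x I J = (\<Sum>k'\<in>S. if k' = k then b k \<nu> else 0)"
        unfolding weight_entry_def S(4) w(3)
        by (rule sum.cong[OF refl]) (use S(2) w(4) in \<open>auto simp: K_entry_monomial sh\<close>)
      then have b0: "b k \<nu> = 0" using ker[OF w(1,2)] S(1) k\<nu>(2) by simp
      have "?f y = \<zero>\<^bsub>skew_product n\<^esub>"
        by (rule skew_entry_eqI[OF f[OF y] X.zero_closed])
          (simp add: skew_entry_pure K_monomial_closed dc[OF y], simp add: k\<nu>(1) b0 delta_def
              skew_entry_zero)
      then show ?thesis using I.zero_closed by simp
    qed
  qed
  have sum_ideal: "finsum (skew_product n) ?f U \<in> ?I" if "finite U" "U \<subseteq> ?T" for U
    using that
  proof (induction U)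
    case (insert y U)
    have "finsum (skew_product n) ?f (insert y U) = ?f y \<oplus>\<^bsub>skew_product n\<^esub> finsum (skew_product n) ?f
        U"
      by (rule X.finsum_insert[OF insert.hyps]) (use f insert.prems in auto)
    moreover have "?f y \<in> ?I" "finsum (skew_product n) ?f U \<in> ?I" using insert f_ideal by auto
    ultimately show ?case by (simp only: I.a_closed)
  qed (simp add: I.zero_closed)
  let ?e = "skew_pure n \<one>\<^bsub>kostant_K n\<^esub> \<chi> :: 'k skew"
  have e: "?e \<in> carrier (skew_product n)"
    by (intro skew_pure_closed kostant_K_one_closed chi_closed)
  have "x \<otimes>\<^bsub>skew_product n\<^esub> ?e = finsum (skew_product n) ?f ?T"
  proof (rule skew_entry_eqI[OF X.m_closed[OF x e]])
    show "finsum (skew_product n) ?f ?T \<in> carrier (skew_product n)" using f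
      by (intro X.finsum_closed) auto
    fix I J z
    have "skew_entry n (x \<otimes>\<^bsub>skew_product n\<^esub> ?e) I J z = (\<Sum>K\<in>multi_indices n (length J).
        skew_entry n x I K (z + weight_diff n K J) * (K_entry n \<one>\<^bsub>kostant_K n\<^esub> K J * \<chi> z))"
      by (simp only: skew_entry_mult[OF x e] skew_entry_pure[OF kostant_K_one_closed chi_closed])
    also have "\<dots> = (\<Sum>K\<in>multi_indices n (length J). if K = J then skew_entry n x I J (z + weight_diff
        n J J) * \<chi> z else 0)"
      by (rule sum.cong[OF refl]) (auto simp: K_entry_one same_shape_self)
    also have "\<dots> = (if J \<in> multi_indices n (length J) then skew_entry n x I J (z + weight_diff n J
        J) * \<chi> z else 0)"
      by (simp add: finite_multi_indices)
    also have "\<dots> = skew_entry n x I J z * \<chi> z"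
    proof -
      have "z + weight_diff n J J = z" if "z \<in> \<Lambda>"
        using compositions_carrier[OF that]
          by (intro eq_vecI) (auto simp: weight_diff_def weight_def)
      moreover have "skew_entry n x I J z = 0" if "J \<notin> multi_indices n (length J)"
        unfolding S(4) by (rule sum.neutral)
            (use that in \<open>simp add: K_entry_monomial same_shape_def\<close>)
      ultimately show ?thesis by simp
    qed
    also have "\<dots> = (\<Sum>k\<in>S. K_entry n (K_monomial n k) I J * (\<Sum>\<nu>\<in>\<Lambda>. delta \<nu> (b k \<nu>) z))"
    proof -
      have "(\<Sum>\<nu>\<in>\<Lambda>. delta \<nu> (b k \<nu>) z) = b k z * \<chi> z" for k
        unfolding delta_def by (simp add: finite_compositions)
      then show ?thesis by (simp add: S(4) sum_distrib_right mult.assoc)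
    qed
    also have "\<dots> = (\<Sum>y\<in>?T. K_entry n (K_monomial n (fst y)) I J * delta (snd y) (b (fst y) (snd y))
        z)"
      by (simp add: sum_distrib_left sum.cartesian_product case_prod_beta)
    also have "\<dots> = (\<Sum>y\<in>?T. skew_entry n (?f y) I J z)"
      by (rule sum.cong[OF refl]) (simp only: skew_entry_pure[OF K_monomial_closed dc])
    also have "\<dots> = skew_entry n (finsum (skew_product n) ?f ?T) I J z"
      by (rule skew_entry_finsum[OF T, symmetric]) (use f in blast)
    finally show "skew_entry n (x \<otimes>\<^bsub>skew_product n\<^esub> ?e) I J z
        = skew_entry n (finsum (skew_product n) ?f ?T) I J z" .
  qed
  then have xe: "x \<otimes>\<^bsub>skew_product n\<^esub> ?e \<in> ?I" using sum_ideal[OF T order_refl] by simp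
  have "x \<otimes>\<^bsub>skew_product n\<^esub> eb = x \<ominus>\<^bsub>skew_product n\<^esub> x \<otimes>\<^bsub>skew_product n\<^esub> ?e"
    unfolding ebar_def X.minus_mult_left[OF x X.one_closed e] X.r_one[OF x] ..
  then have "x = x \<otimes>\<^bsub>skew_product n\<^esub> eb \<oplus>\<^bsub>skew_product n\<^esub> x \<otimes>\<^bsub>skew_product n\<^esub> ?e"
    using X.minus_add_cancel[OF x X.m_closed[OF x e]] by simp
  then show ?thesis using I.a_closed[OF I.I_l_closed[OF eb x] xe] by simp
qed

lemma ideal_eq_kernel:
  "Idl\<^bsub>skew_product n\<^esub> {eb} = {x \<in> carrier (skew_product n). \<forall>I\<in>(multi_indices n r). \<forall>J\<in>(multi_indices
      n r). weight_entry n (x :: 'k::field skew) I J = 0}"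
proof
  interpret X: scalar_algebra "skew_product n :: ('k, 'k skew) module"
    by (rule skew_product_algebra)
  have "weight_entry n (eb :: 'k skew) I J = 0" if "I \<in> multi_indices n r" "J \<in> multi_indices n r"
      for I J
    using weight_composition[OF that(2)] by (simp add: weight_entry_def ebar_entry)
  then show "Idl\<^bsub>skew_product n\<^esub> {eb} \<subseteq> {x \<in> carrier (skew_product n). \<forall>I\<in>(multi_indices n r).
      \<forall>J\<in>(multi_indices n r). weight_entry n (x :: 'k skew) I J = 0}"
    by (intro X.genideal_minimal[OF skew_kernel_ideal]) (use ebar_closed in auto)
qed (use kernel_in_ideal in blast)

end

theorem theorem2p20:
  fixes n r :: nat
  assumes "infinite (UNIV :: 'k::field set)"
    and "n \<ge> 1" and "r \<ge> 1"
  shows "algebra_isomorphic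
    (skew_quotient n (compositions n r) :: ('k, 'k skew set) module)
    (borel_schur_algebra n r :: ('k, 'k tensor_op) module)"
proof -
  let ?S = "skew_product n :: ('k, 'k skew) module"
  let ?I = "Idl\<^bsub>?S\<^esub> {ebar n (compositions n r)}"
  interpret S: scalar_algebra ?S by (rule skew_product_algebra)
  have I: "ideal ?I ?S" by (rule S.genideal_ideal) (simp add: ebar_closed)
  show ?thesis
    unfolding skew_quotient_def
  proof (rule quot_algebra_isomorphic[OF skew_product_algebra I, where \<phi> = "skew_op n r"])
    show "skew_op n r ` carrier ?S = carrier (borel_schur_algebra n r)"
      unfolding carrier_borel_schur_algebra[OF assms(1)]
    proof (rule subset_antisym)
      show "range (count_op n r) \<subseteq> skew_op n r ` carrier ?S"
      proof (rule image_subsetI)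
        fix c :: "(nat \<Rightarrow> nat \<Rightarrow> nat) \<Rightarrow> 'k"
        obtain x where "x \<in> carrier ?S" "skew_op n r x = count_op n r c" by (rule count_op_in_image)
        then show "count_op n r c \<in> skew_op n r ` carrier ?S" by (metis image_eqI)
      qed
      show "skew_op n r ` carrier ?S \<subseteq> range (count_op n r)"
        by (rule image_subsetI) (rule skew_op_in_count_ops)
    qed
    fix x y assume xy: "x \<in> carrier ?S" "y \<in> carrier ?S"
    have "x \<ominus>\<^bsub>?S\<^esub> y = x \<oplus>\<^bsub>?S\<^esub> ((- 1) \<odot>\<^bsub>?S\<^esub> y)"
      using xy by (simp add: a_minus_def S.smult_minus_left S.smult_one)
    then have "weight_entry n (x \<ominus>\<^bsub>?S\<^esub> y) I J = weight_entry n x I J - weight_entry n y I J" for I J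
      using xy S.smult_closed[OF xy(2), of "- 1"]
      by (simp add: weight_entry_def skew_entry_add skew_entry_smult)
    then show "skew_op n r x = skew_op n r y \<longleftrightarrow> x \<ominus>\<^bsub>?S\<^esub> y \<in> ?I"
      unfolding ideal_eq_kernel skew_op_def matrix_op_eq_iff using xy by simp
  qed (simp_all add: skew_op_mult skew_op_add skew_op_smult skew_op_one borel_schur_algebra_simps)
qed

end
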